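(* The tensor product of filtered chain complexes induces ring structures on $K(\mathcal C^{\rm t})$ and $K(\mathcal C^{\rm fg})$. Moreover: (1) There exists a canonical isomorphism of rings $\lambda:K(\mathcal C^{\rm t})\to\Lambda$, uniquely defined by the property that $\lambda([E_1(a)])=t^a$ for every $a\in\mathbb R$. (2) Denote by $i^{\rm fg}:K(\mathcal C^{\rm fg})\to K(\mathcal C^{\rm t})$ the map induced by the inclusion $\mathcal C^{\rm fg}_0\subset\mathcal C^{\rm t}_0$. Then the composition $\lambda\circ i^{\rm fg}:K(\mathcal C^{\rm fg})\to\Lambda$ has values in $\Lambda_P$ and is an isomorphism of rings $K(\mathcal C^{\rm fg})\cong\Lambda_P$. (3) Denote by $j_K:K(\mathcal A\mathcal C^{\rm fg})\to K(\mathcal C^{\rm fg})$ the map induced by the inclusion $\mathcal A\mathcal C^{\rm fg}_0\subset\mathcal C^{\rm fg}_0$. Then the composition $\lambda\circ j_K$ has values in the ideal $\Lambda_P^{(0)}=\{P(t)\in\Lambda_P\mid P(1)=0\}\subset\Lambda_P$ and gives an isomorphism $K(\mathcal A\mathcal C^{\rm fg})\cong\Lambda_P^{(0)}$ which is compatible with $K(\mathcal A\mathcal C^{\rm fg})$ being a $K(\mathcal C^{\rm fg})$-module and $\Lambda_P^{(0)}$ being a $\Lambda_P$-module.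
   Context: Novikov rings: $\Lambda=\{\sum_{k=0}^\infty n_kt^{a_k}\mid n_k\in\mathbb Z,\ a_k\in\mathbb R,\ a_k\to\infty\}$ with the standard multiplication, and $\Lambda_P\subset\Lambda$ the subring of finite sums. A filtered chain complex over a field $\mathbf k$ is a triple $(C_*,\partial,\ell)$ with $(C_*,\partial)$ a $\mathbb Z$-graded chain complex and $\ell:\oplus_iC_i\to\mathbb R\cup\{-\infty\}$ a filtration function ($\ell(x)=-\infty$ iff $x=0$, $\ell(cx)=\ell(x)$ for $c\ne0$, $\ell(x+y)\le\max\{\ell(x),\ell(y)\}$) with $\ell(\partial x)\le\ell(x)$. Write $C^{\le r}=\{x\mid\ell(x)\le r\}$. It is finitely generated if its total space is finite dimensional, and tame if $\oplus_kC_k^{\le r}$ is finite dimensional for every $r$ and $C^{\le r}=0$ for $r$ sufficiently small. $\mathcal C^{\rm fg}$ and $\mathcal C^{\rm t}$ are the persistence homotopy categories of finitely generated, respectively tame, filtered chain complexes: $\hom^r(C,D)$ is the space of degree-$0$ chain maps $f$ with $\ell(f(x))\le\ell(x)+r$ modulo chain homotopies $h$ with $\ell(h(x))\le\ell(x)+r$. The $0$-level categories $\mathcal C_0^{\rm fg},\mathcal C_0^{\rm t}$ (filtration preserving maps up to filtration preserving homotopy) are triangulated by filtered mapping cones. $\mathcal A\mathcal C^{\rm fg}$ is the homotopy category of acyclic finitely generated filtered chain complexes (the full subcategory of $\mathcal C^{\rm fg}$ on complexes with vanishing total homology), with $0$-level $\mathcal A\mathcal C_0^{\rm fg}$ triangulated.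 For each of these, $K(-)$ denotes the Grothendieck group of the $0$-level triangulated category: free abelian group on objects modulo $[B]=[A]+[C]$ for each exact triangle $A\to B\to C\to TA$. The tensor product of filtered complexes is the usual one with $\ell_{C\otimes D}=\ell_C+\ell_D$, and the product on $K$ is $[C]\cdot[D]=[C\otimes D]$; it also gives the $K(\mathcal C^{\rm fg})$-module structure of $K(\mathcal A\mathcal C^{\rm fg})$. $E_1(a)$ is the filtered chain complex $\mathbf k x$ concentrated in degree $0$, $\partial=0$, $\ell(x)=a$. In (3), $\lambda$ denotes the isomorphism $K(\mathcal C^{\rm fg})\cong\Lambda_P$ of (2).
   Formalization: The filtration function is additionally required to be compatible with the grading: each homogeneous component of x has level at most ℓ(x), so every C^{≤r} is a graded subcomplex; without this the claim fails. *)

theory Defs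
  imports
    "HOL-Library.Extended_Real"
    "HOL-Library.Nat_Bijection"
    "HOL-Library.Poly_Mapping"
    "HOL-Algebra.Free_Abelian_Groups"
    "HOL-Algebra.QuotRing"
    "HOL-Algebra.Module"
begin

section \<open>The ambient vector space\<close>

text \<open>
  A Grothendieck group needs a set of objects, so the underlying vector spaces are taken to be
  subspaces of one fixed space of countably infinite dimension over the field \<open>'k\<close>, namely the
  finitely supported functions on the natural numbers.  A tame filtered chain complex is the
  union of its finite dimensional subspaces of filtration level at most \<open>n\<close>, \<open>n = 0, 1, 2, ...\<close>;
  it has countable dimension and is therefore isomorphic to one inside this space.  Direct sums
  and tensor products are computed through the bijections from \<open>nat + nat\<close> and \<open>nat \<times> nat\<close> to \<open>nat\<close>.
\<close>

type_synonym 'k vec = "nat \<Rightarrow>\<^sub>0 'k"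

definition vscale :: "'k::field \<Rightarrow> 'k vec \<Rightarrow> 'k vec"
  where "vscale c x = Poly_Mapping.map ((*) c) x"

lemma lookup_vscale [simp]: "Poly_Mapping.lookup (vscale c x) n = c * Poly_Mapping.lookup x n"
  by (simp add: vscale_def Poly_Mapping.map.rep_eq when_def)

global_interpretation vec: vector_space "vscale :: 'k::field \<Rightarrow> 'k vec \<Rightarrow> 'k vec"
  by unfold_locales (auto intro!: poly_mapping_eqI simp: lookup_add algebra_simps)

definition reindex :: "(nat \<Rightarrow> nat) \<Rightarrow> 'k::field vec \<Rightarrow> 'k vec"
  where "reindex g x =
    (\<Sum>n\<in>Poly_Mapping.keys x. Poly_Mapping.single (g n) (Poly_Mapping.lookup x n))"

definition sum_inl :: "'k::field vec \<Rightarrow> 'k vec"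
  where "sum_inl = reindex (\<lambda>n. sum_encode (Inl n))"

definition sum_inr :: "'k::field vec \<Rightarrow> 'k vec"
  where "sum_inr = reindex (\<lambda>n. sum_encode (Inr n))"

definition sum_fst :: "'k::field vec \<Rightarrow> 'k vec"
  where "sum_fst = Poly_Mapping.map_key (\<lambda>n. sum_encode (Inl n))"

definition sum_snd :: "'k::field vec \<Rightarrow> 'k vec"
  where "sum_snd = Poly_Mapping.map_key (\<lambda>n. sum_encode (Inr n))"

text \<open>The tensor product of \<open>x\<close> and \<open>y\<close>: the basis vectors \<open>e m\<close> and \<open>e n\<close> have the product
  \<open>e (prod_encode (m, n))\<close>.\<close>

definition vtensor :: "'k::field vec \<Rightarrow> 'k vec \<Rightarrow> 'k vec"
  where "vtensor x y =
    (\<Sum>m\<in>Poly_Mapping.keys x. \<Sum>n\<in>Poly_Mapping.keys y.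
       Poly_Mapping.single (prod_encode (m, n))
         (Poly_Mapping.lookup x m * Poly_Mapping.lookup y n))"

definition finite_dim :: "'k::field vec set \<Rightarrow> bool"
  where "finite_dim S \<longleftrightarrow> (\<exists>B. finite B \<and> S \<subseteq> vec.span B)"

definition linear_on_set :: "'k::field vec set \<Rightarrow> ('k vec \<Rightarrow> 'k vec) \<Rightarrow> bool"
  where "linear_on_set S f \<longleftrightarrow>
    (\<forall>x\<in>S. \<forall>y\<in>S. f (x + y) = f x + f y) \<and> (\<forall>c. \<forall>x\<in>S. f (vscale c x) = vscale c (f x))"


section \<open>Filtered chain complexes\<close>

text \<open>
  The graded pieces are subspaces of the ambient space whose sum is direct.  Differential and
  filtration function matter only on the total space; their values outside it are irrelevant.
\<close>

record (overloaded) 'k fcc =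
  grade :: "int \<Rightarrow> 'k vec set"
  bdry :: "'k vec \<Rightarrow> 'k vec"
  lev :: "'k vec \<Rightarrow> ereal"

definition total :: "'k::field fcc \<Rightarrow> 'k vec set"
  where "total C = vec.span (\<Union>i. grade C i)"

text \<open>
  The last axiom says that each sublevel \<open>{x. lev x \<le> r}\<close> is a graded subspace, i.e. the direct
  sum of its intersections with the graded pieces, as is implicit in its being a subcomplex.
\<close>

locale filtered_complex =
  fixes C :: "'k::field fcc"
  assumes subspace_grade: "vec.subspace (grade C i)"
    and grade_direct: "\<lbrakk>finite I; \<And>i. i \<in> I \<Longrightarrow> xs i \<in> grade C i; (\<Sum>i\<in>I. xs i) = 0; i \<in> I\<rbrakk>
      \<Longrightarrow> xs i = 0"
    and bdry_linear: "linear_on_set (total C) (bdry C)"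
    and bdry_grade: "x \<in> grade C i \<Longrightarrow> bdry C x \<in> grade C (i - 1)"
    and bdry_bdry: "x \<in> total C \<Longrightarrow> bdry C (bdry C x) = 0"
    and lev_finite: "x \<in> total C \<Longrightarrow> lev C x \<noteq> \<infinity>"
    and lev_bot: "x \<in> total C \<Longrightarrow> lev C x = -\<infinity> \<longleftrightarrow> x = 0"
    and lev_scale: "\<lbrakk>x \<in> total C; c \<noteq> 0\<rbrakk> \<Longrightarrow> lev C (vscale c x) = lev C x"
    and lev_add: "\<lbrakk>x \<in> total C; y \<in> total C\<rbrakk> \<Longrightarrow> lev C (x + y) \<le> max (lev C x) (lev C y)"
    and lev_bdry: "x \<in> total C \<Longrightarrow> lev C (bdry C x) \<le> lev C x"
    and lev_component: "\<lbrakk>finite I; \<And>i. i \<in> I \<Longrightarrow> xs i \<in> grade C i; i \<in> I\<rbrakk>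
      \<Longrightarrow> lev C (xs i) \<le> lev C (\<Sum>i\<in>I. xs i)"

definition sublevel :: "'k::field fcc \<Rightarrow> real \<Rightarrow> 'k vec set"
  where "sublevel C r = {x \<in> total C. lev C x \<le> ereal r}"

definition fg_complexes :: "'k::field fcc set"
  where "fg_complexes = {C. filtered_complex C \<and> finite_dim (total C)}"

definition tame_complexes :: "'k::field fcc set"
  where "tame_complexes = {C. filtered_complex C \<and> (\<forall>r. finite_dim (sublevel C r)) \<and>
    (\<exists>r0. \<forall>r\<le>r0. sublevel C r = {0})}"

definition acyclic_complex :: "'k::field fcc \<Rightarrow> bool"
  where "acyclic_complex C \<longleftrightarrow> (\<forall>x\<in>total C. bdry C x = 0 \<longrightarrow> (\<exists>y\<in>total C. bdry C y = x))"

definition acyclic_fg_complexes :: "'k::field fcc set"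
  where "acyclic_fg_complexes = {C \<in> fg_complexes. acyclic_complex C}"

definition E1 :: "real \<Rightarrow> 'k::field fcc"
  where "E1 a = \<lparr>grade = (\<lambda>i. if i = 0 then vec.span {Poly_Mapping.single 0 1} else {0}),
    bdry = (\<lambda>_. 0),
    lev = (\<lambda>x. if x = 0 then -\<infinity> else ereal a)\<rparr>"


section \<open>The 0-level homotopy category and its exact triangles\<close>

text \<open>Morphisms of the 0-level category are represented by chain maps; equality of morphisms is
  \<open>filt_homotopic\<close>.\<close>

definition filt_map :: "'k::field fcc \<Rightarrow> 'k fcc \<Rightarrow> ('k vec \<Rightarrow> 'k vec) \<Rightarrow> bool"
  where "filt_map C D f \<longleftrightarrow> linear_on_set (total C) f \<and>
    (\<forall>i. \<forall>x\<in>grade C i. f x \<in> grade D i) \<and>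
    (\<forall>x\<in>total C. f (bdry C x) = bdry D (f x)) \<and>
    (\<forall>x\<in>total C. lev D (f x) \<le> lev C x)"

definition filt_homotopic ::
  "'k::field fcc \<Rightarrow> 'k fcc \<Rightarrow> ('k vec \<Rightarrow> 'k vec) \<Rightarrow> ('k vec \<Rightarrow> 'k vec) \<Rightarrow> bool"
  where "filt_homotopic C D f g \<longleftrightarrow> (\<exists>h. linear_on_set (total C) h \<and>
    (\<forall>i. \<forall>x\<in>grade C i. h x \<in> grade D (i + 1)) \<and>
    (\<forall>x\<in>total C. f x - g x = bdry D (h x) + h (bdry C x)) \<and>
    (\<forall>x\<in>total C. lev D (h x) \<le> lev C x))"

definition filt_equivalence :: "'k::field fcc \<Rightarrow> 'k fcc \<Rightarrow> ('k vec \<Rightarrow> 'k vec) \<Rightarrow> bool"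
  where "filt_equivalence C D f \<longleftrightarrow> filt_map C D f \<and>
    (\<exists>g. filt_map D C g \<and> filt_homotopic C C (g \<circ> f) id \<and> filt_homotopic D D (f \<circ> g) id)"

definition shift :: "'k::field fcc \<Rightarrow> 'k fcc"
  where "shift C = \<lparr>grade = (\<lambda>i. grade C (i - 1)), bdry = (\<lambda>x. - bdry C x), lev = lev C\<rparr>"

text \<open>\<open>cone A B f\<close> has the \<open>i\<close>-th graded piece \<open>B i \<oplus> A (i - 1)\<close>.\<close>

definition cone :: "'k::field fcc \<Rightarrow> 'k fcc \<Rightarrow> ('k vec \<Rightarrow> 'k vec) \<Rightarrow> 'k fcc"
  where "cone A B f =
    \<lparr>grade = (\<lambda>i. {sum_inl b + sum_inr a | a b. b \<in> grade B i \<and> a \<in> grade A (i - 1)}),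
     bdry = (\<lambda>z. sum_inl (bdry B (sum_fst z) + f (sum_snd z)) + sum_inr (- bdry A (sum_snd z))),
     lev = (\<lambda>z. max (lev B (sum_fst z)) (lev A (sum_snd z)))\<rparr>"

definition exact_triangle :: "'k::field fcc set \<Rightarrow> 'k fcc \<Rightarrow> 'k fcc \<Rightarrow> 'k fcc \<Rightarrow>
    ('k vec \<Rightarrow> 'k vec) \<Rightarrow> ('k vec \<Rightarrow> 'k vec) \<Rightarrow> ('k vec \<Rightarrow> 'k vec) \<Rightarrow> bool"
  where "exact_triangle Ob A B C u v w \<longleftrightarrow>
    A \<in> Ob \<and> B \<in> Ob \<and> C \<in> Ob \<and>
    filt_map A B u \<and> filt_map B C v \<and> filt_map C (shift A) w \<and>
    (\<exists>A' B' f a b c. A' \<in> Ob \<and> B' \<in> Ob \<and> filt_map A' B' f \<and>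
       filt_equivalence A A' a \<and> filt_equivalence B B' b \<and>
       filt_equivalence C (cone A' B' f) c \<and>
       filt_homotopic A B' (b \<circ> u) (f \<circ> a) \<and>
       filt_homotopic B (cone A' B' f) (c \<circ> v) (sum_inl \<circ> b) \<and>
       filt_homotopic C (shift A') (a \<circ> w) (sum_snd \<circ> c))"


section \<open>Tensor products\<close>

text \<open>
  The differential is determined on the total space by the graded Leibniz rule; the choice
  operator only affects its values outside.  The filtration level of \<open>z\<close> is the infimum, over
  all ways of writing \<open>z\<close> as a finite sum of products \<open>x \<otimes> y\<close>, of the largest
  \<open>lev x + lev y\<close> that occurs.
\<close>

definition tensor_grade :: "'k::field fcc \<Rightarrow> 'k fcc \<Rightarrow> int \<Rightarrow> 'k vec set"
  where "tensor_grade C D n =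
    vec.span {vtensor x y | x y i j. i + j = n \<and> x \<in> grade C i \<and> y \<in> grade D j}"

definition tensor_bdry :: "'k::field fcc \<Rightarrow> 'k fcc \<Rightarrow> 'k vec \<Rightarrow> 'k vec"
  where "tensor_bdry C D = (SOME d.
    linear_on_set (vec.span (\<Union>n. tensor_grade C D n)) d \<and>
    (\<forall>i j. \<forall>x\<in>grade C i. \<forall>y\<in>grade D j.
       d (vtensor x y) = vtensor (bdry C x) y +
         (if even i then vtensor x (bdry D y) else - vtensor x (bdry D y))))"

definition tensor_lev :: "'k::field fcc \<Rightarrow> 'k fcc \<Rightarrow> 'k vec \<Rightarrow> ereal"
  where "tensor_lev C D z =
    Inf {Sup ((\<lambda>(x, y). lev C x + lev D y) ` S) | S.
      finite S \<and> S \<subseteq> total C \<times> total D \<and> z = (\<Sum>(x, y)\<in>S. vtensor x y)}"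

definition tensor_complex :: "'k::field fcc \<Rightarrow> 'k fcc \<Rightarrow> 'k fcc"  (infixr \<open>\<otimes>\<^sub>c\<close> 70)
  where "C \<otimes>\<^sub>c D =
    \<lparr>grade = tensor_grade C D, bdry = tensor_bdry C D, lev = tensor_lev C D\<rparr>"


section \<open>Grothendieck groups\<close>

type_synonym 'k kclass = "('k fcc \<Rightarrow>\<^sub>0 int) set"

definition triangle_relations :: "'k::field fcc set \<Rightarrow> ('k fcc \<Rightarrow>\<^sub>0 int) set"
  where "triangle_relations Ob =
    {frag_of B - frag_of A - frag_of C | A B C. \<exists>u v w. exact_triangle Ob A B C u v w}"

definition K_relations :: "'k::field fcc set \<Rightarrow> ('k fcc \<Rightarrow>\<^sub>0 int) set"
  where "K_relations Ob = generate (free_Abelian_group Ob) (triangle_relations Ob)"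

definition frag_tensor ::
  "('k::field fcc \<Rightarrow>\<^sub>0 int) \<Rightarrow> ('k fcc \<Rightarrow>\<^sub>0 int) \<Rightarrow> ('k fcc \<Rightarrow>\<^sub>0 int)"
  where "frag_tensor p q = frag_extend (\<lambda>C. frag_extend (\<lambda>D. frag_of (C \<otimes>\<^sub>c D)) q) p"

text \<open>
  The free abelian group on the objects with the biadditive extension of the tensor product.
  This is not yet a ring, the tensor product of complexes being associative and unital only up
  to isomorphism.
\<close>

definition free_tensor :: "'k::field fcc set \<Rightarrow> ('k fcc \<Rightarrow>\<^sub>0 int) ring"
  where "free_tensor Ob =
    \<lparr>carrier = carrier (free_Abelian_group Ob), mult = frag_tensor, one = frag_of (E1 0),
     zero = 0, add = (+)\<rparr>"

text \<open>The underlying abelian group of \<open>K_ring Ob\<close> is the Grothendieck group of the full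
  subcategory with objects \<open>Ob\<close>.  The product of two cosets is the union of the cosets of all
  products of representatives; when the product is well defined, this is a single coset.\<close>

definition K_ring :: "'k::field fcc set \<Rightarrow> 'k kclass ring"
  where "K_ring Ob = free_tensor Ob Quot K_relations Ob"

definition K_coset :: "'k::field fcc set \<Rightarrow> ('k fcc \<Rightarrow>\<^sub>0 int) \<Rightarrow> 'k kclass"
  where "K_coset Ob p = K_relations Ob +>\<^bsub>free_tensor Ob\<^esub> p"

definition K_class :: "'k::field fcc set \<Rightarrow> 'k fcc \<Rightarrow> 'k kclass"
  where "K_class Ob C = K_coset Ob (frag_of C)"

definition K_incl :: "'k::field fcc set \<Rightarrow> 'k kclass \<Rightarrow> 'k kclass"
  where "K_incl Ob' P = (\<Union>p\<in>P. K_coset Ob' p)"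

text \<open>The library's module records extend ring records; the \<open>mult\<close> and \<open>one\<close> components are
  irrelevant for a module.  Scalars are classes of complexes from a possibly larger collection
  of objects, for instance all finitely generated complexes acting on acyclic ones.\<close>

definition K_module :: "'k::field fcc set \<Rightarrow> ('k kclass, 'k kclass) module"
  where "K_module Ob =
    \<lparr>carrier = carrier (K_ring Ob), mult = mult (K_ring Ob), one = one (K_ring Ob),
     zero = zero (K_ring Ob), add = add (K_ring Ob),
     smult = (\<lambda>P X. \<Union>p\<in>P. \<Union>x\<in>X. K_coset Ob (frag_tensor p x))\<rparr>"


section \<open>Novikov rings\<close>

text \<open>An element is represented by its coefficient function \<open>f\<close>: the coefficient of \<open>t\<^sup>a\<close> is
  \<open>f a\<close>.  That the exponents of the series tend to infinity means that only finitely many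
  exponents with nonzero coefficient lie below any given bound.\<close>

definition novikov :: "(real \<Rightarrow> int) ring"
  where "novikov =
    \<lparr>carrier = {f. \<forall>r. finite {a. a \<le> r \<and> f a \<noteq> 0}},
     mult = (\<lambda>f g c. \<Sum>a | f a \<noteq> 0 \<and> g (c - a) \<noteq> 0. f a * g (c - a)),
     one = (\<lambda>a. if a = 0 then 1 else 0),
     zero = (\<lambda>_. 0),
     add = (\<lambda>f g a. f a + g a)\<rparr>"

definition tpow :: "real \<Rightarrow> real \<Rightarrow> int"
  where "tpow a = (\<lambda>b. if b = a then 1 else 0)"

definition novikov_poly :: "(real \<Rightarrow> int) ring"
  where "novikov_poly = novikov\<lparr>carrier := {f. finite {a. f a \<noteq> 0}}\<rparr>"

definition value_at_one :: "(real \<Rightarrow> int) \<Rightarrow> int"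
  where "value_at_one f = (\<Sum>a | f a \<noteq> 0. f a)"

definition novikov_poly0 :: "(real \<Rightarrow> int) set"
  where "novikov_poly0 = {f \<in> carrier novikov_poly. value_at_one f = 0}"

definition novikov_poly0_module :: "(real \<Rightarrow> int, real \<Rightarrow> int) module"
  where "novikov_poly0_module =
    \<lparr>carrier = novikov_poly0, mult = mult novikov, one = one novikov,
     zero = zero novikov, add = add novikov, smult = mult novikov\<rparr>"

end

theory Submission
  imports Defs
begin

text \<open>
  The isomorphism is the Euler characteristic series: the coefficient of \<open>t\<^sup>a\<close> in
  \<open>euler_series C\<close> is the Euler characteristic of the quotient of \<open>{x. lev x \<le> a}\<close> by
  \<open>{x. lev x < a}\<close>.  A tame complex has a basis of homogeneous vectors that is orthogonal, which
  means that the level of a linear combination is the largest level of a basis vector occurring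
  in it, and the basis can be chosen adapted to any given graded subspace (\<open>adapted_obasis\<close>).  The
  series counts the basis vectors of level \<open>a\<close> with the sign of their degree.

  The series is additive and multiplicative.  A filtered homotopy equivalence preserves the
  dimensions of the homology of all sublevel complexes (\<open>homotopy_dim_le\<close>), hence the series, and
  the basis of a cone consists of the two given bases; so an exact triangle gives
  \<open>euler_series B = euler_series A + euler_series C\<close> (\<open>exact_triangle_euler_series\<close>).  The products
  of basis vectors form an orthogonal basis of a tensor product, so tensor products go to products
  of series (\<open>tensor_tame\<close>).

  There are no other invariants: any function on complexes, with values in an abelian group, that
  turns cones into differences factors through the series (\<open>euler_series_universal\<close>).  Every
  complex is the cone of its own differential, taken as a map between two complexes with zero
  differential (\<open>cycle_splitting\<close>); a complex with zero differential is determined by the number of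
  generators in each degree and level; and since a shift changes the class by a sign, all
  generators can be moved to degree 0, infinitely many of them at a time (\<open>cl_collapse\<close>).  So each
  class is a difference of two classes of complexes concentrated in degree 0 with zero
  differential, and these are determined by their series.  Applied to the class of a complex in
  the Grothendieck group, this shows that the relations are exactly the combinations with
  vanishing series (\<open>K_relations_iff\<close>), for tame and for finitely generated complexes.

  A complex with nonzero terms and zero differential is not acyclic, so for acyclic complexes the
  universal property is applied to another function: the class in \<open>K_ring acyclic_fg_complexes\<close> of the cone of
  \<open>C \<rightarrow> flatten m C\<close>, where \<open>flatten m C\<close> is \<open>C\<close> with all levels replaced by a lower bound \<open>m\<close>.
  This cone is acyclic for every \<open>C\<close>, and its formation is compatible with cones.  If \<open>C\<close> is itself
  acyclic then \<open>flatten m C\<close> is contractible, because a contracting homotopy cannot violate a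
  constant filtration, and the class of the cone is \<open>- [C]\<close> (\<open>K_relations_acyclic_iff\<close>).  The image
  consists of the series with value 0 at \<open>t = 1\<close>, which is the Euler characteristic of the whole
  complex.

  The relations being the kernel of the series, a coset is a fibre of the series, and all three
  Grothendieck groups are identified with subsets of the Novikov ring.  Every algebraic law and
  every compatibility claimed below is checked there.  The characterisation of the isomorphism by
  \<open>[E1 a] \<mapsto> t\<^sup>a\<close> is a rigidity property of the Novikov ring: a ring endomorphism that fixes all
  \<open>t\<^sup>a\<close> is automatically compatible with infinite sums (\<open>novikov_endomorphism_unique\<close>).
\<close>


section \<open>Linear algebra in the ambient space\<close>

global_interpretation vecp: vector_space_pair "vscale :: 'k::field \<Rightarrow> 'k vec \<Rightarrow> 'k vec"
    "vscale :: 'k \<Rightarrow> 'k vec \<Rightarrow> 'k vec"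
  ..

abbreviation vlin :: "('k::field vec \<Rightarrow> 'k vec) \<Rightarrow> bool"
  where "vlin \<equiv> Vector_Spaces.linear vscale vscale"

lemmas vlin_add = vecp.linear_add
  and vlin_scale = vecp.linear_scale
  and vlin_sum = vecp.linear_sum
  and vlin_0 = vecp.linear_0
  and vlin_diff = vecp.linear_diff
  and vlin_neg = vecp.linear_neg

lemma vlinI:
  assumes "\<And>x y. f (x + y) = f x + f y" "\<And>c x. f (vscale c x) = vscale c (f x)"
  shows "vlin f"
  using assms by (simp add: Vector_Spaces.linear_iff vec.vector_space_axioms)

lemma vlin_id: "vlin (\<lambda>x. x)" and vlin_zero: "vlin (\<lambda>x. 0)"
  by (auto intro!: vlinI)

lemma vlin_comp: "vlin f \<Longrightarrow> vlin g \<Longrightarrow> vlin (\<lambda>x. f (g x))"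
  by (intro vlinI) (simp_all add: vlin_add vlin_scale)

lemma vlin_plus: "vlin f \<Longrightarrow> vlin g \<Longrightarrow> vlin (\<lambda>x. f x + g x)"
  by (intro vlinI) (simp_all add: vlin_add vlin_scale vec.scale_right_distrib)

lemma vlin_minus: "vlin f \<Longrightarrow> vlin g \<Longrightarrow> vlin (\<lambda>x. f x - g x)"
  by (intro vlinI) (simp_all add: vlin_add vlin_scale vec.scale_right_diff_distrib)

lemma vlin_uminus: "vlin f \<Longrightarrow> vlin (\<lambda>x. - f x)"
  by (intro vlinI) (simp_all add: vlin_add vlin_scale)

lemma vlin_on_set: "vlin f \<Longrightarrow> linear_on_set S f"
  by (simp add: linear_on_set_def vlin_add vlin_scale)

lemma vlin_eq_on_span:
  assumes "vlin f" "vlin g" "\<And>b. b \<in> B \<Longrightarrow> f b = g b" "x \<in> vec.span B"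
  shows "f x = g x"
  using vecp.linear_eq_on[OF assms(1,2,4)] assms(3) by blast

lemma vlin_extend:
  assumes "vec.independent B"
  obtains g where "vlin g" "\<And>b. b \<in> B \<Longrightarrow> g b = f b"
  using vecp.linear_independent_extend[OF assms] by blast

lemma linear_on_set_sum:
  assumes "linear_on_set S f" "vec.subspace S" "finite T" "\<And>b. b \<in> T \<Longrightarrow> b \<in> S"
  shows "f (\<Sum>b\<in>T. vscale (c b) b) = (\<Sum>b\<in>T. vscale (c b) (f b))"
  using assms(3,4)
proof (induction rule: finite_induct)
  case empty
  have "f (vscale 0 0) = vscale 0 (f 0)"
    using assms(1) vec.subspace_0[OF assms(2)] unfolding linear_on_set_def by blast
  then show ?case by simp
next
  case (insert a F)
  have "vscale (c a) a \<in> S" "(\<Sum>b\<in>F. vscale (c b) b) \<in> S"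
    using insert.prems assms(2) by (auto intro: vec.subspace_scale vec.subspace_sum)
  then have "f (vscale (c a) a + (\<Sum>b\<in>F. vscale (c b) b)) =
      f (vscale (c a) a) + f (\<Sum>b\<in>F. vscale (c b) b)"
    using assms(1) by (simp add: linear_on_set_def)
  then show ?case
    using insert assms(1) by (simp add: linear_on_set_def)
qed

text \<open>Differentials and chain maps are given on a subspace only; extending them to the whole
  ambient space turns questions about them into questions about bases.\<close>

lemma linear_on_set_extend:
  assumes "linear_on_set S f" "vec.subspace S"
  obtains g where "vlin g" "\<And>x. x \<in> S \<Longrightarrow> g x = f x"
proof -
  obtain B where B: "B \<subseteq> S" "vec.independent B" "S \<subseteq> vec.span B"
    using vec.maximal_independent_subset by metis
  obtain g where g: "vlin g" "\<And>b. b \<in> B \<Longrightarrow> g b = f b"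
    using vlin_extend[OF B(2)] by metis
  have "g x = f x" if "x \<in> S" for x
  proof -
    have "x \<in> vec.span B" using B(3) that by blast
    then obtain T r where x: "finite T" "T \<subseteq> B" "x = (\<Sum>b\<in>T. vscale (r b) b)"
      unfolding vec.span_explicit by blast
    have "f x = (\<Sum>b\<in>T. vscale (r b) (f b))"
      unfolding x(3) using x B(1) by (intro linear_on_set_sum[OF assms x(1)]) auto
    also have "\<dots> = (\<Sum>b\<in>T. vscale (r b) (g b))"
      using x(2) g(2) by (intro sum.cong) auto
    also have "\<dots> = g x"
      unfolding x(3) by (simp add: vlin_sum[OF g(1)] vlin_scale[OF g(1)])
    finally show ?thesis by simp
  qed
  then show thesis using g(1) that by blast
qed


subsection \<open>Dimension\<close>

lemma finite_dim_mono: "finite_dim V \<Longrightarrow> S \<subseteq> V \<Longrightarrow> finite_dim S"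
  unfolding finite_dim_def by blast

lemma finite_dim_basis:
  assumes "finite_dim V" "I \<subseteq> V" "vec.independent I"
  obtains B where "I \<subseteq> B" "B \<subseteq> V" "vec.independent B" "V \<subseteq> vec.span B" "finite B"
proof -
  obtain B where B: "I \<subseteq> B" "B \<subseteq> V" "vec.independent B" "V \<subseteq> vec.span B"
    using vec.maximal_independent_subset_extend[OF assms(2,3)] by metis
  obtain F where "finite F" "V \<subseteq> vec.span F"
    using assms(1) unfolding finite_dim_def by blast
  then have "finite B"
    using vec.independent_span_bound[of F B] B(2,3) by blast
  then show thesis using B that by blast
qed

lemma finite_dim_basis_exists:
  assumes "finite_dim V"
  obtains B where "B \<subseteq> V" "vec.independent B" "V \<subseteq> vec.span B" "finite B"
  by (rule finite_dim_basis[OF assms, of "{}"]) (auto simp: vec.independent_empty intro: that)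

lemma finite_dim_independent_finite:
  "finite_dim V \<Longrightarrow> I \<subseteq> V \<Longrightarrow> vec.independent I \<Longrightarrow> finite I"
  by (metis finite_dim_basis finite_subset)

lemma finite_dim_span: "finite B \<Longrightarrow> finite_dim (vec.span B)"
  unfolding finite_dim_def by blast

lemma dim_le_subset: "finite_dim V \<Longrightarrow> S \<subseteq> V \<Longrightarrow> vec.dim S \<le> vec.dim V"
proof -
  assume V: "finite_dim V" "S \<subseteq> V"
  obtain B where B: "B \<subseteq> V" "vec.independent B" "V \<subseteq> vec.span B" "finite B"
    using finite_dim_basis_exists[OF V(1)] .
  have "vec.dim S \<le> card B" using B V(2) by (intro vec.dim_le_card) auto
  then show "vec.dim S \<le> vec.dim V" using vec.basis_card_eq_dim[OF B(1,3,2)] by simp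
qed

lemma dim_less_subset:
  assumes "finite_dim V" "vec.subspace S" "S \<subset> V"
  shows "vec.dim S < vec.dim V"
proof -
  obtain B where B: "B \<subseteq> S" "vec.independent B" "S \<subseteq> vec.span B"
    using vec.maximal_independent_subset by metis
  obtain B' where B': "B \<subseteq> B'" "B' \<subseteq> V" "vec.independent B'" "V \<subseteq> vec.span B'" "finite B'"
    using finite_dim_basis[OF assms(1) _ B(2)] B(1) assms(3) by blast
  have "vec.span B = S"
    by (rule vec.span_subspace[OF B(1,3) assms(2)])
  then have "B \<noteq> B'"
    using B'(4) assms(3) by auto
  then have "card B < card B'"
    using B' by (simp add: psubset_card_mono psubsetI)
  then show ?thesis
    using vec.basis_card_eq_dim[OF B(1,3,2)] vec.basis_card_eq_dim[OF B'(2,4,3)] by simp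
qed

lemma independent_Un_direct:
  assumes "vec.independent A" "vec.independent B" "vec.span A \<inter> vec.span B \<subseteq> {0}" "finite A" "finite B"
  shows "vec.independent (A \<union> B)" "A \<inter> B = {}"
proof -
  have "0 \<notin> A" using assms(1) vec.dependent_zero by blast
  then show disj: "A \<inter> B = {}"
    using assms(3) vec.span_superset by blast
  show "vec.independent (A \<union> B)"
  proof (rule vec.independent_if_scalars_zero)
    show "finite (A \<union> B)" using assms by simp
    fix f x assume 0: "(\<Sum>x\<in>A \<union> B. vscale (f x) x) = 0" and x: "x \<in> A \<union> B"
    let ?a = "\<Sum>x\<in>A. vscale (f x) x" and ?b = "\<Sum>x\<in>B. vscale (f x) x"
    have s: "?a + ?b = 0"
      using 0 disj assms(4,5) by (simp add: sum.union_disjoint)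
    have a: "?a \<in> vec.span A" and b: "?b \<in> vec.span B"
      by (auto intro: vec.span_sum vec.span_scale vec.span_base)
    have "?a = - ?b" using s by (simp add: eq_neg_iff_add_eq_0)
    then have "?a \<in> vec.span B" using vec.span_neg[OF b] by simp
    then have "?a = 0" using a assms(3) by blast
    moreover from this have "?b = 0" using s by simp
    ultimately show "f x = 0"
      using x vec.independentD[OF assms(1) assms(4) subset_refl]
        vec.independentD[OF assms(2) assms(5) subset_refl] by blast
  qed
qed

lemma dim_direct_sum:
  assumes "vec.subspace U" "vec.subspace W" "finite_dim U" "finite_dim W" "U \<inter> W \<subseteq> {0}"
  shows "vec.dim {u + w | u w. u \<in> U \<and> w \<in> W} = vec.dim U + vec.dim W"
proof -
  obtain A where A: "A \<subseteq> U" "vec.independent A" "U \<subseteq> vec.span A" "finite A"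
    using finite_dim_basis_exists[OF assms(3)] .
  obtain B where B: "B \<subseteq> W" "vec.independent B" "W \<subseteq> vec.span B" "finite B"
    using finite_dim_basis_exists[OF assms(4)] .
  have sp: "vec.span A = U" "vec.span B = W"
    by (rule vec.span_subspace[OF A(1,3) assms(1)], rule vec.span_subspace[OF B(1,3) assms(2)])
  have ind: "vec.independent (A \<union> B)" "A \<inter> B = {}"
    using independent_Un_direct[OF A(2) B(2)] sp assms(5) A(4) B(4) by auto
  have "vec.span (A \<union> B) = {u + w | u w. u \<in> U \<and> w \<in> W}"
    unfolding vec.span_Un sp by blast
  then have "vec.dim {u + w | u w. u \<in> U \<and> w \<in> W} = card (A \<union> B)"
    using vec.dim_span_eq_card_independent[OF ind(1)] by simp
  also have "\<dots> = vec.dim U + vec.dim W"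
    using A(4) B(4) ind(2) vec.basis_card_eq_dim[OF A(1,3,2)] vec.basis_card_eq_dim[OF B(1,3,2)]
    by (simp add: card_Un_disjoint)
  finally show ?thesis .
qed

lemma subspace_complement:
  assumes "finite_dim V" "vec.subspace V" "vec.subspace S" "S \<subseteq> V"
  obtains K where "vec.subspace K" "K \<subseteq> V" "K \<inter> S \<subseteq> {0}" "V = {u + w | u w. u \<in> S \<and> w \<in> K}"
    "vec.dim V = vec.dim S + vec.dim K"
proof -
  obtain B where B: "B \<subseteq> S" "vec.independent B" "S \<subseteq> vec.span B"
    using vec.maximal_independent_subset by metis
  obtain B' where B': "B \<subseteq> B'" "B' \<subseteq> V" "vec.independent B'" "V \<subseteq> vec.span B'" "finite B'"
    using finite_dim_basis[OF assms(1) _ B(2)] B(1) assms(4) by blast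
  have sp: "vec.span B = S" "vec.span B' = V"
    by (rule vec.span_subspace[OF B(1,3) assms(3)], rule vec.span_subspace[OF B'(2,4) assms(2)])
  let ?K = "vec.span (B' - B)"
  have VK: "V = {u + w | u w. u \<in> S \<and> w \<in> ?K}"
    using vec.span_Un[of B "B' - B"] sp B'(1) by (simp add: Un_absorb1)
  have "x = 0" if x: "x \<in> ?K" "x \<in> S" for x
  proof -
    have r: "vec.representation B' x = vec.representation B x"
      using vec.representation_extend[OF B'(3), of x B] x sp B'(1) by simp
    have r': "vec.representation B' x = vec.representation (B' - B) x"
      using vec.representation_extend[OF B'(3), of x "B' - B"] x by simp
    have "vec.representation B' x b = 0" for b
      using vec.representation_ne_zero[of B x b] vec.representation_ne_zero[of "B' - B" x b] r r'
      by auto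
    then show "x = 0"
      using vec.sum_nonzero_representation_eq[OF B'(3), of x] x sp assms(4) by auto
  qed
  then have KS: "?K \<inter> S \<subseteq> {0}" by blast
  have KV: "?K \<subseteq> V" using sp vec.span_mono[of "B' - B" B'] by blast
  have "vec.dim V = vec.dim S + vec.dim ?K"
    using dim_direct_sum[of S ?K] VK KS KV assms finite_dim_mono[OF assms(1)] by (auto simp: Int_commute)
  then show thesis using that[of ?K] KV KS VK by simp
qed

lemma finite_dim_image: "vlin f \<Longrightarrow> finite_dim V \<Longrightarrow> finite_dim (f ` V)"
  unfolding finite_dim_def by (metis finite_imageI vecp.linear_spans_image)

lemma dim_image_inj:
  assumes "vlin f" "vec.subspace V" "finite_dim V" "\<And>x. x \<in> V \<Longrightarrow> f x = 0 \<Longrightarrow> x = 0"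
  shows "vec.dim (f ` V) = vec.dim V"
proof -
  obtain B where B: "B \<subseteq> V" "vec.independent B" "V \<subseteq> vec.span B" "finite B"
    using finite_dim_basis_exists[OF assms(3)] .
  have sp: "vec.span B = V" by (rule vec.span_subspace[OF B(1,3) assms(2)])
  have inj: "inj_on f V"
    using assms(4) vecp.linear_inj_on_iff_eq_0[OF assms(1,2)] by blast
  have "vec.independent (f ` B)"
    by (rule vecp.linear_independent_injective_image[OF assms(1) B(2)]) (simp add: sp inj)
  then have "vec.dim (vec.span (f ` B)) = card (f ` B)"
    by (rule vec.dim_span_eq_card_independent)
  then show ?thesis
    using vecp.linear_span_image[OF assms(1), of B] sp card_image[OF inj_on_subset[OF inj B(1)]]
      vec.basis_card_eq_dim[OF B(1,3,2)] by simp
qed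

lemma rank_nullity:
  assumes "vlin f" "vec.subspace V" "finite_dim V"
  shows "vec.dim V = vec.dim {x \<in> V. f x = 0} + vec.dim (f ` V)"
proof -
  let ?Z = "{x \<in> V. f x = 0}"
  have Z: "vec.subspace ?Z"
    using vec.subspace_inter[OF assms(2) vecp.linear_subspace_kernel[OF assms(1)]]
    by (simp add: Int_def)
  obtain K where K: "vec.subspace K" "K \<subseteq> V" "K \<inter> ?Z \<subseteq> {0}"
      "V = {u + w | u w. u \<in> ?Z \<and> w \<in> K}" "vec.dim V = vec.dim ?Z + vec.dim K"
    by (rule subspace_complement[OF assms(3,2) Z]) auto
  have "f ` V = f ` K"
  proof
    show "f ` V \<subseteq> f ` K"
    proof
      fix y assume "y \<in> f ` V"
      then obtain x where x: "x \<in> V" "y = f x" by blast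
      then obtain u w where "u \<in> ?Z" "w \<in> K" "x = u + w" using K(4) by blast
      then show "y \<in> f ` K" using x by (simp add: vlin_add[OF assms(1)])
    qed
  qed (use K(2) in blast)
  moreover have "vec.dim (f ` K) = vec.dim K"
    by (rule dim_image_inj[OF assms(1) K(1) finite_dim_mono[OF assms(3) K(2)]]) (use K(2,3) in blast)
  ultimately show ?thesis using K(5) by simp
qed


subsection \<open>Direct sums and tensor products of vectors\<close>

lemma lookup_sum': "Poly_Mapping.lookup (\<Sum>i\<in>I. f i) k = (\<Sum>i\<in>I. Poly_Mapping.lookup (f i) k)"
  by (induction I rule: infinite_finite_induct) (auto simp: lookup_add)

lemma lookup_reindex:
  assumes "inj g"
  shows "Poly_Mapping.lookup (reindex g x) k =
    (if k \<in> range g then Poly_Mapping.lookup x (inv_into UNIV g k) else 0)"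
proof (cases "k \<in> range g")
  case True
  then obtain n where n: "k = g n" by blast
  have "Poly_Mapping.lookup (reindex g x) k =
      (\<Sum>i\<in>Poly_Mapping.keys x. if i = n then Poly_Mapping.lookup x n else 0)"
    unfolding reindex_def lookup_sum' n using assms
    by (intro sum.cong) (auto simp: lookup_single when_def inj_eq)
  also have "\<dots> = Poly_Mapping.lookup x n"
    by (simp add: in_keys_iff)
  finally show ?thesis using n assms by simp
next
  case False
  then show ?thesis
    unfolding reindex_def lookup_sum' by (auto simp: lookup_single when_def intro!: sum.neutral)
qed

lemma sum_encode_eq_iff: "sum_encode s = sum_encode t \<longleftrightarrow> s = t"
  using inj_sum_encode[of UNIV] by (auto simp: inj_def)

lemma inj_encode: "inj (\<lambda>n. sum_encode (Inl n))" "inj (\<lambda>n. sum_encode (Inr n))"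
  using inj_sum_encode[of UNIV] by (auto simp: inj_def)

lemma lookup_sum_inl:
  "Poly_Mapping.lookup (sum_inl x) (sum_encode s) =
    (case s of Inl n \<Rightarrow> Poly_Mapping.lookup x n | Inr n \<Rightarrow> 0)"
  unfolding sum_inl_def lookup_reindex[OF inj_encode(1)]
  by (cases s) (auto simp: sum_encode_eq_iff inv_f_f[OF inj_encode(1)])

lemma lookup_sum_inr:
  "Poly_Mapping.lookup (sum_inr x) (sum_encode s) =
    (case s of Inr n \<Rightarrow> Poly_Mapping.lookup x n | Inl n \<Rightarrow> 0)"
  unfolding sum_inr_def lookup_reindex[OF inj_encode(2)]
  by (cases s) (auto simp: sum_encode_eq_iff inv_f_f[OF inj_encode(2)])

lemma lookup_sum_fst: "Poly_Mapping.lookup (sum_fst z) n = Poly_Mapping.lookup z (sum_encode (Inl n))"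
  unfolding sum_fst_def by (simp add: map_key.rep_eq[OF inj_encode(1)])

lemma lookup_sum_snd: "Poly_Mapping.lookup (sum_snd z) n = Poly_Mapping.lookup z (sum_encode (Inr n))"
  unfolding sum_snd_def by (simp add: map_key.rep_eq[OF inj_encode(2)])

lemma vec_eqI_sum:
  "(\<And>s. Poly_Mapping.lookup x (sum_encode s) = Poly_Mapping.lookup y (sum_encode s)) \<Longrightarrow> x = y"
  by (rule poly_mapping_eqI) (metis sum_decode_inverse)

lemma vlin_inl: "vlin sum_inl" and vlin_inr: "vlin sum_inr"
  and vlin_fst: "vlin sum_fst" and vlin_snd: "vlin sum_snd"
proof -
  show "vlin sum_inl" "vlin sum_inr"
    by (auto intro!: vlinI vec_eqI_sum simp: lookup_sum_inl lookup_sum_inr lookup_add split: sum.splits)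
  show "vlin sum_fst" "vlin sum_snd"
    by (auto intro!: vlinI poly_mapping_eqI simp: lookup_sum_fst lookup_sum_snd lookup_add)
qed

lemma fst_inl [simp]: "sum_fst (sum_inl x) = x" and fst_inr [simp]: "sum_fst (sum_inr x) = 0"
  and snd_inl [simp]: "sum_snd (sum_inl x) = 0" and snd_inr [simp]: "sum_snd (sum_inr x) = x"
  by (auto intro!: poly_mapping_eqI
      simp: lookup_sum_inl lookup_sum_inr lookup_sum_fst lookup_sum_snd)

lemma inl_inr_eq [simp]: "sum_inl (sum_fst z) + sum_inr (sum_snd z) = z"
  by (rule vec_eqI_sum)
    (auto simp: lookup_add lookup_sum_inl lookup_sum_inr lookup_sum_fst lookup_sum_snd split: sum.splits)

lemmas sum_vec_simps = vlin_add[OF vlin_inl] vlin_add[OF vlin_inr] vlin_add[OF vlin_fst] vlin_add[OF vlin_snd]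
  vlin_scale[OF vlin_inl] vlin_scale[OF vlin_inr] vlin_scale[OF vlin_fst] vlin_scale[OF vlin_snd]
  vlin_0[OF vlin_inl] vlin_0[OF vlin_inr] vlin_0[OF vlin_fst] vlin_0[OF vlin_snd]
  vlin_neg[OF vlin_inl] vlin_neg[OF vlin_inr] vlin_neg[OF vlin_fst] vlin_neg[OF vlin_snd]
  vlin_diff[OF vlin_inl] vlin_diff[OF vlin_inr] vlin_diff[OF vlin_fst] vlin_diff[OF vlin_snd]

lemma lookup_vtensor:
  "Poly_Mapping.lookup (vtensor x y) (prod_encode (m, n)) =
    Poly_Mapping.lookup x m * Poly_Mapping.lookup y n"
proof -
  have "Poly_Mapping.lookup (vtensor x y) (prod_encode (m, n)) =
      (\<Sum>m'\<in>Poly_Mapping.keys x. \<Sum>n'\<in>Poly_Mapping.keys y.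
        if m' = m then (if n' = n then Poly_Mapping.lookup x m * Poly_Mapping.lookup y n else 0) else 0)"
    unfolding vtensor_def lookup_sum' by (intro sum.cong) (auto simp: lookup_single when_def)
  also have "\<dots> = (\<Sum>m'\<in>Poly_Mapping.keys x. if m' = m then
        (\<Sum>n'\<in>Poly_Mapping.keys y. if n' = n then Poly_Mapping.lookup x m * Poly_Mapping.lookup y n else 0) else 0)"
    by (intro sum.cong) auto
  also have "\<dots> = Poly_Mapping.lookup x m * Poly_Mapping.lookup y n"
    by (simp add: in_keys_iff)
  finally show ?thesis .
qed

lemma vec_eqI_prod:
  "(\<And>m n. Poly_Mapping.lookup x (prod_encode (m, n)) = Poly_Mapping.lookup y (prod_encode (m, n))) \<Longrightarrow> x = y"
  by (rule poly_mapping_eqI) (metis prod_decode_inverse surj_pair)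

lemma vlin_vtensor_left: "vlin (\<lambda>x. vtensor x y)" and vlin_vtensor_right: "vlin (vtensor x)"
  by (auto intro!: vlinI vec_eqI_prod simp: lookup_vtensor lookup_add algebra_simps)

lemma vtensor_neg: "vtensor (- x) y = - vtensor x y" "vtensor x (- y) = - vtensor x y"
  using vlin_neg[OF vlin_vtensor_left] vlin_neg[OF vlin_vtensor_right] by auto

text \<open>The tensor product of two linear maps, given on the standard basis by
  \<open>e m \<otimes> e n \<mapsto> P (e m) \<otimes> Q (e n)\<close>.\<close>

definition tensor_map :: "('k::field vec \<Rightarrow> 'k vec) \<Rightarrow> ('k vec \<Rightarrow> 'k vec) \<Rightarrow> 'k vec \<Rightarrow> 'k vec"
  where "tensor_map P Q z = (\<Sum>k\<in>Poly_Mapping.keys z. vscale (Poly_Mapping.lookup z k)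
    (vtensor (P (Poly_Mapping.single (fst (prod_decode k)) 1))
             (Q (Poly_Mapping.single (snd (prod_decode k)) 1))))"

lemma tensor_map_superset:
  assumes "finite S" "Poly_Mapping.keys z \<subseteq> S"
  shows "tensor_map P Q z = (\<Sum>k\<in>S. vscale (Poly_Mapping.lookup z k)
    (vtensor (P (Poly_Mapping.single (fst (prod_decode k)) 1))
             (Q (Poly_Mapping.single (snd (prod_decode k)) 1))))"
  unfolding tensor_map_def using assms
  by (intro sum.mono_neutral_left) (auto simp: in_keys_iff)

lemma vlin_tensor_map: "vlin (tensor_map P Q)"
proof (rule vlinI)
  fix x y :: "'a vec"
  let ?S = "Poly_Mapping.keys x \<union> Poly_Mapping.keys y"
  show "tensor_map P Q (x + y) = tensor_map P Q x + tensor_map P Q y"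
    using keys_add[of x y]
    by (simp add: tensor_map_superset[of ?S] lookup_add vec.scale_left_distrib sum.distrib)
next
  fix c and x :: "'a vec"
  have "Poly_Mapping.keys (vscale c x) \<subseteq> Poly_Mapping.keys x"
    by (auto simp: in_keys_iff)
  then show "tensor_map P Q (vscale c x) = vscale c (tensor_map P Q x)"
    by (simp add: tensor_map_superset[of "Poly_Mapping.keys x"] vec.scale_sum_right)
qed

lemma vec_expand: "x = (\<Sum>n\<in>Poly_Mapping.keys x. vscale (Poly_Mapping.lookup x n) (Poly_Mapping.single n 1))"
  by (rule poly_mapping_eqI) (simp add: lookup_sum' lookup_single when_def in_keys_iff if_distrib cong: if_cong)

lemma vec_span_single: "x \<in> vec.span (range (\<lambda>n. Poly_Mapping.single n 1))"
  by (subst vec_expand) (rule vec.span_sum, rule vec.span_scale, rule vec.span_base, simp)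

lemma tensor_map_vtensor:
  assumes "vlin P" "vlin Q"
  shows "tensor_map P Q (vtensor x y) = vtensor (P x) (Q y)"
proof -
  let ?e = "\<lambda>n. Poly_Mapping.single n (1 :: 'a)"
  have ee: "tensor_map P Q (vtensor (?e m) (?e n)) = vtensor (P (?e m)) (Q (?e n))" for m n
  proof -
    have "vtensor (?e m) (?e n) = Poly_Mapping.single (prod_encode (m, n)) 1"
      unfolding vtensor_def by simp
    then show ?thesis by (simp add: tensor_map_def)
  qed
  have ex: "tensor_map P Q (vtensor x (?e n)) = vtensor (P x) (Q (?e n))" for n
    by (rule vlin_eq_on_span[OF vlin_comp[OF vlin_tensor_map vlin_vtensor_left]
          vlin_comp[OF vlin_vtensor_left assms(1)] _ vec_span_single]) (auto simp: ee)
  show ?thesis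
    by (rule vlin_eq_on_span[OF vlin_comp[OF vlin_tensor_map vlin_vtensor_right]
          vlin_comp[OF vlin_vtensor_right assms(2)] _ vec_span_single]) (auto simp: ex)
qed

text \<open>Fixing a coordinate in the second factor turns a vanishing combination of products into one of
  elements of \<open>A\<close>; the coefficients of the latter are the coordinates of combinations of \<open>B\<close>.\<close>

lemma vtensor_independent:
  assumes "vec.independent A" "vec.independent B"
  shows "vec.independent ((\<lambda>(a, b). vtensor a b) ` (A \<times> B))"
    "inj_on (\<lambda>(a, b). vtensor a b) (A \<times> B)"
proof -
  have zero: "c (a, b) = 0"
    if T: "finite T" "T \<subseteq> A \<times> B" and s: "(\<Sum>(a, b)\<in>T. vscale (c (a, b)) (vtensor a b)) = 0"
      and ab: "(a, b) \<in> T" for T c a b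
  proof -
    define A' where "A' = fst ` T"
    define B' where "B' = snd ` T"
    define c' where "c' p = (if p \<in> T then c p else 0)" for p
    have f: "finite A'" "finite B'" "A' \<subseteq> A" "B' \<subseteq> B"
      using T by (auto simp: A'_def B'_def)
    have "T \<subseteq> A' \<times> B'" unfolding A'_def B'_def by force
    then have s': "(\<Sum>(a, b)\<in>A' \<times> B'. vscale (c' (a, b)) (vtensor a b)) = 0"
      using s f by (subst sum.mono_neutral_cong_right[where S = T]) (auto simp: c'_def)
    have "(\<Sum>b\<in>B'. c' (a, b) * Poly_Mapping.lookup b n) = 0" if "a \<in> A'" for a n
    proof -
      have "(\<Sum>a\<in>A'. vscale (\<Sum>b\<in>B'. c' (a, b) * Poly_Mapping.lookup b n) a) = 0"
      proof (rule poly_mapping_eqI)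
        fix m
        have "(\<Sum>(a, b)\<in>A' \<times> B'. c' (a, b) * (Poly_Mapping.lookup a m * Poly_Mapping.lookup b n)) = 0"
          using arg_cong[OF s', of "\<lambda>z. Poly_Mapping.lookup z (prod_encode (m, n))"]
          by (simp add: lookup_sum' lookup_vtensor case_prod_unfold)
        then have "(\<Sum>a\<in>A'. \<Sum>b\<in>B'. c' (a, b) * (Poly_Mapping.lookup a m * Poly_Mapping.lookup b n)) = 0"
          by (simp add: sum.cartesian_product)
        then show "Poly_Mapping.lookup (\<Sum>a\<in>A'. vscale (\<Sum>b\<in>B'. c' (a, b) * Poly_Mapping.lookup b n) a) m
            = Poly_Mapping.lookup 0 m"
          by (simp add: lookup_sum' sum_distrib_left sum_distrib_right algebra_simps)
      qed
      then show ?thesis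
        using vec.independentD[OF assms(1) f(1,3), of "\<lambda>a. \<Sum>b\<in>B'. c' (a, b) * Poly_Mapping.lookup b n"] that
        by blast
    qed
    then have "(\<Sum>b\<in>B'. vscale (c' (a, b)) b) = 0" if "a \<in> A'" for a
      using that by (intro poly_mapping_eqI) (simp add: lookup_sum')
    then have "c' (a, b) = 0" if "a \<in> A'" "b \<in> B'" for a b
      using vec.independentD[OF assms(2) f(2,4), of "\<lambda>b. c' (a, b)"] that by blast
    moreover have "a \<in> A'" "b \<in> B'" using ab unfolding A'_def B'_def by force+
    ultimately have "c' (a, b) = 0" by blast
    then show ?thesis using ab by (simp add: c'_def)
  qed
  show inj: "inj_on (\<lambda>(a, b). vtensor a b) (A \<times> B)"
  proof (rule inj_onI)
    fix p q assume pq: "p \<in> A \<times> B" "q \<in> A \<times> B"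
      and e: "(\<lambda>(a, b). vtensor a b) p = (\<lambda>(a, b). vtensor a b) q"
    show "p = q"
    proof (rule ccontr)
      assume ne: "p \<noteq> q"
      have "(\<lambda>r. if r = p then 1 else - 1) (fst p, snd p) = (0 :: 'a)"
        by (rule zero[of "{p, q}"]) (use pq e ne in \<open>auto simp: case_prod_unfold\<close>)
      then show False by simp
    qed
  qed
  show "vec.independent ((\<lambda>(a, b). vtensor a b) ` (A \<times> B))"
    unfolding vec.dependent_explicit
  proof (rule notI, elim exE conjE bexE)
    fix U u v
    assume U: "finite U" "U \<subseteq> (\<lambda>(a, b). vtensor a b) ` (A \<times> B)"
      and s: "(\<Sum>v\<in>U. vscale (u v) v) = 0" and v: "v \<in> U" "u v \<noteq> 0"
    obtain T where T: "T \<subseteq> A \<times> B" "U = (\<lambda>(a, b). vtensor a b) ` T"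
      using U(2) by (meson subset_imageE)
    have i: "inj_on (\<lambda>(a, b). vtensor a b) T" using inj T(1) by (rule inj_on_subset)
    have fT: "finite T" using U(1) T(2) i finite_image_iff by blast
    have "(\<Sum>(a, b)\<in>T. vscale (u (vtensor a b)) (vtensor a b)) = 0"
      using s unfolding T(2) sum.reindex[OF i] by (simp add: case_prod_unfold)
    then show False
      using zero[OF fT T(1), of "\<lambda>(a, b). u (vtensor a b)"] v T(2) by auto
  qed
qed


section \<open>Orthogonal bases of filtered complexes\<close>

definition supp :: "'k::field vec set \<Rightarrow> 'k vec \<Rightarrow> 'k vec set"
  where "supp B x = {b. vec.representation B x b \<noteq> 0}"

lemma finite_supp [simp]: "finite (supp B x)"
  by (simp add: supp_def vec.finite_representation)

lemma supp_subset: "supp B x \<subseteq> B"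
  by (auto simp: supp_def dest: vec.representation_ne_zero)

lemma supp_sum:
  "vec.independent B \<Longrightarrow> x \<in> vec.span B \<Longrightarrow>
    (\<Sum>b\<in>supp B x. vscale (vec.representation B x b) b) = x"
  unfolding supp_def by (rule vec.sum_nonzero_representation_eq)

lemma in_span_subset_iff:
  assumes "vec.independent B" "S \<subseteq> B"
  shows "x \<in> vec.span S \<longleftrightarrow> x \<in> vec.span B \<and> supp B x \<subseteq> S"
proof
  assume x: "x \<in> vec.span S"
  then have "vec.representation B x = vec.representation S x"
    by (rule vec.representation_extend[OF assms(1) _ assms(2)])
  then show "x \<in> vec.span B \<and> supp B x \<subseteq> S"
    using vec.span_mono[OF assms(2)] x supp_subset[of S x] by (auto simp: supp_def)
next
  assume x: "x \<in> vec.span B \<and> supp B x \<subseteq> S"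
  have "(\<Sum>b\<in>supp B x. vscale (vec.representation B x b) b) \<in> vec.span S"
    by (rule vec.span_sum, rule vec.span_scale, rule vec.span_base) (use x in blast)
  then show "x \<in> vec.span S"
    using supp_sum[OF assms(1)] x by simp
qed

lemma supp_basis: "vec.independent B \<Longrightarrow> b \<in> B \<Longrightarrow> supp B b = {b}"
  by (auto simp: supp_def vec.representation_basis)

lemma supp_eq_empty_iff: "vec.independent B \<Longrightarrow> x \<in> vec.span B \<Longrightarrow> supp B x = {} \<longleftrightarrow> x = 0"
  using supp_sum[of B x] by (auto simp: supp_def vec.representation_zero)

lemma supp_scale: "vec.independent B \<Longrightarrow> x \<in> vec.span B \<Longrightarrow> c \<noteq> 0 \<Longrightarrow> supp B (vscale c x) = supp B x"
  by (simp add: supp_def vec.representation_scale)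

text \<open>Vectors with disjoint supports cannot cancel; here the value of \<open>g\<close> on the support
  determines the summand.\<close>

lemma supp_direct:
  assumes "vec.independent B" "finite I" "\<And>i. i \<in> I \<Longrightarrow> xs i \<in> vec.span B"
    and "\<And>i b. i \<in> I \<Longrightarrow> b \<in> supp B (xs i) \<Longrightarrow> g b = i" and "i \<in> I"
  shows "supp B (xs i) \<subseteq> supp B (\<Sum>i\<in>I. xs i)"
proof
  fix b assume b: "b \<in> supp B (xs i)"
  have "vec.representation B (\<Sum>i\<in>I. xs i) b = (\<Sum>j\<in>I. vec.representation B (xs j) b)"
    using vec.representation_sum[OF assms(1), of I xs] assms(3) by simp
  also have "\<dots> = (\<Sum>j\<in>I. if j = i then vec.representation B (xs i) b else 0)"
  proof (rule sum.cong[OF refl])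
    fix j assume j: "j \<in> I"
    show "vec.representation B (xs j) b = (if j = i then vec.representation B (xs i) b else 0)"
      using assms(4)[OF j, of b] assms(4)[OF assms(5) b] by (auto simp: supp_def)
  qed
  also have "\<dots> \<noteq> 0"
    using b assms(2,5) by (simp add: supp_def)
  finally show "b \<in> supp B (\<Sum>i\<in>I. xs i)" by (simp add: supp_def)
qed

text \<open>The last condition is orthogonality in the non-Archimedean sense.\<close>

definition obasis :: "'k::field fcc \<Rightarrow> 'k vec set \<Rightarrow> bool"
  where "obasis C B \<longleftrightarrow> vec.independent B \<and> B \<subseteq> (\<Union>i. grade C i) \<and> vec.span B = total C \<and>
    (\<forall>x\<in>total C. lev C x = (SUP b\<in>supp B x. lev C b))"

definition hdeg :: "'k::field fcc \<Rightarrow> 'k vec \<Rightarrow> int"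
  where "hdeg C x = (THE i. x \<in> grade C i)"

lemma grade_total: "grade C i \<subseteq> total C"
  unfolding total_def by (intro subsetI vec.span_base) blast

lemma subspace_total: "vec.subspace (total C)"
  unfolding total_def by simp

context filtered_complex begin

lemma zero_grade: "0 \<in> grade C i"
  using subspace_grade vec.subspace_0 by blast

lemma grade_disjoint:
  assumes "x \<in> grade C i" "x \<in> grade C j" "i \<noteq> j"
  shows "x = 0"
proof -
  have "- x \<in> grade C j" using assms(2) by (rule vec.subspace_neg[OF subspace_grade])
  then show ?thesis
    using grade_direct[of "{i, j}" "\<lambda>k. if k = i then x else - x" i] assms
    by fastforce
qed

lemma hdeg_eq: "x \<in> grade C i \<Longrightarrow> x \<noteq> 0 \<Longrightarrow> hdeg C x = i"
  unfolding hdeg_def using grade_disjoint by blast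

lemma bdry_total: "x \<in> total C \<Longrightarrow> bdry C x \<in> total C"
proof -
  assume x: "x \<in> total C"
  obtain g where g: "vlin g" "\<And>x. x \<in> total C \<Longrightarrow> g x = bdry C x"
    using linear_on_set_extend[OF bdry_linear subspace_total] by blast
  have "vec.span (\<Union>i. grade C i) \<subseteq> {x. g x \<in> total C}"
    using g(2) bdry_grade grade_total
    by (intro vec.span_minimal vecp.linear_subspace_linear_preimage[OF g(1)] subspace_total) fastforce
  then show ?thesis using x g(2)[OF x] unfolding total_def by auto
qed

lemma lev_sum_le:
  "finite T \<Longrightarrow> (\<And>i. i \<in> T \<Longrightarrow> x i \<in> total C) \<Longrightarrow> (\<And>i. i \<in> T \<Longrightarrow> lev C (x i) \<le> M) \<Longrightarrow>
    lev C (\<Sum>i\<in>T. x i) \<le> M"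
proof (induction rule: finite_induct)
  case empty
  then show ?case using lev_bot[of 0] subspace_total vec.subspace_0 by fastforce
next
  case (insert i T)
  have "(\<Sum>i\<in>T. x i) \<in> total C"
    using insert by (intro vec.subspace_sum[OF subspace_total]) auto
  then have "lev C (x i + (\<Sum>i\<in>T. x i)) \<le> max (lev C (x i)) (lev C (\<Sum>i\<in>T. x i))"
    using insert by (intro lev_add) auto
  also have "\<dots> \<le> M" using insert by auto
  finally show ?case using insert by simp
qed

lemma lev_zero: "lev C 0 = -\<infinity>"
  using lev_bot[of 0] vec.subspace_0[OF subspace_total] by blast

lemma lev_neg: "x \<in> total C \<Longrightarrow> lev C (- x) = lev C x"
  using lev_scale[of x "-1"] by simp

lemma lev_scale_le: "x \<in> total C \<Longrightarrow> lev C (vscale c x) \<le> lev C x"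
  using lev_scale[of x c] lev_zero by (cases "c = 0") auto

lemma lev_real:
  assumes "x \<in> total C" "x \<noteq> 0" obtains a where "lev C x = ereal a"
  using lev_finite[OF assms(1)] lev_bot[OF assms(1)] assms(2) by (cases "lev C x") auto

lemma obasis_nonzero: "obasis C B \<Longrightarrow> 0 \<notin> B"
  unfolding obasis_def using vec.dependent_zero by blast

lemma obasis_hdeg: "obasis C B \<Longrightarrow> b \<in> B \<Longrightarrow> b \<in> grade C (hdeg C b)"
  using hdeg_eq[of b] obasis_nonzero[of B] unfolding obasis_def by blast

lemma obasis_total: "obasis C B \<Longrightarrow> b \<in> B \<Longrightarrow> b \<in> total C"
  using obasis_hdeg grade_total by blast

lemma obasis_lev: "obasis C B \<Longrightarrow> b \<in> B \<Longrightarrow> lev C b = ereal (real_of_ereal (lev C b))"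
  using lev_real[OF obasis_total[of B b]] obasis_nonzero[of B] by (metis real_of_ereal.simps(1))

lemma obasis_grade:
  assumes "obasis C B"
  shows "grade C i = vec.span {b \<in> B. hdeg C b = i}"
proof
  have "b \<in> grade C i" if "b \<in> B" "hdeg C b = i" for b
    using obasis_hdeg[OF assms] that by blast
  then show "vec.span {b \<in> B. hdeg C b = i} \<subseteq> grade C i"
    by (intro vec.span_minimal subspace_grade) blast
  show "grade C i \<subseteq> vec.span {b \<in> B. hdeg C b = i}"
  proof
    fix x assume x: "x \<in> grade C i"
    have ind: "vec.independent B" and xB: "x \<in> vec.span B"
      using assms x grade_total unfolding obasis_def by blast+
    let ?R = "vec.representation B x"
    let ?y = "\<lambda>j. \<Sum>b\<in>{b \<in> supp B x. hdeg C b = j}. vscale (?R b) b"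
    let ?I = "insert i (hdeg C ` supp B x)"
    let ?z = "\<lambda>j. if j = i then ?y j - x else ?y j"
    have y: "?y j \<in> grade C j" for j
      by (intro vec.subspace_sum subspace_grade vec.subspace_scale)
        (use obasis_hdeg[OF assms] supp_subset in blast)
    have "(\<Sum>j\<in>?I. ?y j) = (\<Sum>b\<in>supp B x. vscale (?R b) b)"
      by (rule sum.group) auto
    then have yx: "(\<Sum>j\<in>?I. ?y j) = x" using supp_sum[OF ind xB] by simp
    have "(\<Sum>j\<in>?I. ?z j) = (\<Sum>j\<in>?I. ?y j - (if j = i then x else 0))"
      by (intro sum.cong) auto
    also have "\<dots> = 0" unfolding sum_subtractf yx by simp
    finally have "?z i = 0"
      by (intro grade_direct[of ?I ?z]) (use y x vec.subspace_diff[OF subspace_grade] in auto)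
    then have "x = ?y i" by simp
    moreover have "?y i \<in> vec.span {b \<in> B. hdeg C b = i}"
      by (rule vec.span_sum, rule vec.span_scale, rule vec.span_base) (use supp_subset in blast)
    ultimately show "x \<in> vec.span {b \<in> B. hdeg C b = i}" by simp
  qed
qed

end

lemma supp_sup_le_iff:
  assumes "vec.independent B" "x \<in> vec.span B"
  shows "(SUP b\<in>supp B x. ereal (l b)) \<le> M \<longleftrightarrow> x \<in> vec.span {b \<in> B. ereal (l b) \<le> M}"
  using in_span_subset_iff[OF assms(1), of "{b \<in> B. ereal (l b) \<le> M}" x] assms(2) supp_subset[of B x]
  by (auto simp: SUP_le_iff)

text \<open>A filtered complex may be specified on a homogeneous orthogonal basis: the axioms
  concerning the filtration say that certain vectors lie in spans of subsets of the basis.\<close>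

lemma filtered_complexI:
  assumes ind: "vec.independent B"
    and grade: "\<And>i. grade C i = vec.span {b \<in> B. deg b = i}"
    and lev: "\<And>x. x \<in> vec.span B \<Longrightarrow> lev C x = (SUP b\<in>supp B x. ereal (l b))"
    and lin: "linear_on_set (vec.span B) (bdry C)"
    and bg: "\<And>b. b \<in> B \<Longrightarrow> bdry C b \<in> grade C (deg b - 1)"
    and bl: "\<And>b. b \<in> B \<Longrightarrow> lev C (bdry C b) \<le> ereal (l b)"
    and bb: "\<And>b. b \<in> B \<Longrightarrow> bdry C (bdry C b) = 0"
  shows "filtered_complex C" "obasis C B" "total C = vec.span B"
    "\<And>b. b \<in> B \<Longrightarrow> hdeg C b = deg b" "\<And>b. b \<in> B \<Longrightarrow> lev C b = ereal (l b)"
proof -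
  have gB: "grade C i \<subseteq> vec.span B" for i
    unfolding grade by (rule vec.span_mono) auto
  have Bg: "B \<subseteq> (\<Union>i. grade C i)"
  proof
    fix b assume "b \<in> B"
    then have "b \<in> grade C (deg b)" unfolding grade by (intro vec.span_base) simp
    then show "b \<in> (\<Union>i. grade C i)" by blast
  qed
  show tot: "total C = vec.span B"
    unfolding total_def using gB Bg
    by (intro antisym vec.span_minimal vec.span_mono) auto
  have gi: "x \<in> grade C i \<longleftrightarrow> x \<in> vec.span B \<and> (\<forall>b\<in>supp B x. deg b = i)" for x i
    unfolding grade using in_span_subset_iff[OF ind, of "{b \<in> B. deg b = i}" x] supp_subset[of B x]
    by auto
  have le: "lev C x \<le> M \<longleftrightarrow> x \<in> vec.span {b \<in> B. ereal (l b) \<le> M}" if "x \<in> vec.span B" for x M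
    using supp_sup_le_iff[OF ind that] lev[OF that] by simp
  show lb: "\<And>b. b \<in> B \<Longrightarrow> lev C b = ereal (l b)"
    by (subst lev[OF vec.span_base]) (auto simp: supp_basis[OF ind])
  obtain g where g: "vlin g" "\<And>x. x \<in> vec.span B \<Longrightarrow> g x = bdry C x"
    using linear_on_set_extend[OF lin] by blast
  have gb: "bdry C b \<in> vec.span B" if "b \<in> B" for b
    using bg[OF that] gB by blast
  show fc: "filtered_complex C"
  proof
    show "vec.subspace (grade C i)" for i unfolding grade by simp
  next
    fix I :: "int set" and xs i
    assume I: "finite I" "\<And>i. i \<in> I \<Longrightarrow> xs i \<in> grade C i" "i \<in> I"
    have sub: "supp B (xs i) \<subseteq> supp B (\<Sum>i\<in>I. xs i)"
      by (rule supp_direct[OF ind I(1), where g = deg]) (use I gi in auto)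
    show "(\<Sum>i\<in>I. xs i) = 0 \<Longrightarrow> xs i = 0"
      using sub I(3) I(2)[OF I(3)] gi[of "xs i" i] supp_eq_empty_iff[OF ind, of "xs i"]
        supp_eq_empty_iff[OF ind vec.span_zero] by simp
    have "(\<Sum>i\<in>I. xs i) \<in> vec.span B" using I gi by (intro vec.span_sum) auto
    then show "lev C (xs i) \<le> lev C (\<Sum>i\<in>I. xs i)"
      using sub I gi lev by (auto intro!: SUP_subset_mono)
  next
    show "linear_on_set (total C) (bdry C)" using lin tot by simp
  next
    fix x i assume x: "x \<in> grade C i"
    have "vec.span {b \<in> B. deg b = i} \<subseteq> {x. g x \<in> grade C (i - 1)}"
      using g(2)[OF vec.span_base] bg
      by (intro vec.span_minimal vecp.linear_subspace_linear_preimage[OF g(1)])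
        (auto simp: grade)
    then show "bdry C x \<in> grade C (i - 1)"
      using x subsetD[OF gB x] g(2)[of x] unfolding grade by auto
  next
    fix x assume "x \<in> total C"
    then have x: "x \<in> vec.span B" using tot by simp
    have gg: "g (g x) = 0"
      by (rule vlin_eq_on_span[OF vlin_comp[OF g(1) g(1)] vlin_zero _ x])
        (use g(2)[OF vec.span_base] g(2)[OF gb] bb in simp)
    have "vec.span B \<subseteq> {x. g x \<in> vec.span B}"
      using g(2)[OF vec.span_base] gb
      by (intro vec.span_minimal vecp.linear_subspace_linear_preimage[OF g(1)]) auto
    then have "g x \<in> vec.span B" using x by blast
    then show "bdry C (bdry C x) = 0" using gg g(2)[OF x] g(2)[of "g x"] by simp
    let ?M = "lev C x"
    have "vec.span {b \<in> B. ereal (l b) \<le> ?M} \<subseteq> {x. g x \<in> vec.span {b \<in> B. ereal (l b) \<le> ?M}}"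
    proof (intro vec.span_minimal vecp.linear_subspace_linear_preimage[OF g(1)] subsetI CollectI)
      fix b assume b: "b \<in> {b \<in> B. ereal (l b) \<le> ?M}"
      have "lev C (bdry C b) \<le> ?M" using bl[of b] b order_trans by blast
      then show "g b \<in> vec.span {b \<in> B. ereal (l b) \<le> ?M}"
        using le[OF gb[of b]] b g(2)[OF vec.span_base[of b]] by simp
    qed simp
    then have "g x \<in> vec.span {b \<in> B. ereal (l b) \<le> ?M}" using le[OF x, of ?M] by blast
    then show "lev C (bdry C x) \<le> ?M"
      using le[OF \<open>g x \<in> vec.span B\<close>] g(2)[OF x] by simp
    show "lev C x \<noteq> \<infinity>"
    proof (cases "supp B x = {}")
      case False
      then have "Sup ((\<lambda>b. ereal (l b)) ` supp B x) = Max ((\<lambda>b. ereal (l b)) ` supp B x)"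
        by (intro Max_Sup[symmetric]) auto
      also have "\<dots> \<in> (\<lambda>b. ereal (l b)) ` supp B x"
        using False by (intro Max_in) auto
      finally show ?thesis using lev[OF x] by auto
    qed (simp add: lev[OF x] bot_ereal_def)
    show "lev C x = -\<infinity> \<longleftrightarrow> x = 0"
    proof
      assume "lev C x = -\<infinity>"
      then have "\<forall>b\<in>supp B x. ereal (l b) \<le> -\<infinity>"
        using lev[OF x] by (metis SUP_upper)
      then show "x = 0" using supp_eq_empty_iff[OF ind x] by auto
    next
      assume "x = 0"
      then show "lev C x = -\<infinity>" using lev[OF x] supp_eq_empty_iff[OF ind x] by (simp add: bot_ereal_def)
    qed
    show "lev C (vscale c x) = lev C x" if "c \<noteq> 0" for c
      using lev[OF x] lev[OF vec.span_scale[OF x]] supp_scale[OF ind x that] by simp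
    fix y assume "y \<in> total C"
    then have y: "y \<in> vec.span B" using tot by simp
    let ?m = "max (lev C x) (lev C y)"
    have "x \<in> vec.span {b \<in> B. ereal (l b) \<le> ?m}" "y \<in> vec.span {b \<in> B. ereal (l b) \<le> ?m}"
      using le[OF x, of ?m] le[OF y, of ?m] by auto
    then show "lev C (x + y) \<le> ?m"
      using le[OF vec.span_add[OF x y], of ?m] vec.span_add by blast
  qed
  interpret filtered_complex C by fact
  have "(\<lambda>b. lev C b) ` supp B x = (\<lambda>b. ereal (l b)) ` supp B x" for x
    using lb supp_subset[of B x] by (intro image_cong) auto
  then show "obasis C B"
    unfolding obasis_def using ind Bg tot lev by auto
  show "hdeg C b = deg b" if "b \<in> B" for b
  proof (rule hdeg_eq)
    show "b \<in> grade C (deg b)" unfolding grade using that by (auto intro: vec.span_base)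
    show "b \<noteq> 0" using ind that vec.dependent_zero by blast
  qed
qed


subsection \<open>Sublevel spaces\<close>

text \<open>The sets \<open>{..a}\<close> and \<open>{..<a}\<close> are treated together, as the series compares the two; with
  \<open>UNIV\<close> the whole complex is a sublevel space as well.\<close>

definition lower_levels :: "ereal set \<Rightarrow> bool"
  where "lower_levels J \<longleftrightarrow> -\<infinity> \<in> J \<and> (\<forall>x\<in>J. \<forall>y\<le>x. y \<in> J)"

definition sublev :: "'k::field fcc \<Rightarrow> ereal set \<Rightarrow> int \<Rightarrow> 'k vec set"
  where "sublev C J i = {x \<in> grade C i. lev C x \<in> J}"

lemma lower_levels_atMost: "lower_levels {..ereal a}" and lower_levels_lessThan: "lower_levels {..<ereal a}"
  by (auto simp: lower_levels_def)

lemma lower_levels_max: "lower_levels J \<Longrightarrow> x \<in> J \<Longrightarrow> y \<in> J \<Longrightarrow> z \<le> max x y \<Longrightarrow> z \<in> J"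
  unfolding lower_levels_def by (metis le_max_iff_disj)

context filtered_complex begin

lemma subspace_sublev:
  assumes "lower_levels J"
  shows "vec.subspace (sublev C J i)"
proof (rule vec.subspaceI)
  show "0 \<in> sublev C J i"
    using zero_grade lev_zero assms by (simp add: sublev_def lower_levels_def)
  fix x y and c
  assume x: "x \<in> sublev C J i"
  then have xt: "x \<in> total C" using grade_total by (auto simp: sublev_def)
  show "vscale c x \<in> sublev C J i"
    using x assms lev_scale_le[OF xt, of c] vec.subspace_scale[OF subspace_grade]
    by (auto simp: sublev_def lower_levels_def)
  assume y: "y \<in> sublev C J i"
  then have yt: "y \<in> total C" using grade_total by (auto simp: sublev_def)
  show "x + y \<in> sublev C J i"
    using x y lower_levels_max[OF assms, of "lev C x" "lev C y"] lev_add[OF xt yt]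
      vec.subspace_add[OF subspace_grade]
    by (auto simp: sublev_def)
qed

text \<open>By orthogonality a vector lies in a sublevel space only if all basis vectors in its support do.\<close>

lemma sublev_span:
  assumes B: "obasis C B" and J: "lower_levels J"
  shows "sublev C J i = vec.span {b \<in> B. hdeg C b = i \<and> lev C b \<in> J}"
proof -
  have ind: "vec.independent B" and sp: "vec.span B = total C"
    using B by (auto simp: obasis_def)
  have lev: "lev C x \<in> J \<longleftrightarrow> (\<forall>b\<in>supp B x. lev C b \<in> J)" if x: "x \<in> total C" for x
  proof (cases "supp B x = {}")
    case True
    then show ?thesis
      using B J x by (simp add: obasis_def lower_levels_def bot_ereal_def)
  next
    case False
    have l: "lev C x = Max (lev C ` supp B x)"
      using B x False by (simp add: obasis_def Max_Sup)
    show ?thesis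
    proof
      assume "lev C x \<in> J"
      moreover have "lev C b \<le> lev C x" if "b \<in> supp B x" for b
        unfolding l using that by simp
      ultimately show "\<forall>b\<in>supp B x. lev C b \<in> J"
        using J unfolding lower_levels_def by blast
    next
      assume a: "\<forall>b\<in>supp B x. lev C b \<in> J"
      have "lev C x \<in> lev C ` supp B x"
        unfolding l using False by (intro Max_in) auto
      then show "lev C x \<in> J" using a by auto
    qed
  qed
  show ?thesis
  proof (rule Set.set_eqI)
    fix x
    have "x \<in> sublev C J i \<longleftrightarrow> x \<in> vec.span B \<and> supp B x \<subseteq> {b \<in> B. hdeg C b = i} \<and> lev C x \<in> J"
      unfolding sublev_def obasis_grade[OF B]
      using in_span_subset_iff[OF ind, of "{b \<in> B. hdeg C b = i}" x] by auto
    also have "\<dots> \<longleftrightarrow> x \<in> vec.span B \<and> supp B x \<subseteq> {b \<in> B. hdeg C b = i \<and> lev C b \<in> J}"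
      using lev sp supp_subset[of B x] by auto
    finally show "x \<in> sublev C J i \<longleftrightarrow> x \<in> vec.span {b \<in> B. hdeg C b = i \<and> lev C b \<in> J}"
      using in_span_subset_iff[OF ind, of "{b \<in> B. hdeg C b = i \<and> lev C b \<in> J}" x] by auto
  qed
qed

end


subsection \<open>Existence of adapted orthogonal bases\<close>

text \<open>\<open>Y \<subseteq> Z\<close> lift bases of the images of \<open>S\<close> and of \<open>V\<close> in the quotient \<open>V / U\<close>; the last clause says
  that \<open>Z\<close> is independent modulo \<open>U\<close>.\<close>

lemma adapted_extension:
  fixes U S V :: "'k::field vec set"
  assumes "vec.subspace U" "vec.subspace V" "U \<subseteq> V" "S \<subseteq> V"
  shows "\<exists>Y Z. Y \<subseteq> Z \<and> Y \<subseteq> S \<and> Z \<subseteq> V \<and>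
    (\<forall>x\<in>S. \<exists>y\<in>U. x - y \<in> vec.span Y) \<and>
    (\<forall>x\<in>V. \<exists>y\<in>U. x - y \<in> vec.span Z) \<and>
    (\<forall>T c. finite T \<longrightarrow> T \<subseteq> Z \<longrightarrow> T \<noteq> {} \<longrightarrow> (\<forall>b\<in>T. c b \<noteq> 0) \<longrightarrow>
      (\<Sum>b\<in>T. vscale (c b) b) \<notin> U)"
proof -
  obtain X0 where X0: "X0 \<subseteq> U" "vec.independent X0" "U \<subseteq> vec.span X0"
    using vec.maximal_independent_subset by metis
  have s0: "vec.span X0 = U" by (rule vec.span_subspace[OF X0(1,3) assms(1)])
  obtain X1 where X1: "X0 \<subseteq> X1" "X1 \<subseteq> X0 \<union> S" "vec.independent X1" "X0 \<union> S \<subseteq> vec.span X1"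
    by (rule vec.maximal_independent_subset_extend[of X0 "X0 \<union> S"]) (use X0 in auto)
  have X1V: "X1 \<subseteq> V" using X1(2) X0(1) assms by blast
  obtain X2 where X2: "X1 \<subseteq> X2" "X2 \<subseteq> V" "vec.independent X2" "V \<subseteq> vec.span X2"
    by (rule vec.maximal_independent_subset_extend[OF X1V X1(3)])
  have dec: "\<exists>y\<in>U. x - y \<in> vec.span (X - X0)" if x: "x \<in> vec.span X" "X0 \<subseteq> X" for x X
  proof -
    have "x \<in> vec.span (X0 \<union> (X - X0))" using x by (simp add: Un_absorb1)
    then obtain y z where "y \<in> U" "z \<in> vec.span (X - X0)" "x = y + z"
      unfolding vec.span_Un s0 by blast
    then show ?thesis by (intro bexI[of _ y]) auto
  qed
  show ?thesis
  proof (rule exI[of _ "X1 - X0"], rule exI[of _ "X2 - X0"], intro conjI allI ballI impI)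
    show "X1 - X0 \<subseteq> X2 - X0" "X1 - X0 \<subseteq> S" "X2 - X0 \<subseteq> V" using X1 X2 by auto
    show "\<exists>y\<in>U. x - y \<in> vec.span (X1 - X0)" if "x \<in> S" for x
      using dec[of x X1] X1(1,4) that by auto
    show "\<exists>y\<in>U. x - y \<in> vec.span (X2 - X0)" if "x \<in> V" for x
      using dec[of x X2] X1(1) X2(1,4) that by auto
    fix T c assume T: "finite T" "T \<subseteq> X2 - X0" "T \<noteq> {}" "\<forall>b\<in>T. (c b :: 'k) \<noteq> 0"
    show "(\<Sum>b\<in>T. vscale (c b) b) \<notin> U"
    proof
      let ?x = "\<Sum>b\<in>T. vscale (c b) b"
      assume "?x \<in> U"
      then have "supp X2 ?x \<subseteq> X0"
        using in_span_subset_iff[OF X2(3), of X0 ?x] s0 X1(1) X2(1) by auto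
      moreover have "?x \<in> vec.span T"
        by (rule vec.span_sum, rule vec.span_scale, rule vec.span_base)
      then have "supp X2 ?x \<subseteq> T"
        using in_span_subset_iff[OF X2(3), of T ?x] T(2) by auto
      moreover have "?x \<in> vec.span X2"
        using \<open>?x \<in> vec.span T\<close> vec.span_mono[of T X2] T(2) by auto
      ultimately have "?x = 0" using supp_eq_empty_iff[OF X2(3), of ?x] T(2) by auto
      then show False
        using vec.independentD[OF X2(3) T(1), of c] T by blast
    qed
  qed
qed

text \<open>A vector of level \<open>a\<close> is, up to a vector of smaller level, a combination of lifts of a basis
  of the quotient of \<open>{x. lev x \<le> a}\<close> by \<open>{x. lev x < a}\<close>.  The process stops because the sublevel
  spaces are finite dimensional.\<close>

lemma (in filtered_complex) level_descent:
  assumes fd: "\<And>r. finite_dim (sublevel C r)" and W: "vec.subspace W" "W \<subseteq> grade C i"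
    and BW: "\<And>a. Bf a \<subseteq> W"
    and step: "\<And>x a. x \<in> W \<Longrightarrow> lev C x \<le> ereal a \<Longrightarrow> \<exists>y. y \<in> grade C i \<and> lev C y < ereal a \<and> x - y \<in> vec.span (Bf a)"
  shows "W \<subseteq> vec.span (\<Union>a. Bf a)"
proof
  let ?V = "\<lambda>x. sublev C {..lev C x} i"
  fix x assume "x \<in> W"
  then show "x \<in> vec.span (\<Union>a. Bf a)"
  proof (induction "vec.dim (?V x)" arbitrary: x rule: less_induct)
    case less
    show ?case
    proof (cases "x = 0")
      case False
      have xt: "x \<in> total C" using less.prems W(2) grade_total by blast
      obtain a where a: "lev C x = ereal a" using lev_real[OF xt False] by blast
      obtain y where y: "y \<in> grade C i" "lev C y < ereal a" "x - y \<in> vec.span (Bf a)"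
        using step[OF less.prems, of a] a by auto
      have sB: "vec.span (Bf a) \<subseteq> W" by (rule vec.span_minimal[OF BW W(1)])
      have yW: "y \<in> W"
        using vec.subspace_diff[OF W(1) less.prems subsetD[OF sB y(3)]] by simp
      have "?V y \<subset> ?V x"
      proof
        show "?V y \<subseteq> ?V x" using y(2) a unfolding sublev_def by fastforce
        have "x \<in> ?V x" "x \<notin> ?V y" using less.prems W(2) a y(2) by (auto simp: sublev_def)
        then show "?V y \<noteq> ?V x" by blast
      qed
      moreover have "finite_dim (?V x)"
        by (rule finite_dim_mono[OF fd[of a]])
          (use grade_total in \<open>auto simp: sublev_def sublevel_def a\<close>)
      moreover have "vec.subspace (?V y)"
        by (rule subspace_sublev) (auto simp: lower_levels_def)
      ultimately have "vec.dim (?V y) < vec.dim (?V x)" by (intro dim_less_subset)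
      then have "y \<in> vec.span (\<Union>a. Bf a)" using less.hyps yW by blast
      moreover have "x - y \<in> vec.span (\<Union>a. Bf a)"
        using y(3) vec.span_mono[of "Bf a" "\<Union>a. Bf a"] by blast
      ultimately show ?thesis using vec.span_add by fastforce
    qed (simp add: vec.span_zero)
  qed
qed

text \<open>For each degree and level, choose lifts of a basis of the quotient of \<open>{x. lev x \<le> a}\<close> by
  \<open>{x. lev x < a}\<close> that extends a basis of the image of \<open>S i\<close>.  Independence modulo lower levels is
  orthogonality, and by \<open>level_descent\<close> the lifts span.\<close>

theorem (in filtered_complex) adapted_obasis:
  assumes fd: "\<And>r. finite_dim (sublevel C r)"
    and S: "\<And>i. vec.subspace (S i)" "\<And>i. S i \<subseteq> grade C i"
  obtains B B' where "obasis C B" "B' \<subseteq> B" "\<And>i. S i = vec.span {b \<in> B'. hdeg C b = i}"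
proof -
  let ?U = "\<lambda>i a. sublev C {..<ereal a} i" and ?V = "\<lambda>i a. sublev C {..ereal a} i"
  have subs: "vec.subspace (?U i a)" "vec.subspace (?V i a)" for i a
    using subspace_sublev lower_levels_atMost lower_levels_lessThan by blast+
  define P where "P i a Y Z \<longleftrightarrow> Y \<subseteq> Z \<and> Y \<subseteq> S i \<inter> ?V i a \<and> Z \<subseteq> ?V i a \<and>
    (\<forall>x\<in>S i \<inter> ?V i a. \<exists>y\<in>?U i a. x - y \<in> vec.span Y) \<and>
    (\<forall>x\<in>?V i a. \<exists>y\<in>?U i a. x - y \<in> vec.span Z) \<and>
    (\<forall>T c. finite T \<longrightarrow> T \<subseteq> Z \<longrightarrow> T \<noteq> {} \<longrightarrow> (\<forall>b\<in>T. c b \<noteq> 0) \<longrightarrow> (\<Sum>b\<in>T. vscale (c b) b) \<notin> ?U i a)"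
    for i a Y Z
  have "\<exists>Y Z. P i a Y Z" for i a
  proof -
    have "?U i a \<subseteq> ?V i a" by (auto simp: sublev_def)
    then show ?thesis
      unfolding P_def by (rule adapted_extension[OF subs[of a i]]) simp
  qed
  then obtain Y Z where YZ': "\<And>i a. P i a (Y i a) (Z i a)" by metis
  have Y1: "\<And>i a. Y i a \<subseteq> Z i a" and Y2: "\<And>i a. Y i a \<subseteq> S i \<inter> ?V i a" and Z1: "\<And>i a. Z i a \<subseteq> ?V i a"
    and Y3: "\<And>i a x. x \<in> S i \<inter> ?V i a \<Longrightarrow> \<exists>y\<in>?U i a. x - y \<in> vec.span (Y i a)"
    and Z2: "\<And>i a x. x \<in> ?V i a \<Longrightarrow> \<exists>y\<in>?U i a. x - y \<in> vec.span (Z i a)"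
    and Z3: "\<And>i a T c. finite T \<Longrightarrow> T \<subseteq> Z i a \<Longrightarrow> T \<noteq> {} \<Longrightarrow> \<forall>b\<in>T. c b \<noteq> 0 \<Longrightarrow>
      (\<Sum>b\<in>T. vscale (c b) b) \<notin> ?U i a"
    using YZ'[unfolded P_def] by (simp_all only: all_simps simp_thms)
  define B where "B = (\<Union>i a. Z i a)"
  define B' where "B' = (\<Union>i a. Y i a)"
  have Zg: "b \<in> grade C i \<and> b \<noteq> 0 \<and> lev C b = ereal a" if b: "b \<in> Z i a" for b i a
  proof -
    have "b \<in> ?V i a" using Z1 b by blast
    moreover have "(\<Sum>b\<in>{b}. vscale 1 b) \<notin> ?U i a"
      by (intro Z3) (use b in auto)
    then have "b \<notin> ?U i a" by simp
    ultimately show ?thesis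
      using vec.subspace_0[OF subs(1)[of a i]] by (auto simp: sublev_def)
  qed
  have hd: "hdeg C b = i" "lev C b = ereal a" "b \<in> total C" if "b \<in> Z i a" for b i a
    using Zg[OF that] hdeg_eq[of b i] subsetD[OF grade_total, of b C i] by auto
  have Zeq: "b \<in> Z i a" if b: "b \<in> B" "hdeg C b = i" "lev C b = ereal a" for b i a
  proof -
    obtain i' a' where "b \<in> Z i' a'" using b unfolding B_def by blast
    then show ?thesis using hd[of b i' a'] b by auto
  qed
  have B'B: "B' \<subseteq> B" using Y1 unfolding B_def B'_def by blast
  have BT: "B \<subseteq> total C" using hd(3) unfolding B_def by blast
  have Bg: "b \<in> grade C (hdeg C b)" if b: "b \<in> B" for b
  proof -
    obtain i a where ia: "b \<in> Z i a" using b unfolding B_def by blast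
    show ?thesis using hd(1)[OF ia] Zg[OF ia] by simp
  qed
  have orth: "lev C (\<Sum>b\<in>T. vscale (c b) b) = (SUP b\<in>T. lev C b)"
    if T: "finite T" "T \<subseteq> B" and c: "\<And>b. b \<in> T \<Longrightarrow> c b \<noteq> 0" for T c
  proof (rule antisym)
    have Tt: "vscale (c b) b \<in> total C" if "b \<in> T" for b
      using that T(2) BT vec.subspace_scale[OF subspace_total] by blast
    have "lev C (vscale (c b) b) \<le> (SUP b\<in>T. lev C b)" if "b \<in> T" for b
    proof (rule order_trans[OF lev_scale_le SUP_upper[OF that]])
      show "b \<in> total C" using T(2) BT that by blast
    qed
    then show "lev C (\<Sum>b\<in>T. vscale (c b) b) \<le> (SUP b\<in>T. lev C b)"
      by (intro lev_sum_le T(1) Tt)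
    show "(SUP b\<in>T. lev C b) \<le> lev C (\<Sum>b\<in>T. vscale (c b) b)"
    proof (cases "T = {}")
      case False
      have "Max (lev C ` T) \<in> lev C ` T" using False T(1) by (intro Max_in) auto
      then obtain b0 where b0: "b0 \<in> T" "lev C b0 = Max (lev C ` T)" by auto
      have mx: "lev C b \<le> lev C b0" if "b \<in> T" for b using b0 that T(1) by auto
      obtain i a where ia: "b0 \<in> Z i a" using b0(1) T(2) unfolding B_def by blast
      have la: "lev C b0 = ereal a" and di: "hdeg C b0 = i" using hd[OF ia] by auto
      let ?g = "\<lambda>j. \<Sum>b\<in>{b \<in> T. hdeg C b = j}. vscale (c b) b"
      have gj: "?g j \<in> grade C j" for j
        by (intro vec.subspace_sum subspace_grade vec.subspace_scale) (use Bg T(2) in blast)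
      have "(\<Sum>j\<in>hdeg C ` T. ?g j) = (\<Sum>b\<in>T. vscale (c b) b)"
        by (rule sum.group) (use T in auto)
      moreover have "lev C (?g i) \<le> lev C (\<Sum>j\<in>hdeg C ` T. ?g j)"
        by (rule lev_component) (use T gj b0 di in auto)
      moreover have "\<not> lev C (?g i) < ereal a"
      proof
        assume less: "lev C (?g i) < ereal a"
        let ?T1 = "{b \<in> T. hdeg C b = i \<and> lev C b = ereal a}"
        let ?T2 = "{b \<in> T. hdeg C b = i \<and> lev C b \<noteq> ereal a}"
        have "?g i = (\<Sum>b\<in>?T1 \<union> ?T2. vscale (c b) b)" by (intro sum.cong) auto
        also have "\<dots> = (\<Sum>b\<in>?T1. vscale (c b) b) + (\<Sum>b\<in>?T2. vscale (c b) b)"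
          using T(1) by (intro sum.union_disjoint) auto
        finally have split: "(\<Sum>b\<in>?T1. vscale (c b) b) = ?g i - (\<Sum>b\<in>?T2. vscale (c b) b)" by simp
        have "(\<Sum>b\<in>?T2. vscale (c b) b) \<in> ?U i a"
        proof (intro vec.subspace_sum subs vec.subspace_scale)
          fix b assume b: "b \<in> ?T2"
          then have "lev C b < ereal a" using mx[of b] la by auto
          then show "b \<in> ?U i a" using b Bg[of b] T(2) by (auto simp: sublev_def)
        qed
        moreover have "?g i \<in> ?U i a" using less gj by (simp add: sublev_def)
        ultimately have "(\<Sum>b\<in>?T1. vscale (c b) b) \<in> ?U i a"
          unfolding split using vec.subspace_diff subs by blast
        moreover have "?T1 \<subseteq> Z i a" using Zeq T(2) by blast
        moreover have "?T1 \<noteq> {}" using b0 la di by blast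
        moreover have "finite ?T1" using T(1) by simp
        ultimately show False using Z3[of ?T1 i a c] c by blast
      qed
      ultimately have "ereal a \<le> lev C (\<Sum>b\<in>T. vscale (c b) b)" by simp
      then show ?thesis using mx la by (auto intro!: SUP_least intro: order_trans)
    qed (simp add: bot_ereal_def)
  qed
  have ind: "vec.independent B"
    unfolding vec.dependent_explicit
  proof (rule notI, elim exE conjE bexE)
    fix T u v assume T: "finite T" "T \<subseteq> B" "(\<Sum>v\<in>T. vscale (u v) v) = 0" "v \<in> T" "u v \<noteq> (0 :: 'k)"
    let ?T = "{v \<in> T. u v \<noteq> 0}"
    have "(\<Sum>v\<in>?T. vscale (u v) v) = (\<Sum>v\<in>T. vscale (u v) v)"
      by (rule sum.mono_neutral_left) (use T(1) in auto)
    then have "(\<Sum>v\<in>?T. vscale (u v) v) = 0" using T(3) by simp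
    then have "(SUP b\<in>?T. lev C b) = -\<infinity>"
    proof -
      have "lev C (\<Sum>v\<in>?T. vscale (u v) v) = (SUP b\<in>?T. lev C b)"
        by (rule orth) (use T(1,2) in auto)
      then show ?thesis
        unfolding \<open>(\<Sum>v\<in>?T. vscale (u v) v) = 0\<close> by (simp only: lev_zero)
    qed
    moreover have "lev C v \<le> (SUP b\<in>?T. lev C b)" using T by (intro SUP_upper) auto
    moreover obtain i a where "v \<in> Z i a" using T unfolding B_def by blast
    then have "lev C v = ereal a" by (rule hd)
    ultimately show False by simp
  qed
  have "S i \<subseteq> vec.span (\<Union>a. Y i a)" for i
  proof (rule level_descent[OF fd S])
    show "Y i a \<subseteq> S i" for a using Y2 by blast
    fix x a assume "x \<in> S i" "lev C x \<le> ereal a"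
    then have "x \<in> S i \<inter> ?V i a" using S(2) by (auto simp: sublev_def)
    from Y3[OF this] show "\<exists>y. y \<in> grade C i \<and> lev C y < ereal a \<and> x - y \<in> vec.span (Y i a)"
      by (auto simp: sublev_def)
  qed
  moreover have "(\<Union>a. Y i a) \<subseteq> {b \<in> B'. hdeg C b = i}" for i
  proof
    fix b assume "b \<in> (\<Union>a. Y i a)"
    then obtain a where a: "b \<in> Y i a" by blast
    then have "hdeg C b = i" using hd(1)[of b i a] Y1 by blast
    then show "b \<in> {b \<in> B'. hdeg C b = i}" using a unfolding B'_def by blast
  qed
  ultimately have S1: "S i \<subseteq> vec.span {b \<in> B'. hdeg C b = i}" for i
    by (rule order_trans[OF _ vec.span_mono])
  have S2: "vec.span {b \<in> B'. hdeg C b = i} \<subseteq> S i" for i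
  proof (rule vec.span_minimal[OF _ S(1)], clarify)
    fix b assume "b \<in> B'"
    then obtain j a where j: "b \<in> Y j a" unfolding B'_def by blast
    then have "b \<in> Z j a" using Y1 by blast
    then have "hdeg C b = j" by (rule hd)
    then show "b \<in> S (hdeg C b)" using j Y2[of j a] by auto
  qed
  have "grade C i \<subseteq> vec.span (\<Union>a. Z i a)" for i
  proof (rule level_descent[OF fd subspace_grade subset_refl])
    show "Z i a \<subseteq> grade C i" for a using Zg by blast
    fix x a assume "x \<in> grade C i" "lev C x \<le> ereal a"
    then have "x \<in> ?V i a" by (auto simp: sublev_def)
    from Z2[OF this] show "\<exists>y. y \<in> grade C i \<and> lev C y < ereal a \<and> x - y \<in> vec.span (Z i a)"
      by (auto simp: sublev_def)
  qed
  then have gB: "grade C i \<subseteq> vec.span B" for i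
    by (rule order_trans[OF _ vec.span_mono]) (auto simp: B_def)
  have sp: "vec.span B = total C"
  proof
    show "vec.span B \<subseteq> total C" by (rule vec.span_minimal[OF BT subspace_total])
    show "total C \<subseteq> vec.span B"
      unfolding total_def by (rule vec.span_minimal) (use gB in auto)
  qed
  have "obasis C B"
    unfolding obasis_def
  proof (intro conjI ballI)
    show "B \<subseteq> (\<Union>i. grade C i)" using Bg by blast
    fix x assume x: "x \<in> total C"
    have "lev C (\<Sum>b\<in>supp B x. vscale (vec.representation B x b) b) = (SUP b\<in>supp B x. lev C b)"
      by (rule orth) (auto simp: supp_subset, simp add: supp_def)
    then show "lev C x = (SUP b\<in>supp B x. lev C b)"
      using supp_sum[OF ind] x sp by simp
  qed (use ind sp in auto)
  then show thesis using that[OF _ B'B] S1 S2 by blast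
qed

text \<open>When the filtration is given by an infimum, as for tensor products, sublevel spaces are
  easier to identify than levels.\<close>

lemma filtered_complexI_span:
  assumes "vec.independent B" "\<And>i. grade C i = vec.span {b \<in> B. deg b = i}"
    and lev: "\<And>x M. x \<in> vec.span B \<Longrightarrow> lev C x \<le> M \<longleftrightarrow> x \<in> vec.span {b \<in> B. ereal (l b) \<le> M}"
    and "linear_on_set (vec.span B) (bdry C)"
    and "\<And>b. b \<in> B \<Longrightarrow> bdry C b \<in> grade C (deg b - 1)"
    and "\<And>b. b \<in> B \<Longrightarrow> lev C (bdry C b) \<le> ereal (l b)"
    and "\<And>b. b \<in> B \<Longrightarrow> bdry C (bdry C b) = 0"
  shows "filtered_complex C \<and> obasis C B \<and> total C = vec.span B \<and>
    (\<forall>b\<in>B. hdeg C b = deg b \<and> lev C b = ereal (l b))"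
proof -
  have l: "lev C x = (SUP b\<in>supp B x. ereal (l b))" if x: "x \<in> vec.span B" for x
    by (rule antisym)
      (rule lev[OF x, THEN iffD2, OF supp_sup_le_iff[OF assms(1) x, THEN iffD1, OF order_refl]],
       rule supp_sup_le_iff[OF assms(1) x, THEN iffD2, OF lev[OF x, THEN iffD1, OF order_refl]])
  show ?thesis
    using filtered_complexI[OF assms(1,2) l assms(4-7)] by simp
qed

lemma obasis_le_iff:
  assumes "obasis C B" "x \<in> total C"
  shows "lev C x \<le> M \<longleftrightarrow> x \<in> vec.span {b \<in> B. lev C b \<le> M}"
proof -
  have B: "vec.independent B" "vec.span B = total C" using assms(1) by (auto simp: obasis_def)
  have "lev C x \<le> M \<longleftrightarrow> (\<forall>b\<in>supp B x. lev C b \<le> M)"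
    using assms by (simp add: obasis_def SUP_le_iff)
  then show ?thesis
    using in_span_subset_iff[OF B(1), of "{b \<in> B. lev C b \<le> M}" x] assms(2) B(2) supp_subset[of B x]
    by auto
qed


section \<open>Tame complexes and their levels\<close>

definition tame :: "'k::field fcc \<Rightarrow> bool"
  where "tame C \<longleftrightarrow> filtered_complex C \<and> (\<forall>r. finite_dim (sublevel C r))"

definition levels :: "'k::field fcc \<Rightarrow> real set"
  where "levels C = {a. \<exists>x\<in>total C. lev C x = ereal a}"

text \<open>The classes of complexes in question are described by the shape of their sets of levels, so
  that closure under cones and spans of basis vectors reduces to closure of a family of sets of
  reals under unions and subsets.\<close>

definition complexes_with_levels :: "real set set \<Rightarrow> 'k::field fcc set"
  where "complexes_with_levels L = {C. tame C \<and> levels C \<in> L}"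

lemma tame_fc: "tame C \<Longrightarrow> filtered_complex C"
  by (simp add: tame_def)

lemma tame_obasis:
  assumes "tame C" obtains B where "obasis C B"
proof -
  interpret filtered_complex C using assms by (rule tame_fc)
  show thesis
    by (rule adapted_obasis[OF _ subspace_grade subset_refl]) (use assms that in \<open>auto simp: tame_def\<close>)
qed

lemma obasis_finite_le:
  assumes "tame C" "obasis C B"
  shows "finite {b \<in> B. lev C b \<le> ereal r}"
proof (rule finite_dim_independent_finite)
  interpret filtered_complex C using assms by (simp add: tame_def)
  show "finite_dim (sublevel C r)" using assms by (simp add: tame_def)
  show "{b \<in> B. lev C b \<le> ereal r} \<subseteq> sublevel C r"
    using obasis_total[OF assms(2)] by (auto simp: sublevel_def)
  show "vec.independent {b \<in> B. lev C b \<le> ereal r}"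
    by (rule vec.independent_mono[of B]) (use assms in \<open>auto simp: obasis_def\<close>)
qed

lemma tameI:
  assumes "filtered_complex C" "obasis C B" "\<And>r. finite {b \<in> B. lev C b \<le> ereal r}"
  shows "tame C"
  unfolding tame_def
proof (intro conjI allI assms(1))
  fix r
  have "sublevel C r \<subseteq> vec.span {b \<in> B. lev C b \<le> ereal r}"
    using obasis_le_iff[OF assms(2)] by (auto simp: sublevel_def)
  then show "finite_dim (sublevel C r)"
    by (rule finite_dim_mono[OF finite_dim_span[OF assms(3)]])
qed

lemma (in filtered_complex) levels_obasis:
  assumes "obasis C B"
  shows "levels C = {a. \<exists>b\<in>B. lev C b = ereal a}"
proof
  show "{a. \<exists>b\<in>B. lev C b = ereal a} \<subseteq> levels C"
    using obasis_total[OF assms] by (auto simp: levels_def)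
  show "levels C \<subseteq> {a. \<exists>b\<in>B. lev C b = ereal a}"
  proof
    fix a assume "a \<in> levels C"
    then obtain x where x: "x \<in> total C" "lev C x = ereal a" by (auto simp: levels_def)
    have l: "ereal a = (SUP b\<in>supp B x. lev C b)" using assms x by (simp add: obasis_def)
    have ne: "supp B x \<noteq> {}" using l by (auto simp: bot_ereal_def)
    have "Max (lev C ` supp B x) \<in> lev C ` supp B x" using ne by (intro Max_in) auto
    then have "ereal a \<in> lev C ` supp B x" using l ne by (simp add: Max_Sup)
    then show "a \<in> {a. \<exists>b\<in>B. lev C b = ereal a}" using supp_subset[of B x] by auto
  qed
qed

text \<open>Levels are bounded below because only finitely many vectors of an orthogonal basis have
  negative level.\<close>

lemma tame_complexes_eq: "tame_complexes = complexes_with_levels UNIV"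
proof -
  have "\<exists>r0. \<forall>r\<le>r0. sublevel C r = {0}" if C: "tame C" for C :: "'a fcc"
  proof -
    interpret filtered_complex C using C by (rule tame_fc)
    obtain B where B: "obasis C B" using tame_obasis[OF C] .
    let ?F = "(\<lambda>b. real_of_ereal (lev C b)) ` {b \<in> B. lev C b \<le> ereal 0}"
    have fF: "finite ?F" using obasis_finite_le[OF C B, of 0] by blast
    define r0 where "r0 = min (Min ?F) 0 - 1"
    have r0: "r0 < 0" "\<And>a. a \<in> ?F \<Longrightarrow> r0 < a"
      using Min_le[OF fF] unfolding r0_def by fastforce+
    have e: "{b \<in> B. lev C b \<le> ereal r} = {}" if r: "r \<le> r0" for r
    proof (rule ccontr)
      assume "{b \<in> B. lev C b \<le> ereal r} \<noteq> {}"
      then obtain b where b: "b \<in> B" "lev C b \<le> ereal r" by blast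
      have l: "lev C b = ereal (real_of_ereal (lev C b))" using obasis_lev[OF B b(1)] .
      then have "real_of_ereal (lev C b) \<le> r" using b(2) by (metis ereal_less_eq(3))
      then have "real_of_ereal (lev C b) \<in> ?F" using b l r r0(1)
        by (intro imageI) (auto intro: order_trans)
      then show False using r0(2) \<open>real_of_ereal (lev C b) \<le> r\<close> r by fastforce
    qed
    have "sublevel C r = {0}" if r: "r \<le> r0" for r
    proof -
      have "x \<in> sublevel C r \<longleftrightarrow> x = 0" for x
      proof
        assume "x \<in> sublevel C r"
        then have "x \<in> vec.span {b \<in> B. lev C b \<le> ereal r}"
          using obasis_le_iff[OF B, of x] by (simp add: sublevel_def)
        then show "x = 0" unfolding e[OF r] by simp
      next
        assume "x = 0"
        then show "x \<in> sublevel C r"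
          using lev_zero vec.subspace_0[OF subspace_total] by (simp add: sublevel_def)
      qed
      then show ?thesis by blast
    qed
    then show ?thesis by blast
  qed
  then show ?thesis unfolding tame_complexes_def complexes_with_levels_def tame_def by auto
qed

text \<open>A tame complex with finitely many levels equals one of its sublevel spaces.\<close>

lemma fg_complexes_eq: "fg_complexes = complexes_with_levels {A. finite A}"
proof -
  have "C \<in> fg_complexes \<longleftrightarrow> C \<in> complexes_with_levels {A. finite A}" for C :: "'a fcc"
  proof
    assume C: "C \<in> fg_complexes"
    then interpret filtered_complex C by (simp add: fg_complexes_def)
    have fd: "finite_dim (total C)" using C by (simp add: fg_complexes_def)
    have t: "tame C"
      unfolding tame_def using filtered_complex_axioms finite_dim_mono[OF fd]
      by (auto simp: sublevel_def)
    obtain B where B: "obasis C B" using tame_obasis[OF t] .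
    have "finite B"
      using obasis_total[OF B] B by (intro finite_dim_independent_finite[OF fd]) (auto simp: obasis_def)
    then have "finite ((\<lambda>b. real_of_ereal (lev C b)) ` B)" by simp
    moreover have "levels C \<subseteq> (\<lambda>b. real_of_ereal (lev C b)) ` B"
      unfolding levels_obasis[OF B] by force
    ultimately show "C \<in> complexes_with_levels {A. finite A}"
      using t finite_subset by (auto simp: complexes_with_levels_def)
  next
    assume C: "C \<in> complexes_with_levels {A. finite A}"
    then have t: "tame C" and fin: "finite (levels C)" by (auto simp: complexes_with_levels_def)
    interpret filtered_complex C using t by (rule tame_fc)
    obtain B where B: "obasis C B" using tame_obasis[OF t] .
    obtain r where r: "\<And>a. a \<in> levels C \<Longrightarrow> a \<le> r" using fin
      by (meson Max_ge)
    have "B \<subseteq> {b \<in> B. lev C b \<le> ereal r}"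
    proof
      fix b assume b: "b \<in> B"
      have l: "lev C b = ereal (real_of_ereal (lev C b))" using obasis_lev[OF B b] .
      then have "real_of_ereal (lev C b) \<in> levels C" using obasis_total[OF B b] by (auto simp: levels_def)
      then have "ereal (real_of_ereal (lev C b)) \<le> ereal r" using r by simp
      then show "b \<in> {b \<in> B. lev C b \<le> ereal r}" using b l by simp
    qed
    then have "finite B" using obasis_finite_le[OF t B] finite_subset by blast
    then have "finite_dim (vec.span B)" by (rule finite_dim_span)
    then have "finite_dim (total C)" using B by (simp add: obasis_def)
    then show "C \<in> fg_complexes" using filtered_complex_axioms by (simp add: fg_complexes_def)
  qed
  then show ?thesis by blast
qed


section \<open>The Euler characteristic series\<close>

definition deg_sign :: "int \<Rightarrow> int"
  where "deg_sign i = (if even i then 1 else - 1)"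

lemma deg_sign_add: "deg_sign (i + j) = deg_sign i * deg_sign j"
  by (simp add: deg_sign_def)

lemma deg_sign_1 [simp]: "deg_sign 1 = - 1" "deg_sign (- 1) = - 1" "deg_sign 0 = 1"
  by (auto simp: deg_sign_def)

text \<open>The sum over all degrees is finite for a sublevel space of a tame complex, as the
  total dimension is finite.\<close>

definition euler :: "(int \<Rightarrow> 'k::field vec set) \<Rightarrow> int"
  where "euler V = Sum_any (\<lambda>i. deg_sign i * int (vec.dim (V i)))"

text \<open>The coefficient of \<open>t\<^sup>a\<close> is the Euler characteristic of the quotient of the subcomplex
  \<open>{x. lev x \<le> a}\<close> by \<open>{x. lev x < a}\<close>.\<close>

definition euler_series :: "'k::field fcc \<Rightarrow> real \<Rightarrow> int"
  where "euler_series C a = euler (sublev C {..ereal a}) - euler (sublev C {..<ereal a})"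

text \<open>For a tame complex this is the number of vectors of degree \<open>i\<close> and level \<open>a\<close> in any
  orthogonal basis; since the second space is contained in the first and both are then finite
  dimensional, the subtraction does not truncate.\<close>

definition betti :: "'k::field fcc \<Rightarrow> int \<Rightarrow> real \<Rightarrow> nat"
  where "betti C i a = vec.dim (sublev C {..ereal a} i) - vec.dim (sublev C {..<ereal a} i)"

lemma obasis_dim_sublev:
  assumes "filtered_complex C" "obasis C B" "lower_levels J"
  shows "vec.dim (sublev C J i) = card {b \<in> B. hdeg C b = i \<and> lev C b \<in> J}"
proof -
  interpret filtered_complex C by fact
  have "vec.independent {b \<in> B. hdeg C b = i \<and> lev C b \<in> J}"
    by (rule vec.independent_mono[of B]) (use assms in \<open>auto simp: obasis_def\<close>)
  then show ?thesis
    unfolding sublev_span[OF assms(2,3)] by (rule vec.dim_span_eq_card_independent)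
qed

lemma obasis_euler:
  assumes "filtered_complex C" "obasis C B" "lower_levels J" "finite {b \<in> B. lev C b \<in> J}"
  shows "euler (sublev C J) = (\<Sum>b\<in>{b \<in> B. lev C b \<in> J}. deg_sign (hdeg C b))"
proof -
  let ?BJ = "{b \<in> B. lev C b \<in> J}"
  let ?f = "\<lambda>i. deg_sign i * int (card {b \<in> ?BJ. hdeg C b = i})"
  have "euler (sublev C J) = Sum_any ?f"
    unfolding euler_def obasis_dim_sublev[OF assms(1-3)]
    by (rule arg_cong[where f = Sum_any], rule ext) (simp add: conj_commute conj_left_commute)
  also have "\<dots> = sum ?f (hdeg C ` ?BJ)"
  proof (rule Sum_any.expand_superset)
    show "finite (hdeg C ` ?BJ)" using assms(4) by blast
    have "{b \<in> ?BJ. hdeg C b = i} = {}" if "i \<notin> hdeg C ` ?BJ" for i using that by blast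
    then have "?f i = 0" if "i \<notin> hdeg C ` ?BJ" for i using that by (metis (no_types) card.empty mult_zero_right of_nat_0)
    then show "{a. ?f a \<noteq> 0} \<subseteq> hdeg C ` ?BJ" by blast
  qed
  also have "\<dots> = (\<Sum>i\<in>hdeg C ` ?BJ. \<Sum>b\<in>{b \<in> ?BJ. hdeg C b = i}. deg_sign (hdeg C b))"
    by (intro sum.cong) auto
  also have "\<dots> = (\<Sum>b\<in>?BJ. deg_sign (hdeg C b))"
    by (rule sum.group) (use assms(4) in auto)
  finally show ?thesis .
qed

lemma obasis_betti:
  assumes "tame C" "obasis C B"
  shows "betti C i a = card {b \<in> B. hdeg C b = i \<and> lev C b = ereal a}"
proof -
  have fc: "filtered_complex C" using assms by (simp add: tame_def)
  let ?le = "{b \<in> B. hdeg C b = i \<and> lev C b \<le> ereal a}" and ?lt = "{b \<in> B. hdeg C b = i \<and> lev C b < ereal a}"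
  have f: "finite ?le" by (rule finite_subset[OF _ obasis_finite_le[OF assms, of a]]) auto
  have "card {b \<in> B. hdeg C b = i \<and> lev C b = ereal a} = card (?le - ?lt)"
    by (rule arg_cong[where f = card]) auto
  also have "\<dots> = card ?le - card ?lt"
    by (rule card_Diff_subset) (auto intro: rev_finite_subset[OF f])
  finally show ?thesis
    unfolding betti_def obasis_dim_sublev[OF fc assms(2) lower_levels_atMost]
      obasis_dim_sublev[OF fc assms(2) lower_levels_lessThan] by simp
qed

lemma obasis_euler_series:
  assumes "tame C" "obasis C B"
  shows "euler_series C a = (\<Sum>b\<in>{b \<in> B. lev C b = ereal a}. deg_sign (hdeg C b))"
proof -
  have fc: "filtered_complex C" using assms by (simp add: tame_def)
  let ?le = "{b \<in> B. lev C b \<le> ereal a}" and ?lt = "{b \<in> B. lev C b < ereal a}"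
  have f: "finite ?le" by (rule obasis_finite_le[OF assms])
  then have f': "finite ?lt" by (rule rev_finite_subset) auto
  have e: "?le - ?lt = {b \<in> B. lev C b = ereal a}" by auto
  have "sum g (?le - ?lt) = sum g ?le - sum g ?lt" for g :: "'a vec \<Rightarrow> int"
    by (rule sum_diff[OF f]) auto
  note this[of "\<lambda>b. deg_sign (hdeg C b)", unfolded e]
  moreover have "euler (sublev C {..ereal a}) = (\<Sum>b\<in>?le. deg_sign (hdeg C b))"
    using obasis_euler[OF fc assms(2) lower_levels_atMost, of a] f by simp
  moreover have "euler (sublev C {..<ereal a}) = (\<Sum>b\<in>?lt. deg_sign (hdeg C b))"
    using obasis_euler[OF fc assms(2) lower_levels_lessThan, of a] f' by simp
  ultimately show ?thesis unfolding euler_series_def by simp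
qed

lemma euler_series_betti:
  assumes "tame C" "\<And>i. i \<notin> I \<Longrightarrow> betti C i a = 0" "finite I"
  shows "euler_series C a = (\<Sum>i\<in>I. deg_sign i * int (betti C i a))"
proof -
  obtain B where B: "obasis C B" using tame_obasis[OF assms(1)] .
  let ?Ba = "{b \<in> B. lev C b = ereal a}"
  have f: "finite ?Ba" by (rule finite_subset[OF _ obasis_finite_le[OF assms(1) B, of a]]) auto
  have c: "betti C i a = card {b \<in> ?Ba. hdeg C b = i}" for i
    unfolding obasis_betti[OF assms(1) B] by (rule arg_cong[where f = card]) auto
  have sub: "hdeg C ` ?Ba \<subseteq> I"
  proof
    fix i assume "i \<in> hdeg C ` ?Ba"
    then have "{b \<in> ?Ba. hdeg C b = i} \<noteq> {}" by blast
    moreover have "finite {b \<in> ?Ba. hdeg C b = i}" by (rule rev_finite_subset[OF f]) blast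
    ultimately have "card {b \<in> ?Ba. hdeg C b = i} \<noteq> 0" by (simp only: card_eq_0_iff) blast
    then show "i \<in> I" using assms(2)[of i] c[of i] by auto
  qed
  have "euler_series C a = (\<Sum>b\<in>?Ba. deg_sign (hdeg C b))" by (rule obasis_euler_series[OF assms(1) B])
  also have "\<dots> = (\<Sum>i\<in>I. \<Sum>b\<in>{b \<in> ?Ba. hdeg C b = i}. deg_sign (hdeg C b))"
    by (rule sum.group[symmetric]) (use f assms(3) sub in auto)
  also have "\<dots> = (\<Sum>i\<in>I. deg_sign i * int (betti C i a))"
    unfolding c by (intro sum.cong) auto
  finally show ?thesis .
qed

lemma levels_betti:
  assumes "tame C"
  shows "a \<in> levels C \<longleftrightarrow> (\<exists>i. betti C i a \<noteq> 0)"
proof -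
  interpret filtered_complex C using assms by (rule tame_fc)
  obtain B where B: "obasis C B" using tame_obasis[OF assms(1)] .
  have f: "finite {b \<in> B. hdeg C b = i \<and> lev C b = ereal a}" for i
    by (rule finite_subset[OF _ obasis_finite_le[OF assms(1) B, of a]]) auto
  show ?thesis
    unfolding levels_obasis[OF B] obasis_betti[OF assms B] card_eq_0_iff using f by blast
qed

lemma finite_betti_le:
  assumes "tame C"
  shows "finite {(i, a). a \<le> r \<and> betti C i a \<noteq> 0}"
proof -
  obtain B where B: "obasis C B" using tame_obasis[OF assms(1)] .
  let ?F = "(\<lambda>b. (hdeg C b, real_of_ereal (lev C b))) ` {b \<in> B. lev C b \<le> ereal r}"
  have "{(i, a). a \<le> r \<and> betti C i a \<noteq> 0} \<subseteq> ?F"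
  proof
    fix p assume "p \<in> {(i, a). a \<le> r \<and> betti C i a \<noteq> 0}"
    then obtain i a where p: "p = (i, a)" and a: "a \<le> r" "betti C i a \<noteq> 0" by blast
    then have "{b \<in> B. hdeg C b = i \<and> lev C b = ereal a} \<noteq> {}"
      unfolding obasis_betti[OF assms B] by (metis card.empty)
    then obtain b where b: "b \<in> B" "hdeg C b = i" "lev C b = ereal a" by blast
    then have "p = (hdeg C b, real_of_ereal (lev C b))" "b \<in> {b \<in> B. lev C b \<le> ereal r}"
      using a p by auto
    then show "p \<in> ?F" by (rule image_eqI)
  qed
  then show ?thesis using obasis_finite_le[OF assms B] by (meson finite_imageI finite_subset)
qed

lemma finite_levels_le:
  assumes "tame C"
  shows "finite {a. a \<le> r \<and> a \<in> levels C}"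
proof -
  have "{a. a \<le> r \<and> a \<in> levels C} \<subseteq> snd ` {(i, a). a \<le> r \<and> betti C i a \<noteq> 0}"
    unfolding levels_betti[OF assms] by force
  then show ?thesis using finite_betti_le[OF assms] by (meson finite_imageI finite_subset)
qed

lemma euler_series_nonzero_level:
  assumes "tame C" "euler_series C a \<noteq> 0"
  shows "a \<in> levels C"
proof (rule ccontr)
  assume "a \<notin> levels C"
  then have "euler_series C a = 0"
    using euler_series_betti[OF assms(1), of "{}" a] levels_betti[OF assms(1)] by simp
  then show False using assms(2) by simp
qed

lemma euler_series_novikov: "tame C \<Longrightarrow> finite {a. a \<le> r \<and> euler_series C a \<noteq> 0}"
  by (rule finite_subset[OF _ finite_levels_le[of C r]]) (auto dest: euler_series_nonzero_level)


subsection \<open>Mapping cones\<close>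

lemma span_inl_inr:
  "z \<in> vec.span (sum_inl ` X \<union> sum_inr ` Y) \<longleftrightarrow> sum_fst z \<in> vec.span X \<and> sum_snd z \<in> vec.span Y"
proof
  assume "z \<in> vec.span (sum_inl ` X \<union> sum_inr ` Y)"
  then obtain x y where "x \<in> vec.span X" "y \<in> vec.span Y" "z = sum_inl x + sum_inr y"
    unfolding vec.span_Un vecp.linear_span_image[OF vlin_inl] vecp.linear_span_image[OF vlin_inr] by blast
  then show "sum_fst z \<in> vec.span X \<and> sum_snd z \<in> vec.span Y" by (simp add: sum_vec_simps)
next
  assume a: "sum_fst z \<in> vec.span X \<and> sum_snd z \<in> vec.span Y"
  have "sum_inl (sum_fst z) + sum_inr (sum_snd z) \<in> vec.span (sum_inl ` X \<union> sum_inr ` Y)"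
    unfolding vec.span_Un vecp.linear_span_image[OF vlin_inl] vecp.linear_span_image[OF vlin_inr]
    using a by blast
  then show "z \<in> vec.span (sum_inl ` X \<union> sum_inr ` Y)" by simp
qed

lemma independent_inl_inr:
  assumes "vec.independent X" "vec.independent Y"
  shows "vec.independent (sum_inl ` X \<union> sum_inr ` Y)"
proof -
  have fin: "vec.independent (T1 \<union> T2)"
    if T: "T1 \<subseteq> sum_inl ` X" "finite T1" "T2 \<subseteq> sum_inr ` Y" "finite T2" for T1 T2
  proof -
    have iX: "vec.independent (sum_inl ` X)"
      by (rule vecp.linear_independent_injective_image[OF vlin_inl assms(1)])
        (rule inj_on_inverseI[of _ sum_fst], simp)
    have iY: "vec.independent (sum_inr ` Y)"
      by (rule vecp.linear_independent_injective_image[OF vlin_inr assms(2)])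
        (rule inj_on_inverseI[of _ sum_snd], simp)
    have "vec.span T1 \<inter> vec.span T2 \<subseteq> {0}"
    proof
      fix z assume z: "z \<in> vec.span T1 \<inter> vec.span T2"
      have "z \<in> vec.span (sum_inl ` X)" "z \<in> vec.span (sum_inr ` Y)"
        using z vec.span_mono[OF T(1)] vec.span_mono[OF T(3)] by auto
      then show "z \<in> {0}"
        unfolding vecp.linear_span_image[OF vlin_inl] vecp.linear_span_image[OF vlin_inr]
        by (metis fst_inl fst_inr image_iff singletonI sum_vec_simps(9))
    qed
    then show ?thesis
      using independent_Un_direct(1) vec.independent_mono[OF iX T(1)] vec.independent_mono[OF iY T(3)] T
      by blast
  qed
  show ?thesis
  proof (rule vec.independent_explicit_finite_subsets[THEN iffD2], intro allI impI ballI)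
    fix A u v assume A: "A \<subseteq> sum_inl ` X \<union> sum_inr ` Y" "finite A" "(\<Sum>v\<in>A. vscale (u v) v) = 0" "v \<in> A"
    have "A = (A \<inter> sum_inl ` X) \<union> (A \<inter> sum_inr ` Y)" using A by blast
    then have "vec.independent A" using fin[of "A \<inter> sum_inl ` X" "A \<inter> sum_inr ` Y"] A by auto
    then show "u v = 0" using vec.independentD[of A A u v] A by blast
  qed
qed

lemma filt_mapD:
  assumes "filt_map C D f" "filtered_complex C"
  shows "linear_on_set (total C) f" "\<And>i x. x \<in> grade C i \<Longrightarrow> f x \<in> grade D i"
    "\<And>x. x \<in> total C \<Longrightarrow> f (bdry C x) = bdry D (f x)" "\<And>x. x \<in> total C \<Longrightarrow> lev D (f x) \<le> lev C x"
    "\<And>x. x \<in> total C \<Longrightarrow> f x \<in> total D"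
proof -
  show a: "linear_on_set (total C) f" "\<And>i x. x \<in> grade C i \<Longrightarrow> f x \<in> grade D i"
    "\<And>x. x \<in> total C \<Longrightarrow> f (bdry C x) = bdry D (f x)" "\<And>x. x \<in> total C \<Longrightarrow> lev D (f x) \<le> lev C x"
    using assms(1) by (auto simp: filt_map_def)
  obtain g where g: "vlin g" "\<And>x. x \<in> total C \<Longrightarrow> g x = f x"
    using linear_on_set_extend[OF a(1) subspace_total] by blast
  have "vec.span (\<Union>i. grade C i) \<subseteq> {x. g x \<in> total D}"
  proof (intro vec.span_minimal vecp.linear_subspace_linear_preimage[OF g(1)] subspace_total subsetI CollectI)
    fix x assume "x \<in> (\<Union>i. grade C i)"
    then obtain i where i: "x \<in> grade C i" by blast
    then have "x \<in> total C" using grade_total by blast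
    then show "g x \<in> total D" using g(2)[of x] a(2)[OF i] grade_total by auto
  qed
  then show "f x \<in> total D" if "x \<in> total C" for x
    using that g(2)[OF that] unfolding total_def[of C] by auto
qed

locale cone_setting =
  fixes A B :: "'k::field fcc" and f X Y
  assumes A: "filtered_complex A" and B: "filtered_complex B" and f: "filt_map A B f"
    and X: "obasis A X" and Y: "obasis B Y"
begin

sublocale A: filtered_complex A by (rule A)
sublocale B: filtered_complex B by (rule B)

lemma cone_grade: "grade (cone A B f) i = {z. sum_fst z \<in> grade B i \<and> sum_snd z \<in> grade A (i - 1)}"
proof (rule Set.set_eqI)
  fix z
  have "z \<in> grade (cone A B f) i" if "sum_fst z \<in> grade B i" "sum_snd z \<in> grade A (i - 1)"
    using that unfolding cone_def fcc.simps
    by (intro CollectI exI[where x = "sum_snd z"] exI[where x = "sum_fst z"]) simp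
  then show "z \<in> grade (cone A B f) i \<longleftrightarrow> z \<in> {z. sum_fst z \<in> grade B i \<and> sum_snd z \<in> grade A (i - 1)}"
    by (auto simp: cone_def sum_vec_simps)
qed

lemma cone_bdry: "bdry (cone A B f) z = sum_inl (bdry B (sum_fst z) + f (sum_snd z)) + sum_inr (- bdry A (sum_snd z))"
  and cone_lev: "lev (cone A B f) z = max (lev B (sum_fst z)) (lev A (sum_snd z))"
  by (simp_all add: cone_def)

definition "cb = sum_inl ` Y \<union> sum_inr ` X"

text \<open>The basis of the source enters with its degrees raised by one, which causes the minus sign in
  the Euler characteristic series of a cone.\<close>

lemma cone_basis:
  "filtered_complex (cone A B f)" "obasis (cone A B f) cb"
  "total (cone A B f) = {z. sum_fst z \<in> total B \<and> sum_snd z \<in> total A}"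
  "\<And>b. b \<in> Y \<Longrightarrow> hdeg (cone A B f) (sum_inl b) = hdeg B b \<and> lev (cone A B f) (sum_inl b) = lev B b"
  "\<And>a. a \<in> X \<Longrightarrow> hdeg (cone A B f) (sum_inr a) = hdeg A a + 1 \<and> lev (cone A B f) (sum_inr a) = lev A a"
proof -
  define deg where "deg z = (if z \<in> sum_inl ` Y then hdeg B (sum_fst z) else hdeg A (sum_snd z) + 1)" for z
  define l where "l z = real_of_ereal (lev (cone A B f) z)" for z
  have iX: "vec.independent X" "vec.span X = total A" and iY: "vec.independent Y" "vec.span Y = total B"
    using X Y by (auto simp: obasis_def)
  have nl: "sum_inr a \<notin> sum_inl ` Y" if "a \<in> X" for a
    using A.obasis_nonzero[OF X] that by (metis imageE snd_inl snd_inr)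
  have dY: "deg (sum_inl b) = hdeg B b" if "b \<in> Y" for b using that by (auto simp: deg_def)
  have dX: "deg (sum_inr a) = hdeg A a + 1" if "a \<in> X" for a using nl[OF that] by (auto simp: deg_def)
  have levY: "lev (cone A B f) (sum_inl b) = lev B b" if "b \<in> Y" for b
    by (simp add: cone_lev A.lev_zero max_def)
  have levX: "lev (cone A B f) (sum_inr a) = lev A a" if "a \<in> X" for a
    by (simp add: cone_lev B.lev_zero max_def)
  have lY: "ereal (l (sum_inl b)) = lev B b" if "b \<in> Y" for b
    unfolding l_def levY[OF that] using B.obasis_lev[OF Y that] by simp
  have lX: "ereal (l (sum_inr a)) = lev A a" if "a \<in> X" for a
    unfolding l_def levX[OF that] using A.obasis_lev[OF X that] by simp
  have in_sp: "z \<in> vec.span cb \<longleftrightarrow> sum_fst z \<in> total B \<and> sum_snd z \<in> total A" for z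
    unfolding cb_def span_inl_inr iX iY ..
  have lin: "linear_on_set (vec.span cb) (bdry (cone A B f))"
    unfolding linear_on_set_def
  proof (intro conjI allI ballI)
    fix x y c assume x: "x \<in> vec.span cb"
    then show "bdry (cone A B f) (vscale c x) = vscale c (bdry (cone A B f) x)"
      using A.bdry_linear B.bdry_linear filt_mapD(1)[OF f A] unfolding linear_on_set_def in_sp
      by (simp add: cone_bdry sum_vec_simps vec.scale_right_distrib algebra_simps)
    assume "y \<in> vec.span cb"
    then show "bdry (cone A B f) (x + y) = bdry (cone A B f) x + bdry (cone A B f) y"
      using x A.bdry_linear B.bdry_linear filt_mapD(1)[OF f A] unfolding linear_on_set_def in_sp
      by (simp add: cone_bdry sum_vec_simps algebra_simps)
  qed
  have main: "filtered_complex (cone A B f) \<and> obasis (cone A B f) cb \<and> total (cone A B f) = vec.span cb \<and>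
    (\<forall>b\<in>cb. hdeg (cone A B f) b = deg b \<and> lev (cone A B f) b = ereal (l b))"
  proof (rule filtered_complexI_span[OF _ _ _ lin])
    show "vec.independent cb" unfolding cb_def by (rule independent_inl_inr[OF iY(1) iX(1)])
    show "grade (cone A B f) i = vec.span {b \<in> cb. deg b = i}" for i
    proof -
      have "{b \<in> cb. deg b = i} = sum_inl ` {b \<in> Y. hdeg B b = i} \<union> sum_inr ` {a \<in> X. hdeg A a = i - 1}"
        unfolding cb_def using dX dY by auto
      then show ?thesis
        unfolding cone_grade A.obasis_grade[OF X] B.obasis_grade[OF Y] by (auto simp: span_inl_inr)
    qed
    show "lev (cone A B f) x \<le> M \<longleftrightarrow> x \<in> vec.span {b \<in> cb. ereal (l b) \<le> M}" if "x \<in> vec.span cb" for x M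
    proof -
      have "{b \<in> cb. ereal (l b) \<le> M} = sum_inl ` {b \<in> Y. lev B b \<le> M} \<union> sum_inr ` {a \<in> X. lev A a \<le> M}"
        unfolding cb_def using lX lY by auto
      then show ?thesis
        using that unfolding in_sp
        by (simp add: span_inl_inr cone_lev obasis_le_iff[OF X] obasis_le_iff[OF Y])
    qed
    fix z assume "z \<in> cb"
    then consider b where "b \<in> Y" "z = sum_inl b" | a where "a \<in> X" "z = sum_inr a"
      unfolding cb_def by blast
    note cases = this
    have fX: "a \<in> total A" "f a \<in> total B" "lev B (f a) \<le> lev A a" if "a \<in> X" for a
      using filt_mapD[OF f A] A.obasis_total[OF X that] by auto
    have f0: "f 0 = 0"
      using filt_mapD(1)[OF f A] vec.subspace_0[OF subspace_total[of A]] unfolding linear_on_set_def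
      by (metis add_cancel_left_left)
    have d0: "bdry A 0 = 0" "bdry B 0 = 0"
      using A.bdry_linear B.bdry_linear vec.subspace_0[OF subspace_total] unfolding linear_on_set_def
      by (metis add_cancel_left_left)+
    have neg: "bdry A (- x) = - bdry A x" "f (- x) = - f x" if "x \<in> total A" for x
      using A.bdry_linear filt_mapD(1)[OF f A] that unfolding linear_on_set_def
      by (metis vec.scale_minus_left vec.scale_one)+
    show "bdry (cone A B f) z \<in> grade (cone A B f) (deg z - 1)"
      using cases
    proof cases
      case 1
      then show ?thesis
        using B.bdry_grade[OF B.obasis_hdeg[OF Y]] A.zero_grade f0 d0
        by (simp add: dY cone_bdry cone_grade sum_vec_simps)
    next
      case 2
      then show ?thesis
        using A.obasis_hdeg[OF X 2(1)] A.bdry_grade[OF A.obasis_hdeg[OF X 2(1)]] filt_mapD(2)[OF f A]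
          vec.subspace_neg[OF A.subspace_grade] d0
        by (simp add: dX cone_bdry cone_grade sum_vec_simps)
    qed
    show "lev (cone A B f) (bdry (cone A B f) z) \<le> ereal (l z)"
      using cases
    proof cases
      case 1
      then show ?thesis
        using B.lev_bdry[OF B.obasis_total[OF Y]] f0 d0
        by (simp add: lY cone_bdry cone_lev sum_vec_simps A.lev_zero)
    next
      case 2
      then show ?thesis
        using A.lev_bdry[OF fX(1)] A.lev_neg[OF A.bdry_total[OF fX(1)]] fX(3) d0
        by (simp add: lX cone_bdry cone_lev sum_vec_simps)
    qed
    show "bdry (cone A B f) (bdry (cone A B f) z) = 0"
      using cases
    proof cases
      case 1
      then show ?thesis
        using B.bdry_bdry[OF B.obasis_total[OF Y]] f0 d0
        by (simp add: cone_bdry sum_vec_simps)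
    next
      case 2
      then show ?thesis
        using A.bdry_bdry[OF fX(1)] A.bdry_total[OF fX(1)] filt_mapD(3)[OF f A fX(1)] neg d0
        by (simp add: cone_bdry sum_vec_simps)
    qed
  qed
  then show "filtered_complex (cone A B f)" "obasis (cone A B f) cb" by auto
  show "total (cone A B f) = {z. sum_fst z \<in> total B \<and> sum_snd z \<in> total A}"
    using main in_sp by blast
  show "hdeg (cone A B f) (sum_inl b) = hdeg B b \<and> lev (cone A B f) (sum_inl b) = lev B b" if "b \<in> Y" for b
    using main that dY levY by (auto simp: cb_def)
  show "hdeg (cone A B f) (sum_inr a) = hdeg A a + 1 \<and> lev (cone A B f) (sum_inr a) = lev A a" if "a \<in> X" for a
    using main that dX levX by (auto simp: cb_def)
qed

end

lemma cone_tame: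
  assumes "tame A" "tame B" "filt_map A B f"
  shows "tame (cone A B f)" "betti (cone A B f) i a = betti B i a + betti A (i - 1) a"
    "levels (cone A B f) = levels A \<union> levels B"
    "euler_series (cone A B f) a = euler_series B a - euler_series A a"
proof -
  obtain X where X: "obasis A X" using tame_obasis[OF assms(1)] .
  obtain Y where Y: "obasis B Y" using tame_obasis[OF assms(2)] .
  interpret cone_setting A B f X Y
    using assms X Y by (simp add: cone_setting_def tame_def)
  have sel: "{z \<in> cb. P (hdeg (cone A B f) z) (lev (cone A B f) z)} =
      sum_inl ` {b \<in> Y. P (hdeg B b) (lev B b)} \<union> sum_inr ` {a \<in> X. P (hdeg A a + 1) (lev A a)}" for P
    unfolding cb_def using cone_basis(4,5) by auto
  have disj: "sum_inl ` Y' \<inter> sum_inr ` X' = {}" if "X' \<subseteq> X" for X' Y'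
  proof (rule ccontr)
    assume "sum_inl ` Y' \<inter> sum_inr ` X' \<noteq> {}"
    then obtain y x where "x \<in> X'" "sum_inl y = sum_inr x" by auto
    then have "x \<in> X" "sum_snd (sum_inr x) = sum_snd (sum_inl y)" using \<open>X' \<subseteq> X\<close> by auto
    then show False using A.obasis_nonzero[OF X] by simp
  qed
  have inj: "inj_on sum_inl S" "inj_on sum_inr S" for S :: "'a vec set"
    by (rule inj_on_inverseI[of _ sum_fst], simp, rule inj_on_inverseI[of _ sum_snd], simp)
  have fX: "finite {b \<in> X. P b \<and> lev A b = ereal a}" "finite {b \<in> X. lev A b = ereal a}" for P a
    by (rule finite_subset[OF _ obasis_finite_le[OF assms(1) X, of a]]; auto)+
  have fY: "finite {b \<in> Y. P b \<and> lev B b = ereal a}" "finite {b \<in> Y. lev B b = ereal a}" for P a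
    by (rule finite_subset[OF _ obasis_finite_le[OF assms(2) Y, of a]]; auto)+
  show t: "tame (cone A B f)"
  proof (rule tameI[OF cone_basis(1,2)])
    fix r show "finite {b \<in> cb. lev (cone A B f) b \<le> ereal r}"
      unfolding sel[of "\<lambda>_ l. l \<le> ereal r"]
      using obasis_finite_le[OF assms(1) X] obasis_finite_le[OF assms(2) Y] by blast
  qed
  show bt: "betti (cone A B f) i a = betti B i a + betti A (i - 1) a" for i a
  proof -
    have "betti (cone A B f) i a = card (sum_inl ` {b \<in> Y. hdeg B b = i \<and> lev B b = ereal a} \<union>
        sum_inr ` {b \<in> X. hdeg A b + 1 = i \<and> lev A b = ereal a})"
      unfolding obasis_betti[OF t cone_basis(2)] sel[of "\<lambda>d l. d = i \<and> l = ereal a"] ..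
    also have "\<dots> = card {b \<in> Y. hdeg B b = i \<and> lev B b = ereal a} + card {b \<in> X. hdeg A b + 1 = i \<and> lev A b = ereal a}"
    proof (subst card_Un_disjoint)
      show "finite (sum_inl ` {b \<in> Y. hdeg B b = i \<and> lev B b = ereal a})"
        "finite (sum_inr ` {b \<in> X. hdeg A b + 1 = i \<and> lev A b = ereal a})"
        by (rule finite_imageI[OF fY(1)], rule finite_imageI[OF fX(1)])
      show "sum_inl ` {b \<in> Y. hdeg B b = i \<and> lev B b = ereal a} \<inter>
          sum_inr ` {b \<in> X. hdeg A b + 1 = i \<and> lev A b = ereal a} = {}"
        by (rule disj) blast
    qed (simp add: card_image[OF inj(1)] card_image[OF inj(2)])
    also have "{b \<in> X. hdeg A b + 1 = i \<and> lev A b = ereal a} = {b \<in> X. hdeg A b = i - 1 \<and> lev A b = ereal a}"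
      by auto
    finally show ?thesis
      unfolding obasis_betti[OF assms(1) X] obasis_betti[OF assms(2) Y] .
  qed
  show "levels (cone A B f) = levels A \<union> levels B"
  proof (rule Set.set_eqI)
    fix a
    have "(\<exists>i. betti A (i - 1) a \<noteq> 0) \<longleftrightarrow> (\<exists>i. betti A i a \<noteq> 0)"
      by (metis add_diff_cancel_right')
    then show "a \<in> levels (cone A B f) \<longleftrightarrow> a \<in> levels A \<union> levels B"
      unfolding Un_iff levels_betti[OF t] levels_betti[OF assms(1)] levels_betti[OF assms(2)] bt by auto
  qed
  show "euler_series (cone A B f) a = euler_series B a - euler_series A a"
  proof -
    have "euler_series (cone A B f) a = (\<Sum>z\<in>sum_inl ` {b \<in> Y. lev B b = ereal a} \<union>
        sum_inr ` {b \<in> X. lev A b = ereal a}. deg_sign (hdeg (cone A B f) z))"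
      unfolding obasis_euler_series[OF t cone_basis(2)] sel[of "\<lambda>d l. l = ereal a"] ..
    also have "\<dots> = (\<Sum>b\<in>{b \<in> Y. lev B b = ereal a}. deg_sign (hdeg B b)) +
        (\<Sum>b\<in>{b \<in> X. lev A b = ereal a}. deg_sign (hdeg A b + 1))"
    proof (subst sum.union_disjoint)
      show "finite (sum_inl ` {b \<in> Y. lev B b = ereal a})" "finite (sum_inr ` {b \<in> X. lev A b = ereal a})"
        by (rule finite_imageI[OF fY(2)], rule finite_imageI[OF fX(2)])
      show "sum_inl ` {b \<in> Y. lev B b = ereal a} \<inter> sum_inr ` {b \<in> X. lev A b = ereal a} = {}"
        by (rule disj) blast
    qed (simp add: sum.reindex[OF inj(1)] sum.reindex[OF inj(2)] cone_basis(4,5))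
    also have "\<dots> = euler_series B a - euler_series A a"
      unfolding obasis_euler_series[OF assms(1) X] obasis_euler_series[OF assms(2) Y]
      by (simp add: deg_sign_add sum_negf)
    finally show ?thesis .
  qed
qed


subsection \<open>Homotopy invariance\<close>

definition cycles :: "'k::field fcc \<Rightarrow> ereal set \<Rightarrow> int \<Rightarrow> 'k vec set"
  where "cycles C J i = {x \<in> sublev C J i. bdry C x = 0}"

definition boundaries :: "'k::field fcc \<Rightarrow> ereal set \<Rightarrow> int \<Rightarrow> 'k vec set"
  where "boundaries C J i = bdry C ` sublev C J (i + 1)"

lemma linear_on_set_0:
  assumes "linear_on_set S f" "0 \<in> S" shows "f 0 = 0"
  using assms unfolding linear_on_set_def by (metis add_cancel_left_left)

lemma linear_on_set_diff:
  assumes "linear_on_set S f" "vec.subspace S" "x \<in> S" "y \<in> S" shows "f (x - y) = f x - f y"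
proof -
  have "f (x - y + y) = f (x - y) + f y"
    using assms vec.subspace_diff[OF assms(2-4)] unfolding linear_on_set_def by blast
  then show ?thesis by simp
qed

lemma linear_on_set_neg:
  assumes "linear_on_set S f" "x \<in> S" shows "f (- x) = - f x"
  using assms unfolding linear_on_set_def by (metis vec.scale_minus_left vec.scale_one)

context filtered_complex begin

lemma sublev_total: "sublev C J i \<subseteq> total C"
  using grade_total by (auto simp: sublev_def)

lemma bdry_0: "bdry C 0 = 0"
  by (rule linear_on_set_0[OF bdry_linear vec.subspace_0[OF subspace_total]])

lemma bdry_diff: "x \<in> total C \<Longrightarrow> y \<in> total C \<Longrightarrow> bdry C (x - y) = bdry C x - bdry C y"
  by (rule linear_on_set_diff[OF bdry_linear subspace_total])

lemma bdry_neg: "x \<in> total C \<Longrightarrow> bdry C (- x) = - bdry C x"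
  by (rule linear_on_set_neg[OF bdry_linear])

lemma bdry_add: "x \<in> total C \<Longrightarrow> y \<in> total C \<Longrightarrow> bdry C (x + y) = bdry C x + bdry C y"
  using bdry_linear by (simp add: linear_on_set_def)

lemma homology_setup:
  assumes J: "lower_levels J" and fd: "\<And>i. finite_dim (sublev C J i)"
  shows "vec.subspace (cycles C J i)" "vec.subspace (boundaries C J i)" "boundaries C J i \<subseteq> cycles C J i"
    "finite_dim (cycles C J i)" "finite_dim (boundaries C J i)"
    "vec.dim (sublev C J i) = vec.dim (cycles C J i) + vec.dim (boundaries C J (i - 1))"
proof -
  obtain g where g: "vlin g" "\<And>x. x \<in> total C \<Longrightarrow> g x = bdry C x"
    using linear_on_set_extend[OF bdry_linear subspace_total] by blast
  have gs: "g x = bdry C x" if "x \<in> sublev C J i" for x i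
    using that sublev_total by (intro g(2)) blast
  have Z: "cycles C J i = {x \<in> sublev C J i. g x = 0}" for i
    unfolding cycles_def using gs by auto
  have B: "boundaries C J i = g ` sublev C J (i + 1)" for i
    unfolding boundaries_def using gs by (intro image_cong) auto
  note S = subspace_sublev[OF J]
  show sZ: "vec.subspace (cycles C J i)"
    unfolding Z using vec.subspace_inter[OF S vecp.linear_subspace_kernel[OF g(1)]]
    by (simp add: Int_def)
  show "vec.subspace (boundaries C J i)"
    unfolding B by (rule vecp.linear_subspace_image[OF g(1) S])
  show "boundaries C J i \<subseteq> cycles C J i"
  proof
    fix y assume "y \<in> boundaries C J i"
    then obtain x where x: "x \<in> sublev C J (i + 1)" "y = bdry C x" unfolding boundaries_def by blast
    then have xt: "x \<in> total C" and xg: "x \<in> grade C (i + 1)" and xJ: "lev C x \<in> J"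
      using sublev_total by (auto simp: sublev_def)
    show "y \<in> cycles C J i"
      using bdry_bdry[OF xt] bdry_grade[OF xg] lev_bdry[OF xt] xJ J x(2)
      by (auto simp: cycles_def sublev_def lower_levels_def)
  qed
  show "finite_dim (cycles C J i)"
    by (rule finite_dim_mono[OF fd[of i]]) (auto simp: cycles_def)
  show "finite_dim (boundaries C J i)"
    unfolding B by (rule finite_dim_image[OF g(1) fd])
  show "vec.dim (sublev C J i) = vec.dim (cycles C J i) + vec.dim (boundaries C J (i - 1))"
    unfolding Z B using rank_nullity[OF g(1) S fd, of i] by simp
qed

end

lemma Sum_any_deg_sign_shift:
  "Sum_any (\<lambda>i. deg_sign i * f (i - 1)) = - Sum_any (\<lambda>i. deg_sign i * (f i :: int))"
proof -
  have "Sum_any (\<lambda>i. deg_sign i * f (i - 1)) = Sum_any (\<lambda>i. deg_sign (i + 1) * f i)"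
    by (rule Sum_any.reindex_cong[of "\<lambda>i. i + 1"]) (auto simp: bij_def inj_def surj_def intro: exI[of _ "_ - 1"])
  also have "\<dots> = Sum_any (\<lambda>i. (- 1) * (deg_sign i * f i))"
    by (simp add: deg_sign_add)
  also have "\<dots> = - Sum_any (\<lambda>i. deg_sign i * f i)"
  proof (cases "finite {i. deg_sign i * f i \<noteq> 0}")
    case True
    then show ?thesis using Sum_any_right_distrib[OF True, of "- 1"] by simp
  next
    case False
    then have "Sum_any (\<lambda>i. (- 1) * (deg_sign i * f i)) = 0" by (intro Sum_any.infinite) simp
    then show ?thesis unfolding Sum_any.infinite[OF False] by (simp only: minus_zero)
  qed
  finally show ?thesis .
qed

text \<open>By rank and nullity each graded piece contributes its cycles and the boundaries in the
  degree below.\<close>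

lemma (in filtered_complex) euler_homology:
  assumes J: "lower_levels J" and fd: "\<And>i. finite_dim (sublev C J i)"
    and fin: "finite {i. vec.dim (sublev C J i) \<noteq> 0}"
  shows "euler (sublev C J) =
    Sum_any (\<lambda>i. deg_sign i * (int (vec.dim (cycles C J i)) - int (vec.dim (boundaries C J i))))"
proof -
  note d = homology_setup(6)[OF J fd]
  let ?V = "{i. vec.dim (sublev C J i) \<noteq> 0}"
  let ?z = "\<lambda>i. deg_sign i * int (vec.dim (cycles C J i))"
    and ?b = "\<lambda>i. deg_sign i * int (vec.dim (boundaries C J i))"
    and ?b' = "\<lambda>i. deg_sign i * int (vec.dim (boundaries C J (i - 1)))"
  have z: "finite {i. ?z i \<noteq> 0}" and b': "finite {i. ?b' i \<noteq> 0}"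
    by (rule finite_subset[OF _ fin]; auto simp: d)+
  have b: "finite {i. ?b i \<noteq> 0}"
  proof (rule finite_subset[OF _ finite_imageI[OF b', of "\<lambda>i. i - 1"]], rule subsetI)
    fix i assume "i \<in> {i. ?b i \<noteq> 0}"
    then have "i + 1 \<in> {i. ?b' i \<noteq> 0}" by (simp add: deg_sign_def)
    then show "i \<in> (\<lambda>i. i - 1) ` {i. ?b' i \<noteq> 0}" by (rule rev_image_eqI) simp
  qed
  have bn: "finite {i. - ?b i \<noteq> 0}" using b by simp
  have "euler (sublev C J) = Sum_any (\<lambda>i. ?z i + ?b' i)"
    unfolding euler_def d by (simp add: distrib_left)
  also have "\<dots> = Sum_any ?z + Sum_any ?b'" by (rule Sum_any.distrib[OF z b'])
  also have "Sum_any ?b' = - Sum_any ?b" by (rule Sum_any_deg_sign_shift)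
  also have "- Sum_any ?b = Sum_any (\<lambda>i. - ?b i)"
    using Sum_any_right_distrib[OF b, of "- 1"] by simp
  also have "Sum_any ?z + Sum_any (\<lambda>i. - ?b i) = Sum_any (\<lambda>i. ?z i + - ?b i)"
    by (rule Sum_any.distrib[OF z bn, symmetric])
  finally show ?thesis by (simp add: right_diff_distrib)
qed

text \<open>A filtered homotopy left inverse of \<open>f\<close> forces a cycle of \<open>C\<close> whose image bounds to bound.
  Hence a complement of the boundaries in the cycles of \<open>C\<close> maps injectively to a space of cycles
  of \<open>D\<close> that meets the boundaries trivially, and the homology of \<open>C\<close> in degree \<open>i\<close> has at most the
  dimension of that of \<open>D\<close>.\<close>

lemma homotopy_dim_le:
  assumes C: "filtered_complex C" and D: "filtered_complex D" and J: "lower_levels J"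
    and fdC: "\<And>i. finite_dim (sublev C J i)" and fdD: "\<And>i. finite_dim (sublev D J i)"
    and f: "filt_map C D f" and g: "filt_map D C g" and gf: "filt_homotopic C C (g \<circ> f) id"
  shows "vec.dim (cycles C J i) + vec.dim (boundaries D J i) \<le>
    vec.dim (cycles D J i) + vec.dim (boundaries C J i)"
proof -
  interpret C: filtered_complex C by (rule C)
  interpret D: filtered_complex D by (rule D)
  note sC = C.homology_setup[OF J fdC] and sD = D.homology_setup[OF J fdD]
  obtain h where h: "linear_on_set (total C) h" "\<And>i x. x \<in> grade C i \<Longrightarrow> h x \<in> grade C (i + 1)"
      "\<And>x. x \<in> total C \<Longrightarrow> g (f x) - x = bdry C (h x) + h (bdry C x)"
      "\<And>x. x \<in> total C \<Longrightarrow> lev C (h x) \<le> lev C x"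
    using gf unfolding filt_homotopic_def by auto
  obtain f' where f': "vlin f'" "\<And>x. x \<in> total C \<Longrightarrow> f' x = f x"
    using linear_on_set_extend[OF filt_mapD(1)[OF f C] subspace_total] by blast
  obtain K where K: "vec.subspace K" "K \<subseteq> cycles C J i" "K \<inter> boundaries C J i \<subseteq> {0}"
      "vec.dim (cycles C J i) = vec.dim (boundaries C J i) + vec.dim K"
    by (rule subspace_complement[OF sC(4) sC(1) sC(2) sC(3)])
  have h0: "h 0 = 0" by (rule linear_on_set_0[OF h(1) vec.subspace_0[OF subspace_total]])
  have Kt: "x \<in> total C" if "x \<in> K" for x
    using that K(2) C.sublev_total by (auto simp: cycles_def)
  have claim: "x = 0" if x: "x \<in> K" "f x \<in> boundaries D J i" for x
  proof -
    obtain w where w: "w \<in> sublev D J (i + 1)" "f x = bdry D w" using x unfolding boundaries_def by blast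
    have xt: "x \<in> total C" and x0: "bdry C x = 0" and xg: "x \<in> grade C i" and xJ: "lev C x \<in> J"
      using x(1) K(2) Kt by (auto simp: cycles_def sublev_def)
    have wt: "w \<in> total D" and wg: "w \<in> grade D (i + 1)" and wJ: "lev D w \<in> J"
      using w D.sublev_total by (auto simp: sublev_def)
    have gw: "g w \<in> sublev C J (i + 1)"
      using filt_mapD(2)[OF g D wg] filt_mapD(4)[OF g D wt] wJ J by (auto simp: sublev_def lower_levels_def)
    have hx: "h x \<in> sublev C J (i + 1)"
      using h(2)[OF xg] h(4)[OF xt] xJ J by (auto simp: sublev_def lower_levels_def)
    have "x = bdry C (g w) - bdry C (h x)"
      using h(3)[OF xt] w(2) filt_mapD(3)[OF g D wt] x0 h0 by (simp add: algebra_simps)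
    also have "\<dots> = bdry C (g w - h x)"
      using gw hx C.sublev_total by (intro C.bdry_diff[symmetric]) auto
    finally have "x \<in> boundaries C J i"
      unfolding boundaries_def using vec.subspace_diff[OF C.subspace_sublev[OF J] gw hx] by blast
    then show "x = 0" using K(3) x(1) by blast
  qed
  have "vec.dim (f' ` K) = vec.dim K"
  proof (rule dim_image_inj[OF f'(1) K(1) finite_dim_mono[OF sC(4) K(2)]])
    fix x assume "x \<in> K" "f' x = 0"
    then show "x = 0" using claim[of x] f'(2)[OF Kt] vec.subspace_0[OF sD(2)] by simp
  qed
  moreover have "f' ` K \<inter> boundaries D J i \<subseteq> {0}"
  proof
    fix y assume "y \<in> f' ` K \<inter> boundaries D J i"
    then obtain x where "x \<in> K" "y = f' x" "f' x \<in> boundaries D J i" by blast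
    then show "y \<in> {0}" using claim[of x] f'(2)[OF Kt[of x]] vlin_0[OF f'(1)] by simp
  qed
  then have "vec.dim {u + w | u w. u \<in> f' ` K \<and> w \<in> boundaries D J i} =
      vec.dim (f' ` K) + vec.dim (boundaries D J i)"
    by (intro dim_direct_sum vecp.linear_subspace_image[OF f'(1) K(1)] sD
        finite_dim_image[OF f'(1)] finite_dim_mono[OF sC(4) K(2)])
  moreover have "vec.dim {u + w | u w. u \<in> f' ` K \<and> w \<in> boundaries D J i} \<le> vec.dim (cycles D J i)"
  proof (rule dim_le_subset[OF sD(4)])
    have "f' x \<in> cycles D J i" if x: "x \<in> K" for x
    proof -
      have xt: "x \<in> total C" and x0: "bdry C x = 0" and xg: "x \<in> grade C i" and xJ: "lev C x \<in> J"
        using x K(2) Kt by (auto simp: cycles_def sublev_def)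
      have "f 0 = 0" by (rule linear_on_set_0[OF filt_mapD(1)[OF f C] vec.subspace_0[OF subspace_total]])
      then show ?thesis
        using f'(2)[OF xt] filt_mapD(2)[OF f C xg] filt_mapD(3)[OF f C xt] filt_mapD(4)[OF f C xt] xJ J x0
        by (auto simp: cycles_def sublev_def lower_levels_def)
    qed
    then show "{u + w | u w. u \<in> f' ` K \<and> w \<in> boundaries D J i} \<subseteq> cycles D J i"
      using vec.subspace_add[OF sD(1)] sD(3) by blast
  qed
  ultimately show ?thesis using K(4) by simp
qed

lemma lessThan_subset_atMost: "{..<ereal a} \<subseteq> {..ereal a}"
  by auto

text \<open>The inequality of \<open>homotopy_dim_le\<close>, used in both directions for the sublevel complexes at
  \<open>{..a}\<close> and \<open>{..<a}\<close>.\<close>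

lemma filt_equivalence_euler_series:
  assumes C: "tame C" and D: "tame D" and e: "filt_equivalence C D f"
  shows "euler_series C a = euler_series D a"
proof -
  obtain g where f: "filt_map C D f" and g: "filt_map D C g"
    and gf: "filt_homotopic C C (g \<circ> f) id" and fg: "filt_homotopic D D (f \<circ> g) id"
    using e unfolding filt_equivalence_def by blast
  have eq: "euler (sublev C J) = euler (sublev D J)" if J: "lower_levels J" "J \<subseteq> {..ereal a}" for J
  proof -
    have fd: "finite_dim (sublev E J i)" if "tame E" for E :: "'a fcc" and i
    proof -
      interpret E: filtered_complex E using that by (rule tame_fc)
      show ?thesis
        using finite_dim_mono[of "sublevel E a" "sublev E J i"] that J(2) grade_total[of E i]
        by (auto simp: tame_def sublev_def sublevel_def)
    qed
    have fin: "finite {i. vec.dim (sublev E J i) \<noteq> 0}" if E: "tame E" for E :: "'a fcc"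
    proof -
      obtain B where B: "obasis E B" using tame_obasis[OF E] .
      have "finite {b \<in> B. lev E b \<in> J}"
        by (rule finite_subset[OF _ obasis_finite_le[OF E B, of a]]) (use J(2) in auto)
      moreover have "{i. vec.dim (sublev E J i) \<noteq> 0} \<subseteq> hdeg E ` {b \<in> B. lev E b \<in> J}"
      proof
        fix i assume "i \<in> {i. vec.dim (sublev E J i) \<noteq> 0}"
        then have "{b \<in> B. hdeg E b = i \<and> lev E b \<in> J} \<noteq> {}"
          unfolding obasis_dim_sublev[OF tame_fc[OF E] B J(1)] mem_Collect_eq by (metis card.empty)
        then show "i \<in> hdeg E ` {b \<in> B. lev E b \<in> J}" by blast
      qed
      ultimately show ?thesis by (meson finite_imageI finite_subset)
    qed
    note h = homotopy_dim_le[OF tame_fc[OF C] tame_fc[OF D] J(1) fd[OF C] fd[OF D] f g gf]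
      homotopy_dim_le[OF tame_fc[OF D] tame_fc[OF C] J(1) fd[OF D] fd[OF C] g f fg]
    have "int (vec.dim (cycles C J i)) - int (vec.dim (boundaries C J i)) =
      int (vec.dim (cycles D J i)) - int (vec.dim (boundaries D J i))" for i
      using h[of i] by linarith
    then show ?thesis
      unfolding filtered_complex.euler_homology[OF tame_fc[OF C] J(1) fd[OF C] fin[OF C]]
        filtered_complex.euler_homology[OF tame_fc[OF D] J(1) fd[OF D] fin[OF D]] by simp
  qed
  show ?thesis
    unfolding euler_series_def
    using eq[OF lower_levels_atMost[of a] subset_refl]
      eq[OF lower_levels_lessThan[of a] lessThan_subset_atMost] by simp
qed

lemma exact_triangle_euler_series:
  assumes "exact_triangle Ob A B C u v w" "\<And>X. X \<in> Ob \<Longrightarrow> tame X"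
  shows "euler_series B t = euler_series A t + euler_series C t"
proof -
  obtain A' B' f a b c where *: "A' \<in> Ob" "B' \<in> Ob" "filt_map A' B' f" "filt_equivalence A A' a"
      "filt_equivalence B B' b" "filt_equivalence C (cone A' B' f) c" "A \<in> Ob" "B \<in> Ob" "C \<in> Ob"
    using assms(1) unfolding exact_triangle_def by blast
  note t = assms(2)[OF *(1)] assms(2)[OF *(2)]
  show ?thesis
    using filt_equivalence_euler_series[OF assms(2)[OF *(7)] t(1) *(4), of t]
      filt_equivalence_euler_series[OF assms(2)[OF *(8)] t(2) *(5), of t]
      filt_equivalence_euler_series[OF assms(2)[OF *(9)] cone_tame(1)[OF t *(3)] *(6), of t]
      cone_tame(4)[OF t *(3), of t]
    by simp
qed


section \<open>Cone-additive invariants\<close>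

definition filt_iso :: "'k::field fcc \<Rightarrow> 'k fcc \<Rightarrow> ('k vec \<Rightarrow> 'k vec) \<Rightarrow> bool"
  where "filt_iso C D f \<longleftrightarrow> filt_map C D f \<and>
    (\<exists>g. filt_map D C g \<and> (\<forall>x\<in>total C. g (f x) = x) \<and> (\<forall>y\<in>total D. f (g y) = y))"

lemma filt_homotopic_eqI:
  assumes "filtered_complex C" "filtered_complex D" "\<And>x. x \<in> total C \<Longrightarrow> f x = g x"
  shows "filt_homotopic C D f g"
proof -
  interpret C: filtered_complex C by fact
  interpret D: filtered_complex D by fact
  show ?thesis
    unfolding filt_homotopic_def
    by (intro exI[of _ "\<lambda>_. 0"]) (simp add: linear_on_set_def assms(3) D.bdry_0 D.zero_grade D.lev_zero)
qed

lemma filt_map_id: "filtered_complex C \<Longrightarrow> filt_map C C (\<lambda>x. x)"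
  by (simp add: filt_map_def linear_on_set_def)

lemma filt_map_zero: "filtered_complex C \<Longrightarrow> filtered_complex D \<Longrightarrow> filt_map C D (\<lambda>x. 0)"
  by (simp add: filt_map_def linear_on_set_def filtered_complex.zero_grade filtered_complex.bdry_0 filtered_complex.lev_zero)

lemma filt_map_comp:
  assumes "filtered_complex C" "filtered_complex D" "filt_map C D f" "filt_map D E g"
  shows "filt_map C E (g \<circ> f)"
proof -
  note f = filt_mapD[OF assms(3,1)] and g = filt_mapD[OF assms(4,2)]
  show ?thesis
    unfolding filt_map_def
  proof (intro conjI allI ballI)
    show "linear_on_set (total C) (g \<circ> f)"
      using f(1,5) g(1) by (auto simp: linear_on_set_def)
    show "(g \<circ> f) x \<in> grade E i" if "x \<in> grade C i" for x i
      using f(2) g(2) that by simp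
    fix x assume x: "x \<in> total C"
    show "(g \<circ> f) (bdry C x) = bdry E ((g \<circ> f) x)"
      using f(3,5) g(3) x by simp
    show "lev E ((g \<circ> f) x) \<le> lev C x"
      using f(4)[OF x] g(4)[OF f(5)[OF x]] by simp
  qed
qed

lemma filt_iso_imp_equivalence:
  assumes "filtered_complex C" "filtered_complex D" "filt_iso C D f"
  shows "filt_equivalence C D f"
proof -
  obtain g where g: "filt_map C D f" "filt_map D C g" "\<And>x. x \<in> total C \<Longrightarrow> g (f x) = x"
      "\<And>y. y \<in> total D \<Longrightarrow> f (g y) = y"
    using assms(3) unfolding filt_iso_def by blast
  show ?thesis
    unfolding filt_equivalence_def
    by (intro conjI g exI[of _ g] filt_homotopic_eqI assms) (auto simp: g)
qed

lemma filt_iso_id: "filtered_complex C \<Longrightarrow> filt_iso C C (\<lambda>x. x)"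
  unfolding filt_iso_def by (auto intro!: filt_map_id exI[of _ "\<lambda>x. x"])

lemma filt_equivalence_id: "filtered_complex C \<Longrightarrow> filt_equivalence C C (\<lambda>x. x)"
  by (intro filt_iso_imp_equivalence filt_iso_id)

text \<open>Equal numbers give a bijection of orthogonal bases that preserves degree and level, and its
  linear extension is an isomorphism since the differentials impose no condition.\<close>

lemma zero_bdry_iso:
  assumes C: "tame C" and D: "tame D" and 0: "\<And>x. x \<in> total C \<Longrightarrow> bdry C x = 0" "\<And>x. x \<in> total D \<Longrightarrow> bdry D x = 0"
    and eq: "\<And>i a. betti C i a = betti D i a"
  obtains f where "filt_iso C D f"
proof -
  obtain X where X: "obasis C X" using tame_obasis[OF C] .
  obtain Y where Y: "obasis D Y" using tame_obasis[OF D] .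
  interpret C: filtered_complex C using C by (rule tame_fc)
  interpret D: filtered_complex D using D by (rule tame_fc)
  let ?X = "\<lambda>i a. {b \<in> X. hdeg C b = i \<and> lev C b = ereal a}" and ?Y = "\<lambda>i a. {b \<in> Y. hdeg D b = i \<and> lev D b = ereal a}"
  have ex: "\<exists>\<phi>. bij_betw \<phi> (?X i a) (?Y i a)" for i a
  proof (rule finite_same_card_bij)
    show "finite (?X i a)" by (rule finite_subset[OF _ obasis_finite_le[OF C X, of a]]) auto
    show "finite (?Y i a)" by (rule finite_subset[OF _ obasis_finite_le[OF D Y, of a]]) auto
    show "card (?X i a) = card (?Y i a)"
      using eq[of i a] unfolding obasis_betti[OF C X] obasis_betti[OF D Y] .
  qed
  define \<phi> where "\<phi> i a = (SOME f. bij_betw f (?X i a) (?Y i a))" for i a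
  have \<phi>: "bij_betw (\<phi> i a) (?X i a) (?Y i a)" for i a
    unfolding \<phi>_def by (rule someI_ex[OF ex])
  define p where "p b = \<phi> (hdeg C b) (real_of_ereal (lev C b)) b" for b
  define q where "q b = inv_into (?X (hdeg D b) (real_of_ereal (lev D b))) (\<phi> (hdeg D b) (real_of_ereal (lev D b))) b" for b
  have p: "p b \<in> Y \<and> hdeg D (p b) = hdeg C b \<and> lev D (p b) = lev C b \<and> q (p b) = b" if b: "b \<in> X" for b
  proof -
    let ?i = "hdeg C b" and ?a = "real_of_ereal (lev C b)"
    have b': "b \<in> ?X ?i ?a" using C.obasis_lev[OF X b] b by simp
    then have "p b \<in> ?Y ?i ?a" unfolding p_def using bij_betwE[OF \<phi>] by blast
    moreover have "inv_into (?X ?i ?a) (\<phi> ?i ?a) (p b) = b"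
      unfolding p_def using b' bij_betw_inv_into_left[OF \<phi>] by blast
    ultimately show ?thesis using C.obasis_lev[OF X b] by (simp add: q_def)
  qed
  have q: "q b \<in> X \<and> hdeg C (q b) = hdeg D b \<and> lev C (q b) = lev D b \<and> p (q b) = b" if b: "b \<in> Y" for b
  proof -
    let ?i = "hdeg D b" and ?a = "real_of_ereal (lev D b)"
    have b': "b \<in> ?Y ?i ?a" using D.obasis_lev[OF Y b] b by simp
    then have "q b \<in> ?X ?i ?a" unfolding q_def using bij_betwE[OF bij_betw_inv_into[OF \<phi>]] by blast
    moreover have "\<phi> ?i ?a (q b) = b"
      unfolding q_def using b' bij_betw_inv_into_right[OF \<phi>] by blast
    ultimately show ?thesis using D.obasis_lev[OF Y b] by (simp add: p_def)
  qed
  have iX: "vec.independent X" "vec.span X = total C" and iY: "vec.independent Y" "vec.span Y = total D"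
    using X Y by (auto simp: obasis_def)
  obtain F where F: "vlin F" "\<And>b. b \<in> X \<Longrightarrow> F b = p b" using vlin_extend[OF iX(1)] by metis
  obtain G where G: "vlin G" "\<And>b. b \<in> Y \<Longrightarrow> G b = q b" using vlin_extend[OF iY(1)] by metis
  have fm: "filt_map C D F"
    if C: "filtered_complex C" "obasis C X" "\<And>x. x \<in> total C \<Longrightarrow> bdry C x = 0" "vec.span X = total C"
      and D: "filtered_complex D" "obasis D Y" "\<And>x. x \<in> total D \<Longrightarrow> bdry D x = 0" "vec.span Y = total D"
      and F: "vlin F" "\<And>b. b \<in> X \<Longrightarrow> F b \<in> Y \<and> hdeg D (F b) = hdeg C b \<and> lev D (F b) = lev C b"
    for C D :: "'a fcc" and X Y F
  proof -
    interpret C: filtered_complex C by (rule C)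
    interpret D: filtered_complex D by (rule D)
    have Fs: "F x \<in> vec.span Y'" if "x \<in> vec.span X'" "\<And>b. b \<in> X' \<Longrightarrow> F b \<in> Y'" for X' Y' x
      using vec.span_mono[of "F ` X'" Y'] that vecp.linear_span_image[OF F(1), of X'] by blast
    have Ft: "F x \<in> total D" if "x \<in> total C" for x
      using Fs[of x X Y] that F(2) C(4) D(4) by simp
    show ?thesis
      unfolding filt_map_def
    proof (intro conjI allI ballI)
      show "linear_on_set (total C) F" by (rule vlin_on_set[OF F(1)])
      show "F x \<in> grade D i" if "x \<in> grade C i" for x i
        using that unfolding C.obasis_grade[OF C(2)] D.obasis_grade[OF D(2)] by (rule Fs) (use F(2) in auto)
      fix x assume x: "x \<in> total C"
      show "F (bdry C x) = bdry D (F x)" using C(3)[OF x] D(3)[OF Ft[OF x]] vlin_0[OF F(1)] by simp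
      have "x \<in> vec.span {b \<in> X. lev C b \<le> lev C x}" using obasis_le_iff[OF C(2) x, of "lev C x"] by blast
      then have "F x \<in> vec.span {b \<in> Y. lev D b \<le> lev C x}" by (rule Fs) (use F(2) in auto)
      then show "lev D (F x) \<le> lev C x" using obasis_le_iff[OF D(2) Ft[OF x]] by blast
    qed
  qed
  have "filt_map C D F"
    by (rule fm[OF C.filtered_complex_axioms X 0(1) iX(2) D.filtered_complex_axioms Y 0(2) iY(2) F(1)])
      (use p F(2) in auto)
  moreover have "filt_map D C G"
    by (rule fm[OF D.filtered_complex_axioms Y 0(2) iY(2) C.filtered_complex_axioms X 0(1) iX(2) G(1)])
      (use q G(2) in auto)
  moreover have "G (F x) = x" if "x \<in> total C" for x
    by (rule vlin_eq_on_span[OF vlin_comp[OF G(1) F(1)] vlin_id, of X])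
      (use that iX p F(2) G(2) in auto)
  moreover have "F (G y) = y" if "y \<in> total D" for y
    by (rule vlin_eq_on_span[OF vlin_comp[OF F(1) G(1)] vlin_id, of Y])
      (use that iY q F(2) G(2) in auto)
  ultimately show thesis by (intro that[of F]) (auto simp: filt_iso_def)
qed

text \<open>\<open>N i a\<close> stands for a number of generators of degree \<open>i\<close> and level \<open>a\<close>.\<close>

definition locally_finite :: "(int \<Rightarrow> real \<Rightarrow> nat) \<Rightarrow> bool"
  where "locally_finite N \<longleftrightarrow> (\<forall>r. finite {(i, a). a \<le> r \<and> N i a \<noteq> 0})"

lemma betti_locally_finite: "tame C \<Longrightarrow> locally_finite (betti C)"
  unfolding locally_finite_def using finite_betti_le by blast

text \<open>The generators form a countable set, being finite in number below any level, so the
  standard basis of the ambient space has room for them.\<close>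

lemma zero_bdry_model:
  assumes N: "locally_finite N"
  obtains C :: "'k::field fcc" where "tame C" "\<And>x. bdry C x = 0" "\<And>i a. betti C i a = N i a"
proof -
  define T where "T = {(i, a, k). k < N i a}"
  have fT: "finite {t \<in> T. fst (snd t) \<le> r}" for r
  proof (rule finite_subset)
    let ?P = "{(i, a). a \<le> r \<and> N i a \<noteq> 0}"
    show "{t \<in> T. fst (snd t) \<le> r} \<subseteq> (\<Union>(i, a)\<in>?P. (\<lambda>k. (i, a, k)) ` {..<N i a})"
      unfolding T_def by force
    show "finite (\<Union>(i, a)\<in>?P. (\<lambda>k. (i, a, k)) ` {..<N i a})"
      using N by (intro finite_UN_I) (auto simp: locally_finite_def)
  qed
  have "T = (\<Union>n::nat. {t \<in> T. fst (snd t) \<le> real n})"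
  proof
    show "T \<subseteq> (\<Union>n::nat. {t \<in> T. fst (snd t) \<le> real n})"
    proof
      fix t assume "t \<in> T"
      moreover obtain n where "fst (snd t) \<le> real n" using real_arch_simple by blast
      ultimately show "t \<in> (\<Union>n::nat. {t \<in> T. fst (snd t) \<le> real n})" by blast
    qed
  qed blast
  moreover have "countable (\<Union>n::nat. {t \<in> T. fst (snd t) \<le> real n})"
    by (rule countable_UN[OF _ countable_finite[OF fT]]) simp
  ultimately have cT: "countable T" by simp
  define e :: "int \<times> real \<times> nat \<Rightarrow> 'k vec" where "e t = Poly_Mapping.single (to_nat_on T t) 1" for t
  define B where "B = e ` T"
  have inj: "inj_on e T"
  proof (rule inj_onI)
    fix s t assume st: "s \<in> T" "t \<in> T" "e s = e t"
    then have "Poly_Mapping.keys (e s) = Poly_Mapping.keys (e t)" by simp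
    then have "to_nat_on T s = to_nat_on T t" by (simp add: e_def)
    then show "s = t" using inj_on_to_nat_on[OF cT] st by (simp add: inj_on_def)
  qed
  have ind: "vec.independent B"
  proof (rule vec.independent_explicit_finite_subsets[THEN iffD2], intro allI impI ballI)
    fix A u v assume A: "A \<subseteq> B" "finite A" "(\<Sum>v\<in>A. vscale (u v) v) = 0" "v \<in> A"
    have "v \<in> e ` T" using A(1,4) unfolding B_def by blast
    then obtain t where t: "t \<in> T" "v = e t" by blast
    have "0 = Poly_Mapping.lookup (\<Sum>v\<in>A. vscale (u v) v) (to_nat_on T t)" using A(3) by simp
    also have "\<dots> = (\<Sum>w\<in>A. u w * Poly_Mapping.lookup w (to_nat_on T t))" by (simp add: lookup_sum')
    also have "\<dots> = (\<Sum>w\<in>A. if w = v then u v else 0)"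
    proof (rule sum.cong[OF refl])
      fix w assume "w \<in> A"
      then have "w \<in> e ` T" using A(1) unfolding B_def by blast
      then obtain s where s: "s \<in> T" "w = e s" by blast
      have "to_nat_on T s = to_nat_on T t \<longleftrightarrow> s = t"
        using inj_on_to_nat_on[OF cT] s t by (auto simp: inj_on_def)
      moreover have "w = v \<longleftrightarrow> s = t" using inj s t by (auto simp: inj_on_def)
      ultimately show "u w * Poly_Mapping.lookup w (to_nat_on T t) = (if w = v then u v else 0)"
        using s by (auto simp: e_def lookup_single when_def)
    qed
    also have "\<dots> = u v" using A(2,4) by simp
    finally show "u v = 0" by simp
  qed
  define deg where "deg b = fst (inv_into T e b)" for b
  define l where "l b = fst (snd (inv_into T e b))" for b
  define C where "C = \<lparr>grade = (\<lambda>i. vec.span {b \<in> B. deg b = i}), bdry = (\<lambda>_. 0),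
    lev = (\<lambda>x. SUP b\<in>supp B x. ereal (l b))\<rparr>"
  have C: "grade C i = vec.span {b \<in> B. deg b = i}" "bdry C x = 0" "lev C x = (SUP b\<in>supp B x. ereal (l b))" for i x
    by (simp_all add: C_def)
  have l0: "lev C 0 = -\<infinity>"
    unfolding C(3) supp_eq_empty_iff[OF ind vec.span_zero, THEN iffD2, OF refl] by (simp add: bot_ereal_def)
  have "linear_on_set (vec.span B) (bdry C)" by (simp add: linear_on_set_def C)
  then have fc: "filtered_complex C" and ob: "obasis C B"
    and hd: "\<And>b. b \<in> B \<Longrightarrow> hdeg C b = deg b" and lv: "\<And>b. b \<in> B \<Longrightarrow> lev C b = ereal (l b)"
    using filtered_complexI[OF ind C(1) C(3)] l0 by (simp_all add: C(1,2) vec.span_zero)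
  have it: "inv_into T e (e t) = t" if "t \<in> T" for t using inj that by simp
  have "tame C"
  proof (rule tameI[OF fc ob])
    fix r
    have "{b \<in> B. lev C b \<le> ereal r} \<subseteq> e ` {t \<in> T. fst (snd t) \<le> r}"
      using lv it by (auto simp: B_def l_def)
    then show "finite {b \<in> B. lev C b \<le> ereal r}" using fT by (meson finite_imageI finite_subset)
  qed
  moreover have "betti C i a = N i a" for i a
  proof -
    have "{b \<in> B. hdeg C b = i \<and> lev C b = ereal a} = e ` {t \<in> T. fst t = i \<and> fst (snd t) = a}"
      using lv hd it by (auto simp: B_def l_def deg_def)
    also have "{t \<in> T. fst t = i \<and> fst (snd t) = a} = (\<lambda>k. (i, a, k)) ` {..<N i a}"
      by (auto simp: T_def)
    finally have "betti C i a = card (e ` (\<lambda>k. (i, a, k)) ` {..<N i a})"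
      using obasis_betti[OF \<open>tame C\<close> ob] by simp
    also have "\<dots> = card ((\<lambda>k. (i, a, k)) ` {..<N i a})"
      by (rule card_image, rule inj_on_subset[OF inj]) (auto simp: T_def)
    also have "\<dots> = N i a" by (simp add: card_image inj_on_def)
    finally show ?thesis .
  qed
  ultimately show thesis using that C(2) by blast
qed

text \<open>With \<open>X\<close> a part of an orthogonal basis; the cycles and a complement of them are of this form.\<close>

definition span_complex :: "'k::field fcc \<Rightarrow> 'k vec set \<Rightarrow> int \<Rightarrow> 'k fcc"
  where "span_complex C X k =
    \<lparr>grade = (\<lambda>i. vec.span {b \<in> X. hdeg C b = i + k}), bdry = (\<lambda>_. 0), lev = lev C\<rparr>"

lemma span_complex:
  assumes C: "tame C" and B: "obasis C B" and XB: "X \<subseteq> B"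
  shows "tame (span_complex C X k)" "total (span_complex C X k) = vec.span X"
    "levels (span_complex C X k) \<subseteq> levels C"
proof -
  interpret filtered_complex C using C by (rule tame_fc)
  have iB: "vec.independent B" "vec.span B = total C" using B by (auto simp: obasis_def)
  let ?l = "\<lambda>b. real_of_ereal (lev C b)" and ?S = "span_complex C X k"
  have l: "ereal (?l b) = lev C b" if "b \<in> X" for b using obasis_lev[OF B] that XB by auto
  have main: "filtered_complex ?S \<and> obasis ?S X \<and> total ?S = vec.span X \<and>
      (\<forall>b\<in>X. hdeg ?S b = hdeg C b - k \<and> lev ?S b = ereal (?l b))"
  proof (rule filtered_complexI_span)
    show "vec.independent X" by (rule vec.independent_mono[OF iB(1) XB])
    show "grade ?S i = vec.span {b \<in> X. hdeg C b - k = i}" for i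
      unfolding span_complex_def fcc.simps by (rule arg_cong[where f = vec.span]) auto
    show "lev ?S x \<le> M \<longleftrightarrow> x \<in> vec.span {b \<in> X. ereal (?l b) \<le> M}" if x: "x \<in> vec.span X" for x M
    proof -
      have xB: "x \<in> vec.span B" "supp B x \<subseteq> X" using x in_span_subset_iff[OF iB(1) XB] by auto
      have "lev ?S x \<le> M \<longleftrightarrow> x \<in> vec.span {b \<in> B. lev C b \<le> M}"
        using obasis_le_iff[OF B, of x] xB iB by (simp add: span_complex_def)
      also have "\<dots> \<longleftrightarrow> supp B x \<subseteq> {b \<in> B. lev C b \<le> M}"
        using in_span_subset_iff[OF iB(1), of "{b \<in> B. lev C b \<le> M}" x] xB by auto
      also have "\<dots> \<longleftrightarrow> supp B x \<subseteq> {b \<in> X. ereal (?l b) \<le> M}"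
      proof -
        have "\<forall>b\<in>supp B x. ereal (?l b) = lev C b" using l xB(2) by blast
        then show ?thesis using xB(2) XB by (auto simp: subset_iff)
      qed
      also have "\<dots> \<longleftrightarrow> x \<in> vec.span {b \<in> X. ereal (?l b) \<le> M}"
        using in_span_subset_iff[OF iB(1), of "{b \<in> X. ereal (?l b) \<le> M}" x] xB XB by auto
      finally show ?thesis .
    qed
  qed (auto simp: span_complex_def linear_on_set_def vec.span_zero lev_zero)
  then have fc: "filtered_complex ?S" and ob: "obasis ?S X" and t: "total ?S = vec.span X" by auto
  have lS: "lev ?S = lev C" by (simp add: span_complex_def)
  show "total ?S = vec.span X" by (rule t)
  show "tame ?S"
  proof (rule tameI[OF fc ob])
    show "finite {b \<in> X. lev ?S b \<le> ereal r}" for r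
      unfolding lS by (rule finite_subset[OF _ obasis_finite_le[OF C B, of r]]) (use XB in auto)
  qed
  show "levels ?S \<subseteq> levels C"
    unfolding levels_def t lS using vec.span_mono[OF XB] iB(2) by auto
qed

text \<open>\<open>C\<close> is the cone of its differential, regarded as a map from an orthogonal complement of the
  cycles (shifted down) to the cycles.  Regarded as complexes, both of these have zero
  differential.\<close>

lemma cycle_splitting:
  assumes C: "tame C"
  obtains A S f c where "tame A" "tame S" "levels A \<subseteq> levels C" "levels S \<subseteq> levels C"
    "\<And>x. bdry A x = 0" "\<And>x. bdry S x = 0" "filt_map A S f" "filt_iso C (cone A S f) c"
proof -
  interpret filtered_complex C using C by (rule tame_fc)
  obtain g where g: "vlin g" "\<And>x. x \<in> total C \<Longrightarrow> g x = bdry C x"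
    using linear_on_set_extend[OF bdry_linear subspace_total] by blast
  let ?Z = "\<lambda>i. {x \<in> grade C i. bdry C x = 0}"
  have Zg: "?Z i = grade C i \<inter> {x. g x = 0}" for i
    using g(2) grade_total[of C i] by auto
  have sZ: "vec.subspace (?Z i)" for i
    unfolding Zg by (intro vec.subspace_inter subspace_grade vecp.linear_subspace_kernel[OF g(1)])
  obtain B X where B: "obasis C B" and XB: "X \<subseteq> B" and X: "\<And>i. ?Z i = vec.span {b \<in> X. hdeg C b = i}"
    by (rule adapted_obasis[OF _ sZ]) (use C in \<open>auto simp: tame_def\<close>)
  have iB: "vec.independent B" "vec.span B = total C" using B by (auto simp: obasis_def)
  define W where "W = B - X"
  have WB: "W \<subseteq> B" by (auto simp: W_def)
  define A where "A = span_complex C W 1"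
  define S where "S = span_complex C X 0"
  note tA = span_complex[OF C B WB, of 1, folded A_def] and tS = span_complex[OF C B XB, of 0, folded S_def]
  have gS: "grade S i = ?Z i" for i unfolding X S_def by (simp add: span_complex_def)
  have gA: "grade A i = vec.span {b \<in> W. hdeg C b = i + 1}" for i by (simp add: A_def span_complex_def)
  have bA: "bdry A x = 0" "bdry S x = 0" and lA: "lev A x = lev C x" "lev S x = lev C x" for x
    by (simp_all add: A_def S_def span_complex_def)
  have AC: "grade A i \<subseteq> grade C (i + 1)" for i
    unfolding gA obasis_grade[OF B] by (rule vec.span_mono) (use WB in auto)
  have tAC: "total A \<subseteq> total C" and tSC: "total S \<subseteq> total C"
    unfolding tA(2) tS(2) iB(2)[symmetric] by (auto intro!: vec.span_mono XB WB)
  have f: "filt_map A S (bdry C)"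
    unfolding filt_map_def
  proof (intro conjI allI ballI)
    show "linear_on_set (total A) (bdry C)"
      using bdry_linear tAC unfolding linear_on_set_def by blast
    show "bdry C x \<in> grade S i" if x: "x \<in> grade A i" for x i
      using bdry_grade[of x "i + 1"] bdry_bdry[of x] x AC grade_total unfolding gS by fastforce
    fix x assume "x \<in> total A"
    then have x: "x \<in> total C" using tAC by blast
    show "bdry C (bdry A x) = bdry S (bdry C x)" by (simp add: bA bdry_0)
    show "lev S (bdry C x) \<le> lev A x" using lev_bdry[OF x] by (simp add: lA)
  qed
  interpret A: filtered_complex A using tA(1) by (rule tame_fc)
  interpret S: filtered_complex S using tS(1) by (rule tame_fc)
  obtain XA where XA: "obasis A XA" using tame_obasis[OF tA(1)] .
  obtain XS where XS: "obasis S XS" using tame_obasis[OF tS(1)] .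
  interpret K: cone_setting A S "bdry C" XA XS
    using XA XS f A.filtered_complex_axioms S.filtered_complex_axioms by (simp add: cone_setting_def)
  obtain p where p: "vlin p" "\<And>b. b \<in> B \<Longrightarrow> p b = (if b \<in> X then b else 0)"
    using vlin_extend[OF iB(1), of "\<lambda>b. if b \<in> X then b else 0"] by metis
  define q where "q x = x - p x" for x
  have q: "vlin q" unfolding q_def by (intro vlin_minus vlin_id p(1))
  have ps: "p x \<in> vec.span {b \<in> X. P b} \<and> q x \<in> vec.span {b \<in> W. P b}" if x: "x \<in> vec.span {b \<in> B. P b}" for x P
  proof -
    have pb: "p b \<in> vec.span {b \<in> X. P b} \<and> q b \<in> vec.span {b \<in> W. P b}" if "b \<in> {b \<in> B. P b}" for b
      using that p(2)[of b] by (auto simp: q_def W_def intro: vec.span_base vec.span_zero)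
    have "vec.span {b \<in> B. P b} \<subseteq> {x. p x \<in> vec.span {b \<in> X. P b}} \<inter> {x. q x \<in> vec.span {b \<in> W. P b}}"
      using pb by (intro vec.span_minimal vec.subspace_inter
          vecp.linear_subspace_linear_preimage[OF p(1)] vecp.linear_subspace_linear_preimage[OF q]) auto
    then show ?thesis using x by blast
  qed
  have pt: "p x \<in> total S" "q x \<in> total A" if "x \<in> total C" for x
    using ps[of x "\<lambda>_. True"] that iB(2) tA(2) tS(2) by auto
  have pg: "p x \<in> grade S i" "q x \<in> grade A (i - 1)" if "x \<in> grade C i" for x i
    using ps[of x "\<lambda>b. hdeg C b = i"] that[unfolded obasis_grade[OF B]] unfolding gS[unfolded X] gA by auto
  have pl: "lev C (p x) \<le> lev C x" "lev C (q x) \<le> lev C x" if x: "x \<in> total C" for x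
  proof -
    have "x \<in> vec.span {b \<in> B. lev C b \<le> lev C x}" using obasis_le_iff[OF B x, of "lev C x"] by blast
    from ps[OF this] have "p x \<in> vec.span {b \<in> B. lev C b \<le> lev C x}" "q x \<in> vec.span {b \<in> B. lev C b \<le> lev C x}"
      using vec.span_mono[of "{b \<in> X. lev C b \<le> lev C x}" "{b \<in> B. lev C b \<le> lev C x}"]
        vec.span_mono[of "{b \<in> W. lev C b \<le> lev C x}" "{b \<in> B. lev C b \<le> lev C x}"] XB WB by auto
    then show "lev C (p x) \<le> lev C x" "lev C (q x) \<le> lev C x"
      using obasis_le_iff[OF B, of "p x"] obasis_le_iff[OF B, of "q x"] pt[OF x] tAC tSC by auto
  qed
  have pS: "p x = x" "bdry C x = 0" if "x \<in> total S" for x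
  proof -
    show "p x = x"
      by (rule vlin_eq_on_span[OF p(1) vlin_id, of X]) (use that tS(2) p(2) XB in auto)
    have "vec.span X \<subseteq> {x. g x = 0}"
    proof (rule vec.span_minimal[OF _ vecp.linear_subspace_kernel[OF g(1)]], rule subsetI)
      fix b assume b: "b \<in> X"
      then have "b \<in> ?Z (hdeg C b)" unfolding X by (intro vec.span_base) simp
      then show "b \<in> {x. g x = 0}" unfolding Zg by blast
    qed
    then show "bdry C x = 0" using that tS(2) g(2)[OF subsetD[OF tSC that]] by auto
  qed
  have pA: "p x = 0" if "x \<in> total A" for x
    by (rule vlin_eq_on_span[OF p(1) vlin_zero, of W]) (use that tA(2) p(2) in \<open>auto simp: W_def\<close>)
  have bS: "bdry C x \<in> total S" if "x \<in> total C" for x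
  proof -
    have "bdry C x = bdry C (q x)"
      using bdry_diff[of x "p x"] that pS(2)[OF pt(1)[OF that]] pt(1)[OF that] tSC by (auto simp: q_def)
    then show ?thesis using filt_mapD(5)[OF f A.filtered_complex_axioms pt(2)[OF that]] by simp
  qed
  let ?c = "\<lambda>x. sum_inl (p x) + sum_inr (q x)" and ?d = "\<lambda>z. sum_fst z + sum_snd z"
  have "filt_map C (cone A S (bdry C)) ?c"
    unfolding filt_map_def
  proof (intro conjI allI ballI)
    show "linear_on_set (total C) ?c"
      by (intro vlin_on_set vlin_plus vlin_comp[OF vlin_inl] vlin_comp[OF vlin_inr] p(1) q)
    show "?c x \<in> grade (cone A S (bdry C)) i" if "x \<in> grade C i" for x i
      using pg[OF that] by (simp add: K.cone_grade sum_vec_simps)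
    fix x assume x: "x \<in> total C"
    have "bdry C (q x) = bdry C x"
      using bdry_diff[of x "p x"] x pS(2)[OF pt(1)[OF x]] pt(1)[OF x] tSC by (auto simp: q_def)
    then show "?c (bdry C x) = bdry (cone A S (bdry C)) (?c x)"
      using pS(1)[OF bS[OF x]] by (simp add: K.cone_bdry sum_vec_simps bA q_def)
    show "lev (cone A S (bdry C)) (?c x) \<le> lev C x"
      using pl[OF x] by (simp add: K.cone_lev sum_vec_simps lA)
  qed
  moreover have "filt_map (cone A S (bdry C)) C ?d"
    unfolding filt_map_def
  proof (intro conjI allI ballI)
    show "linear_on_set (total (cone A S (bdry C))) ?d"
      by (intro vlin_on_set vlin_plus vlin_fst vlin_snd)
    show "?d z \<in> grade C i" if z: "z \<in> grade (cone A S (bdry C)) i" for z i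
      using z AC[of "i - 1"] gS[of i] unfolding K.cone_grade
      by (auto intro!: vec.subspace_add[OF subspace_grade])
    fix z assume "z \<in> total (cone A S (bdry C))"
    then have z: "sum_fst z \<in> total S" "sum_snd z \<in> total A" "sum_fst z \<in> total C" "sum_snd z \<in> total C"
      using K.cone_basis(3) tAC tSC by auto
    show "?d (bdry (cone A S (bdry C)) z) = bdry C (?d z)"
      using bdry_add[OF z(3,4)] pS(2)[OF z(1)] by (simp add: K.cone_bdry sum_vec_simps bA)
    show "lev C (?d z) \<le> lev (cone A S (bdry C)) z"
      using lev_add[OF z(3,4)] by (simp add: K.cone_lev lA)
  qed
  moreover have "?d (?c x) = x" for x by (simp add: sum_vec_simps q_def)
  moreover have "?c (?d z) = z" if "z \<in> total (cone A S (bdry C))" for z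
  proof -
    have "sum_fst z \<in> total S" "sum_snd z \<in> total A" using that K.cone_basis(3) by auto
    then show ?thesis using pS(1) pA vlin_add[OF p(1)] by (simp add: q_def)
  qed
  ultimately have "filt_iso C (cone A S (bdry C)) ?c" unfolding filt_iso_def by blast
  then show thesis using that[OF tA(1) tS(1) tA(3) tS(3) bA f] by blast
qed

lemma cone_filt_map:
  assumes A: "tame A" and B: "tame B" and f: "filt_map A B f" and A': "tame A'" and B': "tame B'"
    and f': "filt_map A' B' f'" and \<alpha>: "filt_map A A' \<alpha>" and \<beta>: "filt_map B B' \<beta>"
    and com: "\<And>x. x \<in> total A \<Longrightarrow> \<beta> (f x) = f' (\<alpha> x)"
  shows "filt_map (cone A B f) (cone A' B' f') (\<lambda>z. sum_inl (\<beta> (sum_fst z)) + sum_inr (\<alpha> (sum_snd z)))"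
proof -
  obtain X Y X' Y' where o: "obasis A X" "obasis B Y" "obasis A' X'" "obasis B' Y'"
    using tame_obasis[OF A] tame_obasis[OF B] tame_obasis[OF A'] tame_obasis[OF B'] by metis
  interpret K: cone_setting A B f X Y
    using A B f o by (simp add: cone_setting_def tame_fc)
  interpret K': cone_setting A' B' f' X' Y'
    using A' B' f' o by (simp add: cone_setting_def tame_fc)
  note a = filt_mapD[OF \<alpha> tame_fc[OF A]] and b = filt_mapD[OF \<beta> tame_fc[OF B]]
  note ff = filt_mapD[OF f tame_fc[OF A]]
  show ?thesis
    unfolding filt_map_def
  proof (intro conjI allI ballI)
    show "linear_on_set (total (cone A B f)) (\<lambda>z. sum_inl (\<beta> (sum_fst z)) + sum_inr (\<alpha> (sum_snd z)))"
      unfolding linear_on_set_def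
    proof (intro conjI allI ballI)
      fix x c assume x: "x \<in> total (cone A B f)"
      then show "sum_inl (\<beta> (sum_fst (vscale c x))) + sum_inr (\<alpha> (sum_snd (vscale c x))) =
          vscale c (sum_inl (\<beta> (sum_fst x)) + sum_inr (\<alpha> (sum_snd x)))"
        using a(1) b(1) unfolding linear_on_set_def K.cone_basis(3)
        by (simp add: sum_vec_simps vec.scale_right_distrib)
      fix y assume "y \<in> total (cone A B f)"
      then show "sum_inl (\<beta> (sum_fst (x + y))) + sum_inr (\<alpha> (sum_snd (x + y))) =
          sum_inl (\<beta> (sum_fst x)) + sum_inr (\<alpha> (sum_snd x)) + (sum_inl (\<beta> (sum_fst y)) + sum_inr (\<alpha> (sum_snd y)))"
        using x a(1) b(1) unfolding linear_on_set_def K.cone_basis(3)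
        by (simp add: sum_vec_simps algebra_simps)
    qed
    show "sum_inl (\<beta> (sum_fst z)) + sum_inr (\<alpha> (sum_snd z)) \<in> grade (cone A' B' f') i"
      if "z \<in> grade (cone A B f) i" for z i
      using that a(2) b(2) by (simp add: K.cone_grade K'.cone_grade sum_vec_simps)
    fix z assume "z \<in> total (cone A B f)"
    then have z: "sum_fst z \<in> total B" "sum_snd z \<in> total A" unfolding K.cone_basis(3) by auto
    have "\<beta> (bdry B (sum_fst z) + f (sum_snd z)) = \<beta> (bdry B (sum_fst z)) + \<beta> (f (sum_snd z))"
      using b(1) K.B.bdry_total[OF z(1)] ff(5)[OF z(2)] unfolding linear_on_set_def by blast
    then show "sum_inl (\<beta> (sum_fst (bdry (cone A B f) z))) + sum_inr (\<alpha> (sum_snd (bdry (cone A B f) z))) =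
        bdry (cone A' B' f') (sum_inl (\<beta> (sum_fst z)) + sum_inr (\<alpha> (sum_snd z)))"
      using b(3)[OF z(1)] a(3)[OF z(2)] com[OF z(2)] linear_on_set_neg[OF a(1) K.A.bdry_total[OF z(2)]]
      by (simp add: K.cone_bdry K'.cone_bdry sum_vec_simps)
    show "lev (cone A' B' f') (sum_inl (\<beta> (sum_fst z)) + sum_inr (\<alpha> (sum_snd z))) \<le> lev (cone A B f) z"
      using a(4)[OF z(2)] b(4)[OF z(1)]
      by (auto simp: K.cone_lev K'.cone_lev sum_vec_simps le_max_iff_disj)
  qed
qed

lemma euler_series_iso: "tame C \<Longrightarrow> tame D \<Longrightarrow> filt_iso C D f \<Longrightarrow> euler_series C a = euler_series D a"
  by (intro filt_equivalence_euler_series filt_iso_imp_equivalence) (auto simp: tame_fc)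

definition frag_euler :: "('k::field fcc \<Rightarrow>\<^sub>0 int) \<Rightarrow> real \<Rightarrow> int"
  where "frag_euler p a = (\<Sum>C\<in>Poly_Mapping.keys p. Poly_Mapping.lookup p C * euler_series C a)"

lemma frag_euler_superset:
  "finite S \<Longrightarrow> Poly_Mapping.keys p \<subseteq> S \<Longrightarrow>
    frag_euler p a = (\<Sum>C\<in>S. Poly_Mapping.lookup p C * euler_series C a)"
  unfolding frag_euler_def by (rule sum.mono_neutral_left) (auto simp: in_keys_iff)

lemma frag_euler_of [simp]: "frag_euler (frag_of C) a = euler_series C a"
  by (simp add: frag_euler_def)

lemma frag_euler_0 [simp]: "frag_euler 0 a = 0"
  by (simp add: frag_euler_def)

lemma frag_euler_add [simp]: "frag_euler (p + q) a = frag_euler p a + frag_euler q a"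
  and frag_euler_diff [simp]: "frag_euler (p - q) a = frag_euler p a - frag_euler q a"
proof -
  let ?S = "Poly_Mapping.keys p \<union> Poly_Mapping.keys q"
  show "frag_euler (p + q) a = frag_euler p a + frag_euler q a"
    using keys_add[of p q]
    by (simp add: frag_euler_superset[of ?S] lookup_add distrib_right sum.distrib)
  show "frag_euler (p - q) a = frag_euler p a - frag_euler q a"
    using keys_diff[of p q]
    by (simp add: frag_euler_superset[of ?S] lookup_minus left_diff_distrib sum_subtractf)
qed

lemma frag_euler_minus [simp]: "frag_euler (- p) a = - frag_euler p a"
  using frag_euler_diff[of 0 p a] by simp

text \<open>An assignment of elements of an abelian group modulo a subgroup \<open>R\<close> to complexes that turns
  cones into differences.  The ideal \<open>L\<close> of sets of reals selects the complexes: all sets give the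
  tame complexes, finite sets the finitely generated ones, and finite sets bounded below by \<open>m\<close>
  those on which the levels can be flattened to \<open>m\<close>.  The values lie in a free abelian group modulo
  \<open>R\<close> since that is the form of a Grothendieck group.\<close>

locale cone_functional =
  fixes L :: "real set set" and \<theta> :: "'k::field fcc \<Rightarrow> 'b \<Rightarrow>\<^sub>0 int" and R :: "('b \<Rightarrow>\<^sub>0 int) set"
  assumes L_empty: "{} \<in> L"
    and L_Un: "S \<in> L \<Longrightarrow> T \<in> L \<Longrightarrow> S \<union> T \<in> L"
    and L_subset: "S \<in> L \<Longrightarrow> T \<subseteq> S \<Longrightarrow> T \<in> L"
    and R_0: "0 \<in> R" and R_diff: "x \<in> R \<Longrightarrow> y \<in> R \<Longrightarrow> x - y \<in> R"
    and cone: "\<And>A B X f c. A \<in> complexes_with_levels L \<Longrightarrow> B \<in> complexes_with_levels L \<Longrightarrow>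
      X \<in> complexes_with_levels L \<Longrightarrow> filt_map A B f \<Longrightarrow> filt_iso X (cone A B f) c \<Longrightarrow>
      \<theta> B - \<theta> A - \<theta> X \<in> R"
begin

definition eqv :: "('b \<Rightarrow>\<^sub>0 int) \<Rightarrow> ('b \<Rightarrow>\<^sub>0 int) \<Rightarrow> bool"  (infix \<open>\<asymp>\<close> 50)
  where "x \<asymp> y \<longleftrightarrow> x - y \<in> R"

lemma R_neg: "x \<in> R \<Longrightarrow> - x \<in> R"
  using R_diff[OF R_0, of x] by simp

lemma R_add: "x \<in> R \<Longrightarrow> y \<in> R \<Longrightarrow> x + y \<in> R"
  using R_diff[of x "- y"] R_neg[of y] by simp

lemma eqv_refl [simp]: "x \<asymp> x"
  by (simp add: eqv_def R_0)

lemma eqv_sym: "x \<asymp> y \<Longrightarrow> y \<asymp> x"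
  using R_neg[of "x - y"] by (simp add: eqv_def)

lemma eqv_trans [trans]: "x \<asymp> y \<Longrightarrow> y \<asymp> z \<Longrightarrow> x \<asymp> z"
  using R_add[of "x - y" "y - z"] by (simp add: eqv_def)

lemma eqv_add: "x \<asymp> y \<Longrightarrow> x' \<asymp> y' \<Longrightarrow> x + x' \<asymp> y + y'"
  using R_add[of "x - y" "x' - y'"] by (simp add: eqv_def algebra_simps)

lemma eqv_diff: "x \<asymp> y \<Longrightarrow> x' \<asymp> y' \<Longrightarrow> x - x' \<asymp> y - y'"
  using R_diff[of "x - y" "x' - y'"] by (simp add: eqv_def algebra_simps)

lemma cone_eqv:
  assumes "A \<in> complexes_with_levels L" "B \<in> complexes_with_levels L" "X \<in> complexes_with_levels L"
    "filt_map A B f" "filt_iso X (cone A B f) c"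
  shows "\<theta> X \<asymp> \<theta> B - \<theta> A"
  using R_neg[OF cone[OF assms]] by (simp add: eqv_def algebra_simps)

lemma cone_object:
  assumes "A \<in> complexes_with_levels L" "B \<in> complexes_with_levels L" "filt_map A B f"
  shows "cone A B f \<in> complexes_with_levels L"
  using assms cone_tame(1,3)[of A B f] L_Un by (simp add: complexes_with_levels_def)

text \<open>The cone of a filtered isomorphism \<open>f : X \<rightarrow> Y\<close> is isomorphic to that of the identity of \<open>X\<close>;
  computing its class in both ways gives \<open>\<theta> Y - \<theta> X\<close> and \<open>0\<close>.\<close>

lemma iso_eqv:
  assumes X: "X \<in> complexes_with_levels L" and Y: "Y \<in> complexes_with_levels L" and f: "filt_iso X Y f"
  shows "\<theta> X \<asymp> \<theta> Y"
proof -
  have tX: "tame X" and tY: "tame Y" using X Y by (auto simp: complexes_with_levels_def)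
  obtain g where g: "filt_map X Y f" "filt_map Y X g" "\<And>x. x \<in> total X \<Longrightarrow> g (f x) = x"
      "\<And>y. y \<in> total Y \<Longrightarrow> f (g y) = y"
    using f unfolding filt_iso_def by blast
  note id = filt_map_id[OF tame_fc[OF tX]]
  obtain BX BY where o: "obasis X BX" "obasis Y BY"
    using tame_obasis[OF tX] tame_obasis[OF tY] by metis
  interpret K: cone_setting X Y f BX BY
    using tX tY g(1) o by (simp add: cone_setting_def tame_fc)
  interpret K': cone_setting X X "\<lambda>x. x" BX BX
    using tX id o by (simp add: cone_setting_def tame_fc)
  have "filt_map (cone X Y f) (cone X X (\<lambda>x. x)) (\<lambda>z. sum_inl (g (sum_fst z)) + sum_inr (sum_snd z))"
    by (rule cone_filt_map[OF tX tY g(1) tX tX id id g(2)]) (simp add: g(3))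
  moreover have "filt_map (cone X X (\<lambda>x. x)) (cone X Y f) (\<lambda>z. sum_inl (f (sum_fst z)) + sum_inr (sum_snd z))"
    by (rule cone_filt_map[OF tX tX id tX tY g(1) id g(1)]) simp
  ultimately have "filt_iso (cone X Y f) (cone X X (\<lambda>x. x)) (\<lambda>z. sum_inl (g (sum_fst z)) + sum_inr (sum_snd z))"
    unfolding filt_iso_def K.cone_basis(3) K'.cone_basis(3)
    by (intro conjI exI[of _ "\<lambda>z. sum_inl (f (sum_fst z)) + sum_inr (sum_snd z)"]) (auto simp: sum_vec_simps g)
  then have "\<theta> (cone X Y f) \<asymp> \<theta> X - \<theta> X"
    by (rule cone_eqv[OF X X cone_object[OF X Y g(1)] id])
  moreover have "\<theta> (cone X Y f) \<asymp> \<theta> Y - \<theta> X"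
    by (rule cone_eqv[OF X Y cone_object[OF X Y g(1)] g(1) filt_iso_id[OF K.cone_basis(1)]])
  ultimately have "\<theta> Y - \<theta> X \<asymp> \<theta> X - \<theta> X" using eqv_sym eqv_trans by blast
  then show ?thesis using eqv_sym[of "\<theta> Y" "\<theta> X"] by (simp add: eqv_def)
qed

definition admissible :: "(int \<Rightarrow> real \<Rightarrow> nat) \<Rightarrow> bool"
  where "admissible N \<longleftrightarrow> locally_finite N \<and> {a. \<exists>i. N i a \<noteq> 0} \<in> L"

definition model :: "(int \<Rightarrow> real \<Rightarrow> nat) \<Rightarrow> 'k fcc"
  where "model N = (SOME C. tame C \<and> (\<forall>x. bdry C x = 0) \<and> (\<forall>i a. betti C i a = N i a))"

text \<open>Complexes with zero differential and the same \<open>N\<close> are isomorphic, so the class does not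
  depend on the choice of the model.\<close>

definition cl :: "(int \<Rightarrow> real \<Rightarrow> nat) \<Rightarrow> ('b \<Rightarrow>\<^sub>0 int)"
  where "cl N = \<theta> (model N)"

lemma levels_admissible: "tame C \<Longrightarrow> levels C \<in> L \<longleftrightarrow> admissible (betti C)"
proof -
  assume C: "tame C"
  have "{a. \<exists>i. betti C i a \<noteq> 0} = levels C" using levels_betti[OF C] by blast
  then show ?thesis using betti_locally_finite[OF C] by (simp add: admissible_def)
qed

lemma model:
  assumes "admissible N"
  shows "tame (model N)" "bdry (model N) x = 0" "betti (model N) i a = N i a"
    "model N \<in> complexes_with_levels L"
proof -
  have "\<exists>C :: 'k fcc. tame C \<and> (\<forall>x. bdry C x = 0) \<and> (\<forall>i a. betti C i a = N i a)"
    using zero_bdry_model[of N] assms unfolding admissible_def by metis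
  then have m: "tame (model N) \<and> (\<forall>x. bdry (model N) x = 0) \<and> (\<forall>i a. betti (model N) i a = N i a)"
    unfolding model_def by (rule someI_ex)
  then show "tame (model N)" "bdry (model N) x = 0" "betti (model N) i a = N i a" by auto
  have "betti (model N) = N" by (intro ext) (use m in simp)
  then show "model N \<in> complexes_with_levels L"
    using m levels_admissible[of "model N"] assms by (simp add: complexes_with_levels_def)
qed

lemma zero_bdry_eqv:
  assumes C: "C \<in> complexes_with_levels L" and 0: "\<And>x. x \<in> total C \<Longrightarrow> bdry C x = 0"
    and N: "\<And>i a. betti C i a = N i a"
  shows "\<theta> C \<asymp> cl N" "admissible N"
proof -
  have tC: "tame C" using C by (simp add: complexes_with_levels_def)
  have "betti C = N" using N by blast
  then show a: "admissible N"
    using C levels_admissible[of C] by (simp add: complexes_with_levels_def)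
  obtain f where "filt_iso C (model N) f"
    by (rule zero_bdry_iso[OF tC model(1)[OF a] 0]) (simp_all add: model[OF a] N)
  then show "\<theta> C \<asymp> cl N" unfolding cl_def by (rule iso_eqv[OF C model(4)[OF a]])
qed

text \<open>A direct sum with a shifted complex is the cone of the zero map.\<close>

lemma cl_cone:
  assumes N: "admissible N" and M: "admissible M"
  shows "cl (\<lambda>i a. N i a + M (i - 1) a) \<asymp> cl N - cl M"
proof -
  let ?z = "\<lambda>x :: 'k vec. 0 :: 'k vec" and ?A = "model M" and ?B = "model N"
  let ?C = "cone ?A ?B ?z"
  note A = model[OF M] and B = model[OF N]
  note f = filt_map_zero[OF tame_fc[OF A(1)] tame_fc[OF B(1)]]
  note t = cone_tame[OF A(1) B(1) f]
  have C: "?C \<in> complexes_with_levels L" by (rule cone_object[OF A(4) B(4) f])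
  have "\<theta> ?C \<asymp> cl (\<lambda>i a. N i a + M (i - 1) a)"
  proof (rule zero_bdry_eqv[OF C])
    fix x show "bdry ?C x = 0" by (simp add: cone_def A(2) B(2) sum_vec_simps)
  next
    fix i a show "betti ?C i a = N i a + M (i - 1) a" by (simp add: t(2) A(3) B(3))
  qed
  moreover have "\<theta> ?C \<asymp> cl N - cl M"
    unfolding cl_def by (rule cone_eqv[OF A(4) B(4) C f filt_iso_id[OF tame_fc[OF t(1)]]])
  ultimately show ?thesis using eqv_sym eqv_trans by blast
qed

text \<open>Generators may be moved between degrees while keeping their levels, as long as those of
  degree \<open>j\<close> only reach a finite set \<open>S j\<close> of degrees.\<close>

lemma admissible_spread:
  assumes N: "admissible N" and S: "\<And>j. finite (S j)"
    and M: "\<And>i a. M i a \<noteq> 0 \<Longrightarrow> \<exists>j. N j a \<noteq> 0 \<and> i \<in> S j"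
  shows "admissible M"
  unfolding admissible_def locally_finite_def
proof (intro conjI allI)
  fix r
  have f: "finite {(j, a). a \<le> r \<and> N j a \<noteq> 0}"
    using N by (simp add: admissible_def locally_finite_def)
  show "finite {(i, a). a \<le> r \<and> M i a \<noteq> 0}"
  proof (rule finite_subset)
    show "{(i, a). a \<le> r \<and> M i a \<noteq> 0} \<subseteq> (\<Union>(j, a)\<in>{(j, a). a \<le> r \<and> N j a \<noteq> 0}. (\<lambda>i. (i, a)) ` S j)"
      using M by force
    show "finite (\<Union>(j, a)\<in>{(j, a). a \<le> r \<and> N j a \<noteq> 0}. (\<lambda>i. (i, a)) ` S j)"
      using S by (intro finite_UN_I f) auto
  qed
next
  show "{a. \<exists>i. M i a \<noteq> 0} \<in> L"
    by (rule L_subset[of "{a. \<exists>i. N i a \<noteq> 0}"]) (use N M in \<open>auto simp: admissible_def\<close>)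
qed

lemma admissible_add:
  assumes "admissible N" "admissible M"
  shows "admissible (\<lambda>i a. N i a + M i a)"
  unfolding admissible_def locally_finite_def
proof (intro conjI allI)
  fix r
  have "{(i, a). a \<le> r \<and> N i a + M i a \<noteq> 0} =
      {(i, a). a \<le> r \<and> N i a \<noteq> 0} \<union> {(i, a). a \<le> r \<and> M i a \<noteq> 0}"
    by auto
  then show "finite {(i, a). a \<le> r \<and> N i a + M i a \<noteq> 0}"
    using assms by (simp add: admissible_def locally_finite_def)
  have "{a. \<exists>i. N i a + M i a \<noteq> 0} = {a. \<exists>i. N i a \<noteq> 0} \<union> {a. \<exists>i. M i a \<noteq> 0}" by auto
  then show "{a. \<exists>i. N i a + M i a \<noteq> 0} \<in> L"
    using L_Un assms by (simp add: admissible_def)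
qed

lemma admissible_shift: "admissible N \<Longrightarrow> admissible (\<lambda>i. N (i + k))"
  by (rule admissible_spread[where S = "\<lambda>j. {j - k}"]) force+

lemma cl_zero: "cl (\<lambda>i a. 0) \<asymp> 0"
proof -
  have "admissible (\<lambda>i a. 0)" using L_empty by (simp add: admissible_def locally_finite_def)
  from cl_cone[OF this this] show ?thesis by simp
qed

text \<open>The shifted complex is the cone of the map to the zero complex.\<close>

lemma cl_shift:
  assumes "admissible M" shows "cl (\<lambda>i. M (i - 1)) \<asymp> - cl M"
proof -
  have "admissible (\<lambda>i a. 0)" using L_empty by (simp add: admissible_def locally_finite_def)
  from cl_cone[OF this assms] have "cl (\<lambda>i a. M (i - 1) a) \<asymp> cl (\<lambda>i a. 0) - cl M" by simp
  also have "\<dots> \<asymp> 0 - cl M" by (intro eqv_diff cl_zero eqv_refl)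
  finally show ?thesis by simp
qed

lemma cl_add:
  assumes N: "admissible N" and M: "admissible M"
  shows "cl (\<lambda>i a. N i a + M i a) \<asymp> cl N + cl M"
proof -
  have M': "admissible (\<lambda>i. M (i + 1))" by (rule admissible_shift[OF M])
  have "cl (\<lambda>i a. N i a + M i a) \<asymp> cl N - cl (\<lambda>i. M (i + 1))"
    using cl_cone[OF N M'] by simp
  moreover have "cl M \<asymp> - cl (\<lambda>i. M (i + 1))"
    using cl_shift[OF M'] by simp
  then have "cl N + cl M \<asymp> cl N - cl (\<lambda>i. M (i + 1))"
    using eqv_add[OF eqv_refl[of "cl N"]] by fastforce
  ultimately show ?thesis using eqv_sym eqv_trans by blast
qed

lemma cl_shift2:
  assumes "admissible M" shows "cl (\<lambda>i. M (i - 2)) \<asymp> cl M"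
proof -
  have M': "admissible (\<lambda>i. M (i - 1))" using admissible_shift[OF assms, of "-1"] by simp
  have "cl (\<lambda>i. M (i - 2)) \<asymp> - cl (\<lambda>i. M (i - 1))"
    using cl_shift[OF M'] by (simp add: diff_diff_eq)
  also have "- cl (\<lambda>i. M (i - 1)) \<asymp> cl M"
    using eqv_diff[OF eqv_refl[of 0] cl_shift[OF assms]] by simp
  finally show ?thesis .
qed

definition in_degree_0 :: "(real \<Rightarrow> nat) \<Rightarrow> int \<Rightarrow> real \<Rightarrow> nat"
  where "in_degree_0 F i a = (if i = 0 then F a else 0)"

definition even_part :: "(int \<Rightarrow> real \<Rightarrow> nat) \<Rightarrow> real \<Rightarrow> nat"
  where "even_part N a = (\<Sum>j | N j a \<noteq> 0. if even j then N j a else 0)"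

definition odd_part :: "(int \<Rightarrow> real \<Rightarrow> nat) \<Rightarrow> real \<Rightarrow> nat"
  where "odd_part N a = (\<Sum>j | N j a \<noteq> 0. if odd j then N j a else 0)"

lemma finite_degrees:
  assumes "locally_finite N" shows "finite {j. N j a \<noteq> 0}"
proof (rule finite_subset)
  show "{j. N j a \<noteq> 0} \<subseteq> fst ` {(j, b). b \<le> a \<and> N j b \<noteq> 0}" by force
  show "finite (fst ` {(j, b). b \<le> a \<and> N j b \<noteq> 0})"
    using assms by (simp add: locally_finite_def)
qed

lemma sum_nonzero:
  fixes N :: "int \<Rightarrow> real \<Rightarrow> nat"
  assumes "(\<Sum>j | N j a \<noteq> 0. if P j then N j a else 0) \<noteq> 0"
  shows "\<exists>j. N j a \<noteq> 0 \<and> P j"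
proof (rule ccontr)
  assume "\<not> (\<exists>j. N j a \<noteq> 0 \<and> P j)"
  then have "(\<Sum>j | N j a \<noteq> 0. if P j then N j a else 0) = 0"
    by (intro sum.neutral) auto
  then show False using assms by simp
qed

text \<open>Shifting by 2 does not change classes, but a complex may have infinitely many generators, in
  unbounded degrees, so they are moved simultaneously.  A generator of degree \<open>n \<ge> 2\<close> together with
  auxiliary generators in degrees \<open>n - 2, n - 4, \<dots>\<close> down to 0 or 1 is the same as these auxiliary
  generators shifted up by 2 together with one generator of degree 0 or 1.  \<open>Qp\<close> collects the
  auxiliary generators for all \<open>n \<ge> 2\<close>, \<open>Qn\<close> similar ones for negative degrees, and \<open>Co\<close> the
  resulting generators in degrees 0 and 1; the classes of \<open>Qp\<close> and \<open>Qn\<close> then cancel.  These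
  collections are admissible since a generator of degree \<open>n\<close> and level \<open>a\<close> only requires finitely
  many auxiliary ones, all of level \<open>a\<close>.\<close>

lemma cl_collapse:
  assumes N: "admissible N"
  shows "cl N \<asymp> cl (in_degree_0 (even_part N)) - cl (in_degree_0 (odd_part N))"
    "admissible (in_degree_0 (even_part N))" "admissible (in_degree_0 (odd_part N))"
proof -
  have fin: "finite {j. N j a \<noteq> 0}" for a
    using N finite_degrees by (simp add: admissible_def)
  define Qp where "Qp i a = (if 0 \<le> i then \<Sum>j | N j a \<noteq> 0. if i + 2 \<le> j \<and> even (j - i) then N j a else 0 else 0)" for i a
  define Qn where "Qn i a = (if i < 0 then \<Sum>j | N j a \<noteq> 0. if j \<le> i \<and> even (j - i) then N j a else 0 else 0)" for i a
  define Co where "Co i a = (if i = 0 \<or> i = 1 then \<Sum>j | N j a \<noteq> 0. if even (j - i) then N j a else 0 else 0)" for i a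
  have aQp: "admissible Qp"
  proof (rule admissible_spread[OF N, of "\<lambda>j. {0..j}"])
    fix i a assume "Qp i a \<noteq> 0"
    then have "0 \<le> i" "(\<Sum>j | N j a \<noteq> 0. if i + 2 \<le> j \<and> even (j - i) then N j a else 0) \<noteq> 0"
      by (auto simp: Qp_def split: if_splits)
    then show "\<exists>j. N j a \<noteq> 0 \<and> i \<in> {0..j}" using sum_nonzero[where N = N and a = a and P = "\<lambda>j. i + 2 \<le> j \<and> even (j - i)"] by auto
  qed simp
  have aQn: "admissible Qn"
  proof (rule admissible_spread[OF N, of "\<lambda>j. {j..0}"])
    fix i a assume "Qn i a \<noteq> 0"
    then have "i < 0" "(\<Sum>j | N j a \<noteq> 0. if j \<le> i \<and> even (j - i) then N j a else 0) \<noteq> 0"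
      by (auto simp: Qn_def split: if_splits)
    then show "\<exists>j. N j a \<noteq> 0 \<and> i \<in> {j..0}" using sum_nonzero[where N = N and a = a and P = "\<lambda>j. j \<le> i \<and> even (j - i)"] by auto
  qed simp
  show a0: "admissible (in_degree_0 (even_part N))"
    by (rule admissible_spread[OF N, of "\<lambda>j. {0}"])
      (use sum_nonzero[where N = N and P = even] in \<open>auto simp: in_degree_0_def even_part_def split: if_splits\<close>)
  show a1: "admissible (in_degree_0 (odd_part N))"
    by (rule admissible_spread[OF N, of "\<lambda>j. {0}"])
      (use sum_nonzero[where N = N and P = odd] in \<open>auto simp: in_degree_0_def odd_part_def split: if_splits\<close>)
  have Co: "Co = (\<lambda>i a. in_degree_0 (even_part N) i a + in_degree_0 (odd_part N) (i - 1) a)"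
    by (intro ext) (auto simp: Co_def in_degree_0_def even_part_def odd_part_def intro!: sum.cong)
  have aCo: "admissible Co"
    unfolding Co using admissible_add[OF a0 admissible_shift[OF a1, of "-1"]] by simp
  have key: "N i a + Qp i a + Qn (i - 2) a = Co i a + Qp (i - 2) a + Qn i a" for i a
  proof -
    let ?s = "\<lambda>P. \<Sum>j | N j a \<noteq> 0. if P j then N j a else 0"
    have add: "?s P + ?s Q = ?s (\<lambda>j. P j \<or> Q j)" if "\<And>j. \<not> (P j \<and> Q j)" for P Q
      unfolding sum.distrib[symmetric] by (rule sum.cong) (use that in auto)
    have n: "N i a = ?s (\<lambda>j. j = i)" using fin[of a] by (cases "N i a = 0") auto
    consider "i < 0" | "i = 0 \<or> i = 1" | "i \<ge> 2" by linarith
    then show ?thesis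
    proof cases
      case 1
      have "?s (\<lambda>j. j = i) + ?s (\<lambda>j. j \<le> i - 2 \<and> even (j - (i - 2))) = ?s (\<lambda>j. j \<le> i \<and> even (j - i))"
        by (subst add) (auto intro!: sum.cong, presburger+)
      then show ?thesis using 1 n by (simp add: Qp_def Qn_def Co_def)
    next
      case 2
      have "?s (\<lambda>j. j = i) + ?s (\<lambda>j. i + 2 \<le> j \<and> even (j - i)) =
          ?s (\<lambda>j. j = i \<or> i + 2 \<le> j \<and> even (j - i))" by (rule add) auto
      moreover have "?s (\<lambda>j. j = i \<or> i + 2 \<le> j \<and> even (j - i)) + ?s (\<lambda>j. j \<le> i - 2 \<and> even (j - (i - 2))) =
          ?s (\<lambda>j. even (j - i))"
        by (subst add) (auto intro!: sum.cong, presburger+)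
      ultimately have "?s (\<lambda>j. j = i) + ?s (\<lambda>j. i + 2 \<le> j \<and> even (j - i)) +
          ?s (\<lambda>j. j \<le> i - 2 \<and> even (j - (i - 2))) = ?s (\<lambda>j. even (j - i))" by simp
      moreover have "Qp i a = ?s (\<lambda>j. i + 2 \<le> j \<and> even (j - i))" "Qp (i - 2) a = 0" "Qn i a = 0"
        "Qn (i - 2) a = ?s (\<lambda>j. j \<le> i - 2 \<and> even (j - (i - 2)))" "Co i a = ?s (\<lambda>j. even (j - i))"
        using 2 by (auto simp: Qp_def Qn_def Co_def)
      ultimately show ?thesis using n by linarith
    next
      case 3
      have "?s (\<lambda>j. j = i) + ?s (\<lambda>j. i + 2 \<le> j \<and> even (j - i)) = ?s (\<lambda>j. i - 2 + 2 \<le> j \<and> even (j - (i - 2)))"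
        by (subst add) (auto intro!: sum.cong, presburger+)
      then show ?thesis using 3 n by (simp add: Qp_def Qn_def Co_def)
    qed
  qed
  have sQp: "admissible (\<lambda>i. Qp (i - 2))" and sQn: "admissible (\<lambda>i. Qn (i - 2))"
    using admissible_shift[OF aQp, of "-2"] admissible_shift[OF aQn, of "-2"] by auto
  have "cl (\<lambda>i a. N i a + Qp i a + Qn (i - 2) a) \<asymp> cl N + cl Qp + cl Qn"
    using cl_add[OF admissible_add[OF N aQp] sQn]
      eqv_add[OF cl_add[OF N aQp] cl_shift2[OF aQn]] eqv_trans by blast
  moreover have "cl (\<lambda>i a. Co i a + Qp (i - 2) a + Qn i a) \<asymp> cl Co + cl Qp + cl Qn"
    using cl_add[OF admissible_add[OF aCo sQp] aQn]
      eqv_add[OF eqv_trans[OF cl_add[OF aCo sQp] eqv_add[OF eqv_refl cl_shift2[OF aQp]]] eqv_refl] eqv_trans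
    by blast
  ultimately have "cl N + cl Qp + cl Qn \<asymp> cl Co + cl Qp + cl Qn"
    unfolding key using eqv_sym eqv_trans by blast
  then have "cl N \<asymp> cl Co" by (simp add: eqv_def)
  also have "cl Co \<asymp> cl (in_degree_0 (even_part N)) - cl (in_degree_0 (odd_part N))"
    unfolding Co by (rule cl_cone[OF a0 a1])
  finally show "cl N \<asymp> cl (in_degree_0 (even_part N)) - cl (in_degree_0 (odd_part N))" .
qed

lemma even_odd_euler:
  assumes "tame C"
  shows "euler_series C a = int (even_part (betti C) a) - int (odd_part (betti C) a)"
proof -
  have "euler_series C a = (\<Sum>i | betti C i a \<noteq> 0. deg_sign i * int (betti C i a))"
    by (rule euler_series_betti[OF assms _ finite_degrees[OF betti_locally_finite[OF assms]]]) simp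
  also have "\<dots> = (\<Sum>i | betti C i a \<noteq> 0. int (if even i then betti C i a else 0) - int (if odd i then betti C i a else 0))"
    by (intro sum.cong) (auto simp: deg_sign_def)
  finally show ?thesis by (simp add: sum_subtractf even_part_def odd_part_def)
qed

lemma in_degree_0_add:
  assumes "admissible (in_degree_0 F)" "admissible (in_degree_0 G)"
  shows "admissible (in_degree_0 (\<lambda>a. F a + G a))"
    "cl (in_degree_0 (\<lambda>a. F a + G a)) \<asymp> cl (in_degree_0 F) + cl (in_degree_0 G)"
proof -
  have "in_degree_0 (\<lambda>a. F a + G a) = (\<lambda>i a. in_degree_0 F i a + in_degree_0 G i a)"
    by (intro ext) (simp add: in_degree_0_def)
  then show "admissible (in_degree_0 (\<lambda>a. F a + G a))"
    "cl (in_degree_0 (\<lambda>a. F a + G a)) \<asymp> cl (in_degree_0 F) + cl (in_degree_0 G)"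
    using admissible_add[OF assms] cl_add[OF assms] by simp_all
qed

text \<open>A normal form for \<open>x\<close>: the difference of two complexes with zero differential in degree 0
  whose Euler characteristic series differ by \<open>\<chi>\<close>.\<close>

definition represents :: "('b \<Rightarrow>\<^sub>0 int) \<Rightarrow> (real \<Rightarrow> int) \<Rightarrow> bool"
  where "represents x \<chi> \<longleftrightarrow> (\<exists>F G. admissible (in_degree_0 F) \<and> admissible (in_degree_0 G) \<and>
    x \<asymp> cl (in_degree_0 F) - cl (in_degree_0 G) \<and> (\<forall>a. \<chi> a = int (F a) - int (G a)))"

lemma represents_diff:
  assumes "represents x \<chi>" "represents y \<psi>"
  shows "represents (x - y) (\<lambda>a. \<chi> a - \<psi> a)"
proof -
  obtain F G where F: "admissible (in_degree_0 F)" and G: "admissible (in_degree_0 G)"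
    and x: "x \<asymp> cl (in_degree_0 F) - cl (in_degree_0 G)" "\<And>a. \<chi> a = int (F a) - int (G a)"
    using assms(1) unfolding represents_def by blast
  obtain F' G' where F': "admissible (in_degree_0 F')" and G': "admissible (in_degree_0 G')"
    and y: "y \<asymp> cl (in_degree_0 F') - cl (in_degree_0 G')" "\<And>a. \<psi> a = int (F' a) - int (G' a)"
    using assms(2) unfolding represents_def by blast
  note FG = in_degree_0_add[OF F G'] and GF = in_degree_0_add[OF G F']
  have "x - y \<asymp> cl (in_degree_0 F) - cl (in_degree_0 G) - (cl (in_degree_0 F') - cl (in_degree_0 G'))"
    by (rule eqv_diff[OF x(1) y(1)])
  also have "cl (in_degree_0 F) - cl (in_degree_0 G) - (cl (in_degree_0 F') - cl (in_degree_0 G')) =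
      cl (in_degree_0 F) + cl (in_degree_0 G') - (cl (in_degree_0 G) + cl (in_degree_0 F'))" by simp
  also have "\<dots> \<asymp> cl (in_degree_0 (\<lambda>a. F a + G' a)) - cl (in_degree_0 (\<lambda>a. G a + F' a))"
    by (rule eqv_diff[OF eqv_sym[OF FG(2)] eqv_sym[OF GF(2)]])
  finally show ?thesis
    unfolding represents_def
    by (intro exI[of _ "\<lambda>a. F a + G' a"] exI[of _ "\<lambda>a. G a + F' a"] conjI FG GF) (auto simp: x y)
qed

lemma represents_eqv: "represents x \<chi> \<Longrightarrow> y \<asymp> x \<Longrightarrow> represents y \<chi>"
  unfolding represents_def using eqv_trans by blast

lemma represents_zero_bdry:
  assumes "C \<in> complexes_with_levels L" "\<And>x. bdry C x = 0"
  shows "represents (\<theta> C) (euler_series C)"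
proof -
  have t: "tame C" using assms by (simp add: complexes_with_levels_def)
  have e: "\<theta> C \<asymp> cl (betti C)" "admissible (betti C)" using zero_bdry_eqv[OF assms(1)] assms(2) by auto
  note c = cl_collapse[OF e(2)]
  show ?thesis
    unfolding represents_def using c e(1) eqv_trans even_odd_euler[OF t] by blast
qed

lemma represents_complex:
  assumes C: "C \<in> complexes_with_levels L"
  shows "represents (\<theta> C) (euler_series C)"
proof -
  have t: "tame C" "levels C \<in> L" using C by (auto simp: complexes_with_levels_def)
  obtain A S f c where *: "tame A" "tame S" "levels A \<subseteq> levels C" "levels S \<subseteq> levels C"
      "\<And>x. bdry A x = 0" "\<And>x. bdry S x = 0" "filt_map A S f" "filt_iso C (cone A S f) c"
    using cycle_splitting[OF t(1)] by blast
  have AS: "A \<in> complexes_with_levels L" "S \<in> complexes_with_levels L"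
    using * L_subset[OF t(2)] by (auto simp: complexes_with_levels_def)
  have e: "euler_series C = (\<lambda>a. euler_series S a - euler_series A a)"
    using euler_series_iso[OF t(1) cone_tame(1)[OF *(1,2,7)] *(8)] cone_tame(4)[OF *(1,2,7)] by auto
  have "represents (\<theta> S - \<theta> A) (\<lambda>a. euler_series S a - euler_series A a)"
    by (intro represents_diff represents_zero_bdry AS *)
  then show ?thesis
    unfolding e using cone_eqv[OF AS C *(7,8)] by (rule represents_eqv)
qed

text \<open>Normal forms with the same number of generators at each level are equal.  If the series of
  \<open>p\<close> vanishes, the two complexes in the normal form of its value have this property.\<close>

theorem euler_series_universal:
  assumes "Poly_Mapping.keys p \<subseteq> complexes_with_levels L" "\<And>a. frag_euler p a = 0"
  shows "frag_extend \<theta> p \<in> R"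
proof -
  have "represents (frag_extend \<theta> p) (frag_euler p)"
    using assms(1)
  proof (induction rule: frag_induction)
    case zero
    have a: "admissible (in_degree_0 (\<lambda>a. 0))"
      using L_empty by (simp add: admissible_def locally_finite_def in_degree_0_def)
    show ?case
      unfolding represents_def by (intro exI[of _ "\<lambda>a. 0"] conjI a) auto
  next
    case (one C)
    have "frag_euler (frag_of C) = euler_series C" by auto
    then show ?case using represents_complex[OF one] by simp
  next
    case (diff p q)
    have "frag_euler (p - q) = (\<lambda>a. frag_euler p a - frag_euler q a)" by auto
    then show ?case using represents_diff[OF diff] by (simp add: frag_extend_diff)
  qed
  then obtain F G where FG: "frag_extend \<theta> p \<asymp> cl (in_degree_0 F) - cl (in_degree_0 G)"
      "\<And>a. frag_euler p a = int (F a) - int (G a)"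
    unfolding represents_def by blast
  have "F = G" using FG(2) assms(2) by auto
  then show ?thesis using FG(1) by (simp add: eqv_def)
qed

end

lemma exact_triangle_cone:
  assumes Ob: "A \<in> Ob" "B \<in> Ob" "X \<in> Ob" "\<And>X. X \<in> Ob \<Longrightarrow> tame X"
    and f: "filt_map A B f" and c: "filt_iso X (cone A B f) c"
  shows "frag_of B - frag_of A - frag_of X \<in> triangle_relations Ob"
proof -
  have tA: "tame A" and tB: "tame B" and tX: "tame X" using Ob by auto
  note fA = tame_fc[OF tA] and fB = tame_fc[OF tB] and fX = tame_fc[OF tX]
  obtain BA BB where o: "obasis A BA" "obasis B BB"
    using tame_obasis[OF tA] tame_obasis[OF tB] by metis
  interpret K: cone_setting A B f BA BB
    using fA fB f o by (simp add: cone_setting_def)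
  let ?K = "cone A B f"
  note fK = K.cone_basis(1)
  obtain g where g: "filt_map X ?K c" "filt_map ?K X g" "\<And>y. y \<in> total ?K \<Longrightarrow> c (g y) = y"
    using c unfolding filt_iso_def by blast
  have inl: "filt_map B ?K sum_inl"
    unfolding filt_map_def
  proof (intro conjI allI ballI)
    show "linear_on_set (total B) sum_inl" by (rule vlin_on_set[OF vlin_inl])
    have f0: "f 0 = 0"
      by (rule linear_on_set_0[OF filt_mapD(1)[OF f fA] vec.subspace_0[OF subspace_total]])
    show "sum_inl x \<in> grade ?K i" if "x \<in> grade B i" for x i
      using that K.A.zero_grade by (simp add: K.cone_grade)
    fix x
    show "sum_inl (bdry B x) = bdry ?K (sum_inl x)"
      by (simp add: K.cone_bdry f0 K.A.bdry_0 sum_vec_simps)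
    show "lev ?K (sum_inl x) \<le> lev B x" by (simp add: K.cone_lev K.A.lev_zero)
  qed
  have snd: "filt_map ?K (shift A) sum_snd"
    unfolding filt_map_def
  proof (intro conjI allI ballI)
    show "linear_on_set (total ?K) sum_snd" by (rule vlin_on_set[OF vlin_snd])
  qed (auto simp: shift_def K.cone_grade K.cone_bdry K.cone_lev sum_vec_simps)
  have fc_shift: "filt_homotopic X (shift A) ((\<lambda>x. x) \<circ> (sum_snd \<circ> c)) (sum_snd \<circ> c)"
    unfolding filt_homotopic_def
    by (intro exI[of _ "\<lambda>_. 0"])
      (auto simp: linear_on_set_def shift_def K.A.zero_grade K.A.bdry_0 K.A.lev_zero)
  have "exact_triangle Ob A B X f (g \<circ> sum_inl) (sum_snd \<circ> c)"
    unfolding exact_triangle_def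
  proof (intro conjI exI)
    show "filt_map B X (g \<circ> sum_inl)" by (rule filt_map_comp[OF fB fK inl g(2)])
    show "filt_map X (shift A) (sum_snd \<circ> c)" by (rule filt_map_comp[OF fX fK g(1) snd])
    show "filt_equivalence A A (\<lambda>x. x)" "filt_equivalence B B (\<lambda>x. x)"
      by (intro filt_equivalence_id fA fB)+
    show "filt_equivalence X (cone A B f) c" by (rule filt_iso_imp_equivalence[OF fX fK c])
    show "filt_homotopic A B ((\<lambda>x. x) \<circ> f) (f \<circ> (\<lambda>x. x))"
      by (rule filt_homotopic_eqI[OF fA fB]) simp
    show "filt_homotopic B (cone A B f) (c \<circ> (g \<circ> sum_inl)) (sum_inl \<circ> (\<lambda>x. x))"
      by (rule filt_homotopic_eqI[OF fB fK]) (simp add: g(3) filt_mapD(5)[OF inl fB])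
    show "filt_homotopic X (shift A) ((\<lambda>x. x) \<circ> (sum_snd \<circ> c)) (sum_snd \<circ> c)" by (rule fc_shift)
  qed (use Ob f in auto)
  then show ?thesis unfolding triangle_relations_def by blast
qed


section \<open>The relation subgroup\<close>

lemma triangle_relations_carrier: "triangle_relations Ob \<subseteq> carrier (free_Abelian_group Ob)"
proof
  fix x assume "x \<in> triangle_relations Ob"
  then obtain A B C u v w where x: "x = frag_of B - frag_of A - frag_of C" "exact_triangle Ob A B C u v w"
    unfolding triangle_relations_def by blast
  then have "A \<in> Ob" "B \<in> Ob" "C \<in> Ob" by (auto simp: exact_triangle_def)
  then have "Poly_Mapping.keys (frag_of B - frag_of A) \<subseteq> Ob" "Poly_Mapping.keys (frag_of C) \<subseteq> Ob"
    using keys_diff[of "frag_of B" "frag_of A"] by auto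
  then show "x \<in> carrier (free_Abelian_group Ob)"
    using keys_diff[of "frag_of B - frag_of A" "frag_of C"] x(1) by auto
qed

lemma subgroup_K_relations: "subgroup (K_relations Ob) (free_Abelian_group Ob)"
  unfolding K_relations_def
  by (rule group.generate_is_subgroup[OF group_free_Abelian_group triangle_relations_carrier])

lemma K_relations_0: "0 \<in> K_relations Ob"
  using subgroup.one_closed[OF subgroup_K_relations] by simp

lemma K_relations_keys: "x \<in> K_relations Ob \<Longrightarrow> Poly_Mapping.keys x \<subseteq> Ob"
  using subgroup.subset[OF subgroup_K_relations] by fastforce

lemma K_relations_add: "x \<in> K_relations Ob \<Longrightarrow> y \<in> K_relations Ob \<Longrightarrow> x + y \<in> K_relations Ob"
  using subgroup.m_closed[OF subgroup_K_relations] by fastforce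

lemma K_relations_neg: "x \<in> K_relations Ob \<Longrightarrow> - x \<in> K_relations Ob"
  using subgroup.m_inv_closed[OF subgroup_K_relations] K_relations_keys by fastforce

lemma K_relations_diff: "x \<in> K_relations Ob \<Longrightarrow> y \<in> K_relations Ob \<Longrightarrow> x - y \<in> K_relations Ob"
  using K_relations_add[of x Ob "- y"] K_relations_neg by fastforce

lemma triangle_K_relations: "x \<in> triangle_relations Ob \<Longrightarrow> x \<in> K_relations Ob"
  unfolding K_relations_def by (rule generate.incl)

lemma K_relations_euler:
  assumes Ob: "\<And>X. X \<in> Ob \<Longrightarrow> tame X" and x: "x \<in> K_relations Ob"
  shows "frag_euler x a = 0"
  using x unfolding K_relations_def
proof (induction rule: generate.induct)
  case one
  then show ?case by simp
next
  case (incl x)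
  then obtain A B C u v w where "x = frag_of B - frag_of A - frag_of C" "exact_triangle Ob A B C u v w"
    unfolding triangle_relations_def by blast
  then show ?case using exact_triangle_euler_series[of Ob A B C u v w a] Ob by simp
next
  case (inv x)
  then obtain A B C u v w where x: "x = frag_of B - frag_of A - frag_of C" "exact_triangle Ob A B C u v w"
    unfolding triangle_relations_def by blast
  have "Poly_Mapping.keys x \<subseteq> Ob" using triangle_relations_carrier inv by fastforce
  then show ?case using exact_triangle_euler_series[OF x(2), of a] Ob x(1) by simp
next
  case (eng x y)
  then show ?case by simp
qed

text \<open>Cones give exact triangles, so taking classes modulo the relations turns cones into
  differences; the universal property of the series says that a combination with vanishing series
  has vanishing class.\<close>

lemma K_relations_iff:
  assumes L: "{} \<in> L" "\<And>S T. S \<in> L \<Longrightarrow> T \<in> L \<Longrightarrow> S \<union> T \<in> L" "\<And>S T. S \<in> L \<Longrightarrow> T \<subseteq> S \<Longrightarrow> T \<in> L"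
    and p: "Poly_Mapping.keys p \<subseteq> complexes_with_levels L"
  shows "p \<in> K_relations (complexes_with_levels L) \<longleftrightarrow> (\<forall>a. frag_euler p a = 0)"
proof
  assume "p \<in> K_relations (complexes_with_levels L)"
  then show "\<forall>a. frag_euler p a = 0"
    using K_relations_euler[of "complexes_with_levels L" p] by (auto simp: complexes_with_levels_def)
next
  assume 0: "\<forall>a. frag_euler p a = 0"
  interpret cone_functional L frag_of "K_relations (complexes_with_levels L)"
  proof
    fix A B X f c
    assume "A \<in> complexes_with_levels L" "B \<in> complexes_with_levels L"
      "X \<in> complexes_with_levels L" "filt_map A B f" "filt_iso X (cone A B f) c"
    then show "frag_of B - frag_of A - frag_of X \<in> K_relations (complexes_with_levels L)"
      by (intro triangle_K_relations exact_triangle_cone) (auto simp: complexes_with_levels_def)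
  qed (auto intro: L K_relations_0 K_relations_diff)
  have "frag_extend frag_of p \<in> K_relations (complexes_with_levels L)"
    by (rule euler_series_universal[OF p]) (use 0 in blast)
  moreover have "frag_extend frag_of p = p"
    using subset_UNIV[of "Poly_Mapping.keys p"] by (induction p rule: frag_induction) (auto simp: frag_extend_diff)
  ultimately show "p \<in> K_relations (complexes_with_levels L)" by simp
qed


section \<open>Acyclic complexes\<close>

lemma homogeneous_components:
  assumes "tame C"
  obtains \<pi> where "\<And>i. vlin (\<pi> i)" "\<And>i x. x \<in> total C \<Longrightarrow> \<pi> i x \<in> grade C i"
    "\<And>i x. x \<in> grade C i \<Longrightarrow> \<pi> i x = x" "\<And>i x. x \<in> total C \<Longrightarrow> \<pi> i (bdry C x) = bdry C (\<pi> (i + 1) x)"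
    "\<And>x. x \<in> total C \<Longrightarrow> x \<in> vec.span (range (\<lambda>i. \<pi> i x))"
proof -
  interpret filtered_complex C using assms by (rule tame_fc)
  obtain B where B: "obasis C B" using tame_obasis[OF assms] .
  have iB: "vec.independent B" "vec.span B = total C" using B by (auto simp: obasis_def)
  obtain g where g: "vlin g" "\<And>x. x \<in> total C \<Longrightarrow> g x = bdry C x"
    using linear_on_set_extend[OF bdry_linear subspace_total] by blast
  define \<pi> where "\<pi> i = (SOME f. vlin f \<and> (\<forall>b\<in>B. f b = (if hdeg C b = i then b else 0)))" for i
  have "\<exists>f. vlin f \<and> (\<forall>b\<in>B. f b = (if hdeg C b = i then b else 0))" for i
    using vlin_extend[OF iB(1), of "\<lambda>b. if hdeg C b = i then b else 0"] by metis
  then have "vlin (\<pi> i) \<and> (\<forall>b\<in>B. \<pi> i b = (if hdeg C b = i then b else 0))" for i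
    unfolding \<pi>_def by (rule someI_ex)
  then have \<pi>: "\<And>i. vlin (\<pi> i)" "\<And>i b. b \<in> B \<Longrightarrow> \<pi> i b = (if hdeg C b = i then b else 0)" by auto
  have p2: "\<pi> i x \<in> grade C i" if "x \<in> total C" for i x
  proof -
    have "vec.span B \<subseteq> {x. \<pi> i x \<in> grade C i}"
      using \<pi>(2) obasis_hdeg[OF B] zero_grade
      by (intro vec.span_minimal vecp.linear_subspace_linear_preimage[OF \<pi>(1)] subspace_grade) auto
    then show ?thesis using that iB(2) by blast
  qed
  have p3: "\<pi> i x = (if j = i then x else 0)" if x: "x \<in> grade C j" for i j x
  proof (cases "j = i")
    case True
    have "\<pi> i x = x"
      by (rule vlin_eq_on_span[OF \<pi>(1) vlin_id _ x[unfolded obasis_grade[OF B]]]) (use \<pi>(2) True in auto)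
    then show ?thesis using True by simp
  next
    case False
    have "\<pi> i x = 0"
      by (rule vlin_eq_on_span[OF \<pi>(1) vlin_zero _ x[unfolded obasis_grade[OF B]]]) (use \<pi>(2) False in auto)
    then show ?thesis using False by simp
  qed
  have p4: "\<pi> i (bdry C x) = bdry C (\<pi> (i + 1) x)" if x: "x \<in> total C" for i x
  proof -
    have "\<pi> i (g x) = g (\<pi> (i + 1) x)"
    proof (rule vlin_eq_on_span[OF vlin_comp[OF \<pi>(1) g(1)] vlin_comp[OF g(1) \<pi>(1)], of B])
      fix b assume b: "b \<in> B"
      have gb: "g b \<in> grade C (hdeg C b - 1)"
        using g(2)[OF obasis_total[OF B b]] bdry_grade[OF obasis_hdeg[OF B b]] by simp
      show "\<pi> i (g b) = g (\<pi> (i + 1) b)"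
        using p3[OF gb, of i] \<pi>(2)[OF b, of "i + 1"] vlin_0[OF g(1)] by auto
    qed (use x iB in simp)
    then show ?thesis
      using g(2)[OF x] g(2)[OF subsetD[OF grade_total p2[OF x]]] by simp
  qed
  have p5: "x \<in> vec.span (range (\<lambda>i. \<pi> i x))" if x: "x \<in> total C" for x
  proof -
    have xB: "x \<in> vec.span B" using x iB by simp
    let ?R = "vec.representation B x"
    have "\<pi> i x = (\<Sum>b\<in>{b \<in> supp B x. hdeg C b = i}. vscale (?R b) b)" for i
    proof -
      have "\<pi> i x = \<pi> i (\<Sum>b\<in>supp B x. vscale (?R b) b)" using supp_sum[OF iB(1) xB] by simp
      also have "\<dots> = (\<Sum>b\<in>supp B x. vscale (?R b) (\<pi> i b))"
        by (simp add: vlin_sum[OF \<pi>(1)] vlin_scale[OF \<pi>(1)])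
      also have "\<dots> = (\<Sum>b\<in>{b \<in> supp B x. hdeg C b = i}. vscale (?R b) b)"
      proof (rule sum.mono_neutral_cong_right)
        show "\<forall>b\<in>supp B x - {b \<in> supp B x. hdeg C b = i}. vscale (?R b) (\<pi> i b) = 0"
        proof
          fix b assume b: "b \<in> supp B x - {b \<in> supp B x. hdeg C b = i}"
          then have "b \<in> B" using supp_subset[of B x] by blast
          then show "vscale (?R b) (\<pi> i b) = 0" using \<pi>(2)[of b i] b by simp
        qed
        fix b assume b: "b \<in> {b \<in> supp B x. hdeg C b = i}"
        then have "b \<in> B" using supp_subset[of B x] by blast
        then show "vscale (?R b) (\<pi> i b) = vscale (?R b) b" using \<pi>(2)[of b i] b by simp
      qed auto
      finally show ?thesis .
    qed
    then have "(\<Sum>i\<in>hdeg C ` supp B x. \<pi> i x) = (\<Sum>b\<in>supp B x. vscale (?R b) b)"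
      by (simp add: sum.group)
    then have "x = (\<Sum>i\<in>hdeg C ` supp B x. \<pi> i x)" using supp_sum[OF iB(1) xB] by simp
    also have "\<dots> \<in> vec.span (range (\<lambda>i. \<pi> i x))"
      by (rule vec.span_sum, rule vec.span_base) simp
    finally show ?thesis .
  qed
  show thesis by (rule that[OF \<pi>(1) p2 _ p4 p5]) (simp_all add: p3)
qed

text \<open>A contracting homotopy inverts the differential on a complement of the cycles.  It cannot
  in general be chosen to respect the filtration.\<close>

lemma acyclic_contraction:
  assumes C: "tame C" and ac: "acyclic_complex C"
  obtains h where "vlin h" "\<And>i x. x \<in> grade C i \<Longrightarrow> h x \<in> grade C (i + 1)"
    "\<And>x. x \<in> total C \<Longrightarrow> bdry C (h x) + h (bdry C x) = x"
    "\<And>i x. x \<in> grade C i \<Longrightarrow> bdry C x = 0 \<Longrightarrow> \<exists>y\<in>grade C (i + 1). bdry C y = x"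
proof -
  interpret filtered_complex C using C by (rule tame_fc)
  obtain \<pi> where \<pi>: "\<And>i. vlin (\<pi> i)" "\<And>i x. x \<in> total C \<Longrightarrow> \<pi> i x \<in> grade C i"
    "\<And>i x. x \<in> grade C i \<Longrightarrow> \<pi> i x = x" "\<And>i x. x \<in> total C \<Longrightarrow> \<pi> i (bdry C x) = bdry C (\<pi> (i + 1) x)"
    "\<And>x. x \<in> total C \<Longrightarrow> x \<in> vec.span (range (\<lambda>i. \<pi> i x))"
    by (rule homogeneous_components[OF C]) (rule that)
  obtain g where g: "vlin g" "\<And>x. x \<in> total C \<Longrightarrow> g x = bdry C x"
    using linear_on_set_extend[OF bdry_linear subspace_total] by blast
  let ?Z = "\<lambda>i. {x \<in> grade C i. bdry C x = 0}"
  have Zg: "?Z i = grade C i \<inter> {x. g x = 0}" for i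
    using g(2) grade_total[of C i] by auto
  have sZ: "vec.subspace (?Z i)" for i
    unfolding Zg by (intro vec.subspace_inter subspace_grade vecp.linear_subspace_kernel[OF g(1)])
  obtain B X where B: "obasis C B" and XB: "X \<subseteq> B" and X: "\<And>i. ?Z i = vec.span {b \<in> X. hdeg C b = i}"
    by (rule adapted_obasis[OF _ sZ]) (use C in \<open>auto simp: tame_def\<close>)
  have iB: "vec.independent B" "vec.span B = total C" using B by (auto simp: obasis_def)
  let ?V = "vec.span (B - X)"
  have XZ: "x \<in> vec.span X" if "x \<in> ?Z i" for x i
    using that unfolding X using vec.span_mono[of "{b \<in> X. hdeg C b = i}" X] by blast
  have cyc: "x \<in> vec.span X" if x: "x \<in> total C" "bdry C x = 0" for x
  proof -
    have "\<pi> i x \<in> ?Z i" for i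
      using \<pi>(2)[OF x(1), of i] \<pi>(4)[OF x(1), of "i - 1"] x(2) vlin_0[OF \<pi>(1)] by simp
    then have r: "range (\<lambda>i. \<pi> i x) \<subseteq> vec.span X" using XZ by blast
    show ?thesis by (rule subsetD[OF vec.span_minimal[OF r vec.subspace_span] \<pi>(5)[OF x(1)]])
  qed
  have inj: "x = 0" if x: "x \<in> ?V" "g x = 0" for x
  proof -
    have xt: "x \<in> total C" using x(1) vec.span_mono[of "B - X" B] iB(2) by auto
    then have "x \<in> vec.span X" using cyc g(2)[OF xt] x(2) by simp
    then have "supp B x \<subseteq> X" "supp B x \<subseteq> B - X"
      using in_span_subset_iff[OF iB(1) XB, of x] in_span_subset_iff[OF iB(1) Diff_subset[of B X], of x] x(1)
      by blast+
    then show "x = 0" using supp_eq_empty_iff[OF iB(1), of x] xt iB(2) by blast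
  qed
  then have "inj_on g ?V" using vecp.linear_inj_on_iff_eq_0[OF g(1), of ?V] by simp
  then obtain g' where g': "vlin g'" "\<And>v. v \<in> ?V \<Longrightarrow> g' (g v) = v"
    using vecp.linear_exists_left_inverse_on[OF g(1), of ?V] by auto
  obtain p where p: "vlin p" "\<And>b. b \<in> B \<Longrightarrow> p b = (if b \<in> X then b else 0)"
    using vlin_extend[OF iB(1), of "\<lambda>b. if b \<in> X then b else 0"] by metis
  have pb: "p x \<in> vec.span {b \<in> X. P b} \<and> x - p x \<in> vec.span {b \<in> B - X. P b}"
    if x: "x \<in> vec.span {b \<in> B. P b}" for x P
  proof -
    have pb: "p b \<in> vec.span {b \<in> X. P b} \<and> b - p b \<in> vec.span {b \<in> B - X. P b}" if "b \<in> {b \<in> B. P b}" for b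
      using that p(2)[of b] by (auto intro: vec.span_base vec.span_zero)
    have "vec.span {b \<in> B. P b} \<subseteq> {x. p x \<in> vec.span {b \<in> X. P b}} \<inter> {x. x - p x \<in> vec.span {b \<in> B - X. P b}}"
      using pb by (intro vec.span_minimal vec.subspace_inter
          vecp.linear_subspace_linear_preimage[OF p(1)]
          vecp.linear_subspace_linear_preimage[OF vlin_minus[OF vlin_id p(1)]]) auto
    then show ?thesis using x by blast
  qed
  have pt: "p x \<in> vec.span X" "x - p x \<in> ?V" if "x \<in> total C" for x
  proof -
    have e: "{b \<in> B. True} = B" "{b \<in> X. True} = X" "{b \<in> B - X. True} = B - X" by auto
    from pb[where P = "\<lambda>_. True", of x] show "p x \<in> vec.span X" "x - p x \<in> ?V"
      unfolding e using that iB(2) by auto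
  qed
  have pX: "p x = x" if "x \<in> vec.span X" for x
    by (rule vlin_eq_on_span[OF p(1) vlin_id _ that]) (use p(2) XB in auto)
  have Xt: "vec.span X \<subseteq> total C" using vec.span_mono[OF XB] iB(2) by simp
  have gX: "bdry C x = 0" if "x \<in> vec.span X" for x
  proof -
    have "vec.span X \<subseteq> {x. g x = 0}"
    proof (rule vec.span_minimal[OF _ vecp.linear_subspace_kernel[OF g(1)]], rule subsetI)
      fix b assume b: "b \<in> X"
      then have "b \<in> ?Z (hdeg C b)" unfolding X by (intro vec.span_base) simp
      then show "b \<in> {x. g x = 0}" unfolding Zg by blast
    qed
    then show ?thesis using that g(2)[OF subsetD[OF Xt that]] by auto
  qed
  define h where "h x = g' (p x)" for x
  have h: "vlin h" unfolding h_def by (rule vlin_comp[OF g'(1) p(1)])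
  have acg: "\<exists>y\<in>grade C (i + 1). bdry C y = z" if z: "z \<in> grade C i" "bdry C z = 0" for z i
  proof -
    have zt: "z \<in> total C" using z(1) grade_total by blast
    obtain y where y: "y \<in> total C" "bdry C y = z"
      using ac zt z(2) unfolding acyclic_complex_def by blast
    have "bdry C (\<pi> (i + 1) y) = z" using \<pi>(4)[OF y(1), of i] \<pi>(3)[OF z(1)] y(2) by simp
    then show ?thesis using \<pi>(2)[OF y(1)] by blast
  qed
  have split: "bdry C (y - p y) = bdry C y" if y: "y \<in> total C" for y
  proof -
    have "p y \<in> vec.span X" by (rule pt(1)[OF y])
    then show ?thesis using bdry_diff[OF y subsetD[OF Xt], of "p y"] gX by simp
  qed
  have h2: "h x \<in> grade C (i + 1)" if x: "x \<in> grade C i" for x i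
  proof -
    have "p x \<in> ?Z i"
      unfolding X using pb[of x "\<lambda>b. hdeg C b = i"] x unfolding obasis_grade[OF B] by blast
    then obtain y where y: "y \<in> grade C (i + 1)" "bdry C y = p x" using acg by blast
    have yt: "y \<in> total C" using y(1) grade_total by blast
    have q: "y - p y \<in> vec.span {b \<in> B - X. hdeg C b = i + 1}"
      using pb[of y "\<lambda>b. hdeg C b = i + 1"] y(1) unfolding obasis_grade[OF B] by blast
    have qV: "y - p y \<in> ?V" using q vec.span_mono[of "{b \<in> B - X. hdeg C b = i + 1}" "B - X"] by blast
    have qg: "y - p y \<in> grade C (i + 1)"
      unfolding obasis_grade[OF B] using q vec.span_mono[of "{b \<in> B - X. hdeg C b = i + 1}" "{b \<in> B. hdeg C b = i + 1}"] by blast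
    have "g (y - p y) = p x"
      using split[OF yt] y(2) g(2)[OF subsetD[OF grade_total qg]] by simp
    then have "h x = y - p y" unfolding h_def using g'(2)[OF qV] by simp
    then show ?thesis using qg by simp
  qed
  have h3: "bdry C (h x) + h (bdry C x) = x" if x: "x \<in> total C" for x
  proof -
    have px: "p x \<in> vec.span X" and qx: "x - p x \<in> ?V"
      by (rule pt[OF x])+
    have pxt: "p x \<in> total C" using px Xt by blast
    obtain y where y: "y \<in> total C" "bdry C y = p x"
      using ac pxt gX[OF px] unfolding acyclic_complex_def by blast
    have qy: "y - p y \<in> ?V" by (rule pt(2)[OF y(1)])
    have qyt: "y - p y \<in> total C" using qy vec.span_mono[of "B - X" B] iB(2) by auto
    have "g (y - p y) = p x" using split[OF y(1)] y(2) g(2)[OF qyt] by simp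
    then have hx: "h x = y - p y" unfolding h_def using g'(2)[OF qy] by simp
    have "bdry C x \<in> vec.span X" using cyc[OF bdry_total[OF x] bdry_bdry[OF x]] .
    then have hb: "h (bdry C x) = g' (bdry C x)" unfolding h_def using pX by simp
    have "x - p x \<in> total C" using qx vec.span_mono[of "B - X" B] iB(2) by auto
    then have bx: "bdry C x = g (x - p x)" using split[OF x] g(2)[of "x - p x"] by simp
    have "h (bdry C x) = x - p x" unfolding hb unfolding bx by (rule g'(2)[OF qx])
    then show ?thesis using hx split[OF y(1)] y(2) by simp
  qed
  show thesis by (rule that[OF h h2 h3 acg])
qed

text \<open>The value of the series at \<open>t = 1\<close> is the Euler characteristic of the whole complex, hence
  that of its homology.\<close>

lemma acyclic_euler_total:
  assumes C: "C \<in> acyclic_fg_complexes"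
  shows "finite {a. euler_series C a \<noteq> 0}" "(\<Sum>a | euler_series C a \<noteq> 0. euler_series C a) = 0"
proof -
  have fg: "C \<in> complexes_with_levels {A. finite A}" and ac: "acyclic_complex C"
    using C fg_complexes_eq by (auto simp: acyclic_fg_complexes_def)
  then have t: "tame C" and fl: "finite (levels C)" by (auto simp: complexes_with_levels_def)
  interpret filtered_complex C using t by (rule tame_fc)
  obtain B where B: "obasis C B" using tame_obasis[OF t] .
  have fd: "finite_dim (total C)" using C by (simp add: acyclic_fg_complexes_def fg_complexes_def)
  have fB: "finite B"
    using obasis_total[OF B] B by (intro finite_dim_independent_finite[OF fd]) (auto simp: obasis_def)
  show f: "finite {a. euler_series C a \<noteq> 0}"
    by (rule finite_subset[OF _ fl]) (auto dest: euler_series_nonzero_level[OF t])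
  have J: "lower_levels UNIV" by (simp add: lower_levels_def)
  have fds: "finite_dim (sublev C UNIV i)" for i by (rule finite_dim_mono[OF fd sublev_total])
  have "finite {i. vec.dim (sublev C UNIV i) \<noteq> 0}"
  proof (rule finite_subset[OF _ finite_imageI[OF fB, of "hdeg C"]], rule subsetI)
    fix i assume "i \<in> {i. vec.dim (sublev C UNIV i) \<noteq> 0}"
    then have "{b \<in> B. hdeg C b = i \<and> lev C b \<in> UNIV} \<noteq> {}"
      unfolding obasis_dim_sublev[OF filtered_complex_axioms B J] mem_Collect_eq by (metis card.empty)
    then show "i \<in> hdeg C ` B" by blast
  qed
  note eh = euler_homology[OF J fds this]
  have "cycles C UNIV i = boundaries C UNIV i" for i
  proof
    show "boundaries C UNIV i \<subseteq> cycles C UNIV i" by (rule homology_setup(3)[OF J fds])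
    obtain h where "\<And>i x. x \<in> grade C i \<Longrightarrow> bdry C x = 0 \<Longrightarrow> \<exists>y\<in>grade C (i + 1). bdry C y = x"
      by (rule acyclic_contraction[OF t ac]) (rule that)
    then show "cycles C UNIV i \<subseteq> boundaries C UNIV i"
      unfolding cycles_def boundaries_def sublev_def by fastforce
  qed
  then have "euler (sublev C UNIV) = 0" unfolding eh by simp
  then have 0: "(\<Sum>b\<in>B. deg_sign (hdeg C b)) = 0"
    using obasis_euler[OF filtered_complex_axioms B J] fB by simp
  have "(\<Sum>a | euler_series C a \<noteq> 0. euler_series C a) = (\<Sum>a\<in>levels C. euler_series C a)"
    by (rule sum.mono_neutral_left[OF fl]) (auto dest: euler_series_nonzero_level[OF t])
  also have "\<dots> = (\<Sum>a\<in>levels C. \<Sum>b\<in>{b \<in> B. real_of_ereal (lev C b) = a}. deg_sign (hdeg C b))"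
  proof (rule sum.cong[OF refl])
    fix a
    have "{b \<in> B. lev C b = ereal a} = {b \<in> B. real_of_ereal (lev C b) = a}"
      using obasis_lev[OF B] by force
    then show "euler_series C a = (\<Sum>b\<in>{b \<in> B. real_of_ereal (lev C b) = a}. deg_sign (hdeg C b))"
      using obasis_euler_series[OF t B, of a] by simp
  qed
  also have "\<dots> = (\<Sum>b\<in>B. deg_sign (hdeg C b))"
    by (rule sum.group[OF fB fl]) (use obasis_lev[OF B] obasis_total[OF B] in \<open>auto simp: levels_def\<close>)
  finally show "(\<Sum>a | euler_series C a \<noteq> 0. euler_series C a) = 0" using 0 by simp
qed

lemma filt_isoI:
  assumes C: "filtered_complex C" and D: "filtered_complex D" and f: "filt_map C D f"
    and gf: "\<And>x. x \<in> total C \<Longrightarrow> g (f x) = x" and fg: "\<And>y. y \<in> total D \<Longrightarrow> f (g y) = y"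
    and gt: "\<And>y. y \<in> total D \<Longrightarrow> g y \<in> total C" and gg: "\<And>i y. y \<in> grade D i \<Longrightarrow> g y \<in> grade C i"
    and gl: "\<And>y. y \<in> total D \<Longrightarrow> lev C (g y) \<le> lev D y"
  shows "filt_iso C D f"
proof -
  interpret C: filtered_complex C by (rule C)
  interpret D: filtered_complex D by (rule D)
  note f' = filt_mapD[OF f C]
  have "filt_map D C g"
    unfolding filt_map_def
  proof (intro conjI allI ballI)
    show "linear_on_set (total D) g"
      unfolding linear_on_set_def
    proof (intro conjI allI ballI)
      fix x c assume x: "x \<in> total D"
      have "f (vscale c (g x)) = vscale c x"
        using f'(1) gt[OF x] fg[OF x] unfolding linear_on_set_def by simp
      then show "g (vscale c x) = vscale c (g x)"
        using gf[OF vec.subspace_scale[OF subspace_total gt[OF x]], of c] by simp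
      fix y assume y: "y \<in> total D"
      have "f (g x + g y) = x + y"
        using f'(1) gt[OF x] gt[OF y] fg[OF x] fg[OF y] unfolding linear_on_set_def by simp
      then show "g (x + y) = g x + g y"
        using gf[OF vec.subspace_add[OF subspace_total gt[OF x] gt[OF y]]] by simp
    qed
    fix y assume y: "y \<in> total D"
    show "g (bdry D y) = bdry C (g y)"
      using f'(3)[OF gt[OF y]] fg[OF y] gf[OF C.bdry_total[OF gt[OF y]]] by simp
  qed (use gg gl in auto)
  then show ?thesis unfolding filt_iso_def using f gf fg by blast
qed

text \<open>The contracting homotopy carries the first copy of \<open>X\<close>, of unshifted degree, to the second.\<close>

lemma cone_id_contraction:
  fixes X :: "'k::field fcc"
  defines "K \<equiv> cone X X (\<lambda>x. x)" and "H \<equiv> \<lambda>z :: 'k vec. - sum_inr (sum_fst z)"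
  assumes X: "tame X"
  shows "filt_homotopic K K (\<lambda>z. 0) id"
proof -
  obtain B where B: "obasis X B" using tame_obasis[OF X] .
  interpret Q: cone_setting X X "\<lambda>x. x" B B
    using X B filt_map_id[OF tame_fc[OF X]] by (simp add: cone_setting_def tame_fc)
  have H: "vlin H" unfolding H_def by (intro vlin_uminus vlin_comp[OF vlin_inr vlin_fst])
  show ?thesis
    unfolding filt_homotopic_def
  proof (intro exI[of _ H] conjI allI ballI)
    show "linear_on_set (total K) H" by (rule vlin_on_set[OF H])
    show "H x \<in> grade K (i + 1)" if "x \<in> grade K i" for x i
      using that Q.A.zero_grade vec.subspace_neg[OF Q.A.subspace_grade]
      by (simp add: K_def H_def Q.cone_grade sum_vec_simps)
    fix z assume z: "z \<in> total K"
    then have z': "sum_fst z \<in> total X" "sum_snd z \<in> total X" unfolding K_def Q.cone_basis(3) by auto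
    have "sum_inl (sum_fst z) + sum_inr (sum_snd z) = z" by simp
    then show "0 - id z = bdry K (H z) + H (bdry K z)"
      by (simp add: K_def H_def Q.cone_bdry sum_vec_simps Q.A.bdry_0 Q.A.bdry_neg[OF z'(1)] algebra_simps)
    show "lev K (H z) \<le> lev K z"
      using Q.A.lev_neg[OF z'(1)] by (simp add: K_def H_def Q.cone_lev sum_vec_simps Q.A.lev_zero)
  qed
qed

text \<open>A contractible complex \<open>X\<close> is isomorphic in the homotopy category to the cone of the identity
  of \<open>X\<close>, so there is an exact triangle all of whose vertices are \<open>X\<close>.\<close>

lemma contractible_K_relations:
  fixes X :: "'k::field fcc"
  assumes X: "X \<in> Ob" "tame X" and h: "filt_homotopic X X (\<lambda>x. 0) id"
  shows "frag_of X \<in> K_relations Ob"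
proof -
  obtain B where B: "obasis X B" using tame_obasis[OF X(2)] .
  note fX = tame_fc[OF X(2)]
  interpret Q: cone_setting X X "\<lambda>x. x" B B
    using X B filt_map_id[OF fX] by (simp add: cone_setting_def tame_fc)
  let ?K = "cone X X (\<lambda>x. x)"
  note fK = Q.cone_basis(1)
  have sh: "filt_map X (shift X) (\<lambda>x. 0)" "filt_homotopic X (shift X) ((\<lambda>x. x) \<circ> (\<lambda>x. 0)) (sum_snd \<circ> (\<lambda>x. 0))"
    unfolding filt_homotopic_def
    by (auto simp: filt_map_def linear_on_set_def shift_def Q.A.zero_grade Q.A.bdry_0 Q.A.lev_zero sum_vec_simps
        intro!: exI[of _ "\<lambda>_. 0"])
  have inl: "filt_homotopic X ?K ((\<lambda>x. 0) \<circ> (\<lambda>x. 0)) (sum_inl \<circ> (\<lambda>x. x))"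
    unfolding filt_homotopic_def
  proof (intro exI[of _ "\<lambda>x. - sum_inr x"] conjI allI ballI)
    show "linear_on_set (total X) (\<lambda>x. - sum_inr x)" by (intro vlin_on_set vlin_uminus vlin_inr)
    show "- sum_inr x \<in> grade ?K (i + 1)" if "x \<in> grade X i" for x i
      using that Q.A.zero_grade vec.subspace_neg[OF Q.A.subspace_grade]
      by (simp add: Q.cone_grade sum_vec_simps)
    fix x assume x: "x \<in> total X"
    show "((\<lambda>x. 0) \<circ> (\<lambda>x. 0)) x - (sum_inl \<circ> (\<lambda>x. x)) x = bdry ?K (- sum_inr x) + - sum_inr (bdry X x)"
      by (simp add: Q.cone_bdry sum_vec_simps Q.A.bdry_0 Q.A.bdry_neg[OF x])
    show "lev ?K (- sum_inr x) \<le> lev X x"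
      using Q.A.lev_neg[OF x] by (simp add: Q.cone_lev sum_vec_simps Q.A.lev_zero)
  qed
  have "exact_triangle Ob X X X (\<lambda>x. x) (\<lambda>x. 0) (\<lambda>x. 0)"
    unfolding exact_triangle_def
  proof (intro conjI exI)
    show "filt_equivalence X X (\<lambda>x. x)" "filt_equivalence X X (\<lambda>x. x)"
      by (rule filt_equivalence_id[OF fX])+
    show "filt_equivalence X ?K (\<lambda>x. 0)"
      unfolding filt_equivalence_def
      using filt_map_zero[OF fX fK] filt_map_zero[OF fK fX] h cone_id_contraction[OF X(2)]
      by (auto simp: comp_def intro!: exI[of _ "\<lambda>x. 0"])
    show "filt_homotopic X X ((\<lambda>x. x) \<circ> (\<lambda>x. x)) ((\<lambda>x. x) \<circ> (\<lambda>x. x))"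
      by (rule filt_homotopic_eqI[OF fX fX]) simp
    show "filt_homotopic X (shift X) ((\<lambda>x. x) \<circ> (\<lambda>x. 0)) (sum_snd \<circ> (\<lambda>x. 0))" by (rule sh(2))
  qed (rule X(1) sh(1) inl filt_map_id[OF fX] filt_map_zero[OF fX fX])+
  then have "frag_of X - frag_of X - frag_of X \<in> triangle_relations Ob"
    unfolding triangle_relations_def by blast
  then have "- (frag_of X - frag_of X - frag_of X) \<in> K_relations Ob"
    by (intro K_relations_neg triangle_K_relations)
  then show ?thesis by simp
qed

text \<open>Every linear map between complexes flattened to the same level preserves the filtration, and
  contracting homotopies do so in particular.\<close>

definition flatten :: "real \<Rightarrow> 'k::field fcc \<Rightarrow> 'k fcc"
  where "flatten m C = C\<lparr>lev := \<lambda>x. if x = 0 then -\<infinity> else ereal m\<rparr>"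

definition levels_above :: "real \<Rightarrow> real set set"
  where "levels_above m = {A. finite A \<and> A \<subseteq> {m..}}"

text \<open>On complexes with levels at least \<open>m\<close>, where the identity is a filtered map to the
  flattened complex.  The cone is always acyclic; its formation carries cones to cones; and if \<open>C\<close>
  is acyclic, its class is the negative of the class of \<open>C\<close>.\<close>

definition level_cone :: "real \<Rightarrow> 'k::field fcc \<Rightarrow> 'k fcc"
  where "level_cone m C = cone C (flatten m C) (\<lambda>x. x)"

lemma lev_ge_level:
  assumes "C \<in> complexes_with_levels (levels_above m)" "x \<in> total C" "x \<noteq> 0"
  shows "ereal m \<le> lev C x"
proof -
  interpret filtered_complex C using assms by (simp add: complexes_with_levels_def tame_def)
  obtain a where a: "lev C x = ereal a" using lev_real[OF assms(2,3)] .
  then have "a \<in> levels C" using assms(2) by (auto simp: levels_def)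
  then show ?thesis using assms(1) a by (auto simp: complexes_with_levels_def levels_above_def)
qed

lemma flatten_simps [simp]:
  "grade (flatten m C) = grade C" "bdry (flatten m C) = bdry C" "total (flatten m C) = total C"
  "lev (flatten m C) x = (if x = 0 then -\<infinity> else ereal m)"
  by (auto simp: flatten_def total_def)

lemma fg_levels_above: "complexes_with_levels (levels_above m) \<subseteq> fg_complexes"
  unfolding fg_complexes_eq by (auto simp: complexes_with_levels_def levels_above_def)

lemma flatten_tame:
  assumes C: "C \<in> complexes_with_levels (levels_above m)"
  shows "tame (flatten m C)" "flatten m C \<in> fg_complexes" "filt_map C (flatten m C) (\<lambda>x. x)"
proof -
  interpret filtered_complex C using C by (simp add: complexes_with_levels_def tame_def)
  have t: "tame C" using C by (simp add: complexes_with_levels_def)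
  obtain B where B: "obasis C B" using tame_obasis[OF t] .
  have iB: "vec.independent B" "vec.span B = total C" using B by (auto simp: obasis_def)
  have "filtered_complex (flatten m C) \<and> obasis (flatten m C) B \<and> total (flatten m C) = vec.span B \<and>
    (\<forall>b\<in>B. hdeg (flatten m C) b = hdeg C b \<and> lev (flatten m C) b = ereal m)"
  proof (rule filtered_complexI_span[OF iB(1)])
    show "lev (flatten m C) x \<le> M \<longleftrightarrow> x \<in> vec.span {b \<in> B. ereal m \<le> M}" if "x \<in> vec.span B" for x M
      using that by (cases "ereal m \<le> M") auto
    show "linear_on_set (vec.span B) (bdry (flatten m C))" using bdry_linear iB(2) by simp
    show "grade (flatten m C) i = vec.span {b \<in> B. hdeg C b = i}" for i
      using obasis_grade[OF B] by simp
  qed (use obasis_hdeg[OF B] bdry_grade bdry_bdry[OF obasis_total[OF B]] in auto)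
  then have fc: "filtered_complex (flatten m C)" by simp
  have fg: "finite_dim (total C)" using C fg_levels_above[of m] by (auto simp: fg_complexes_def)
  then show "flatten m C \<in> fg_complexes" using fc by (simp add: fg_complexes_def)
  then show "tame (flatten m C)" unfolding fg_complexes_eq by (simp add: complexes_with_levels_def)
  show "filt_map C (flatten m C) (\<lambda>x. x)"
    unfolding filt_map_def using lev_ge_level[OF C] by (auto simp: linear_on_set_def)
qed

lemma level_cone_acyclic:
  assumes C: "C \<in> complexes_with_levels (levels_above m)"
  shows "level_cone m C \<in> acyclic_fg_complexes"
proof -
  have t: "tame C" and fl: "finite (levels C)" using C by (auto simp: complexes_with_levels_def levels_above_def)
  note f = flatten_tame[OF C]
  obtain B B' where B: "obasis C B" "obasis (flatten m C) B'" using tame_obasis[OF t] tame_obasis[OF f(1)] by metis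
  interpret K: cone_setting C "flatten m C" "\<lambda>x. x" B B'
    using t f B by (simp add: cone_setting_def tame_fc)
  have "finite (levels (flatten m C))" using f(2) unfolding fg_complexes_eq by (simp add: complexes_with_levels_def)
  then have fg: "level_cone m C \<in> fg_complexes"
    unfolding fg_complexes_eq level_cone_def using cone_tame(1,3)[OF t f(1,3)] fl
    by (simp add: complexes_with_levels_def)
  have "\<exists>y\<in>total (level_cone m C). bdry (level_cone m C) y = z"
    if z: "z \<in> total (level_cone m C)" "bdry (level_cone m C) z = 0" for z
  proof -
    have "sum_fst (bdry (level_cone m C) z) = 0" using z(2) by (simp add: sum_vec_simps)
    then have a: "bdry C (sum_fst z) + sum_snd z = 0" unfolding level_cone_def K.cone_bdry by (simp add: sum_vec_simps)
    have "sum_fst z \<in> total C" using z(1) unfolding level_cone_def K.cone_basis(3) by simp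
    then have "sum_inr (sum_fst z) \<in> total (level_cone m C)"
      unfolding level_cone_def K.cone_basis(3) by (simp add: vec.subspace_0[OF subspace_total])
    moreover have "sum_snd z = - bdry C (sum_fst z)" using a by (simp add: add_eq_0_iff)
    then have "bdry (level_cone m C) (sum_inr (sum_fst z)) = sum_inl (sum_fst z) + sum_inr (sum_snd z)"
      unfolding level_cone_def K.cone_bdry by (simp add: K.A.bdry_0)
    ultimately show ?thesis by (metis inl_inr_eq)
  qed
  then show ?thesis using fg by (simp add: acyclic_fg_complexes_def acyclic_complex_def)
qed

lemma sum_vec_eqI: "sum_fst x = sum_fst y \<Longrightarrow> sum_snd x = sum_snd y \<Longrightarrow> x = y"
  by (metis inl_inr_eq)

text \<open>Both sides are built from two copies each of \<open>A\<close> and \<open>B\<close>; the isomorphism exchanges the two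
  middle summands, with a sign on the twice shifted copy of \<open>A\<close>.\<close>

lemma level_cone_additive:
  assumes Ob: "A \<in> complexes_with_levels (levels_above m)" "B \<in> complexes_with_levels (levels_above m)"
      "X \<in> complexes_with_levels (levels_above m)"
    and f: "filt_map A B f" and c: "filt_iso X (cone A B f) c"
  obtains F c' where "filt_map (level_cone m A) (level_cone m B) F"
    "filt_iso (level_cone m X) (cone (level_cone m A) (level_cone m B) F) c'"
proof -
  have t: "tame A" "tame B" "tame X" using Ob by (auto simp: complexes_with_levels_def)
  note flA = flatten_tame[OF Ob(1)] and flB = flatten_tame[OF Ob(2)] and flX = flatten_tame[OF Ob(3)]
  obtain BA BB BX FA FB FX where o: "obasis A BA" "obasis B BB" "obasis X BX"
      "obasis (flatten m A) FA" "obasis (flatten m B) FB" "obasis (flatten m X) FX"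
    using tame_obasis[OF t(1)] tame_obasis[OF t(2)] tame_obasis[OF t(3)]
      tame_obasis[OF flA(1)] tame_obasis[OF flB(1)] tame_obasis[OF flX(1)] by metis
  interpret K: cone_setting A B f BA BB using t f o by (simp add: cone_setting_def tame_fc)
  interpret TA: cone_setting A "flatten m A" "\<lambda>x. x" BA FA using t flA o by (simp add: cone_setting_def tame_fc)
  interpret TB: cone_setting B "flatten m B" "\<lambda>x. x" BB FB using t flB o by (simp add: cone_setting_def tame_fc)
  interpret TX: cone_setting X "flatten m X" "\<lambda>x. x" BX FX using t flX o by (simp add: cone_setting_def tame_fc)
  note fD = filt_mapD[OF f tame_fc[OF t(1)]]
  define F where "F = (\<lambda>z. sum_inl (f (sum_fst z)) + sum_inr (f (sum_snd z)))"
  have f0: "f 0 = 0" by (rule linear_on_set_0[OF fD(1) vec.subspace_0[OF subspace_total]])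
  have "filt_map (flatten m A) (flatten m B) f"
    using f f0 unfolding filt_map_def by auto
  then have F: "filt_map (level_cone m A) (level_cone m B) F"
    unfolding level_cone_def F_def by (intro cone_filt_map t flA flB f) simp_all
  have tT: "tame (level_cone m A)" "tame (level_cone m B)" "tame (level_cone m X)"
    unfolding level_cone_def by (intro cone_tame(1) t flA flB flX)+
  obtain TBA TBB where oT: "obasis (level_cone m A) TBA" "obasis (level_cone m B) TBB"
    using tame_obasis[OF tT(1)] tame_obasis[OF tT(2)] by metis
  interpret W: cone_setting "level_cone m A" "level_cone m B" F TBA TBB
    using tT F oT by (simp add: cone_setting_def tame_fc)
  obtain d where c1: "filt_map X (cone A B f) c" and d1: "filt_map (cone A B f) X d"
    and dc: "\<And>x. x \<in> total X \<Longrightarrow> d (c x) = x" and cd: "\<And>y. y \<in> total (cone A B f) \<Longrightarrow> c (d y) = y"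
    using c unfolding filt_iso_def by blast
  note cD = filt_mapD[OF c1 tame_fc[OF t(3)]] and dD = filt_mapD[OF d1 K.cone_basis(1)]
  have c0: "c 0 = 0" and d0: "d 0 = 0"
    by (rule linear_on_set_0[OF cD(1) vec.subspace_0[OF subspace_total]],
        rule linear_on_set_0[OF dD(1) vec.subspace_0[OF subspace_total]])
  have cs: "sum_fst (c x) \<in> total B" "sum_snd (c x) \<in> total A" if "x \<in> total X" for x
    using cD(5)[OF that] unfolding K.cone_basis(3) by auto
  let ?c = "\<lambda>z. sum_inl (sum_inl (sum_fst (c (sum_fst z))) + sum_inr (sum_fst (c (sum_snd z))))
    + sum_inr (sum_inl (sum_snd (c (sum_fst z))) + sum_inr (- sum_snd (c (sum_snd z))))"
  let ?d = "\<lambda>w. sum_inl (d (sum_inl (sum_fst (sum_fst w)) + sum_inr (sum_fst (sum_snd w))))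
    + sum_inr (d (sum_inl (sum_snd (sum_fst w)) + sum_inr (- sum_snd (sum_snd w))))"
  let ?K = "cone (level_cone m A) (level_cone m B) F"
  have tX: "total (level_cone m X) = {z. sum_fst z \<in> total X \<and> sum_snd z \<in> total X}"
    unfolding level_cone_def TX.cone_basis(3) by simp
  have tK: "total ?K = {w. sum_fst (sum_fst w) \<in> total B \<and> sum_snd (sum_fst w) \<in> total B \<and>
      sum_fst (sum_snd w) \<in> total A \<and> sum_snd (sum_snd w) \<in> total A}"
    unfolding W.cone_basis(3) unfolding level_cone_def TA.cone_basis(3) TB.cone_basis(3) by auto
  have gK: "grade ?K i = {w. sum_fst (sum_fst w) \<in> grade B i \<and> sum_snd (sum_fst w) \<in> grade B (i - 1) \<and>
      sum_fst (sum_snd w) \<in> grade A (i - 1) \<and> sum_snd (sum_snd w) \<in> grade A (i - 1 - 1)}" for i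
    unfolding W.cone_grade unfolding level_cone_def TA.cone_grade TB.cone_grade by auto
  have c': "filt_map (level_cone m X) ?K ?c"
    unfolding filt_map_def
  proof (intro conjI allI ballI)
    show "linear_on_set (total (level_cone m X)) ?c"
      unfolding linear_on_set_def tX
    proof (intro conjI allI ballI)
      fix x k assume x: "x \<in> {z. sum_fst z \<in> total X \<and> sum_snd z \<in> total X}"
      then show "?c (vscale k x) = vscale k (?c x)"
        using cD(1) unfolding linear_on_set_def by (simp add: sum_vec_simps vec.scale_right_distrib vec.scale_right_diff_distrib)
      fix y assume "y \<in> {z. sum_fst z \<in> total X \<and> sum_snd z \<in> total X}"
      then show "?c (x + y) = ?c x + ?c y"
        using x cD(1) unfolding linear_on_set_def by (simp add: sum_vec_simps algebra_simps)
    qed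
    show "?c z \<in> grade ?K i" if z: "z \<in> grade (level_cone m X) i" for z i
    proof -
      have "sum_fst z \<in> grade X i" "sum_snd z \<in> grade X (i - 1)"
        using z unfolding level_cone_def TX.cone_grade by auto
      from cD(2)[OF this(1)] cD(2)[OF this(2)] show ?thesis
        unfolding gK K.cone_grade by (simp add: sum_vec_simps vec.subspace_neg[OF K.A.subspace_grade])
    qed
    fix z assume z: "z \<in> total (level_cone m X)"
    then have z1: "sum_fst z \<in> total X" and z2: "sum_snd z \<in> total X" unfolding tX by auto
    have "c (bdry X (sum_fst z) + sum_snd z) = c (bdry X (sum_fst z)) + c (sum_snd z)"
      using cD(1) TX.A.bdry_total[OF z1] z2 unfolding linear_on_set_def by blast
    then have e1: "c (bdry X (sum_fst z) + sum_snd z) = bdry (cone A B f) (c (sum_fst z)) + c (sum_snd z)"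
      using cD(3)[OF z1] by simp
    then have e1': "c (sum_snd z + bdry X (sum_fst z)) = bdry (cone A B f) (c (sum_fst z)) + c (sum_snd z)"
      by (simp add: add.commute)
    have e2: "c (- bdry X (sum_snd z)) = - bdry (cone A B f) (c (sum_snd z))"
      using linear_on_set_neg[OF cD(1) TX.A.bdry_total[OF z2]] cD(3)[OF z2] by simp
    note s = cs(2)[OF z1] cs(2)[OF z2]
    have e3: "f (- sum_snd (c (sum_snd z))) = - f (sum_snd (c (sum_snd z)))"
      by (rule linear_on_set_neg[OF fD(1) s(2)])
    have bd: "bdry (level_cone m X) z = sum_inl (bdry X (sum_fst z) + sum_snd z) + sum_inr (- bdry X (sum_snd z))"
      unfolding level_cone_def TX.cone_bdry by simp
    show "?c (bdry (level_cone m X) z) = bdry ?K (?c z)"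
      unfolding bd W.cone_bdry unfolding level_cone_def TA.cone_bdry TB.cone_bdry F_def
      by (simp add: e1 e1' e2 e3 sum_vec_simps K.cone_bdry K.A.bdry_neg[OF s(2)] algebra_simps)
    have l1: "lev (flatten m B) (sum_fst (c (sum_fst z))) \<le> lev (flatten m X) (sum_fst z)"
      "lev (flatten m A) (sum_snd (c (sum_fst z))) \<le> lev (flatten m X) (sum_fst z)"
      using c0 by (auto simp: sum_vec_simps)
    have l2: "lev B (sum_fst (c (sum_snd z))) \<le> lev X (sum_snd z)" "lev A (sum_snd (c (sum_snd z))) \<le> lev X (sum_snd z)"
      using cD(4)[OF z2] unfolding K.cone_lev by auto
    have "lev ?K (?c z) = max (max (lev (flatten m B) (sum_fst (c (sum_fst z)))) (lev B (sum_fst (c (sum_snd z)))))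
        (max (lev (flatten m A) (sum_snd (c (sum_fst z)))) (lev A (sum_snd (c (sum_snd z)))))"
      unfolding W.cone_lev unfolding level_cone_def TA.cone_lev TB.cone_lev
      using K.A.lev_neg[OF s(2)]
      by (simp only: sum_vec_simps fst_inl fst_inr snd_inl snd_inr add_0 add_0_right minus_zero)
    also have "\<dots> \<le> max (lev (flatten m X) (sum_fst z)) (lev X (sum_snd z))"
      using l1 l2 by (intro max.boundedI) (blast intro: order_trans max.cobounded1 max.cobounded2)+
    also have "\<dots> = lev (level_cone m X) z" unfolding level_cone_def TX.cone_lev ..
    finally show "lev ?K (?c z) \<le> lev (level_cone m X) z" .
  qed
  have "filt_iso (level_cone m X) ?K ?c"
  proof (rule filt_isoI[where g = ?d, OF tame_fc[OF tT(3)] W.cone_basis(1) c'])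
    fix z assume "z \<in> total (level_cone m X)"
    then show "?d (?c z) = z" unfolding tX by (simp add: sum_vec_simps dc)
  next
    fix w assume w: "w \<in> total ?K"
    have i: "sum_inl (sum_fst (sum_fst w)) + sum_inr (sum_fst (sum_snd w)) \<in> total (cone A B f)"
      "sum_inl (sum_snd (sum_fst w)) + sum_inr (- sum_snd (sum_snd w)) \<in> total (cone A B f)"
      using w vec.subspace_neg[OF subspace_total[of A]] unfolding tK K.cone_basis(3) by (auto simp: sum_vec_simps)
    have "c (d (sum_inl (sum_snd (sum_fst w)) - sum_inr (sum_snd (sum_snd w)))) =
        sum_inl (sum_snd (sum_fst w)) - sum_inr (sum_snd (sum_snd w))"
      using cd[OF i(2)] by (simp add: sum_vec_simps)
    then show "?c (?d w) = w"
      by (intro sum_vec_eqI[of "?c (?d w)" w] sum_vec_eqI[of "sum_fst (?c (?d w))" "sum_fst w"]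
          sum_vec_eqI[of "sum_snd (?c (?d w))" "sum_snd w"]) (simp_all add: sum_vec_simps cd[OF i(1)])
    show "?d w \<in> total (level_cone m X)" unfolding tX using dD(5)[OF i(1)] dD(5)[OF i(2)] by (simp add: sum_vec_simps)
    have w2: "sum_snd (sum_snd w) \<in> total A" using w unfolding tK by simp
    have l1: "lev (flatten m X) (d (sum_inl (sum_fst (sum_fst w)) + sum_inr (sum_fst (sum_snd w)))) \<le>
        max (lev (flatten m B) (sum_fst (sum_fst w))) (lev (flatten m A) (sum_fst (sum_snd w)))"
      using d0 by (auto simp: sum_vec_simps)
    have l2: "lev X (d (sum_inl (sum_snd (sum_fst w)) + sum_inr (- sum_snd (sum_snd w)))) \<le>
        max (lev B (sum_snd (sum_fst w))) (lev A (sum_snd (sum_snd w)))"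
      using dD(4)[OF i(2)] K.A.lev_neg[OF w2] unfolding K.cone_lev by (simp add: sum_vec_simps)
    have "lev (level_cone m X) (?d w) = max (lev (flatten m X) (d (sum_inl (sum_fst (sum_fst w)) + sum_inr (sum_fst (sum_snd w)))))
        (lev X (d (sum_inl (sum_snd (sum_fst w)) + sum_inr (- sum_snd (sum_snd w)))))"
      unfolding level_cone_def TX.cone_lev by (simp only: sum_vec_simps fst_inl fst_inr snd_inl snd_inr add_0 add_0_right)
    also have "\<dots> \<le> max (max (lev (flatten m B) (sum_fst (sum_fst w))) (lev B (sum_snd (sum_fst w))))
        (max (lev (flatten m A) (sum_fst (sum_snd w))) (lev A (sum_snd (sum_snd w))))"
      by (intro max.boundedI order_trans[OF l1] order_trans[OF l2])
        (simp_all only: le_max_iff_disj order_refl simp_thms)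
    also have "\<dots> = lev ?K w"
      unfolding W.cone_lev unfolding level_cone_def TA.cone_lev TB.cone_lev ..
    finally show "lev (level_cone m X) (?d w) \<le> lev ?K w" .
  next
    fix i w assume w: "w \<in> grade ?K i"
    have "sum_inl (sum_fst (sum_fst w)) + sum_inr (sum_fst (sum_snd w)) \<in> grade (cone A B f) i"
      "sum_inl (sum_snd (sum_fst w)) + sum_inr (- sum_snd (sum_snd w)) \<in> grade (cone A B f) (i - 1)"
      using w vec.subspace_neg[OF K.A.subspace_grade] unfolding gK K.cone_grade by (auto simp: sum_vec_simps)
    from dD(2)[OF this(1)] dD(2)[OF this(2)] show "?d w \<in> grade (level_cone m X) i"
      unfolding level_cone_def TX.cone_grade by (simp add: sum_vec_simps)
  qed
  then show thesis using that F by blast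
qed

text \<open>The universal property is applied to \<open>C \<mapsto> [level_cone m C]\<close>, which is defined on complexes
  that need not be acyclic, with \<open>m\<close> a lower bound for the finitely many levels in \<open>p\<close>.  It shows
  that \<open>p\<close> is sent to 0, and on acyclic complexes this map is \<open>C \<mapsto> - [C]\<close>.\<close>

theorem K_relations_acyclic_iff:
  assumes p: "Poly_Mapping.keys p \<subseteq> (acyclic_fg_complexes :: 'k::field fcc set)"
  shows "p \<in> K_relations acyclic_fg_complexes \<longleftrightarrow> (\<forall>a. frag_euler p a = 0)"
proof
  let ?R = "K_relations (acyclic_fg_complexes :: 'k fcc set)"
  have tame: "tame X" if "X \<in> acyclic_fg_complexes" for X :: "'k fcc"
    using that fg_complexes_eq by (auto simp: acyclic_fg_complexes_def complexes_with_levels_def)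
  show "p \<in> ?R \<Longrightarrow> \<forall>a. frag_euler p a = 0"
    using K_relations_euler[OF tame] by blast
  assume 0: "\<forall>a. frag_euler p a = 0"
  have fin: "finite (levels C)" if "C \<in> acyclic_fg_complexes" for C :: "'k fcc"
    using that fg_complexes_eq by (auto simp: acyclic_fg_complexes_def complexes_with_levels_def)
  define V where "V = (\<Union>C\<in>Poly_Mapping.keys p. levels C)"
  have fV: "finite V" unfolding V_def using fin p by (intro finite_UN_I) auto
  define m where "m = Min (insert 0 V)"
  have m: "m \<le> a" if "a \<in> V" for a unfolding m_def using fV that by simp
  have keys: "C \<in> complexes_with_levels (levels_above m)" if C: "C \<in> Poly_Mapping.keys p" for C
  proof -
    have "C \<in> acyclic_fg_complexes" using C p by blast
    then show ?thesis
      using tame fin m C unfolding V_def by (auto simp: complexes_with_levels_def levels_above_def)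
  qed
  let ?\<theta> = "\<lambda>C :: 'k fcc. frag_of (level_cone m C)"
  interpret cone_functional "levels_above m" ?\<theta> ?R
  proof
    fix A B X :: "'k fcc" and f c
    assume Ob: "A \<in> complexes_with_levels (levels_above m)" "B \<in> complexes_with_levels (levels_above m)"
      "X \<in> complexes_with_levels (levels_above m)" "filt_map A B f" "filt_iso X (cone A B f) c"
    obtain F c' where F: "filt_map (level_cone m A) (level_cone m B) F"
        "filt_iso (level_cone m X) (cone (level_cone m A) (level_cone m B) F) c'"
      by (rule level_cone_additive[OF Ob])
    show "?\<theta> B - ?\<theta> A - ?\<theta> X \<in> ?R"
      by (intro triangle_K_relations exact_triangle_cone[OF level_cone_acyclic level_cone_acyclic level_cone_acyclic tame F] Ob)
  qed (auto simp: levels_above_def intro: K_relations_0 K_relations_diff finite_subset)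
  have e: "frag_extend ?\<theta> p \<in> ?R" by (rule euler_series_universal) (use keys 0 in auto)
  have "p + frag_extend ?\<theta> p \<in> ?R"
    using subset_refl[of "Poly_Mapping.keys p"]
  proof (induction rule: frag_induction)
    case zero
    show ?case by (simp add: K_relations_0)
  next
    case (diff a b)
    have "a - b + frag_extend ?\<theta> (a - b) = a + frag_extend ?\<theta> a - (b + frag_extend ?\<theta> b)"
      by (simp add: frag_extend_diff)
    then show ?case using K_relations_diff[OF diff] by (simp only:)
  next
    case (one C)
    have C: "C \<in> acyclic_fg_complexes" using one p by blast
    note CL = keys[OF one] and fl = flatten_tame[OF keys[OF one]]
    have ac: "acyclic_complex C" using C by (simp add: acyclic_fg_complexes_def)
    then have flac: "flatten m C \<in> acyclic_fg_complexes"
      using fl(2) by (simp add: acyclic_fg_complexes_def acyclic_complex_def)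
    interpret fl: filtered_complex "flatten m C" using fl(1) by (rule tame_fc)
    obtain h where h: "vlin h" "\<And>i x. x \<in> grade C i \<Longrightarrow> h x \<in> grade C (i + 1)"
        "\<And>x. x \<in> total C \<Longrightarrow> bdry C (h x) + h (bdry C x) = x"
      by (rule acyclic_contraction[OF tame[OF C] ac]) (rule that)
    have ht: "h x \<in> total C" if "x \<in> total C" for x
    proof -
      have "vec.span (\<Union>i. grade C i) \<subseteq> {x. h x \<in> total C}"
        using h(2) grade_total
        by (intro vec.span_minimal vecp.linear_subspace_linear_preimage[OF h(1)] subspace_total) fastforce
      then show ?thesis using that unfolding total_def by blast
    qed
    have "filt_homotopic (flatten m C) (flatten m C) (\<lambda>x. 0) id"
      unfolding filt_homotopic_def
    proof (intro exI[of _ "\<lambda>x. - h x"] conjI allI ballI)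
      show "linear_on_set (total (flatten m C)) (\<lambda>x. - h x)" by (intro vlin_on_set vlin_uminus h)
      show "- h x \<in> grade (flatten m C) (i + 1)" if "x \<in> grade (flatten m C) i" for x i
        using h(2) that vec.subspace_neg[OF fl.subspace_grade] by simp
      fix x assume x: "x \<in> total (flatten m C)"
      then have "bdry C (- h x) = - bdry C (h x)" using fl.bdry_neg[of "h x"] ht by simp
      then show "0 - id x = bdry (flatten m C) (- h x) + - h (bdry (flatten m C) x)"
        using arg_cong[OF h(3), of x uminus] x by (simp del: add_uminus_conv_diff)
      show "lev (flatten m C) (- h x) \<le> lev (flatten m C) x" using vlin_0[OF h(1)] by auto
    qed
    then have 1: "frag_of (flatten m C) \<in> ?R" by (rule contractible_K_relations[OF flac fl(1)])
    have "frag_of (flatten m C) - frag_of C - frag_of (level_cone m C) \<in> ?R"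
      using exact_triangle_cone[OF C flac level_cone_acyclic[OF CL] tame fl(3), folded level_cone_def]
        filt_iso_id[OF tame_fc[OF tame[OF level_cone_acyclic[OF CL]]]]
      by (intro triangle_K_relations) (simp add: level_cone_def)
    from K_relations_diff[OF 1 this] show ?case by (simp add: add.commute)
  qed
  from K_relations_diff[OF this e] show "p \<in> ?R" by simp
qed


section \<open>Tensor products\<close>

lemma vtensor_span:
  assumes "x \<in> vec.span S" "y \<in> vec.span T"
  shows "vtensor x y \<in> vec.span ((\<lambda>(a, b). vtensor a b) ` (S \<times> T))"
proof -
  let ?U = "vec.span ((\<lambda>(a, b). vtensor a b) ` (S \<times> T))"
  have 1: "vtensor a y \<in> ?U" if a: "a \<in> S" for a
  proof -
    have "vec.span T \<subseteq> {y. vtensor a y \<in> ?U}"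
      using a by (intro vec.span_minimal vecp.linear_subspace_linear_preimage[OF vlin_vtensor_right])
        (auto intro!: vec.span_base)
    then show ?thesis using assms(2) by blast
  qed
  have "vec.span S \<subseteq> {x. vtensor x y \<in> ?U}"
    using 1 by (intro vec.span_minimal vecp.linear_subspace_linear_preimage[OF vlin_vtensor_left]) auto
  then show ?thesis using assms(1) by blast
qed

locale tensor_setting =
  fixes C D :: "'k::field fcc" and X Y :: "'k vec set"
  assumes C: "filtered_complex C" and D: "filtered_complex D"
    and X: "obasis C X" and Y: "obasis D Y"
begin

sublocale C: filtered_complex C by (rule C)
sublocale D: filtered_complex D by (rule D)

definition "tb = (\<lambda>(a, b). vtensor a b) ` (X \<times> Y)"
text \<open>The factors of a basis vector of the tensor product are determined by \<open>tb_inj\<close>, which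
  makes its expected degree and level functions of the vector.\<close>

definition "factors = inv_into (X \<times> Y) (\<lambda>(a, b). vtensor a b)"
definition "tdeg t = hdeg C (fst (factors t)) + hdeg D (snd (factors t))"
definition "tlev t = real_of_ereal (lev C (fst (factors t))) + real_of_ereal (lev D (snd (factors t)))"

lemma iX: "vec.independent X" "vec.span X = total C" and iY: "vec.independent Y" "vec.span Y = total D"
  using X Y by (auto simp: obasis_def)

lemma tb_independent: "vec.independent tb" and tb_inj: "inj_on (\<lambda>(a, b). vtensor a b) (X \<times> Y)"
  unfolding tb_def using vtensor_independent[OF iX(1) iY(1)] by auto

lemma tb_simps:
  assumes "a \<in> X" "b \<in> Y"
  shows "factors (vtensor a b) = (a, b)" "vtensor a b \<in> tb" "tdeg (vtensor a b) = hdeg C a + hdeg D b"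
    "ereal (tlev (vtensor a b)) = lev C a + lev D b"
proof -
  show f: "factors (vtensor a b) = (a, b)"
    unfolding factors_def using inv_into_f_f[OF tb_inj, of "(a, b)"] assms by simp
  show "vtensor a b \<in> tb" using assms unfolding tb_def by auto
  show "tdeg (vtensor a b) = hdeg C a + hdeg D b" by (simp add: tdeg_def f)
  show "ereal (tlev (vtensor a b)) = lev C a + lev D b"
    unfolding tlev_def f using C.obasis_lev[OF X assms(1)] D.obasis_lev[OF Y assms(2)]
    by (metis fst_conv plus_ereal.simps(1) snd_conv)
qed

lemma tbE:
  assumes "t \<in> tb" obtains a b where "a \<in> X" "b \<in> Y" "t = vtensor a b"
  using assms unfolding tb_def by auto

lemma tensor_grade_eq: "tensor_grade C D n = vec.span {t \<in> tb. tdeg t = n}"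
proof
  show "tensor_grade C D n \<subseteq> vec.span {t \<in> tb. tdeg t = n}"
    unfolding tensor_grade_def
  proof (rule vec.span_minimal, clarify)
    fix x y i j assume g: "x \<in> grade C i" "y \<in> grade D j"
    then have "vtensor x y \<in> vec.span ((\<lambda>(a, b). vtensor a b) ` ({a \<in> X. hdeg C a = i} \<times> {b \<in> Y. hdeg D b = j}))"
      unfolding C.obasis_grade[OF X] D.obasis_grade[OF Y] by (rule vtensor_span)
    moreover have "(\<lambda>(a, b). vtensor a b) ` ({a \<in> X. hdeg C a = i} \<times> {b \<in> Y. hdeg D b = j}) \<subseteq> {t \<in> tb. tdeg t = i + j}"
      using tb_simps by auto
    ultimately show "vtensor x y \<in> vec.span {t \<in> tb. tdeg t = i + j}" using vec.span_mono by blast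
  qed simp
  show "vec.span {t \<in> tb. tdeg t = n} \<subseteq> tensor_grade C D n"
    unfolding tensor_grade_def
  proof (rule vec.span_mono, rule subsetI)
    fix t assume t: "t \<in> {t \<in> tb. tdeg t = n}"
    then obtain a b where ab: "a \<in> X" "b \<in> Y" "t = vtensor a b" by (auto elim: tbE)
    have "hdeg C a + hdeg D b = n" using t tb_simps(3)[OF ab(1,2)] ab(3) by simp
    then show "t \<in> {vtensor x y |x y i j. i + j = n \<and> x \<in> grade C i \<and> y \<in> grade D j}"
      using ab(3) C.obasis_hdeg[OF X ab(1)] D.obasis_hdeg[OF Y ab(2)] by blast
  qed
qed

lemma tensor_total: "vec.span (\<Union>n. tensor_grade C D n) = vec.span tb"
proof
  show "vec.span (\<Union>n. tensor_grade C D n) \<subseteq> vec.span tb"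
  proof (rule vec.span_minimal)
    have "tensor_grade C D n \<subseteq> vec.span tb" for n
      unfolding tensor_grade_eq by (rule vec.span_mono) auto
    then show "(\<Union>n. tensor_grade C D n) \<subseteq> vec.span tb" by blast
  qed simp
  show "vec.span tb \<subseteq> vec.span (\<Union>n. tensor_grade C D n)"
  proof (rule vec.span_mono, rule subsetI)
    fix t assume "t \<in> tb"
    then have "t \<in> tensor_grade C D (tdeg t)" unfolding tensor_grade_eq by (intro vec.span_base) simp
    then show "t \<in> (\<Union>n. tensor_grade C D n)" by blast
  qed
qed

text \<open>Together with extensions \<open>dC\<close> and \<open>dD\<close> of the differentials to the ambient space, the sign map
  turns the graded Leibniz rule into the formula \<open>dC \<otimes> id + sgn_map \<otimes> dD\<close> for a linear map on the
  whole ambient space.  This map \<open>dT\<close> shows that a differential as in \<open>tensor_bdry\<close> exists.\<close>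

definition "sgn_map = (SOME s. vlin s \<and> (\<forall>b\<in>X. s b = (if even (hdeg C b) then b else - b)))"

lemma sgn_map: "vlin sgn_map" "x \<in> grade C i \<Longrightarrow> sgn_map x = (if even i then x else - x)"
proof -
  have "\<exists>s. vlin s \<and> (\<forall>b\<in>X. s b = (if even (hdeg C b) then b else - b))"
    using vlin_extend[OF iX(1), of "\<lambda>b. if even (hdeg C b) then b else - b"] by metis
  then have s: "vlin sgn_map \<and> (\<forall>b\<in>X. sgn_map b = (if even (hdeg C b) then b else - b))"
    unfolding sgn_map_def by (rule someI_ex)
  then show v: "vlin sgn_map" by blast
  show "sgn_map x = (if even i then x else - x)" if x: "x \<in> grade C i"
  proof (rule vlin_eq_on_span[OF v _ _ x[unfolded C.obasis_grade[OF X]]])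
    show "vlin (\<lambda>x. if even i then x else - x)" by (cases "even i") (auto intro: vlin_id vlin_uminus)
    fix b assume "b \<in> {b \<in> X. hdeg C b = i}"
    then show "sgn_map b = (if even i then b else - b)" using s by auto
  qed
qed

definition "dC = (SOME g. vlin g \<and> (\<forall>x\<in>total C. g x = bdry C x))"
definition "dD = (SOME g. vlin g \<and> (\<forall>x\<in>total D. g x = bdry D x))"
definition "dT z = tensor_map dC (\<lambda>y. y) z + tensor_map sgn_map dD z"

lemma dC: "vlin dC" "\<And>x. x \<in> total C \<Longrightarrow> dC x = bdry C x"
  and dD: "vlin dD" "\<And>x. x \<in> total D \<Longrightarrow> dD x = bdry D x"
proof -
  have "\<exists>g. vlin g \<and> (\<forall>x\<in>total C. g x = bdry C x)"
    using linear_on_set_extend[OF C.bdry_linear subspace_total] by metis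
  then have "vlin dC \<and> (\<forall>x\<in>total C. dC x = bdry C x)" unfolding dC_def by (rule someI_ex)
  then show "vlin dC" "\<And>x. x \<in> total C \<Longrightarrow> dC x = bdry C x" by auto
  have "\<exists>g. vlin g \<and> (\<forall>x\<in>total D. g x = bdry D x)"
    using linear_on_set_extend[OF D.bdry_linear subspace_total] by metis
  then have "vlin dD \<and> (\<forall>x\<in>total D. dD x = bdry D x)" unfolding dD_def by (rule someI_ex)
  then show "vlin dD" "\<And>x. x \<in> total D \<Longrightarrow> dD x = bdry D x" by auto
qed

lemma dT_linear: "vlin dT"
  unfolding dT_def by (intro vlin_plus vlin_tensor_map)

lemma dT_leibniz:
  assumes "x \<in> grade C i" "y \<in> grade D j"
  shows "dT (vtensor x y) = vtensor (bdry C x) y +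
    (if even i then vtensor x (bdry D y) else - vtensor x (bdry D y))"
proof -
  have "x \<in> total C" "y \<in> total D" using assms grade_total by blast+
  then show ?thesis
    unfolding dT_def tensor_map_vtensor[OF dC(1) vlin_id] tensor_map_vtensor[OF sgn_map(1) dD(1)]
    using dC(2) dD(2) sgn_map(2)[OF assms(1)] by (simp add: vtensor_neg)
qed

lemma tensor_bdry: "linear_on_set (vec.span tb) (tensor_bdry C D)" "z \<in> vec.span tb \<Longrightarrow> tensor_bdry C D z = dT z"
proof -
  let ?P = "\<lambda>d. linear_on_set (vec.span tb) d \<and>
    (\<forall>i j. \<forall>x\<in>grade C i. \<forall>y\<in>grade D j. d (vtensor x y) = vtensor (bdry C x) y +
      (if even i then vtensor x (bdry D y) else - vtensor x (bdry D y)))"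
  have "?P dT" using dT_leibniz vlin_on_set[OF dT_linear] by blast
  then have P: "?P (tensor_bdry C D)" unfolding tensor_bdry_def tensor_total by (rule someI[of ?P])
  then show lin: "linear_on_set (vec.span tb) (tensor_bdry C D)" by blast
  obtain g where g: "vlin g" "\<And>z. z \<in> vec.span tb \<Longrightarrow> g z = tensor_bdry C D z"
    using linear_on_set_extend[OF lin] by blast
  assume z: "z \<in> vec.span tb"
  have "g z = dT z"
  proof (rule vlin_eq_on_span[OF g(1) dT_linear _ z])
    fix t assume t: "t \<in> tb"
    then obtain a b where ab: "a \<in> X" "b \<in> Y" "t = vtensor a b" by (rule tbE)
    note h = C.obasis_hdeg[OF X ab(1)] D.obasis_hdeg[OF Y ab(2)]
    have "g t = tensor_bdry C D t" using g(2) t by (simp add: vec.span_base)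
    also have "\<dots> = dT t" unfolding ab(3) dT_leibniz[OF h] using P h by blast
    finally show "g t = dT t" .
  qed
  then show "tensor_bdry C D z = dT z" using g(2)[OF z] by simp
qed

lemma vtensor_span_le:
  assumes "x \<in> total C" "y \<in> total D" "lev C x + lev D y \<le> M"
  shows "vtensor x y \<in> vec.span {t \<in> tb. ereal (tlev t) \<le> M}"
proof -
  have "x \<in> vec.span {a \<in> X. lev C a \<le> lev C x}" "y \<in> vec.span {b \<in> Y. lev D b \<le> lev D y}"
    using obasis_le_iff[OF X assms(1)] obasis_le_iff[OF Y assms(2)] by blast+
  then have "vtensor x y \<in> vec.span ((\<lambda>(a, b). vtensor a b) `
      ({a \<in> X. lev C a \<le> lev C x} \<times> {b \<in> Y. lev D b \<le> lev D y}))" by (rule vtensor_span)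
  moreover have "(\<lambda>(a, b). vtensor a b) ` ({a \<in> X. lev C a \<le> lev C x} \<times> {b \<in> Y. lev D b \<le> lev D y})
      \<subseteq> {t \<in> tb. ereal (tlev t) \<le> M}"
  proof clarify
    fix a b assume ab: "a \<in> X" "lev C a \<le> lev C x" "b \<in> Y" "lev D b \<le> lev D y"
    have "lev C a + lev D b \<le> lev C x + lev D y" using ab by (intro add_mono)
    then show "vtensor a b \<in> tb \<and> ereal (tlev (vtensor a b)) \<le> M"
      using tb_simps(2,4)[OF ab(1,3)] assms(3) by simp
  qed
  ultimately show ?thesis using vec.span_mono by blast
qed

text \<open>Writing \<open>z\<close> in the basis \<open>tb\<close> realises the infimum that defines the level of \<open>z\<close>: in any
  other expression of \<open>z\<close> as a sum of products \<open>x \<otimes> y\<close>, expanding the factors only involves basis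
  vectors of level at most \<open>lev x + lev y\<close>.\<close>

lemma tensor_lev_le_iff:
  assumes z: "z \<in> vec.span tb"
  shows "tensor_lev C D z \<le> M \<longleftrightarrow> z \<in> vec.span {t \<in> tb. ereal (tlev t) \<le> M}"
proof
  assume M: "tensor_lev C D z \<le> M"
  have "ereal (tlev t) \<le> M" if t: "t \<in> supp tb z" for t
  proof -
    have "ereal (tlev t) \<le> tensor_lev C D z"
      unfolding tensor_lev_def
    proof (rule Inf_greatest)
      fix r assume "r \<in> {Sup ((\<lambda>(x, y). lev C x + lev D y) ` S) | S.
        finite S \<and> S \<subseteq> total C \<times> total D \<and> z = (\<Sum>(x, y)\<in>S. vtensor x y)}"
      then obtain S where S: "finite S" "S \<subseteq> total C \<times> total D" "z = (\<Sum>(x, y)\<in>S. vtensor x y)"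
        and r: "r = Sup ((\<lambda>(x, y). lev C x + lev D y) ` S)" by blast
      have "z \<in> vec.span {t \<in> tb. ereal (tlev t) \<le> r}"
        unfolding S(3)
      proof (rule vec.span_sum)
        fix p assume p: "p \<in> S"
        obtain x y where xy: "p = (x, y)" by (cases p)
        have "lev C x + lev D y \<le> r"
          unfolding r using p by (intro Sup_upper) (auto simp: xy intro: rev_image_eqI)
        then show "(case p of (x, y) \<Rightarrow> vtensor x y) \<in> vec.span {t \<in> tb. ereal (tlev t) \<le> r}"
          unfolding xy using vtensor_span_le[of x y r] p S(2) xy by auto
      qed
      then have "supp tb z \<subseteq> {t \<in> tb. ereal (tlev t) \<le> r}"
        using in_span_subset_iff[OF tb_independent, of "{t \<in> tb. ereal (tlev t) \<le> r}" z] by blast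
      then show "ereal (tlev t) \<le> r" using t by blast
    qed
    then show ?thesis using M order_trans by blast
  qed
  then have "supp tb z \<subseteq> {t \<in> tb. ereal (tlev t) \<le> M}" using supp_subset[of tb z] by blast
  then show "z \<in> vec.span {t \<in> tb. ereal (tlev t) \<le> M}"
    using in_span_subset_iff[OF tb_independent, of "{t \<in> tb. ereal (tlev t) \<le> M}" z] z by blast
next
  assume "z \<in> vec.span {t \<in> tb. ereal (tlev t) \<le> M}"
  then have sM: "supp tb z \<subseteq> {t \<in> tb. ereal (tlev t) \<le> M}"
    using in_span_subset_iff[OF tb_independent, of "{t \<in> tb. ereal (tlev t) \<le> M}" z] by blast
  let ?R = "vec.representation tb z"
  let ?q = "\<lambda>t. (vscale (?R t) (fst (factors t)), snd (factors t))"
  let ?S = "?q ` supp tb z"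
  have fac: "fst (factors t) \<in> X \<and> snd (factors t) \<in> Y \<and> t = vtensor (fst (factors t)) (snd (factors t)) \<and>
      ?R t \<noteq> 0" if t: "t \<in> supp tb z" for t
  proof -
    have "t \<in> tb" using t supp_subset[of tb z] by blast
    then obtain a b where "a \<in> X" "b \<in> Y" "t = vtensor a b" by (rule tbE)
    then show ?thesis using tb_simps(1)[of a b] t by (simp add: supp_def)
  qed
  have inj: "inj_on ?q (supp tb z)"
  proof (rule inj_onI)
    fix s t assume st: "s \<in> supp tb z" "t \<in> supp tb z" "?q s = ?q t"
    have "supp X (vscale (?R u) (fst (factors u))) = {fst (factors u)}" if "u \<in> supp tb z" for u
      using fac[OF that] supp_scale[OF iX(1) vec.span_base, of "fst (factors u)" "?R u"]
        supp_basis[OF iX(1), of "fst (factors u)"] by simp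
    from this[OF st(1)] this[OF st(2)] have "fst (factors s) = fst (factors t)" using st(3) by simp
    then have "factors s = factors t" using st(3) by (simp add: prod_eq_iff)
    then show "s = t" using fac[OF st(1)] fac[OF st(2)] by metis
  qed
  have "z = (\<Sum>t\<in>supp tb z. vscale (?R t) t)" using supp_sum[OF tb_independent z] by simp
  also have "\<dots> = (\<Sum>t\<in>supp tb z. vtensor (vscale (?R t) (fst (factors t))) (snd (factors t)))"
    using fac by (intro sum.cong refl) (metis vlin_scale[OF vlin_vtensor_left])
  also have "\<dots> = (\<Sum>(x, y)\<in>?S. vtensor x y)" by (simp add: sum.reindex[OF inj])
  finally have zS: "z = (\<Sum>(x, y)\<in>?S. vtensor x y)" .
  have ST: "?S \<subseteq> total C \<times> total D"
    using fac C.obasis_total[OF X] D.obasis_total[OF Y] vec.subspace_scale[OF subspace_total[of C]] by auto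
  have "tensor_lev C D z \<le> Sup ((\<lambda>(x, y). lev C x + lev D y) ` ?S)"
    unfolding tensor_lev_def using zS ST by (intro Inf_lower CollectI exI[of _ ?S]) auto
  also have "\<dots> \<le> M"
  proof (rule Sup_least)
    fix r assume "r \<in> (\<lambda>(x, y). lev C x + lev D y) ` ?S"
    then obtain t where t: "t \<in> supp tb z"
      and r: "r = lev C (vscale (?R t) (fst (factors t))) + lev D (snd (factors t))" by auto
    note ft = fac[OF t]
    have "r = lev C (fst (factors t)) + lev D (snd (factors t))"
      unfolding r using ft C.lev_scale[OF C.obasis_total[OF X]] by simp
    also have "\<dots> = ereal (tlev t)" using tb_simps(4)[of "fst (factors t)" "snd (factors t)"] ft by simp
    finally show "r \<le> M" using sM t by auto
  qed
  finally show "tensor_lev C D z \<le> M" .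
qed

lemma dT_basis:
  assumes a: "a \<in> X" and b: "b \<in> Y"
  shows "dT (vtensor a b) \<in> tensor_grade C D (hdeg C a + hdeg D b - 1)"
    "dT (vtensor a b) \<in> vec.span {t \<in> tb. ereal (tlev t) \<le> lev C a + lev D b}"
    "dT (dT (vtensor a b)) = 0"
proof -
  let ?i = "hdeg C a" and ?j = "hdeg D b"
  note ai = C.obasis_hdeg[OF X a] and bj = D.obasis_hdeg[OF Y b]
  note at = C.obasis_total[OF X a] and bt = D.obasis_total[OF Y b]
  note da = C.bdry_grade[OF ai] and db = D.bdry_grade[OF bj]
  have g: "vtensor x y \<in> tensor_grade C D (i + j)" if "x \<in> grade C i" "y \<in> grade D j" for x y i j
    unfolding tensor_grade_def using that by (intro vec.span_base) blast
  have sg: "vec.subspace (tensor_grade C D n)" for n unfolding tensor_grade_def by simp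
  have 1: "vtensor (bdry C a) b \<in> tensor_grade C D (?i + ?j - 1)"
    using g[OF da bj] by (simp add: algebra_simps)
  have 2: "vtensor a (bdry D b) \<in> tensor_grade C D (?i + ?j - 1)"
    using g[OF ai db] by (simp add: algebra_simps)
  show "dT (vtensor a b) \<in> tensor_grade C D (?i + ?j - 1)"
    unfolding dT_leibniz[OF ai bj] using 1 2 vec.subspace_add[OF sg] vec.subspace_neg[OF sg] by simp
  let ?V = "vec.span {t \<in> tb. ereal (tlev t) \<le> lev C a + lev D b}"
  have 3: "vtensor (bdry C a) b \<in> ?V"
    by (intro vtensor_span_le C.bdry_total at bt add_mono C.lev_bdry order_refl)
  have 4: "vtensor a (bdry D b) \<in> ?V"
    by (intro vtensor_span_le D.bdry_total at bt add_mono D.lev_bdry order_refl)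
  show "dT (vtensor a b) \<in> ?V"
    unfolding dT_leibniz[OF ai bj] using vec.span_add[OF 3 4] vec.span_add[OF 3 vec.span_neg[OF 4]] by simp
  have z: "vtensor 0 y = 0" "vtensor x 0 = 0" for x y :: "'k vec"
    using vlin_0[OF vlin_vtensor_left] vlin_0[OF vlin_vtensor_right] by auto
  show "dT (dT (vtensor a b)) = 0"
    unfolding dT_leibniz[OF ai bj]
    by (cases "even ?i")
      (simp_all add: vlin_add[OF dT_linear] vlin_neg[OF dT_linear] vlin_diff[OF dT_linear] dT_leibniz[OF da bj] dT_leibniz[OF ai db]
        C.bdry_bdry[OF at] D.bdry_bdry[OF bt] z)
qed

lemma tensor_basis:
  "filtered_complex (C \<otimes>\<^sub>c D)" "obasis (C \<otimes>\<^sub>c D) tb" "total (C \<otimes>\<^sub>c D) = vec.span tb"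
  "\<And>a b. a \<in> X \<Longrightarrow> b \<in> Y \<Longrightarrow> hdeg (C \<otimes>\<^sub>c D) (vtensor a b) = hdeg C a + hdeg D b \<and>
    lev (C \<otimes>\<^sub>c D) (vtensor a b) = lev C a + lev D b"
proof -
  have T: "grade (C \<otimes>\<^sub>c D) = tensor_grade C D" "bdry (C \<otimes>\<^sub>c D) = tensor_bdry C D" "lev (C \<otimes>\<^sub>c D) = tensor_lev C D"
    by (simp_all add: tensor_complex_def)
  have main: "filtered_complex (C \<otimes>\<^sub>c D) \<and> obasis (C \<otimes>\<^sub>c D) tb \<and> total (C \<otimes>\<^sub>c D) = vec.span tb \<and>
    (\<forall>t\<in>tb. hdeg (C \<otimes>\<^sub>c D) t = tdeg t \<and> lev (C \<otimes>\<^sub>c D) t = ereal (tlev t))"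
  proof (rule filtered_complexI_span[OF tb_independent])
    show "grade (C \<otimes>\<^sub>c D) i = vec.span {t \<in> tb. tdeg t = i}" for i
      unfolding T tensor_grade_eq ..
    show "lev (C \<otimes>\<^sub>c D) x \<le> M \<longleftrightarrow> x \<in> vec.span {t \<in> tb. ereal (tlev t) \<le> M}" if "x \<in> vec.span tb" for x M
      unfolding T by (rule tensor_lev_le_iff[OF that])
    show "linear_on_set (vec.span tb) (bdry (C \<otimes>\<^sub>c D))" unfolding T by (rule tensor_bdry(1))
    fix t assume "t \<in> tb"
    then obtain a b where a: "a \<in> X" and b: "b \<in> Y" and t: "t = vtensor a b" by (rule tbE)
    note s = tb_simps[OF a b] and d = dT_basis[OF a b]
    have e: "tensor_bdry C D t = dT t" unfolding t by (rule tensor_bdry(2)[OF vec.span_base[OF s(2)]])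
    have dt: "dT t \<in> vec.span tb"
      using d(2) vec.span_mono[of "{t \<in> tb. ereal (tlev t) \<le> lev C a + lev D b}" tb] unfolding t by blast
    show "bdry (C \<otimes>\<^sub>c D) t \<in> grade (C \<otimes>\<^sub>c D) (tdeg t - 1)"
      unfolding T e unfolding t s by (rule d(1))
    show "lev (C \<otimes>\<^sub>c D) (bdry (C \<otimes>\<^sub>c D) t) \<le> ereal (tlev t)"
      unfolding T e tensor_lev_le_iff[OF dt] unfolding t s(4) by (rule d(2))
    show "bdry (C \<otimes>\<^sub>c D) (bdry (C \<otimes>\<^sub>c D) t) = 0"
      unfolding T e tensor_bdry(2)[OF dt] unfolding t by (rule d(3))
  qed
  then show "filtered_complex (C \<otimes>\<^sub>c D)" "obasis (C \<otimes>\<^sub>c D) tb" "total (C \<otimes>\<^sub>c D) = vec.span tb" by auto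
  show "hdeg (C \<otimes>\<^sub>c D) (vtensor a b) = hdeg C a + hdeg D b \<and>
    lev (C \<otimes>\<^sub>c D) (vtensor a b) = lev C a + lev D b" if "a \<in> X" "b \<in> Y" for a b
    using main tb_simps[OF that] by simp
qed

text \<open>A contracting homotopy \<open>h\<close> of \<open>D\<close> gives the contracting homotopy \<open>x \<otimes> y \<mapsto> \<plusminus> x \<otimes> h y\<close>.\<close>

lemma tensor_acyclic:
  assumes h: "vlin h" "\<And>i y. y \<in> grade D i \<Longrightarrow> h y \<in> grade D (i + 1)"
    "\<And>y. y \<in> total D \<Longrightarrow> bdry D (h y) + h (bdry D y) = y"
  shows "acyclic_complex (C \<otimes>\<^sub>c D)"
proof -
  define H where "H = tensor_map sgn_map h"
  have H: "vlin H" unfolding H_def by (rule vlin_tensor_map)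
  have Hv: "H (vtensor x y) = (if even i then vtensor x (h y) else - vtensor x (h y))" if "x \<in> grade C i" for x y i
    unfolding H_def tensor_map_vtensor[OF sgn_map(1) h(1)] sgn_map(2)[OF that] by (simp add: vtensor_neg)
  have Hb: "dT (H (vtensor a b)) + H (dT (vtensor a b)) = vtensor a b \<and> H (vtensor a b) \<in> vec.span tb"
    if a: "a \<in> X" and b: "b \<in> Y" for a b
  proof
    let ?i = "hdeg C a" and ?j = "hdeg D b"
    note ai = C.obasis_hdeg[OF X a] and bj = D.obasis_hdeg[OF Y b]
    note bt = D.obasis_total[OF Y b] and da = C.bdry_grade[OF ai] and hb = h(2)[OF bj]
    have e: "vtensor a (bdry D (h b)) + vtensor a (h (bdry D b)) = vtensor a b"
      using h(3)[OF bt] vlin_add[OF vlin_vtensor_right, of a] by metis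
    show "dT (H (vtensor a b)) + H (dT (vtensor a b)) = vtensor a b"
      using e by (cases "even ?i")
        (simp_all add: Hv[OF ai] Hv[OF da] dT_leibniz[OF ai bj] dT_leibniz[OF ai hb] vlin_add[OF H] vlin_neg[OF H] vlin_diff[OF H]
          vlin_neg[OF dT_linear] algebra_simps)
    have "vtensor a (h b) \<in> tensor_grade C D (?i + (?j + 1))"
      unfolding tensor_grade_def using ai hb by (intro vec.span_base) blast
    then have v: "vtensor a (h b) \<in> vec.span tb"
      unfolding tensor_grade_eq using vec.span_mono[of "{t \<in> tb. tdeg t = ?i + (?j + 1)}" tb] by blast
    then show "H (vtensor a b) \<in> vec.span tb"
      unfolding Hv[OF ai] using v vec.span_neg[OF v] by simp
  qed
  have key: "dT (H z) + H (dT z) = z" if z: "z \<in> vec.span tb" for z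
    by (rule vlin_eq_on_span[OF vlin_plus[OF vlin_comp[OF dT_linear H] vlin_comp[OF H dT_linear]] vlin_id _ z])
      (use Hb in \<open>auto elim: tbE\<close>)
  have Hs: "H z \<in> vec.span tb" if "z \<in> vec.span tb" for z
  proof -
    have "vec.span tb \<subseteq> {z. H z \<in> vec.span tb}"
      by (intro vec.span_minimal vecp.linear_subspace_linear_preimage[OF H]) (use Hb in \<open>auto elim: tbE\<close>)
    then show ?thesis using that by blast
  qed
  have T: "bdry (C \<otimes>\<^sub>c D) = tensor_bdry C D" by (simp add: tensor_complex_def)
  show ?thesis
    unfolding acyclic_complex_def tensor_basis(3) T
  proof (intro ballI impI)
    fix z assume z: "z \<in> vec.span tb" "tensor_bdry C D z = 0"
    then have "dT (H z) = z" using key[OF z(1)] tensor_bdry(2)[OF z(1)] vlin_0[OF H] by simp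
    then show "\<exists>y\<in>vec.span tb. tensor_bdry C D y = z"
      using Hs[OF z(1)] tensor_bdry(2)[OF Hs[OF z(1)]] by (intro bexI[of _ "H z"]) auto
  qed
qed

end

lemma tame_lower_bound:
  assumes "tame C" obtains m where "\<And>x. x \<in> total C \<Longrightarrow> x \<noteq> 0 \<Longrightarrow> ereal m < lev C x"
proof -
  have "C \<in> tame_complexes" unfolding tame_complexes_eq using assms by (simp add: complexes_with_levels_def)
  then obtain r0 where "sublevel C r0 = {0}" unfolding tame_complexes_def by blast
  then have "ereal r0 < lev C x" if "x \<in> total C" "x \<noteq> 0" for x
    using that unfolding sublevel_def by (metis (mono_tags, lifting) mem_Collect_eq not_le singletonD)
  then show thesis using that by blast
qed

text \<open>Levels are bounded below, so only finitely many pairs of basis vectors have levels adding up to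
  at most \<open>r\<close>, and grouping the pairs by the level of the first factor gives the product of the
  series.\<close>

lemma tensor_tame:
  assumes tC: "tame C" and tD: "tame D"
  shows "tame (C \<otimes>\<^sub>c D)" "levels (C \<otimes>\<^sub>c D) = {a + b | a b. a \<in> levels C \<and> b \<in> levels D}"
    "euler_series (C \<otimes>\<^sub>c D) = euler_series C \<otimes>\<^bsub>novikov\<^esub> euler_series D"
proof -
  obtain X where X: "obasis C X" using tame_obasis[OF tC] .
  obtain Y where Y: "obasis D Y" using tame_obasis[OF tD] .
  interpret tensor_setting C D X Y using tC tD X Y by (simp add: tensor_setting_def tame_fc)
  obtain mC where mC: "\<And>x. x \<in> total C \<Longrightarrow> x \<noteq> 0 \<Longrightarrow> ereal mC < lev C x" by (rule tame_lower_bound[OF tC]) (rule that)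
  obtain mD where mD: "\<And>x. x \<in> total D \<Longrightarrow> x \<noteq> 0 \<Longrightarrow> ereal mD < lev D x" by (rule tame_lower_bound[OF tD]) (rule that)
  define lC where "lC a = real_of_ereal (lev C a)" for a
  define lD where "lD b = real_of_ereal (lev D b)" for b
  have lC: "lev C a = ereal (lC a)" "mC < lC a" if "a \<in> X" for a
  proof -
    show l: "lev C a = ereal (lC a)" unfolding lC_def by (rule C.obasis_lev[OF X that])
    have "a \<noteq> 0" using that C.obasis_nonzero[OF X] by blast
    then show "mC < lC a" using mC[OF C.obasis_total[OF X that]] l by simp
  qed
  have lD: "lev D b = ereal (lD b)" "mD < lD b" if "b \<in> Y" for b
  proof -
    show l: "lev D b = ereal (lD b)" unfolding lD_def by (rule D.obasis_lev[OF Y that])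
    have "b \<noteq> 0" using that D.obasis_nonzero[OF Y] by blast
    then show "mD < lD b" using mD[OF D.obasis_total[OF Y that]] l by simp
  qed
  have lT: "lev (C \<otimes>\<^sub>c D) (vtensor a b) = ereal (lC a + lD b)" if "a \<in> X" "b \<in> Y" for a b
    using tensor_basis(4)[OF that] lC(1)[OF that(1)] lD(1)[OF that(2)] by simp
  have fX: "finite {a \<in> X. lC a \<le> r}" for r
    by (rule finite_subset[OF _ obasis_finite_le[OF tC X, of r]]) (use lC in auto)
  have fY: "finite {b \<in> Y. lD b \<le> r}" for r
    by (rule finite_subset[OF _ obasis_finite_le[OF tD Y, of r]]) (use lD in auto)
  have fin: "finite {(a, b). a \<in> X \<and> b \<in> Y \<and> lC a + lD b \<le> r}" for r
  proof (rule finite_subset)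
    show "{(a, b). a \<in> X \<and> b \<in> Y \<and> lC a + lD b \<le> r} \<subseteq> {a \<in> X. lC a \<le> r - mD} \<times> {b \<in> Y. lD b \<le> r - mC}"
      using lC(2) lD(2) by fastforce
    show "finite ({a \<in> X. lC a \<le> r - mD} \<times> {b \<in> Y. lD b \<le> r - mC})" using fX fY by blast
  qed
  show t: "tame (C \<otimes>\<^sub>c D)"
  proof (rule tameI[OF tensor_basis(1,2)])
    fix r
    have "{t \<in> tb. lev (C \<otimes>\<^sub>c D) t \<le> ereal r} \<subseteq> (\<lambda>(a, b). vtensor a b) ` {(a, b). a \<in> X \<and> b \<in> Y \<and> lC a + lD b \<le> r}"
    proof
      fix t assume t: "t \<in> {t \<in> tb. lev (C \<otimes>\<^sub>c D) t \<le> ereal r}"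
      then obtain a b where ab: "a \<in> X" "b \<in> Y" "t = vtensor a b" by (auto elim: tbE)
      then have "lC a + lD b \<le> r" using t lT by simp
      then have "(a, b) \<in> {(a, b). a \<in> X \<and> b \<in> Y \<and> lC a + lD b \<le> r}" using ab by blast
      then show "t \<in> (\<lambda>(a, b). vtensor a b) ` {(a, b). a \<in> X \<and> b \<in> Y \<and> lC a + lD b \<le> r}"
        by (rule rev_image_eqI) (simp add: ab)
    qed
    then show "finite {t \<in> tb. lev (C \<otimes>\<^sub>c D) t \<le> ereal r}" using fin by (meson finite_imageI finite_subset)
  qed
  interpret T: filtered_complex "C \<otimes>\<^sub>c D" by (rule tensor_basis(1))
  show "levels (C \<otimes>\<^sub>c D) = {a + b | a b. a \<in> levels C \<and> b \<in> levels D}"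
  proof -
    have "levels C = lC ` X" unfolding C.levels_obasis[OF X] using lC(1) by force
    moreover have "levels D = lD ` Y" unfolding D.levels_obasis[OF Y] using lD(1) by force
    moreover have "levels (C \<otimes>\<^sub>c D) = (\<lambda>(a, b). lC a + lD b) ` (X \<times> Y)"
      unfolding T.levels_obasis[OF tensor_basis(2)] tb_def using lT by force
    ultimately show ?thesis by force
  qed
  show "euler_series (C \<otimes>\<^sub>c D) = euler_series C \<otimes>\<^bsub>novikov\<^esub> euler_series D"
  proof
    fix c
    let ?P = "{(a, b). a \<in> X \<and> b \<in> Y \<and> lC a + lD b = c}"
    let ?s = "\<lambda>a. deg_sign (hdeg C a)" and ?s' = "\<lambda>b. deg_sign (hdeg D b)"
    have fP: "finite ?P" by (rule finite_subset[OF _ fin[of c]]) auto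
    have eC: "euler_series C p = (\<Sum>a\<in>{a \<in> X. lC a = p}. ?s a)" for p
      unfolding obasis_euler_series[OF tC X] by (rule sum.cong) (use lC in auto)
    have eD: "euler_series D p = (\<Sum>b\<in>{b \<in> Y. lD b = p}. ?s' b)" for p
      unfolding obasis_euler_series[OF tD Y] by (rule sum.cong) (use lD in auto)
    have set: "{t \<in> tb. lev (C \<otimes>\<^sub>c D) t = ereal c} = (\<lambda>(a, b). vtensor a b) ` ?P"
      unfolding tb_def using lT by auto
    have inj: "inj_on (\<lambda>(a, b). vtensor a b) ?P" by (rule inj_on_subset[OF tb_inj]) auto
    have "euler_series (C \<otimes>\<^sub>c D) c = (\<Sum>(a, b)\<in>?P. ?s a * ?s' b)"
      unfolding obasis_euler_series[OF t tensor_basis(2)] set sum.reindex[OF inj]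
      by (rule sum.cong) (auto simp: tensor_basis(4) deg_sign_add)
    also have "\<dots> = (\<Sum>p\<in>lC ` fst ` ?P. \<Sum>(a, b)\<in>{q \<in> ?P. lC (fst q) = p}. ?s a * ?s' b)"
      by (rule sum.group[symmetric]) (use fP in auto)
    also have "\<dots> = (\<Sum>p\<in>lC ` fst ` ?P. euler_series C p * euler_series D (c - p))"
    proof (rule sum.cong[OF refl])
      fix p
      have "{q \<in> ?P. lC (fst q) = p} = {a \<in> X. lC a = p} \<times> {b \<in> Y. lD b = c - p}" by auto
      then have "(\<Sum>(a, b)\<in>{q \<in> ?P. lC (fst q) = p}. ?s a * ?s' b) =
          (\<Sum>a\<in>{a \<in> X. lC a = p}. \<Sum>b\<in>{b \<in> Y. lD b = c - p}. ?s a * ?s' b)"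
        by (simp only: sum.cartesian_product)
      then show "(\<Sum>(a, b)\<in>{q \<in> ?P. lC (fst q) = p}. ?s a * ?s' b) = euler_series C p * euler_series D (c - p)"
        by (simp add: eC eD sum_product)
    qed
    also have "\<dots> = (\<Sum>p | euler_series C p \<noteq> 0 \<and> euler_series D (c - p) \<noteq> 0. euler_series C p * euler_series D (c - p))"
    proof (rule sum.mono_neutral_right)
      show "finite (lC ` fst ` ?P)" using fP by blast
      show "{p. euler_series C p \<noteq> 0 \<and> euler_series D (c - p) \<noteq> 0} \<subseteq> lC ` fst ` ?P"
      proof clarify
        fix p assume "euler_series C p \<noteq> 0" "euler_series D (c - p) \<noteq> 0"
        then have "{a \<in> X. lC a = p} \<noteq> {}" "{b \<in> Y. lD b = c - p} \<noteq> {}"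
          unfolding eC eD by (metis sum.empty)+
        then obtain a b where "a \<in> X" "lC a = p" "b \<in> Y" "lD b = c - p" by blast
        then have "(a, b) \<in> ?P" "p = lC (fst (a, b))" by auto
        then show "p \<in> lC ` fst ` ?P" by blast
      qed
    qed auto
    finally show "euler_series (C \<otimes>\<^sub>c D) c = (euler_series C \<otimes>\<^bsub>novikov\<^esub> euler_series D) c"
      by (simp add: novikov_def)
  qed
qed

lemma tensor_closed:
  "C \<in> tame_complexes \<Longrightarrow> D \<in> tame_complexes \<Longrightarrow> C \<otimes>\<^sub>c D \<in> tame_complexes"
  "C \<in> fg_complexes \<Longrightarrow> D \<in> fg_complexes \<Longrightarrow> C \<otimes>\<^sub>c D \<in> fg_complexes"
  "C \<in> fg_complexes \<Longrightarrow> D \<in> acyclic_fg_complexes \<Longrightarrow> C \<otimes>\<^sub>c D \<in> acyclic_fg_complexes"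
proof -
  show "C \<in> tame_complexes \<Longrightarrow> D \<in> tame_complexes \<Longrightarrow> C \<otimes>\<^sub>c D \<in> tame_complexes"
    unfolding tame_complexes_eq using tensor_tame(1) by (auto simp: complexes_with_levels_def)
  have fg: "C \<otimes>\<^sub>c D \<in> fg_complexes" if "C \<in> fg_complexes" "D \<in> fg_complexes" for D
  proof -
    have t: "tame C" "tame D" "finite (levels C)" "finite (levels D)"
      using that unfolding fg_complexes_eq by (auto simp: complexes_with_levels_def)
    have "finite ((\<lambda>(a, b). a + b) ` (levels C \<times> levels D))" using t by blast
    moreover have "levels (C \<otimes>\<^sub>c D) \<subseteq> (\<lambda>(a, b). a + b) ` (levels C \<times> levels D)"
      unfolding tensor_tame(2)[OF t(1,2)] by auto
    ultimately have "finite (levels (C \<otimes>\<^sub>c D))" by (rule rev_finite_subset)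
    then show ?thesis
      unfolding fg_complexes_eq using tensor_tame(1)[OF t(1,2)] by (simp add: complexes_with_levels_def)
  qed
  then show "C \<in> fg_complexes \<Longrightarrow> D \<in> fg_complexes \<Longrightarrow> C \<otimes>\<^sub>c D \<in> fg_complexes" .
  assume fC: "C \<in> fg_complexes" and acD: "D \<in> acyclic_fg_complexes"
  then have fD: "D \<in> fg_complexes" and aD: "acyclic_complex D" by (auto simp: acyclic_fg_complexes_def)
  have t: "tame C" "tame D"
    using fC fD unfolding fg_complexes_eq by (auto simp: complexes_with_levels_def)
  obtain X Y where XY: "obasis C X" "obasis D Y" using tame_obasis[OF t(1)] tame_obasis[OF t(2)] by metis
  interpret tensor_setting C D X Y using t XY by (simp add: tensor_setting_def tame_fc)
  obtain h where h: "vlin h" "\<And>i y. y \<in> grade D i \<Longrightarrow> h y \<in> grade D (i + 1)"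
    "\<And>y. y \<in> total D \<Longrightarrow> bdry D (h y) + h (bdry D y) = y"
    by (rule acyclic_contraction[OF t(2) aD]) (rule that)
  show "C \<otimes>\<^sub>c D \<in> acyclic_fg_complexes"
    using tensor_acyclic[OF h] fg[OF fC fD] by (simp add: acyclic_fg_complexes_def)
qed


section \<open>Novikov rings\<close>

lemma novikov_mult: "(f \<otimes>\<^bsub>novikov\<^esub> g) c = (\<Sum>a | f a \<noteq> 0 \<and> g (c - a) \<noteq> 0. f a * g (c - a))"
  and novikov_add: "(f \<oplus>\<^bsub>novikov\<^esub> g) = (\<lambda>a. f a + g a)"
  and novikov_one: "\<one>\<^bsub>novikov\<^esub> = tpow 0"
  and novikov_zero: "\<zero>\<^bsub>novikov\<^esub> = (\<lambda>_. 0)"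
  and novikov_carrier: "f \<in> carrier novikov \<longleftrightarrow> (\<forall>r. finite {a. a \<le> r \<and> f a \<noteq> 0})"
  by (simp_all add: novikov_def tpow_def)

lemma novikov_poly_simps:
  "mult novikov_poly = mult novikov" "add novikov_poly = add novikov"
  "\<one>\<^bsub>novikov_poly\<^esub> = \<one>\<^bsub>novikov\<^esub>" "\<zero>\<^bsub>novikov_poly\<^esub> = \<zero>\<^bsub>novikov\<^esub>"
  "f \<in> carrier novikov_poly \<longleftrightarrow> finite {a. f a \<noteq> 0}"
  by (simp_all add: novikov_poly_def novikov_def)

lemma novikov_poly_carrier: "f \<in> carrier novikov_poly \<Longrightarrow> f \<in> carrier novikov"
  unfolding novikov_poly_simps novikov_carrier by (auto elim: rev_finite_subset)

definition order_ge :: "real \<Rightarrow> (real \<Rightarrow> int) \<Rightarrow> bool"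
  where "order_ge m f \<longleftrightarrow> (\<forall>a. f a \<noteq> 0 \<longrightarrow> m \<le> a)"

lemma least_exponent:
  assumes "f \<in> carrier novikov" "f a \<noteq> 0"
  obtains b where "f b \<noteq> 0" "b \<le> a" "order_ge b f"
proof -
  let ?S = "{b. b \<le> a \<and> f b \<noteq> 0}"
  have fin: "finite ?S" using assms(1) by (simp add: novikov_carrier)
  have "?S \<noteq> {}" using assms(2) by auto
  then have M: "Min ?S \<in> ?S" using fin by (rule Min_in[rotated])
  have "order_ge (Min ?S) f"
    unfolding order_ge_def
  proof (intro allI impI)
    fix b assume b: "f b \<noteq> 0"
    show "Min ?S \<le> b"
    proof (cases "b \<le> a")
      case True
      then show ?thesis using b by (intro Min_le[OF fin]) simp
    qed (use M in auto)
  qed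
  then show thesis using that[of "Min ?S"] M by auto
qed

lemma order_bound:
  assumes "f \<in> carrier novikov" obtains m where "order_ge m f"
proof (cases "\<exists>a. f a \<noteq> 0")
  case True
  then show thesis using least_exponent[OF assms] that by metis
qed (use that in \<open>auto simp: order_ge_def\<close>)

lemma novikov_mult_superset:
  assumes "finite A" "{a. f a \<noteq> 0 \<and> g (c - a) \<noteq> 0} \<subseteq> A"
  shows "(f \<otimes>\<^bsub>novikov\<^esub> g) c = (\<Sum>a\<in>A. f a * g (c - a))"
  unfolding novikov_mult using assms by (intro sum.mono_neutral_left) auto

lemma novikov_mult_finite:
  assumes "f \<in> carrier novikov" "g \<in> carrier novikov"
  shows "finite {a. f a \<noteq> 0 \<and> g (c - a) \<noteq> 0}"
proof -
  obtain m where m: "order_ge m g" using order_bound[OF assms(2)] .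
  have "{a. f a \<noteq> 0 \<and> g (c - a) \<noteq> 0} \<subseteq> {a. a \<le> c - m \<and> f a \<noteq> 0}"
    using m by (auto simp: order_ge_def)
  then show ?thesis using assms(1) by (auto simp: novikov_carrier intro: finite_subset)
qed

lemma novikov_mult_nonzero:
  assumes "(f \<otimes>\<^bsub>novikov\<^esub> g) c \<noteq> 0"
  obtains a where "f a \<noteq> 0" "g (c - a) \<noteq> 0"
proof -
  have "{a. f a \<noteq> 0 \<and> g (c - a) \<noteq> 0} \<noteq> {}"
    using assms unfolding novikov_mult by (metis sum.empty)
  then show thesis using that by blast
qed

lemma order_ge_mult: "order_ge m f \<Longrightarrow> order_ge n g \<Longrightarrow> order_ge (m + n) (f \<otimes>\<^bsub>novikov\<^esub> g)"
  unfolding order_ge_def by (metis add_mono add_diff_cancel_left' diff_add_cancel novikov_mult_nonzero add.commute)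

lemma novikov_mult_closed:
  assumes f: "f \<in> carrier novikov" and g: "g \<in> carrier novikov"
  shows "f \<otimes>\<^bsub>novikov\<^esub> g \<in> carrier novikov"
  unfolding novikov_carrier
proof
  fix r
  obtain m n where mn: "order_ge m f" "order_ge n g" using order_bound f g by metis
  let ?A = "{a. a \<le> r - n \<and> f a \<noteq> 0}" and ?B = "{b. b \<le> r - m \<and> g b \<noteq> 0}"
  have "{c. c \<le> r \<and> (f \<otimes>\<^bsub>novikov\<^esub> g) c \<noteq> 0} \<subseteq> (\<lambda>(a, b). a + b) ` (?A \<times> ?B)"
  proof clarify
    fix c assume c: "c \<le> r" "(f \<otimes>\<^bsub>novikov\<^esub> g) c \<noteq> 0"
    from c(2) obtain a where a: "f a \<noteq> 0" "g (c - a) \<noteq> 0" by (rule novikov_mult_nonzero)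
    then have "m \<le> a" "n \<le> c - a" using mn by (auto simp: order_ge_def)
    then have "(a, c - a) \<in> ?A \<times> ?B" using a c by auto
    then show "c \<in> (\<lambda>(a, b). a + b) ` (?A \<times> ?B)" by (rule rev_image_eqI) simp
  qed
  moreover have "finite (?A \<times> ?B)" using f g by (simp add: novikov_carrier)
  ultimately show "finite {c. c \<le> r \<and> (f \<otimes>\<^bsub>novikov\<^esub> g) c \<noteq> 0}" by (meson finite_imageI finite_subset)
qed

lemma novikov_add_closed:
  assumes "f \<in> carrier novikov" "g \<in> carrier novikov"
  shows "(\<lambda>a. f a + g a) \<in> carrier novikov"
  unfolding novikov_carrier
proof
  fix r
  have "{a. a \<le> r \<and> f a + g a \<noteq> 0} \<subseteq> {a. a \<le> r \<and> f a \<noteq> 0} \<union> {a. a \<le> r \<and> g a \<noteq> 0}" by auto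
  then show "finite {a. a \<le> r \<and> f a + g a \<noteq> 0}"
    using assms by (auto simp: novikov_carrier intro: finite_subset)
qed

lemma novikov_scale_closed: "f \<in> carrier novikov \<Longrightarrow> (\<lambda>a. n * f a) \<in> carrier novikov"
  unfolding novikov_carrier by (auto elim: rev_finite_subset)

lemma novikov_neg_closed: "f \<in> carrier novikov \<Longrightarrow> (\<lambda>a. - f a) \<in> carrier novikov"
  by (simp add: novikov_carrier)

lemma tpow_closed: "tpow a \<in> carrier novikov_poly"
  by (simp add: novikov_poly_simps tpow_def)

lemma novikov_mult_commute: "f \<otimes>\<^bsub>novikov\<^esub> g = g \<otimes>\<^bsub>novikov\<^esub> f"
proof
  fix c
  have "(f \<otimes>\<^bsub>novikov\<^esub> g) c = (\<Sum>a\<in>(\<lambda>b. c - b) ` {b. g b \<noteq> 0 \<and> f (c - b) \<noteq> 0}. f a * g (c - a))"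
    unfolding novikov_mult by (rule sum.cong) (auto intro: image_eqI[of _ _ "c - _"])
  also have "\<dots> = (g \<otimes>\<^bsub>novikov\<^esub> f) c"
    unfolding novikov_mult by (subst sum.reindex) (auto simp: inj_on_def mult.commute)
  finally show "(f \<otimes>\<^bsub>novikov\<^esub> g) c = (g \<otimes>\<^bsub>novikov\<^esub> f) c" .
qed

lemma tpow_mult: "(tpow a \<otimes>\<^bsub>novikov\<^esub> f) c = f (c - a)"
  by (subst novikov_mult_superset[of "{a}"]) (auto simp: tpow_def split: if_splits)

lemma novikov_distrib:
  assumes "f \<in> carrier novikov" "g \<in> carrier novikov" "h \<in> carrier novikov"
  shows "(\<lambda>a. f a + g a) \<otimes>\<^bsub>novikov\<^esub> h = (\<lambda>c. (f \<otimes>\<^bsub>novikov\<^esub> h) c + (g \<otimes>\<^bsub>novikov\<^esub> h) c)"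
proof
  fix c
  let ?A = "{a. f a \<noteq> 0 \<and> h (c - a) \<noteq> 0} \<union> {a. g a \<noteq> 0 \<and> h (c - a) \<noteq> 0}"
  have A: "finite ?A" using assms by (simp add: novikov_mult_finite)
  have "((\<lambda>a. f a + g a) \<otimes>\<^bsub>novikov\<^esub> h) c = (\<Sum>a\<in>?A. (f a + g a) * h (c - a))"
    by (rule novikov_mult_superset[OF A]) auto
  also have "\<dots> = (\<Sum>a\<in>?A. f a * h (c - a)) + (\<Sum>a\<in>?A. g a * h (c - a))"
    by (simp add: distrib_right sum.distrib)
  also have "(\<Sum>a\<in>?A. f a * h (c - a)) = (f \<otimes>\<^bsub>novikov\<^esub> h) c"
    by (rule novikov_mult_superset[OF A, symmetric]) auto
  also have "(\<Sum>a\<in>?A. g a * h (c - a)) = (g \<otimes>\<^bsub>novikov\<^esub> h) c"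
    by (rule novikov_mult_superset[OF A, symmetric]) auto
  finally show "((\<lambda>a. f a + g a) \<otimes>\<^bsub>novikov\<^esub> h) c = (f \<otimes>\<^bsub>novikov\<^esub> h) c + (g \<otimes>\<^bsub>novikov\<^esub> h) c" .
qed

text \<open>Both sides are sums over the same finite set of triples of exponents: as the exponents are
  bounded below, only finitely many pairs of exponents of \<open>f\<close> and \<open>g\<close> matter for a given \<open>c\<close>.\<close>

lemma novikov_assoc:
  assumes f: "f \<in> carrier novikov" and g: "g \<in> carrier novikov" and h: "h \<in> carrier novikov"
  shows "(f \<otimes>\<^bsub>novikov\<^esub> g) \<otimes>\<^bsub>novikov\<^esub> h = f \<otimes>\<^bsub>novikov\<^esub> (g \<otimes>\<^bsub>novikov\<^esub> h)"
proof
  fix c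
  obtain mf mg mh where m: "order_ge mf f" "order_ge mg g" "order_ge mh h" using order_bound f g h by metis
  (* all exponents of f, g and their product that can contribute to the coefficient at c *)
  let ?A = "{a. a \<le> c - mg - mh \<and> f a \<noteq> 0}" and ?B = "{b. b \<le> c - mf - mh \<and> g b \<noteq> 0}"
  let ?S = "(\<lambda>(a, b). a + b) ` (?A \<times> ?B)"
  have fA: "finite ?A" and fS: "finite ?S" using f g by (auto simp: novikov_carrier)
  have S: "a + b \<in> ?S" if "a \<in> ?A" "b \<in> ?B" for a b using that by force
  have "((f \<otimes>\<^bsub>novikov\<^esub> g) \<otimes>\<^bsub>novikov\<^esub> h) c = (\<Sum>s\<in>?S. (f \<otimes>\<^bsub>novikov\<^esub> g) s * h (c - s))"
  proof (rule novikov_mult_superset[OF fS], clarify)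
    fix s assume s: "(f \<otimes>\<^bsub>novikov\<^esub> g) s \<noteq> 0" "h (c - s) \<noteq> 0"
    from s(1) obtain a where a: "f a \<noteq> 0" "g (s - a) \<noteq> 0" by (rule novikov_mult_nonzero)
    have "mf \<le> a" "mg \<le> s - a" "mh \<le> c - s" using m a s by (auto simp: order_ge_def)
    then show "s \<in> ?S" using S[of a "s - a"] a by simp
  qed
  also have "\<dots> = (\<Sum>s\<in>?S. \<Sum>a\<in>?A. f a * g (s - a) * h (c - s))"
  proof (rule sum.cong[OF refl])
    fix s
    show "(f \<otimes>\<^bsub>novikov\<^esub> g) s * h (c - s) = (\<Sum>a\<in>?A. f a * g (s - a) * h (c - s))"
    proof (cases "h (c - s) = 0")
      case False
      then have "mh \<le> c - s" using m by (auto simp: order_ge_def)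
      then have "(f \<otimes>\<^bsub>novikov\<^esub> g) s = (\<Sum>a\<in>?A. f a * g (s - a))"
        by (intro novikov_mult_superset[OF fA]) (use m(2) in \<open>force simp: order_ge_def\<close>)
      then show ?thesis by (simp add: sum_distrib_right)
    qed simp
  qed
  also have "\<dots> = (\<Sum>a\<in>?A. f a * (\<Sum>s\<in>?S. g (s - a) * h (c - s)))"
    by (subst sum.swap) (simp add: sum_distrib_left mult.assoc)
  also have "\<dots> = (\<Sum>a\<in>?A. f a * (g \<otimes>\<^bsub>novikov\<^esub> h) (c - a))"
  proof (rule sum.cong[OF refl])
    fix a assume a: "a \<in> ?A"
    have "(g \<otimes>\<^bsub>novikov\<^esub> h) (c - a) = (\<Sum>b\<in>(\<lambda>s. s - a) ` ?S. g b * h (c - a - b))"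
    proof (rule novikov_mult_superset, use fS in blast, clarify)
      fix b assume b: "g b \<noteq> 0" "h (c - a - b) \<noteq> 0"
      then have "mf \<le> a" "mh \<le> c - a - b" using m a by (auto simp: order_ge_def)
      then have "a + b \<in> ?S" using S[OF a, of b] b by simp
      then show "b \<in> (\<lambda>s. s - a) ` ?S" by (rule rev_image_eqI) simp
    qed
    also have "\<dots> = (\<Sum>s\<in>?S. g (s - a) * h (c - s))"
      by (subst sum.reindex) (auto simp: inj_on_def)
    finally show "f a * (\<Sum>s\<in>?S. g (s - a) * h (c - s)) = f a * (g \<otimes>\<^bsub>novikov\<^esub> h) (c - a)" by simp
  qed
  also have "\<dots> = (f \<otimes>\<^bsub>novikov\<^esub> (g \<otimes>\<^bsub>novikov\<^esub> h)) c"
  proof (rule novikov_mult_superset[OF fA, symmetric], rule subsetI)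
    fix a assume a: "a \<in> {a. f a \<noteq> 0 \<and> (g \<otimes>\<^bsub>novikov\<^esub> h) (c - a) \<noteq> 0}"
    then have "mg + mh \<le> c - a" using order_ge_mult[OF m(2,3)] by (auto simp: order_ge_def)
    then show "a \<in> ?A" using a by simp
  qed
  finally show "((f \<otimes>\<^bsub>novikov\<^esub> g) \<otimes>\<^bsub>novikov\<^esub> h) c = (f \<otimes>\<^bsub>novikov\<^esub> (g \<otimes>\<^bsub>novikov\<^esub> h)) c" .
qed

lemma tpow_0_mult: "tpow 0 \<otimes>\<^bsub>novikov\<^esub> f = f"
  by (rule ext) (simp add: tpow_mult)

lemma cring_novikov: "cring novikov"
proof (rule cringI)
  show "abelian_group novikov"
  proof (rule abelian_groupI)
    show "\<exists>y\<in>carrier novikov. y \<oplus>\<^bsub>novikov\<^esub> x = \<zero>\<^bsub>novikov\<^esub>" if "x \<in> carrier novikov" for x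
      by (rule bexI[OF _ novikov_neg_closed[OF that]]) (simp add: novikov_add novikov_zero)
  qed (auto simp: novikov_add novikov_zero novikov_add_closed add_ac, simp add: novikov_carrier)
  show "comm_monoid novikov"
    by (rule comm_monoidI)
      (auto simp: novikov_mult_closed novikov_one tpow_0_mult novikov_assoc novikov_poly_carrier[OF tpow_closed]
        intro: novikov_mult_commute)
qed (simp add: novikov_add novikov_distrib)

lemma novikov_poly_mult_closed:
  assumes "f \<in> carrier novikov_poly" "g \<in> carrier novikov_poly"
  shows "f \<otimes>\<^bsub>novikov\<^esub> g \<in> carrier novikov_poly"
proof -
  have "{c. (f \<otimes>\<^bsub>novikov\<^esub> g) c \<noteq> 0} \<subseteq> (\<lambda>(a, b). a + b) ` ({a. f a \<noteq> 0} \<times> {b. g b \<noteq> 0})"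
  proof clarify
    fix c assume "(f \<otimes>\<^bsub>novikov\<^esub> g) c \<noteq> 0"
    then obtain a where a: "f a \<noteq> 0" "g (c - a) \<noteq> 0" by (rule novikov_mult_nonzero)
    then have "(a, c - a) \<in> {a. f a \<noteq> 0} \<times> {b. g b \<noteq> 0}" by simp
    then show "c \<in> (\<lambda>(a, b). a + b) ` ({a. f a \<noteq> 0} \<times> {b. g b \<noteq> 0})" by (rule rev_image_eqI) simp
  qed
  moreover have "finite ({a. f a \<noteq> 0} \<times> {b. g b \<noteq> 0})" using assms by (simp add: novikov_poly_simps)
  ultimately show ?thesis unfolding novikov_poly_simps by (meson finite_imageI finite_subset)
qed

lemma novikov_poly_add_closed:
  assumes "f \<in> carrier novikov_poly" "g \<in> carrier novikov_poly"
  shows "(\<lambda>a. f a + g a) \<in> carrier novikov_poly"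
  using assms unfolding novikov_poly_simps
  by (rule_tac finite_subset[of _ "{a. f a \<noteq> 0} \<union> {a. g a \<noteq> 0}"]) auto

lemma cring_novikov_poly: "cring novikov_poly"
proof -
  interpret N: cring novikov by (rule cring_novikov)
  note c = novikov_poly_carrier
  show ?thesis
  proof (rule cringI)
    show "abelian_group novikov_poly"
    proof (rule abelian_groupI, unfold novikov_poly_simps(2,4))
      fix x assume x: "x \<in> carrier novikov_poly"
      show "\<exists>y\<in>carrier novikov_poly. y \<oplus>\<^bsub>novikov\<^esub> x = \<zero>\<^bsub>novikov\<^esub>"
        by (rule bexI[of _ "\<lambda>a. - x a"]) (use x in \<open>auto simp: novikov_add novikov_zero novikov_poly_simps\<close>)
    qed (auto simp: novikov_add novikov_zero novikov_poly_add_closed add_ac, simp add: novikov_poly_simps)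
    show "comm_monoid novikov_poly"
      by (rule comm_monoidI)
        (auto simp: novikov_poly_simps(1,3) novikov_poly_mult_closed novikov_one tpow_0_mult c novikov_assoc tpow_closed
          intro: novikov_mult_commute)
  qed (simp add: novikov_poly_simps(1,2) c N.l_distr)
qed

lemma value_at_one_superset:
  "finite A \<Longrightarrow> {a. f a \<noteq> 0} \<subseteq> A \<Longrightarrow> value_at_one f = (\<Sum>a\<in>A. f a)"
  unfolding value_at_one_def by (rule sum.mono_neutral_left) auto

lemma value_at_one_add:
  assumes "f \<in> carrier novikov_poly" "g \<in> carrier novikov_poly"
  shows "value_at_one (\<lambda>a. f a + g a) = value_at_one f + value_at_one g"
proof -
  let ?A = "{a. f a \<noteq> 0} \<union> {a. g a \<noteq> 0}"
  have A: "finite ?A" using assms by (simp add: novikov_poly_simps)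
  have "value_at_one (\<lambda>a. f a + g a) = (\<Sum>a\<in>?A. f a + g a)" by (rule value_at_one_superset[OF A]) auto
  then show ?thesis
    using value_at_one_superset[OF A, of f] value_at_one_superset[OF A, of g] by (simp add: sum.distrib)
qed

text \<open>The coefficients of the product are summed first over the exponents of \<open>f\<close>; what remains for a
  fixed one is the sum of all coefficients of \<open>g\<close>, shifted.\<close>

lemma value_at_one_mult:
  assumes f: "f \<in> carrier novikov_poly" and g: "g \<in> carrier novikov_poly"
  shows "value_at_one (f \<otimes>\<^bsub>novikov\<^esub> g) = value_at_one f * value_at_one g"
proof -
  let ?A = "{a. f a \<noteq> 0}" and ?B = "{b. g b \<noteq> 0}"
  let ?S = "(\<lambda>(a, b). a + b) ` (?A \<times> ?B)"
  have fA: "finite ?A" "finite ?B" using f g by (simp_all add: novikov_poly_simps)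
  then have fS: "finite ?S" by blast
  have S: "a + b \<in> ?S" if "a \<in> ?A" "b \<in> ?B" for a b using that by force
  have "value_at_one (f \<otimes>\<^bsub>novikov\<^esub> g) = (\<Sum>s\<in>?S. (f \<otimes>\<^bsub>novikov\<^esub> g) s)"
  proof (rule value_at_one_superset[OF fS], clarify)
    fix c assume "(f \<otimes>\<^bsub>novikov\<^esub> g) c \<noteq> 0"
    then obtain a where "f a \<noteq> 0" "g (c - a) \<noteq> 0" by (rule novikov_mult_nonzero)
    then show "c \<in> ?S" using S[of a "c - a"] by simp
  qed
  also have "\<dots> = (\<Sum>s\<in>?S. \<Sum>a\<in>?A. f a * g (s - a))"
    by (intro sum.cong refl novikov_mult_superset fA) auto
  also have "\<dots> = (\<Sum>a\<in>?A. f a * (\<Sum>s\<in>?S. g (s - a)))"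
    by (subst sum.swap) (simp add: sum_distrib_left)
  also have "\<dots> = (\<Sum>a\<in>?A. f a * value_at_one g)"
  proof (rule sum.cong[OF refl])
    fix a assume a: "a \<in> ?A"
    have "value_at_one g = (\<Sum>b\<in>(\<lambda>s. s - a) ` ?S. g b)"
    proof (rule value_at_one_superset, use fS in blast, clarify)
      fix b assume "g b \<noteq> 0"
      then have "a + b \<in> ?S" using S[OF a, of b] by simp
      then show "b \<in> (\<lambda>s. s - a) ` ?S" by (rule rev_image_eqI) simp
    qed
    also have "\<dots> = (\<Sum>s\<in>?S. g (s - a))" by (subst sum.reindex) (auto simp: inj_on_def)
    finally show "f a * (\<Sum>s\<in>?S. g (s - a)) = f a * value_at_one g" by simp
  qed
  also have "\<dots> = value_at_one f * value_at_one g"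
    by (simp add: value_at_one_def sum_distrib_right)
  finally show ?thesis .
qed

lemma ideal_novikov_poly0: "ideal novikov_poly0 novikov_poly"
proof -
  interpret P: cring novikov_poly by (rule cring_novikov_poly)
  show ?thesis
  proof (rule idealI[OF P.ring_axioms])
    show "subgroup novikov_poly0 (add_monoid novikov_poly)"
    proof (rule group.subgroupI[OF P.a_group])
      show "novikov_poly0 \<subseteq> carrier (add_monoid novikov_poly)" by (auto simp: novikov_poly0_def)
      have "(\<lambda>_. 0) \<in> novikov_poly0" by (simp add: novikov_poly0_def novikov_poly_simps value_at_one_def)
      then show "novikov_poly0 \<noteq> {}" by blast
      fix f assume f: "f \<in> novikov_poly0"
      have nf: "(\<lambda>a. - f a) \<in> novikov_poly0"
        using f by (simp add: novikov_poly0_def novikov_poly_simps value_at_one_def sum_negf)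
      have "\<ominus>\<^bsub>novikov_poly\<^esub> f = (\<lambda>a. - f a)"
        by (rule P.sum_zero_eq_neg[symmetric])
          (use f nf in \<open>auto simp: novikov_poly0_def novikov_poly_simps novikov_add novikov_zero\<close>)
      then show "inv\<^bsub>add_monoid novikov_poly\<^esub> f \<in> novikov_poly0" using nf by (simp add: a_inv_def)
      fix g assume "g \<in> novikov_poly0"
      then show "f \<otimes>\<^bsub>add_monoid novikov_poly\<^esub> g \<in> novikov_poly0"
        using f by (simp add: novikov_poly0_def novikov_poly_simps(2) novikov_add novikov_poly_add_closed value_at_one_add)
    qed
    fix f g assume "f \<in> novikov_poly0" "g \<in> carrier novikov_poly"
    then show "g \<otimes>\<^bsub>novikov_poly\<^esub> f \<in> novikov_poly0" "f \<otimes>\<^bsub>novikov_poly\<^esub> g \<in> novikov_poly0"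
      by (simp_all add: novikov_poly0_def novikov_poly_simps(1) novikov_poly_mult_closed value_at_one_mult)
  qed
qed

lemma module_novikov_poly0: "Module.module novikov_poly novikov_poly0_module"
proof -
  interpret N: cring novikov by (rule cring_novikov)
  interpret P: cring novikov_poly by (rule cring_novikov_poly)
  interpret I: ideal novikov_poly0 novikov_poly by (rule ideal_novikov_poly0)
  have sub: "f \<in> carrier novikov_poly" if "f \<in> novikov_poly0" for f
    using that unfolding novikov_poly0_def by blast
  note M = novikov_poly0_module_def
  note c = novikov_poly_carrier
  show ?thesis
  proof (rule moduleI[OF cring_novikov_poly])
    show "abelian_group novikov_poly0_module"
    proof (rule abelian_groupI)
      fix f assume f: "f \<in> carrier novikov_poly0_module"
      then have "(\<lambda>a. - f a) \<in> novikov_poly0"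
        by (simp add: M novikov_poly0_def novikov_poly_simps value_at_one_def sum_negf)
      then show "\<exists>y\<in>carrier novikov_poly0_module. y \<oplus>\<^bsub>novikov_poly0_module\<^esub> f = \<zero>\<^bsub>novikov_poly0_module\<^esub>"
        by (intro bexI[of _ "\<lambda>a. - f a"]) (simp_all add: M novikov_add novikov_zero)
    next
      show "\<zero>\<^bsub>novikov_poly0_module\<^esub> \<in> carrier novikov_poly0_module"
        using I.zero_closed by (simp add: M novikov_poly_simps)
    qed (use I.a_closed in \<open>auto simp: M novikov_poly_simps(2,4) novikov_add novikov_zero add_ac\<close>)
  qed (use I.I_l_closed sub c in \<open>auto simp: M novikov_poly_simps(1-4) N.l_distr N.r_distr N.m_assoc\<close>)
qed

text \<open>\<open>v\<close> is the geometric series of \<open>g\<close>: the exponents of the \<open>n\<close>-th power are at least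
  \<open>n \<epsilon>\<close>, so each coefficient of the sum of all powers is a finite sum.\<close>

lemma one_minus_invertible:
  assumes g: "g \<in> carrier novikov" and \<epsilon>: "\<epsilon> > 0" "order_ge \<epsilon> g"
  obtains v where "v \<in> carrier novikov" "\<And>c. v c - (g \<otimes>\<^bsub>novikov\<^esub> v) c = tpow 0 c"
proof -
  define pw where "pw n = ((\<lambda>f. g \<otimes>\<^bsub>novikov\<^esub> f) ^^ n) (tpow 0)" for n
  have pw: "pw 0 = tpow 0" "pw (Suc n) = g \<otimes>\<^bsub>novikov\<^esub> pw n" for n by (simp_all add: pw_def)
  have pc: "pw n \<in> carrier novikov" for n
    by (induction n) (simp_all add: pw novikov_poly_carrier[OF tpow_closed] novikov_mult_closed[OF g])
  have po: "order_ge (real n * \<epsilon>) (pw n)" for n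
  proof (induction n)
    case 0
    then show ?case by (simp add: pw order_ge_def tpow_def)
  next
    case (Suc n)
    then show ?case using order_ge_mult[OF \<epsilon>(2) Suc] by (simp add: pw algebra_simps)
  qed
  define N where "N c = nat \<lceil>c / \<epsilon>\<rceil>" for c
  have Nz: "pw n c = 0" if "N c < n" for n c
  proof (rule ccontr)
    assume "pw n c \<noteq> 0"
    then have "real n * \<epsilon> \<le> c" using po[of n] by (simp add: order_ge_def)
    then have "real n \<le> c / \<epsilon>" using \<epsilon>(1) by (simp add: field_simps)
    then have "real n \<le> real (N c)" unfolding N_def by linarith
    then show False using that by simp
  qed
  have Nm: "N b \<le> N c" if "b \<le> c" for b c
    unfolding N_def using that \<epsilon>(1) by (intro nat_mono ceiling_mono divide_right_mono) auto
  define v where "v c = (\<Sum>n\<le>N c. pw n c)" for c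
  have v: "v b = (\<Sum>n\<le>N c. pw n b)" if "b \<le> c" for b c
    unfolding v_def using Nm[OF that] Nz by (intro sum.mono_neutral_left) auto
  have vc: "v \<in> carrier novikov"
    unfolding novikov_carrier
  proof
    fix r
    have "{a. a \<le> r \<and> v a \<noteq> 0} \<subseteq> (\<Union>n\<le>N r. {a. a \<le> r \<and> pw n a \<noteq> 0})"
    proof clarify
      fix a assume a: "a \<le> r" "v a \<noteq> 0"
      then have "\<exists>n\<in>{..N r}. pw n a \<noteq> 0" using v[OF a(1)] by (metis sum.neutral)
      then show "a \<in> (\<Union>n\<le>N r. {a. a \<le> r \<and> pw n a \<noteq> 0})" using a by blast
    qed
    moreover have "finite (\<Union>n\<le>N r. {a. a \<le> r \<and> pw n a \<noteq> 0})" using pc by (simp add: novikov_carrier)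
    ultimately show "finite {a. a \<le> r \<and> v a \<noteq> 0}" by (rule finite_subset)
  qed
  have "v c - (g \<otimes>\<^bsub>novikov\<^esub> v) c = tpow 0 c" for c
  proof -
    have m: "0 \<le> b" if "pw n b \<noteq> 0" for n b
    proof -
      have "real n * \<epsilon> \<le> b" using po[of n] that by (simp add: order_ge_def)
      then show ?thesis using \<epsilon>(1) mult_nonneg_nonneg[of "real n" \<epsilon>] by linarith
    qed
    define A where "A = {a. a \<le> c \<and> g a \<noteq> 0}"
    have A: "finite A" using g by (simp add: novikov_carrier A_def)
    have vA: "v (c - a) = (\<Sum>n\<le>N c. pw n (c - a))" if "g a \<noteq> 0" for a
      using v[of "c - a" c] that \<epsilon> by (force simp: order_ge_def)
    have "(g \<otimes>\<^bsub>novikov\<^esub> v) c = (\<Sum>a\<in>A. g a * v (c - a))"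
    proof (rule novikov_mult_superset[OF A], clarify)
      fix a assume a: "g a \<noteq> 0" "v (c - a) \<noteq> 0"
      then have "\<exists>n\<in>{..N c}. pw n (c - a) \<noteq> 0" using vA[OF a(1)] by (metis sum.neutral)
      then have "0 \<le> c - a" using m by blast
      then show "a \<in> A" using a by (simp add: A_def)
    qed
    also have "\<dots> = (\<Sum>a\<in>A. \<Sum>n\<le>N c. g a * pw n (c - a))"
      by (rule sum.cong) (auto simp: A_def vA sum_distrib_left)
    also have "\<dots> = (\<Sum>n\<le>N c. \<Sum>a\<in>A. g a * pw n (c - a))" by (rule sum.swap)
    also have "\<dots> = (\<Sum>n\<le>N c. pw (Suc n) c)"
      unfolding pw(2)
      by (intro sum.cong refl novikov_mult_superset[OF A, symmetric]) (use m in \<open>force simp: A_def\<close>)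
    finally have "v c - (g \<otimes>\<^bsub>novikov\<^esub> v) c = (\<Sum>n\<le>N c. pw n c - pw (Suc n) c)"
      by (simp add: v_def sum_subtractf)
    also have "\<dots> = pw 0 c - pw (Suc (N c)) c" by (rule sum_telescope)
    finally show ?thesis using Nz[of c "Suc (N c)"] by (simp add: pw(1))
  qed
  then show thesis using that[OF vc] by blast
qed

text \<open>The leading coefficient of a unit is \<open>\<plusminus>1\<close>, whereas that of \<open>1 + 2 h\<close> is even if \<open>h\<close> has a
  negative exponent.\<close>

lemma unit_order_ge_0:
  assumes h: "h \<in> carrier novikov" and k: "k \<in> carrier novikov"
    and u: "(\<lambda>a. tpow 0 a + 2 * h a) \<otimes>\<^bsub>novikov\<^esub> k = tpow 0"
  shows "order_ge 0 h"
proof (rule ccontr)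
  let ?u = "\<lambda>a. tpow 0 a + 2 * h a"
  assume "\<not> order_ge 0 h"
  then obtain a0 where a0: "h a0 \<noteq> 0" "a0 < 0" by (auto simp: order_ge_def)
  obtain a where a: "h a \<noteq> 0" "a \<le> a0" "order_ge a h" by (rule least_exponent[OF h a0(1)])
  have uo: "order_ge a ?u" using a(2,3) a0 by (auto simp: order_ge_def tpow_def)
  have ua: "?u a = 2 * h a" using a(2) a0(2) by (simp add: tpow_def)
  have "\<exists>b. k b \<noteq> 0"
  proof (rule ccontr)
    assume "\<not> (\<exists>b. k b \<noteq> 0)"
    then have "(?u \<otimes>\<^bsub>novikov\<^esub> k) 0 = 0" by (simp add: novikov_mult)
    then show False unfolding u by (simp add: tpow_def)
  qed
  then obtain b0 where "k b0 \<noteq> 0" by blast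
  then obtain b where b: "k b \<noteq> 0" "order_ge b k" by (rule least_exponent[OF k])
  have "(?u \<otimes>\<^bsub>novikov\<^esub> k) (a + b) = (\<Sum>x\<in>{a}. ?u x * k (a + b - x))"
  proof (rule novikov_mult_superset)
    show "{x. ?u x \<noteq> 0 \<and> k (a + b - x) \<noteq> 0} \<subseteq> {a}"
      using uo b(2) unfolding order_ge_def by force
  qed simp
  then have "tpow 0 (a + b) = 2 * (h a * k b)" unfolding u using ua by simp
  moreover have "h a * k b \<noteq> 0" using a(1) b(1) by simp
  moreover have "tpow 0 (a + b) = 0 \<or> tpow 0 (a + b) = 1" by (simp add: tpow_def)
  ultimately show False by presburger
qed

text \<open>A ring endomorphism fixing all \<open>t\<^sup>a\<close> is the identity although the \<open>t\<^sup>a\<close> do not generate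
  the ring: it is automatically continuous, because \<open>1 + 2 g\<close> is a unit whenever all exponents of
  \<open>g\<close> are positive, and its image \<open>1 + 2 \<phi> g\<close>, again a unit, forces the exponents of \<open>\<phi> g\<close> to be
  nonnegative.  So the coefficient of \<open>\<phi> f\<close> at \<open>x\<close> only depends on a truncation of \<open>f\<close> above \<open>x\<close>.\<close>

theorem novikov_endomorphism_unique:
  assumes \<phi>: "\<phi> \<in> ring_hom novikov novikov" and t: "\<And>a. \<phi> (tpow a) = tpow a" and f: "f \<in> carrier novikov"
  shows "\<phi> f = f"
proof -
  interpret N: cring novikov by (rule cring_novikov)
  note c = novikov_poly_carrier
  have cl: "\<phi> x \<in> carrier novikov" if "x \<in> carrier novikov" for x
    using ring_hom_closed[OF \<phi> that] .
  have add: "\<phi> (\<lambda>a. x a + y a) = (\<lambda>a. \<phi> x a + \<phi> y a)" if "x \<in> carrier novikov" "y \<in> carrier novikov" for x y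
    using ring_hom_add[OF \<phi> that] by (simp add: novikov_add)
  have mul: "\<phi> (x \<otimes>\<^bsub>novikov\<^esub> y) = \<phi> x \<otimes>\<^bsub>novikov\<^esub> \<phi> y" if "x \<in> carrier novikov" "y \<in> carrier novikov" for x y
    using ring_hom_mult[OF \<phi> that] .
  have tc: "tpow a \<in> carrier novikov" for a by (rule c[OF tpow_closed])
  have zc: "(\<lambda>_. 0) \<in> carrier novikov" by (simp add: novikov_carrier)
  have zero: "\<phi> (\<lambda>_. 0) = (\<lambda>_. 0)"
  proof
    fix a show "\<phi> (\<lambda>_. 0) a = 0" using fun_cong[OF add[OF zc zc], of a] by simp
  qed
  have neg: "\<phi> (\<lambda>a. - x a) = (\<lambda>a. - \<phi> x a)" if x: "x \<in> carrier novikov" for x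
  proof
    fix a show "\<phi> (\<lambda>a. - x a) a = - \<phi> x a"
      using fun_cong[OF add[OF x novikov_neg_closed[OF x]], of a] fun_cong[OF zero, of a] by simp
  qed
  have scaleN: "\<phi> (\<lambda>b. int n * x b) = (\<lambda>b. int n * \<phi> x b)" if x: "x \<in> carrier novikov" for n x
  proof (induction n)
    case 0
    then show ?case using zero by simp
  next
    case (Suc n)
    have "\<phi> (\<lambda>b. x b + int n * x b) = (\<lambda>b. \<phi> x b + int n * \<phi> x b)"
      using add[OF x novikov_scale_closed[OF x, of "int n"]] Suc by simp
    then show ?case by (simp add: algebra_simps)
  qed
  have scale: "\<phi> (\<lambda>b. n * x b) = (\<lambda>b. n * \<phi> x b)" if x: "x \<in> carrier novikov" for n x
  proof (cases "n \<ge> 0")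
    case True
    then show ?thesis using scaleN[OF x, of "nat n"] by simp
  next
    case False
    then have "\<phi> (\<lambda>b. - (int (nat (- n)) * x b)) = (\<lambda>b. - (int (nat (- n)) * \<phi> x b))"
      using neg[OF novikov_scale_closed[OF x, of "int (nat (- n))"]] scaleN[OF x, of "nat (- n)"] by simp
    then show ?thesis using False by simp
  qed
  have poly: "\<phi> p = p" if "finite A" "{a. p a \<noteq> 0} \<subseteq> A" for A p
    using that
  proof (induction A arbitrary: p rule: finite_induct)
    case empty
    then have "p = (\<lambda>_. 0)" by auto
    then show ?case using zero by simp
  next
    case (insert a A)
    let ?q = "\<lambda>b. if b = a then 0 else p b"
    have q: "{b. ?q b \<noteq> 0} \<subseteq> A" using insert.prems by auto
    then have qc: "?q \<in> carrier novikov"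
      using finite_subset[OF q insert.hyps(1)] by (intro c) (simp only: novikov_poly_simps)
    have p: "p = (\<lambda>b. ?q b + p a * tpow a b)" by (auto simp: tpow_def)
    have "\<phi> (\<lambda>b. ?q b + p a * tpow a b) = (\<lambda>b. ?q b + p a * tpow a b)"
      using add[OF qc novikov_scale_closed[OF tc, of "p a" a]] insert.IH[OF q] scale[OF tc, of "p a" a] t by simp
    then show ?case using p by simp
  qed
  show ?thesis
  proof
    fix x :: real
    define r where "r = x + 1"
    let ?p = "\<lambda>a. if a \<le> r then f a else 0" and ?g = "\<lambda>a. if a > 0 then f (a + r) else 0"
    have fp: "finite {a. a \<le> r \<and> f a \<noteq> 0}" using f by (simp add: novikov_carrier)
    have sp: "{a. ?p a \<noteq> 0} \<subseteq> {a. a \<le> r \<and> f a \<noteq> 0}" by auto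
    have pc: "?p \<in> carrier novikov"
      using finite_subset[OF sp fp] by (intro c) (simp add: novikov_poly_simps)
    have gc: "?g \<in> carrier novikov"
      unfolding novikov_carrier
    proof
      fix s
      have "{a. a \<le> s \<and> ?g a \<noteq> 0} \<subseteq> (\<lambda>a. a - r) ` {a. a \<le> s + r \<and> f a \<noteq> 0}"
      proof
        fix a assume "a \<in> {a. a \<le> s \<and> ?g a \<noteq> 0}"
        then have "a + r \<in> {a. a \<le> s + r \<and> f a \<noteq> 0}" by (auto split: if_splits)
        then show "a \<in> (\<lambda>a. a - r) ` {a. a \<le> s + r \<and> f a \<noteq> 0}" by (rule rev_image_eqI) simp
      qed
      then show "finite {a. a \<le> s \<and> ?g a \<noteq> 0}"
        by (rule finite_subset) (use f in \<open>simp add: novikov_carrier\<close>)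
    qed
    (* the truncation of f at r, plus t^r times a series with positive exponents; the image of the
       second term has exponents at least r, hence does not contribute at x = r - 1 *)
    have fe: "f = (\<lambda>a. ?p a + (tpow r \<otimes>\<^bsub>novikov\<^esub> ?g) a)" by (rule ext) (simp add: tpow_mult)
    have fx: "\<phi> f = (\<lambda>a. ?p a + (tpow r \<otimes>\<^bsub>novikov\<^esub> \<phi> ?g) a)"
      using add[OF pc novikov_mult_closed[OF tc gc, of r]] mul[OF tc gc, of r] poly[OF fp sp] t fe by simp
    let ?h = "\<lambda>a. - 2 * ?g a"
    have hc: "?h \<in> carrier novikov" by (rule novikov_scale_closed[OF gc])
    obtain \<epsilon> where \<epsilon>: "\<epsilon> > 0" "order_ge \<epsilon> ?h"
    proof (cases "\<exists>a. ?h a \<noteq> 0")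
      case True
      then obtain a where "?h a \<noteq> 0" by blast
      then obtain b where "?h b \<noteq> 0" "order_ge b ?h" by (rule least_exponent[OF hc])
      then show thesis using that[of b] by (auto split: if_splits)
    qed (use that[of 1] in \<open>auto simp: order_ge_def\<close>)
    obtain v where v: "v \<in> carrier novikov" "\<And>c. v c - (?h \<otimes>\<^bsub>novikov\<^esub> v) c = tpow 0 c"
      by (rule one_minus_invertible[OF hc \<epsilon>]) (rule that)
    have g2: "(\<lambda>a. 2 * ?g a) \<in> carrier novikov" by (rule novikov_scale_closed[OF gc])
    have n2: "(?h \<otimes>\<^bsub>novikov\<^esub> v) c = - ((\<lambda>a. 2 * ?g a) \<otimes>\<^bsub>novikov\<^esub> v) c" for c
      unfolding novikov_mult sum_negf[symmetric] by (rule sum.cong) auto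
    have "(\<lambda>a. tpow 0 a + 2 * ?g a) \<otimes>\<^bsub>novikov\<^esub> v = tpow 0"
      unfolding novikov_distrib[OF tc g2 v(1)] tpow_0_mult using v(2) n2 by auto
    then have "\<phi> (\<lambda>a. tpow 0 a + 2 * ?g a) \<otimes>\<^bsub>novikov\<^esub> \<phi> v = tpow 0"
      using mul[OF novikov_add_closed[OF tc g2] v(1)] t by metis
    moreover have "\<phi> (\<lambda>a. tpow 0 a + 2 * ?g a) = (\<lambda>a. tpow 0 a + 2 * \<phi> ?g a)"
      using add[OF tc g2] scale[OF gc, of 2] t by simp
    ultimately have "order_ge 0 (\<phi> ?g)"
      using unit_order_ge_0[OF cl[OF gc] cl[OF v(1)]] by simp
    then have "\<phi> ?g (x - r) = 0" by (auto simp: order_ge_def r_def)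
    then show "\<phi> f x = f x" unfolding fx by (simp add: tpow_mult r_def)
  qed
qed


section \<open>Grothendieck groups as subrings of the Novikov ring\<close>

lemma frag_tensor_simps:
  "frag_tensor 0 q = 0" "frag_tensor p 0 = 0"
  "frag_tensor (p - p') q = frag_tensor p q - frag_tensor p' q"
  "frag_tensor p (q - q') = frag_tensor p q - frag_tensor p q'"
  "frag_tensor (frag_of C) (frag_of D) = frag_of (C \<otimes>\<^sub>c D)"
proof -
  show "frag_tensor p (q - q') = frag_tensor p q - frag_tensor p q'"
    using subset_UNIV[of "Poly_Mapping.keys p"]
    by (induction p rule: frag_induction) (simp_all add: frag_tensor_def frag_extend_diff)
  show "frag_tensor p 0 = 0"
    using subset_UNIV[of "Poly_Mapping.keys p"]
    by (induction p rule: frag_induction) (simp_all add: frag_tensor_def frag_extend_diff)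
qed (simp_all add: frag_tensor_def frag_extend_diff)

lemma frag_tensor_keys:
  assumes "\<And>C D. C \<in> Ob \<Longrightarrow> D \<in> Ob' \<Longrightarrow> C \<otimes>\<^sub>c D \<in> Ob'"
    "Poly_Mapping.keys p \<subseteq> Ob" "Poly_Mapping.keys q \<subseteq> Ob'"
  shows "Poly_Mapping.keys (frag_tensor p q) \<subseteq> Ob'"
  using assms(2)
proof (induction p rule: frag_induction)
  case (one C)
  show ?case
    using assms(3)
  proof (induction q rule: frag_induction)
    case (one D)
    then show ?case using assms(1)[OF \<open>C \<in> Ob\<close>] by (simp add: frag_tensor_simps)
  next
    case (diff a b)
    then show ?case unfolding frag_tensor_simps using keys_diff by fast
  qed (simp add: frag_tensor_simps)
next
  case (diff a b)
  then show ?case unfolding frag_tensor_simps using keys_diff by fast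
qed (simp add: frag_tensor_simps)

lemma frag_euler_diff': "frag_euler (p - q) = (\<lambda>a. frag_euler p a - frag_euler q a)"
  by (rule ext) simp

lemma frag_euler_of': "frag_euler (frag_of C) = euler_series C"
  by (rule ext) simp

lemma frag_euler_carrier:
  assumes "\<And>X. X \<in> Ob \<Longrightarrow> tame X" "Poly_Mapping.keys p \<subseteq> Ob"
  shows "frag_euler p \<in> carrier novikov"
  using assms(2)
proof (induction p rule: frag_induction)
  case zero
  then show ?case by (simp add: novikov_carrier)
next
  case (one C)
  then show ?case using euler_series_novikov[OF assms(1)] by (simp add: frag_euler_of' novikov_carrier)
next
  case (diff a b)
  then show ?case
    unfolding frag_euler_diff' using novikov_add_closed[OF _ novikov_neg_closed] by fastforce
qed

lemma frag_euler_tensor: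
  assumes tame: "\<And>X. X \<in> Ob \<Longrightarrow> tame X" "\<And>X. X \<in> Ob' \<Longrightarrow> tame X"
    and p: "Poly_Mapping.keys p \<subseteq> Ob" and q: "Poly_Mapping.keys q \<subseteq> Ob'"
  shows "frag_euler (frag_tensor p q) = frag_euler p \<otimes>\<^bsub>novikov\<^esub> frag_euler q"
proof -
  interpret N: cring novikov by (rule cring_novikov)
  have minus: "(\<lambda>a. f a - g a) = f \<ominus>\<^bsub>novikov\<^esub> g" if "f \<in> carrier novikov" "g \<in> carrier novikov" for f g
  proof -
    have "\<ominus>\<^bsub>novikov\<^esub> g = (\<lambda>a. - g a)"
      by (rule N.sum_zero_eq_neg[symmetric])
        (use that novikov_neg_closed in \<open>auto simp: novikov_add novikov_zero\<close>)
    then show ?thesis by (simp add: a_minus_def novikov_add)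
  qed
  have cq: "frag_euler q \<in> carrier novikov" by (rule frag_euler_carrier[OF _ q]) (rule tame(2))
  have "frag_euler (frag_tensor p q) = frag_euler p \<otimes>\<^bsub>novikov\<^esub> frag_euler q \<and> frag_euler p \<in> carrier novikov"
    using p
  proof (induction p rule: frag_induction)
    case zero
    have z: "frag_euler 0 = \<zero>\<^bsub>novikov\<^esub>" by (rule ext) (simp add: novikov_zero)
    show ?case unfolding frag_tensor_simps z using cq by simp
  next
    case (one C)
    have C: "euler_series C \<in> carrier novikov"
      using euler_series_novikov[OF tame(1)[OF one]] by (simp add: novikov_carrier)
    have "frag_euler (frag_tensor (frag_of C) q) = euler_series C \<otimes>\<^bsub>novikov\<^esub> frag_euler q \<and> frag_euler q \<in> carrier novikov"
      using q
    proof (induction q rule: frag_induction)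
      case zero
      have z: "frag_euler 0 = \<zero>\<^bsub>novikov\<^esub>" by (rule ext) (simp add: novikov_zero)
      show ?case unfolding frag_tensor_simps z using C by simp
    next
      case (one D)
      then show ?case
        using tensor_tame(3)[OF tame(1)[OF \<open>C \<in> Ob\<close>] tame(2)[OF one]] euler_series_novikov[OF tame(2)[OF one]]
        by (simp add: frag_tensor_simps frag_euler_of' novikov_carrier)
    next
      case (diff a b)
      then show ?case
        using C by (simp add: frag_tensor_simps frag_euler_diff' minus N.r_minus a_minus_def N.r_distr)
    qed
    then show ?case using C by (simp add: frag_euler_of')
  next
    case (diff a b)
    then show ?case
      using cq by (simp add: frag_tensor_simps frag_euler_diff' minus N.l_minus a_minus_def N.l_distr)
  qed
  then show ?thesis by blast
qed

text \<open>Transport of the ring axioms along a bijection that respects the operations.\<close>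

lemma cring_pullback:
  assumes S: "cring S" and inj: "inj_on h (carrier R)" and img: "h ` carrier R = carrier S"
    and cl: "\<And>x y. x \<in> carrier R \<Longrightarrow> y \<in> carrier R \<Longrightarrow> x \<oplus>\<^bsub>R\<^esub> y \<in> carrier R \<and> x \<otimes>\<^bsub>R\<^esub> y \<in> carrier R"
      "\<zero>\<^bsub>R\<^esub> \<in> carrier R" "\<one>\<^bsub>R\<^esub> \<in> carrier R"
    and hom: "\<And>x y. x \<in> carrier R \<Longrightarrow> y \<in> carrier R \<Longrightarrow> h (x \<oplus>\<^bsub>R\<^esub> y) = h x \<oplus>\<^bsub>S\<^esub> h y"
      "\<And>x y. x \<in> carrier R \<Longrightarrow> y \<in> carrier R \<Longrightarrow> h (x \<otimes>\<^bsub>R\<^esub> y) = h x \<otimes>\<^bsub>S\<^esub> h y"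
      "h \<zero>\<^bsub>R\<^esub> = \<zero>\<^bsub>S\<^esub>" "h \<one>\<^bsub>R\<^esub> = \<one>\<^bsub>S\<^esub>"
  shows "cring R"
proof -
  interpret S: cring S by (rule S)
  have hc: "h x \<in> carrier S" if "x \<in> carrier R" for x using img that by blast
  have eqI: "x = y" if "x \<in> carrier R" "y \<in> carrier R" "h x = h y" for x y
    using inj_onD[OF inj that(3,1,2)] .
  show ?thesis
  proof (rule cringI)
    show "abelian_group R"
    proof (rule abelian_groupI)
      fix x assume x: "x \<in> carrier R"
      obtain y where y: "y \<in> carrier R" "h y = \<ominus>\<^bsub>S\<^esub> h x" 
        using S.a_inv_closed[OF hc[OF x]] unfolding img[symmetric] by (metis imageE)
      then show "\<exists>y\<in>carrier R. y \<oplus>\<^bsub>R\<^esub> x = \<zero>\<^bsub>R\<^esub>"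
        using x by (intro bexI[of _ y] eqI) (simp_all add: cl hom hc S.l_neg)
    next
      fix x y z assume c: "x \<in> carrier R" "y \<in> carrier R" "z \<in> carrier R"
      show "x \<oplus>\<^bsub>R\<^esub> y \<oplus>\<^bsub>R\<^esub> z = x \<oplus>\<^bsub>R\<^esub> (y \<oplus>\<^bsub>R\<^esub> z)"
        by (rule eqI) (simp_all add: c cl hom hc S.a_assoc)
      show "x \<oplus>\<^bsub>R\<^esub> y = y \<oplus>\<^bsub>R\<^esub> x"
        by (rule eqI) (simp_all add: c cl hom hc S.a_comm)
      show "\<zero>\<^bsub>R\<^esub> \<oplus>\<^bsub>R\<^esub> x = x"
        by (rule eqI) (simp_all add: c cl hom hc)
    qed (use cl in auto)
    show "comm_monoid R"
    proof (rule comm_monoidI)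
      fix x y z assume c: "x \<in> carrier R" "y \<in> carrier R" "z \<in> carrier R"
      show "x \<otimes>\<^bsub>R\<^esub> y \<otimes>\<^bsub>R\<^esub> z = x \<otimes>\<^bsub>R\<^esub> (y \<otimes>\<^bsub>R\<^esub> z)"
        by (rule eqI) (simp_all add: c cl hom hc S.m_assoc)
    next
      fix x y assume c: "x \<in> carrier R" "y \<in> carrier R"
      show "x \<otimes>\<^bsub>R\<^esub> y = y \<otimes>\<^bsub>R\<^esub> x"
        by (rule eqI) (simp_all add: c cl hom hc S.m_comm)
    next
      fix x assume c: "x \<in> carrier R"
      show "\<one>\<^bsub>R\<^esub> \<otimes>\<^bsub>R\<^esub> x = x"
        by (rule eqI) (simp_all add: c cl hom hc)
    qed (use cl in auto)
    fix x y z assume c: "x \<in> carrier R" "y \<in> carrier R" "z \<in> carrier R"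
    show "(x \<oplus>\<^bsub>R\<^esub> y) \<otimes>\<^bsub>R\<^esub> z = x \<otimes>\<^bsub>R\<^esub> z \<oplus>\<^bsub>R\<^esub> y \<otimes>\<^bsub>R\<^esub> z"
      by (rule eqI) (simp_all add: c cl hom hc S.l_distr)
  qed
qed

text \<open>The common setting of the three Grothendieck groups: a class \<open>Ob\<close> of complexes for which the
  relations are the kernel of the Euler characteristic series, whose image is \<open>I\<close>.\<close>

locale K_setting =
  fixes Ob :: "'k::field fcc set" and I :: "(real \<Rightarrow> int) set"
  assumes tame: "X \<in> Ob \<Longrightarrow> tame X"
    and kernel: "Poly_Mapping.keys p \<subseteq> Ob \<Longrightarrow> p \<in> K_relations Ob \<longleftrightarrow> (\<forall>a. frag_euler p a = 0)"
    and image: "frag_euler ` {p. Poly_Mapping.keys p \<subseteq> Ob} = I"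
begin

lemma coset_eq:
  assumes p: "Poly_Mapping.keys p \<subseteq> Ob"
  shows "K_coset Ob p = {q. Poly_Mapping.keys q \<subseteq> Ob \<and> frag_euler q = frag_euler p}"
proof -
  have "q \<in> K_coset Ob p \<longleftrightarrow> q - p \<in> K_relations Ob" for q
  proof -
    have "q \<in> K_coset Ob p \<longleftrightarrow> (\<exists>h\<in>K_relations Ob. q = h + p)"
      by (simp add: K_coset_def a_r_coset_def r_coset_def free_tensor_def)
    also have "\<dots> \<longleftrightarrow> q - p \<in> K_relations Ob" by (metis add_diff_cancel_right' diff_add_cancel)
    finally show ?thesis .
  qed
  moreover have "q - p \<in> K_relations Ob \<longleftrightarrow> Poly_Mapping.keys q \<subseteq> Ob \<and> frag_euler q = frag_euler p" for q
  proof
    assume r: "q - p \<in> K_relations Ob"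
    have k: "Poly_Mapping.keys (q - p) \<subseteq> Ob" by (rule K_relations_keys[OF r])
    then have "Poly_Mapping.keys q \<subseteq> Ob" using keys_add[of "q - p" p] p by auto
    moreover have "frag_euler q = frag_euler p" using kernel[OF k] r by auto
    ultimately show "Poly_Mapping.keys q \<subseteq> Ob \<and> frag_euler q = frag_euler p" by blast
  next
    assume q: "Poly_Mapping.keys q \<subseteq> Ob \<and> frag_euler q = frag_euler p"
    then have "Poly_Mapping.keys (q - p) \<subseteq> Ob" using keys_diff[of q p] p by auto
    then show "q - p \<in> K_relations Ob" using kernel q by simp
  qed
  ultimately show ?thesis by auto
qed

text \<open>The series is constant on a coset, and \<open>ev\<close> is its common value.\<close>

definition ev :: "'k kclass \<Rightarrow> real \<Rightarrow> int"
  where "ev P = the_elem (frag_euler ` P)"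

lemma coset_self: "Poly_Mapping.keys p \<subseteq> Ob \<Longrightarrow> p \<in> K_coset Ob p"
  by (simp add: coset_eq)

lemma ev_coset: "Poly_Mapping.keys p \<subseteq> Ob \<Longrightarrow> ev (K_coset Ob p) = frag_euler p"
proof -
  assume p: "Poly_Mapping.keys p \<subseteq> Ob"
  then have "frag_euler ` K_coset Ob p = {frag_euler p}" unfolding coset_eq[OF p] by blast
  then show ?thesis by (simp add: ev_def)
qed

lemma carrier_K: "carrier (K_ring Ob) = K_coset Ob ` {p. Poly_Mapping.keys p \<subseteq> Ob}"
proof -
  have "carrier (K_ring Ob) = (\<Union>p\<in>carrier (free_tensor Ob). {K_coset Ob p})"
    by (simp add: K_ring_def FactRing_def A_RCOSETS_def' K_coset_def)
  then show ?thesis by (auto simp: free_tensor_def)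
qed

lemma carrierE:
  assumes "P \<in> carrier (K_ring Ob)"
  obtains p where "Poly_Mapping.keys p \<subseteq> Ob" "P = K_coset Ob p"
  using assms unfolding carrier_K by blast

lemma ev_bij: "inj_on ev (carrier (K_ring Ob))" "ev ` carrier (K_ring Ob) = I"
proof -
  show "inj_on ev (carrier (K_ring Ob))"
  proof (rule inj_onI)
    fix P Q assume PQ: "P \<in> carrier (K_ring Ob)" "Q \<in> carrier (K_ring Ob)" "ev P = ev Q"
    obtain p q where "Poly_Mapping.keys p \<subseteq> Ob" "P = K_coset Ob p" "Poly_Mapping.keys q \<subseteq> Ob" "Q = K_coset Ob q"
      using PQ(1,2) by (metis carrierE)
    note pq = this
    have "frag_euler p = frag_euler q"
      using PQ(3) unfolding pq(2,4) ev_coset[OF pq(1)] ev_coset[OF pq(3)] .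
    then show "P = Q" unfolding pq(2,4) coset_eq[OF pq(1)] coset_eq[OF pq(3)] by simp
  qed
  have "ev ` carrier (K_ring Ob) = frag_euler ` {p. Poly_Mapping.keys p \<subseteq> Ob}"
    unfolding carrier_K image_image by (rule image_cong) (auto simp: ev_coset)
  then show "ev ` carrier (K_ring Ob) = I" using image by simp
qed

lemma add_coset:
  assumes p: "Poly_Mapping.keys p \<subseteq> Ob" and q: "Poly_Mapping.keys q \<subseteq> Ob"
  shows "K_coset Ob p \<oplus>\<^bsub>K_ring Ob\<^esub> K_coset Ob q = K_coset Ob (p + q)" "Poly_Mapping.keys (p + q) \<subseteq> Ob"
proof -
  show pq: "Poly_Mapping.keys (p + q) \<subseteq> Ob" using keys_add[of p q] p q by auto
  have "x \<in> K_coset Ob (p + q) \<longleftrightarrow> (\<exists>h\<in>K_coset Ob p. \<exists>k\<in>K_coset Ob q. x = h + k)" for x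
  proof
    assume x: "x \<in> K_coset Ob (p + q)"
    then have "x - q \<in> K_coset Ob p"
      unfolding coset_eq[OF pq] coset_eq[OF p] using keys_diff[of x q] q by (auto simp: fun_eq_iff)
    then show "\<exists>h\<in>K_coset Ob p. \<exists>k\<in>K_coset Ob q. x = h + k"
      using coset_self[OF q] by (intro bexI[of _ "x - q"] bexI[of _ q]) auto
  next
    assume "\<exists>h\<in>K_coset Ob p. \<exists>k\<in>K_coset Ob q. x = h + k"
    then obtain h k where "h \<in> K_coset Ob p" "k \<in> K_coset Ob q" "x = h + k" by blast
    then show "x \<in> K_coset Ob (p + q)"
      unfolding coset_eq[OF pq] coset_eq[OF p] coset_eq[OF q] using keys_add[of h k] by (auto simp: fun_eq_iff)
  qed
  then show "K_coset Ob p \<oplus>\<^bsub>K_ring Ob\<^esub> K_coset Ob q = K_coset Ob (p + q)"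
    by (auto simp: K_ring_def FactRing_def set_add_def' free_tensor_def)
qed

lemma zero_coset: "\<zero>\<^bsub>K_ring Ob\<^esub> = K_coset Ob 0"
proof -
  have "K_relations Ob = K_coset Ob 0"
    by (auto simp: K_coset_def a_r_coset_def r_coset_def free_tensor_def)
  then show ?thesis by (simp add: K_ring_def FactRing_def)
qed

lemma ev_add:
  assumes "P \<in> carrier (K_ring Ob)" "Q \<in> carrier (K_ring Ob)"
  shows "P \<oplus>\<^bsub>K_ring Ob\<^esub> Q \<in> carrier (K_ring Ob)" "ev (P \<oplus>\<^bsub>K_ring Ob\<^esub> Q) = ev P \<oplus>\<^bsub>novikov\<^esub> ev Q"
proof -
  obtain p q where pq: "Poly_Mapping.keys p \<subseteq> Ob" "P = K_coset Ob p" "Poly_Mapping.keys q \<subseteq> Ob" "Q = K_coset Ob q"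
    using assms by (metis carrierE)
  note a = add_coset[OF pq(1,3)]
  show "P \<oplus>\<^bsub>K_ring Ob\<^esub> Q \<in> carrier (K_ring Ob)" unfolding pq a(1) using a(2) by (auto simp: carrier_K)
  show "ev (P \<oplus>\<^bsub>K_ring Ob\<^esub> Q) = ev P \<oplus>\<^bsub>novikov\<^esub> ev Q"
    unfolding pq(2,4) a(1) by (auto simp: ev_coset a(2) pq novikov_add)
qed

lemma ev_zero: "\<zero>\<^bsub>K_ring Ob\<^esub> \<in> carrier (K_ring Ob)" "ev \<zero>\<^bsub>K_ring Ob\<^esub> = \<zero>\<^bsub>novikov\<^esub>"
proof -
  have 0: "Poly_Mapping.keys (0 :: 'k fcc \<Rightarrow>\<^sub>0 int) \<subseteq> Ob" by simp
  then show "\<zero>\<^bsub>K_ring Ob\<^esub> \<in> carrier (K_ring Ob)" unfolding zero_coset carrier_K by blast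
  show "ev \<zero>\<^bsub>K_ring Ob\<^esub> = \<zero>\<^bsub>novikov\<^esub>" unfolding zero_coset ev_coset[OF 0] by (rule ext) (simp add: novikov_zero)
qed

lemma class_carrier:
  assumes "C \<in> Ob" shows "K_class Ob C \<in> carrier (K_ring Ob)" "ev (K_class Ob C) = euler_series C"
proof -
  have C: "Poly_Mapping.keys (frag_of C) \<subseteq> Ob" using assms by simp
  then show "K_class Ob C \<in> carrier (K_ring Ob)" unfolding K_class_def carrier_K by blast
  show "ev (K_class Ob C) = euler_series C" unfolding K_class_def ev_coset[OF C] by (rule frag_euler_of')
qed

text \<open>The union that defines products of cosets is a single coset because the class of a product
  is determined by its Euler characteristic series.\<close>

lemma smult_coset:
  assumes O': "K_setting Ob' I'" and closed: "\<And>C D. C \<in> Ob' \<Longrightarrow> D \<in> Ob \<Longrightarrow> C \<otimes>\<^sub>c D \<in> Ob"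
    and p: "Poly_Mapping.keys p \<subseteq> Ob'" and q: "Poly_Mapping.keys q \<subseteq> Ob"
  shows "(\<Union>x\<in>K_coset Ob' p. \<Union>y\<in>K_coset Ob q. K_coset Ob (frag_tensor x y)) = K_coset Ob (frag_tensor p q)"
    "Poly_Mapping.keys (frag_tensor p q) \<subseteq> Ob"
    "frag_euler (frag_tensor p q) = frag_euler p \<otimes>\<^bsub>novikov\<^esub> frag_euler q"
proof -
  interpret O': K_setting Ob' I' by (rule O')
  have k: "Poly_Mapping.keys (frag_tensor x y) \<subseteq> Ob \<and>
      frag_euler (frag_tensor x y) = frag_euler x \<otimes>\<^bsub>novikov\<^esub> frag_euler y"
    if "Poly_Mapping.keys x \<subseteq> Ob'" "Poly_Mapping.keys y \<subseteq> Ob" for x y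
    using frag_tensor_keys[OF closed that] frag_euler_tensor[OF O'.tame tame that] by simp
  show "Poly_Mapping.keys (frag_tensor p q) \<subseteq> Ob"
    "frag_euler (frag_tensor p q) = frag_euler p \<otimes>\<^bsub>novikov\<^esub> frag_euler q"
    using k[OF p q] by auto
  have "K_coset Ob (frag_tensor x y) = K_coset Ob (frag_tensor p q)" if "x \<in> K_coset Ob' p" "y \<in> K_coset Ob q" for x y
  proof -
    have xy: "Poly_Mapping.keys x \<subseteq> Ob'" "frag_euler x = frag_euler p" "Poly_Mapping.keys y \<subseteq> Ob" "frag_euler y = frag_euler q"
      using that unfolding O'.coset_eq[OF p] coset_eq[OF q] by auto
    show ?thesis using k[OF xy(1,3)] k[OF p q] xy(2,4) by (simp add: coset_eq)
  qed
  then show "(\<Union>x\<in>K_coset Ob' p. \<Union>y\<in>K_coset Ob q. K_coset Ob (frag_tensor x y)) = K_coset Ob (frag_tensor p q)"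
    using O'.coset_self[OF p] coset_self[OF q] by blast
qed

lemma incl_coset:
  assumes O': "K_setting Ob' I'" and sub: "Ob \<subseteq> Ob'" and p: "Poly_Mapping.keys p \<subseteq> Ob"
  shows "K_incl Ob' (K_coset Ob p) = K_coset Ob' p"
proof -
  interpret O': K_setting Ob' I' by (rule O')
  have p': "Poly_Mapping.keys p \<subseteq> Ob'" using p sub by blast
  have "K_coset Ob' x = K_coset Ob' p" if "x \<in> K_coset Ob p" for x
  proof -
    have "Poly_Mapping.keys x \<subseteq> Ob'" "frag_euler x = frag_euler p"
      using that sub unfolding coset_eq[OF p] by auto
    then show ?thesis using p' by (simp add: O'.coset_eq)
  qed
  then show ?thesis unfolding K_incl_def using coset_self[OF p] by blast
qed

lemma incl:
  assumes O': "K_setting Ob' I'" and sub: "Ob \<subseteq> Ob'" and P: "P \<in> carrier (K_ring Ob)"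
  shows "K_incl Ob' P \<in> carrier (K_ring Ob')" "K_setting.ev (K_incl Ob' P) = ev P"
proof -
  interpret O': K_setting Ob' I' by (rule O')
  obtain p where p: "Poly_Mapping.keys p \<subseteq> Ob" "P = K_coset Ob p" using P by (rule carrierE)
  have p': "Poly_Mapping.keys p \<subseteq> Ob'" using p sub by blast
  show "K_incl Ob' P \<in> carrier (K_ring Ob')"
    unfolding p(2) incl_coset[OF O' sub p(1)] O'.carrier_K using p' by blast
  show "O'.ev (K_incl Ob' P) = ev P"
    unfolding p(2) incl_coset[OF O' sub p(1)] O'.ev_coset[OF p'] ev_coset[OF p(1)] ..
qed

end

locale K_ring_setting = K_setting +
  assumes tensor: "C \<in> Ob \<Longrightarrow> D \<in> Ob \<Longrightarrow> C \<otimes>\<^sub>c D \<in> Ob" and unit: "E1 0 \<in> Ob"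
begin

lemma mult_coset:
  assumes "Poly_Mapping.keys p \<subseteq> Ob" "Poly_Mapping.keys q \<subseteq> Ob"
  shows "K_coset Ob p \<otimes>\<^bsub>K_ring Ob\<^esub> K_coset Ob q = K_coset Ob (frag_tensor p q)"
proof -
  have "K_coset Ob p \<otimes>\<^bsub>K_ring Ob\<^esub> K_coset Ob q =
      (\<Union>x\<in>K_coset Ob p. \<Union>y\<in>K_coset Ob q. K_coset Ob (frag_tensor x y))"
    by (simp add: K_ring_def FactRing_def rcoset_mult_def K_coset_def free_tensor_def)
  then show ?thesis using smult_coset(1)[OF K_setting_axioms tensor assms] by simp
qed

lemma ev_mult:
  assumes "P \<in> carrier (K_ring Ob)" "Q \<in> carrier (K_ring Ob)"
  shows "P \<otimes>\<^bsub>K_ring Ob\<^esub> Q \<in> carrier (K_ring Ob)" "ev (P \<otimes>\<^bsub>K_ring Ob\<^esub> Q) = ev P \<otimes>\<^bsub>novikov\<^esub> ev Q"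
proof -
  obtain p q where pq: "Poly_Mapping.keys p \<subseteq> Ob" "P = K_coset Ob p" "Poly_Mapping.keys q \<subseteq> Ob" "Q = K_coset Ob q"
    using assms by (metis carrierE)
  note m = mult_coset[OF pq(1,3)] smult_coset(2,3)[OF K_setting_axioms tensor pq(1,3)]
  show "P \<otimes>\<^bsub>K_ring Ob\<^esub> Q \<in> carrier (K_ring Ob)" unfolding pq m(1) carrier_K using m(2) by blast
  show "ev (P \<otimes>\<^bsub>K_ring Ob\<^esub> Q) = ev P \<otimes>\<^bsub>novikov\<^esub> ev Q"
    unfolding pq(2,4) m(1) by (simp add: ev_coset m(2,3) pq)
qed

lemma one_class: "\<one>\<^bsub>K_ring Ob\<^esub> = K_class Ob (E1 0)"
  by (simp add: K_ring_def FactRing_def K_class_def K_coset_def free_tensor_def)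

lemma mult_class: "C \<in> Ob \<Longrightarrow> D \<in> Ob \<Longrightarrow> K_class Ob C \<otimes>\<^bsub>K_ring Ob\<^esub> K_class Ob D = K_class Ob (C \<otimes>\<^sub>c D)"
  unfolding K_class_def by (subst mult_coset) (simp_all add: frag_tensor_simps)

end

lemma E1:
  "E1 a \<in> (fg_complexes :: 'k::field fcc set)" "euler_series (E1 a :: 'k fcc) = tpow a"
proof -
  let ?e = "Poly_Mapping.single 0 1 :: 'k vec" and ?C = "E1 a :: 'k fcc"
  have e0: "?e \<noteq> 0" by (metis lookup_single_eq lookup_zero zero_neq_one)
  have ind: "vec.independent {?e}" using e0 by simp
  have main: "filtered_complex ?C \<and> obasis ?C {?e} \<and> total ?C = vec.span {?e} \<and>
    (\<forall>b\<in>{?e}. hdeg ?C b = 0 \<and> lev ?C b = ereal a)"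
  proof (rule filtered_complexI_span[OF ind])
    fix i :: int
    have "{b. b = ?e \<and> 0 = i} = (if i = 0 then {?e} else {})" by auto
    then show "grade ?C i = vec.span {b \<in> {?e}. 0 = i}" by (simp add: E1_def)
  next
    fix x M assume x: "x \<in> vec.span {?e}"
    show "lev ?C x \<le> M \<longleftrightarrow> x \<in> vec.span {b \<in> {?e}. ereal a \<le> M}"
    proof (cases "ereal a \<le> M")
      case True
      then have "{b \<in> {?e}. ereal a \<le> M} = {?e}" by auto
      then show ?thesis using x True by (simp add: E1_def)
    next
      case False
      then have "{b \<in> {?e}. ereal a \<le> M} = {}" by auto
      then show ?thesis using False by (simp add: E1_def)
    qed
  qed (simp_all add: E1_def linear_on_set_def vec.span_zero)
  then have fc: "filtered_complex ?C" and ob: "obasis ?C {?e}" and tot: "total ?C = vec.span {?e}"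
    and hl: "hdeg ?C ?e = 0" "lev ?C ?e = ereal a" by auto
  show fg: "?C \<in> fg_complexes"
    using fc finite_dim_span[of "{?e}"] by (simp add: fg_complexes_def tot)
  then have t: "tame ?C" by (simp add: fg_complexes_eq complexes_with_levels_def)
  show "euler_series ?C = tpow a"
  proof
    fix c
    have "{b \<in> {?e}. lev ?C b = ereal c} = (if c = a then {?e} else {})" using hl by auto
    then have "euler_series ?C c = (\<Sum>b\<in>(if c = a then {?e} else {}). deg_sign (hdeg ?C b))"
      unfolding obasis_euler_series[OF t ob] by (rule sum.cong) (rule refl)
    also have "\<dots> = (if c = a then deg_sign (hdeg ?C ?e) else 0)" by simp
    also have "\<dots> = tpow a c" unfolding hl(1) by (simp add: tpow_def)
    finally show "euler_series ?C c = tpow a c" .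
  qed
qed

text \<open>The positive and the negative part of \<open>f\<close> count the generators, in degree 0, of two complexes
  with zero differential.\<close>

lemma realize_series:
  assumes f: "f \<in> carrier novikov"
  obtains C D :: "'k::field fcc" where "tame C" "tame D" "levels C \<subseteq> {a. f a \<noteq> 0}" "levels D \<subseteq> {a. f a \<noteq> 0}"
    "\<And>a. euler_series C a - euler_series D a = f a"
proof -
  have ex: "\<exists>C :: 'k fcc. tame C \<and> levels C \<subseteq> {a. g a \<noteq> 0} \<and> (\<forall>a. euler_series C a = int (g a))"
    if g: "\<And>r. finite {a. a \<le> r \<and> g a \<noteq> (0 :: nat)}" for g
  proof -
    let ?N = "\<lambda>i a. if i = (0 :: int) then g a else 0"
    have "locally_finite ?N"
      unfolding locally_finite_def
    proof
      fix r
      have "{(i, a). a \<le> r \<and> ?N i a \<noteq> 0} \<subseteq> {0} \<times> {a. a \<le> r \<and> g a \<noteq> 0}" by (auto split: if_splits)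
      then show "finite {(i, a). a \<le> r \<and> ?N i a \<noteq> 0}" using g[of r] by (meson finite.emptyI finite.insertI finite_SigmaI finite_subset)
    qed
    then obtain C :: "'k fcc" where C: "tame C" "\<And>i a. betti C i a = ?N i a" by (rule zero_bdry_model) (rule that)
    have "levels C \<subseteq> {a. g a \<noteq> 0}"
      using levels_betti[OF C(1)] C(2) by (auto split: if_splits)
    moreover have "euler_series C a = int (g a)" for a
      using euler_series_betti[OF C(1), of "{0}" a] C(2) by simp
    ultimately show ?thesis using C(1) by blast
  qed
  have fin: "finite {a. a \<le> r \<and> nat (f a) \<noteq> 0}" "finite {a. a \<le> r \<and> nat (- f a) \<noteq> 0}" for r
    by (rule finite_subset[of _ "{a. a \<le> r \<and> f a \<noteq> 0}"]; use f in \<open>auto simp: novikov_carrier\<close>)+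
  obtain C D :: "'k fcc" where CD: "tame C" "levels C \<subseteq> {a. nat (f a) \<noteq> 0}" "\<And>a. euler_series C a = int (nat (f a))"
      "tame D" "levels D \<subseteq> {a. nat (- f a) \<noteq> 0}" "\<And>a. euler_series D a = int (nat (- f a))"
    using ex[OF fin(1)] ex[OF fin(2)] by blast
  show thesis by (rule that[OF CD(1,4)]) (use CD(2,3,5,6) in auto)
qed

lemma keys_frag_diff: "C \<in> Ob \<Longrightarrow> D \<in> Ob \<Longrightarrow> Poly_Mapping.keys (frag_of C - frag_of D) \<subseteq> Ob"
  using keys_diff[of "frag_of C" "frag_of D"] by auto

lemma K_setting_tame: "K_ring_setting (tame_complexes :: 'k::field fcc set) (carrier novikov)"
proof
  let ?Ob = "tame_complexes :: 'k fcc set"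
  show tame: "tame X" if "X \<in> ?Ob" for X using that unfolding tame_complexes_eq by (simp add: complexes_with_levels_def)
  show "p \<in> K_relations ?Ob \<longleftrightarrow> (\<forall>a. frag_euler p a = 0)" if "Poly_Mapping.keys p \<subseteq> ?Ob" for p
    using that unfolding tame_complexes_eq by (intro K_relations_iff) auto
  show "frag_euler ` {p. Poly_Mapping.keys p \<subseteq> ?Ob} = carrier novikov"
  proof
    show "frag_euler ` {p. Poly_Mapping.keys p \<subseteq> ?Ob} \<subseteq> carrier novikov"
      using frag_euler_carrier[of ?Ob, OF tame] by blast
    show "carrier novikov \<subseteq> frag_euler ` {p. Poly_Mapping.keys p \<subseteq> ?Ob}"
    proof
      fix f assume "f \<in> carrier novikov"
      then obtain C D :: "'k fcc" where CD: "tame C" "tame D" "\<And>a. euler_series C a - euler_series D a = f a"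
        by (rule realize_series) (rule that)
      have Ob: "C \<in> ?Ob" "D \<in> ?Ob" using CD unfolding tame_complexes_eq by (auto simp: complexes_with_levels_def)
      have "f = frag_euler (frag_of C - frag_of D)" by (rule ext) (simp add: CD)
      then show "f \<in> frag_euler ` {p. Poly_Mapping.keys p \<subseteq> ?Ob}"
        by (rule image_eqI) (rule CollectI, rule keys_frag_diff[OF Ob])
    qed
  qed
  show "C \<in> ?Ob \<Longrightarrow> D \<in> ?Ob \<Longrightarrow> C \<otimes>\<^sub>c D \<in> ?Ob" for C D by (rule tensor_closed(1))
  show "E1 0 \<in> ?Ob" using E1(1) unfolding tame_complexes_eq fg_complexes_eq by (auto simp: complexes_with_levels_def)
qed

lemma frag_euler_poly:
  assumes "Poly_Mapping.keys p \<subseteq> fg_complexes" shows "frag_euler p \<in> carrier novikov_poly"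
  using assms
proof (induction p rule: frag_induction)
  case zero
  then show ?case by (simp add: novikov_poly_simps)
next
  case (one C)
  then have "tame C" "finite (levels C)" unfolding fg_complexes_eq by (auto simp: complexes_with_levels_def)
  then show ?case
    unfolding novikov_poly_simps frag_euler_of'
    using euler_series_nonzero_level[of C] by (auto intro: finite_subset[of _ "levels C"])
next
  case (diff a b)
  then show ?case
    unfolding novikov_poly_simps frag_euler_diff'
    by (rule_tac finite_subset[of _ "{c. frag_euler a c \<noteq> 0} \<union> {c. frag_euler b c \<noteq> 0}"]) auto
qed

lemma K_setting_fg: "K_ring_setting (fg_complexes :: 'k::field fcc set) (carrier novikov_poly)"
proof
  let ?Ob = "fg_complexes :: 'k fcc set"
  show tame: "tame X" if "X \<in> ?Ob" for X using that unfolding fg_complexes_eq by (simp add: complexes_with_levels_def)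
  show "p \<in> K_relations ?Ob \<longleftrightarrow> (\<forall>a. frag_euler p a = 0)" if "Poly_Mapping.keys p \<subseteq> ?Ob" for p
    using that unfolding fg_complexes_eq by (intro K_relations_iff) (auto intro: finite_subset)
  show "frag_euler ` {p. Poly_Mapping.keys p \<subseteq> ?Ob} = carrier novikov_poly"
  proof
    show "frag_euler ` {p. Poly_Mapping.keys p \<subseteq> ?Ob} \<subseteq> carrier novikov_poly"
      using frag_euler_poly by blast
    show "carrier novikov_poly \<subseteq> frag_euler ` {p. Poly_Mapping.keys p \<subseteq> ?Ob}"
    proof
      fix f assume f: "f \<in> carrier novikov_poly"
      obtain C D :: "'k fcc" where CD: "tame C" "tame D" "levels C \<subseteq> {a. f a \<noteq> 0}" "levels D \<subseteq> {a. f a \<noteq> 0}"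
          "\<And>a. euler_series C a - euler_series D a = f a"
        using novikov_poly_carrier[OF f] by (rule realize_series) (rule that)
      have Ob: "C \<in> ?Ob" "D \<in> ?Ob"
        using CD f unfolding fg_complexes_eq novikov_poly_simps by (auto simp: complexes_with_levels_def intro: finite_subset)
      have "f = frag_euler (frag_of C - frag_of D)" by (rule ext) (simp add: CD)
      then show "f \<in> frag_euler ` {p. Poly_Mapping.keys p \<subseteq> ?Ob}"
        by (rule image_eqI) (rule CollectI, rule keys_frag_diff[OF Ob])
    qed
  qed
  show "C \<in> ?Ob \<Longrightarrow> D \<in> ?Ob \<Longrightarrow> C \<otimes>\<^sub>c D \<in> ?Ob" for C D by (rule tensor_closed(2))
  show "E1 0 \<in> ?Ob" by (rule E1(1))
qed

lemma novikov_poly0_diff: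
  assumes "f \<in> novikov_poly0" "g \<in> novikov_poly0" shows "(\<lambda>a. f a - g a) \<in> novikov_poly0"
proof -
  have "(\<lambda>a. - g a) \<in> novikov_poly0"
    using assms(2) by (simp add: novikov_poly0_def novikov_poly_simps value_at_one_def sum_negf)
  then have "(\<lambda>a. f a + - g a) \<in> novikov_poly0"
    using assms(1) unfolding novikov_poly0_def by (simp only: mem_Collect_eq novikov_poly_add_closed value_at_one_add simp_thms add_0)
  then show ?thesis by simp
qed

text \<open>Surjectivity onto \<open>novikov_poly0\<close>: the level cones of two complexes realise any finite series
  up to a multiple of \<open>t\<^sup>m\<close>, which is then determined by the value at 1.\<close>

lemma K_setting_acyclic: "K_setting (acyclic_fg_complexes :: 'k::field fcc set) novikov_poly0"
proof
  let ?Ob = "acyclic_fg_complexes :: 'k fcc set"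
  have fg: "?Ob \<subseteq> fg_complexes" by (auto simp: acyclic_fg_complexes_def)
  show tame: "tame X" if "X \<in> ?Ob" for X
    using that fg unfolding fg_complexes_eq by (auto simp: complexes_with_levels_def)
  show "p \<in> K_relations ?Ob \<longleftrightarrow> (\<forall>a. frag_euler p a = 0)" if "Poly_Mapping.keys p \<subseteq> ?Ob" for p
    by (rule K_relations_acyclic_iff[OF that])
  have sub: "frag_euler p \<in> novikov_poly0" if "Poly_Mapping.keys p \<subseteq> ?Ob" for p
    using that
  proof (induction p rule: frag_induction)
    case zero
    then show ?case by (simp add: novikov_poly0_def novikov_poly_simps value_at_one_def)
  next
    case (one C)
    then show ?case
      using acyclic_euler_total[OF one] by (simp add: novikov_poly0_def novikov_poly_simps value_at_one_def frag_euler_of')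
  next
    case (diff a b)
    then show ?case unfolding frag_euler_diff' by (rule novikov_poly0_diff)
  qed
  show "frag_euler ` {p. Poly_Mapping.keys p \<subseteq> ?Ob} = novikov_poly0"
  proof
    show "frag_euler ` {p. Poly_Mapping.keys p \<subseteq> ?Ob} \<subseteq> novikov_poly0" using sub by blast
    show "novikov_poly0 \<subseteq> frag_euler ` {p. Poly_Mapping.keys p \<subseteq> ?Ob}"
    proof
      fix f assume f0: "f \<in> novikov_poly0"
      then have f: "f \<in> carrier novikov_poly" by (simp add: novikov_poly0_def)
      then have ff: "finite {a. f a \<noteq> 0}" by (simp add: novikov_poly_simps)
      obtain C D :: "'k fcc" where CD: "tame C" "tame D" "levels C \<subseteq> {a. f a \<noteq> 0}" "levels D \<subseteq> {a. f a \<noteq> 0}"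
          "\<And>a. euler_series C a - euler_series D a = f a"
        using novikov_poly_carrier[OF f] by (rule realize_series) (rule that)
      define m where "m = Min (insert 0 {a. f a \<noteq> 0})"
      have m: "m \<le> a" if "f a \<noteq> 0" for a unfolding m_def using ff that by simp
      have L: "C \<in> complexes_with_levels (levels_above m)" "D \<in> complexes_with_levels (levels_above m)"
        using CD(1-4) m finite_subset[OF _ ff] by (auto simp: complexes_with_levels_def levels_above_def)
      have lc: "euler_series (level_cone m E) a = euler_series (flatten m E) a - euler_series E a"
        if "E \<in> complexes_with_levels (levels_above m)" "tame E" for E :: "'k fcc" and a
        unfolding level_cone_def by (rule cone_tame(4)[OF that(2) flatten_tame(1,3)[OF that(1)]])
      have fl: "euler_series (flatten m E) a = 0" if E: "E \<in> complexes_with_levels (levels_above m)" and "a \<noteq> m" for E :: "'k fcc" and a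
      proof (rule ccontr)
        assume "euler_series (flatten m E) a \<noteq> 0"
        then have "a \<in> levels (flatten m E)" by (rule euler_series_nonzero_level[OF flatten_tame(1)[OF E]])
        then show False using \<open>a \<noteq> m\<close> by (auto simp: levels_def split: if_splits)
      qed
      let ?p = "frag_of (level_cone m D) - frag_of (level_cone m C)"
      let ?k = "\<lambda>a. f a - frag_euler ?p a"
      have kp: "Poly_Mapping.keys ?p \<subseteq> ?Ob" by (intro keys_frag_diff level_cone_acyclic L)
      have k0: "?k a = 0" if "a \<noteq> m" for a
        using CD(5)[of a] lc[OF L(1) CD(1), of a] lc[OF L(2) CD(2), of a] fl[OF L(1) that] fl[OF L(2) that] by simp
      have "?k \<in> novikov_poly0" by (rule novikov_poly0_diff[OF f0 sub[OF kp]])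
      then have "value_at_one ?k = 0" by (simp add: novikov_poly0_def)
      moreover have "value_at_one ?k = (\<Sum>a\<in>{m}. ?k a)" by (rule value_at_one_superset) (use k0 in auto)
      ultimately have "?k m = 0" by simp
      then have "?k a = 0" for a using k0 by (cases "a = m") auto
      then have "f = frag_euler ?p" by (intro ext) simp
      then show "f \<in> frag_euler ` {p. Poly_Mapping.keys p \<subseteq> ?Ob}" using kp by blast
    qed
  qed
qed

lemma ring_iso_restrict:
  assumes "f \<in> ring_iso R S" "\<And>x. x \<in> carrier R \<Longrightarrow> g x = f x" "ring R"
  shows "g \<in> ring_iso R S"
proof -
  interpret ring R by fact
  have "bij_betw f (carrier R) (carrier S)" using assms(1) by (simp add: ring_iso_def)
  then have "bij_betw g (carrier R) (carrier S)"
    by (rule bij_betw_cong[THEN iffD1, rotated]) (simp add: assms(2))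
  then show ?thesis
    using assms(1) unfolding ring_iso_def by (simp add: ring_hom_def assms(2) Pi_def)
qed

lemma (in K_ring_setting) cring_K_ring:
  assumes "cring S" "carrier S = I" "mult S = mult novikov" "add S = add novikov"
    "\<one>\<^bsub>S\<^esub> = \<one>\<^bsub>novikov\<^esub>" "\<zero>\<^bsub>S\<^esub> = \<zero>\<^bsub>novikov\<^esub>"
  shows "cring (K_ring Ob)" "ev \<in> ring_iso (K_ring Ob) S"
proof -
  have one: "\<one>\<^bsub>K_ring Ob\<^esub> \<in> carrier (K_ring Ob)" "ev \<one>\<^bsub>K_ring Ob\<^esub> = \<one>\<^bsub>S\<^esub>"
    unfolding one_class using class_carrier[OF unit] E1(2)[of 0] by (auto simp: assms novikov_one)
  show "cring (K_ring Ob)"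
    by (rule cring_pullback[where h = ev, OF assms(1)])
      (auto simp: ev_bij ev_add ev_mult ev_zero one assms)
  show "ev \<in> ring_iso (K_ring Ob) S"
    unfolding ring_iso_def bij_betw_def
    by (auto simp: ev_bij ev_add ev_mult one assms intro!: ring_hom_memI) (use ev_bij(2) in blast)+
qed

theorem theorem4p1p2:
  fixes Ct Cfg ACfg :: "'k::field fcc set"
  defines "Ct \<equiv> tame_complexes" and "Cfg \<equiv> fg_complexes" and "ACfg \<equiv> acyclic_fg_complexes"
  shows
    \<comment> \<open>the tensor product induces ring structures on K(Ct) and K(Cfg)\<close>
    "(\<forall>Ob \<in> {Ct, Cfg}.
       ring (K_ring Ob) \<and>
       \<one>\<^bsub>K_ring Ob\<^esub> = K_class Ob (E1 0) \<and>
       (\<forall>C\<in>Ob. \<forall>D\<in>Ob. C \<otimes>\<^sub>c D \<in> Ob \<and>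
          K_class Ob C \<otimes>\<^bsub>K_ring Ob\<^esub> K_class Ob D = K_class Ob (C \<otimes>\<^sub>c D))) \<and>
     (\<exists>lam.
       \<comment> \<open>(1)\<close>
       lam \<in> ring_iso (K_ring Ct) novikov \<and>
       (\<forall>a. lam (K_class Ct (E1 a)) = tpow a) \<and>
       (\<forall>lam' \<in> ring_iso (K_ring Ct) novikov.
          (\<forall>a. lam' (K_class Ct (E1 a)) = tpow a) \<longrightarrow>
          (\<forall>x \<in> carrier (K_ring Ct). lam' x = lam x)) \<and>
       \<comment> \<open>(2)\<close>
       Cfg \<subseteq> Ct \<and>
       K_incl Ct \<in> ring_hom (K_ring Cfg) (K_ring Ct) \<and>
       (\<forall>C\<in>Cfg. K_incl Ct (K_class Cfg C) = K_class Ct C) \<and>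
       (lam \<circ> K_incl Ct) ` carrier (K_ring Cfg) \<subseteq> carrier novikov_poly \<and>
       lam \<circ> K_incl Ct \<in> ring_iso (K_ring Cfg) novikov_poly \<and>
       \<comment> \<open>(3), with \<open>mu\<close> the isomorphism of (2)\<close>
       K_incl Cfg \<in> hom (add_monoid (K_ring ACfg)) (add_monoid (K_ring Cfg)) \<and>
       (\<forall>C\<in>ACfg. K_incl Cfg (K_class ACfg C) = K_class Cfg C) \<and>
       Module.module (K_ring Cfg) (K_module ACfg) \<and>
       (\<forall>C\<in>Cfg. \<forall>D\<in>ACfg. C \<otimes>\<^sub>c D \<in> ACfg \<and>
          K_class Cfg C \<odot>\<^bsub>K_module ACfg\<^esub> K_class ACfg D = K_class ACfg (C \<otimes>\<^sub>c D)) \<and>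
       ideal novikov_poly0 novikov_poly \<and>
       Module.module novikov_poly novikov_poly0_module \<and>
       (let mu = lam \<circ> K_incl Ct in
          (mu \<circ> K_incl Cfg) ` carrier (K_ring ACfg) \<subseteq> novikov_poly0 \<and>
          mu \<circ> K_incl Cfg
            \<in> iso (add_monoid (K_module ACfg)) (add_monoid novikov_poly0_module) \<and>
          (\<forall>r \<in> carrier (K_ring Cfg). \<forall>x \<in> carrier (K_module ACfg).
             (mu \<circ> K_incl Cfg) (r \<odot>\<^bsub>K_module ACfg\<^esub> x) =
             mu r \<odot>\<^bsub>novikov_poly0_module\<^esub> (mu \<circ> K_incl Cfg) x)))"
proof -
  let ?Ct = "tame_complexes :: 'k fcc set" and ?Cfg = "fg_complexes :: 'k fcc set"
    and ?AC = "acyclic_fg_complexes :: 'k fcc set"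
  interpret T: K_ring_setting ?Ct "carrier novikov" by (rule K_setting_tame)
  interpret F: K_ring_setting ?Cfg "carrier novikov_poly" by (rule K_setting_fg)
  interpret A: K_setting ?AC novikov_poly0 by (rule K_setting_acyclic)
  note T = T.cring_K_ring[OF cring_novikov refl refl refl refl refl]
  note F = F.cring_K_ring[OF cring_novikov_poly refl novikov_poly_simps(1-4)]
  interpret KT: cring "K_ring ?Ct" by (rule T(1))
  interpret KF: cring "K_ring ?Cfg" by (rule F(1))
  interpret N: cring novikov by (rule cring_novikov)
  interpret P: cring novikov_poly by (rule cring_novikov_poly)
  interpret M: Module.module novikov_poly novikov_poly0_module by (rule module_novikov_poly0)
  have FT: "?Cfg \<subseteq> ?Ct"
    unfolding fg_complexes_eq tame_complexes_eq by (auto simp: complexes_with_levels_def)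
  have AF: "?AC \<subseteq> ?Cfg" by (auto simp: acyclic_fg_complexes_def)
  note iF = F.incl[OF T.K_setting_axioms FT] and iA = A.incl[OF F.K_setting_axioms AF]
  have iFe: "T.ev (K_incl ?Ct P) = F.ev P" if "P \<in> carrier (K_ring ?Cfg)" for P
    using iF(2)[OF that] .
  have iAe: "F.ev (K_incl ?Cfg P) = A.ev P" if "P \<in> carrier (K_ring ?AC)" for P
    using iA(2)[OF that] .
  (* identities between classes are verified on their Euler characteristic series *)
  have inj: "x = y" if "x \<in> carrier (K_ring ?Ct)" "y \<in> carrier (K_ring ?Ct)" "T.ev x = T.ev y" for x y
    using inj_onD[OF T.ev_bij(1) that(3,1,2)] .
  have injF: "x = y" if "x \<in> carrier (K_ring ?Cfg)" "y \<in> carrier (K_ring ?Cfg)" "F.ev x = F.ev y" for x y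
    using inj_onD[OF F.ev_bij(1) that(3,1,2)] .
  have injA: "x = y" if "x \<in> carrier (K_ring ?AC)" "y \<in> carrier (K_ring ?AC)" "A.ev x = A.ev y" for x y
    using inj_onD[OF A.ev_bij(1) that(3,1,2)] .
  have E1T: "E1 a \<in> ?Ct" for a using E1(1) FT by blast

  have rings: "\<forall>Ob \<in> {?Ct, ?Cfg}. ring (K_ring Ob) \<and> \<one>\<^bsub>K_ring Ob\<^esub> = K_class Ob (E1 0) \<and>
      (\<forall>C\<in>Ob. \<forall>D\<in>Ob. C \<otimes>\<^sub>c D \<in> Ob \<and>
        K_class Ob C \<otimes>\<^bsub>K_ring Ob\<^esub> K_class Ob D = K_class Ob (C \<otimes>\<^sub>c D))"
    using KT.ring_axioms KF.ring_axioms T.one_class F.one_class T.tensor F.tensor T.mult_class F.mult_class by blast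

  have lamE: "\<forall>a. T.ev (K_class ?Ct (E1 a)) = tpow a"
    using T.class_carrier(2)[OF E1T] E1(2) by metis
  have uniq: "\<forall>lam' \<in> ring_iso (K_ring ?Ct) novikov. (\<forall>a. lam' (K_class ?Ct (E1 a)) = tpow a) \<longrightarrow>
      (\<forall>x \<in> carrier (K_ring ?Ct). lam' x = T.ev x)"
  proof (intro ballI impI)
    fix lam' x
    assume lam': "lam' \<in> ring_iso (K_ring ?Ct) novikov" "\<forall>a. lam' (K_class ?Ct (E1 a)) = tpow a"
      and x: "x \<in> carrier (K_ring ?Ct)"
    (* composing lam' with the inverse of T.ev gives an endomorphism of the Novikov ring *)
    let ?inv = "inv_into (carrier (K_ring ?Ct)) T.ev"
    have "?inv \<in> ring_iso novikov (K_ring ?Ct)" by (rule ring_iso_set_sym[OF KT.ring_axioms T(2)])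
    then have hom: "lam' \<circ> ?inv \<in> ring_hom novikov novikov"
      using lam'(1) by (intro ring_hom_trans) (auto simp: ring_iso_def)
    have inv: "?inv (T.ev y) = y" if "y \<in> carrier (K_ring ?Ct)" for y
      by (rule inv_into_f_f[OF T.ev_bij(1) that])
    have "(lam' \<circ> ?inv) (T.ev x) = T.ev x"
    proof (rule novikov_endomorphism_unique[OF hom])
      show "(lam' \<circ> ?inv) (tpow a) = tpow a" for a
        using inv[OF T.class_carrier(1)[OF E1T[of a]]] lamE lam'(2) by (metis comp_apply)
      show "T.ev x \<in> carrier novikov" using x T.ev_bij(2) by blast
    qed
    then show "lam' x = T.ev x" using inv[OF x] by simp
  qed

  have inclF: "K_incl ?Ct \<in> ring_hom (K_ring ?Cfg) (K_ring ?Ct)"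
  proof (rule ring_hom_memI)
    fix P assume P: "P \<in> carrier (K_ring ?Cfg)"
    show "K_incl ?Ct P \<in> carrier (K_ring ?Ct)" by (rule iF(1)[OF P])
    fix Q assume Q: "Q \<in> carrier (K_ring ?Cfg)"
    show "K_incl ?Ct (P \<otimes>\<^bsub>K_ring ?Cfg\<^esub> Q) = K_incl ?Ct P \<otimes>\<^bsub>K_ring ?Ct\<^esub> K_incl ?Ct Q"
      by (rule inj) (simp_all add: iF(1) iFe P Q F.ev_mult T.ev_mult)
    show "K_incl ?Ct (P \<oplus>\<^bsub>K_ring ?Cfg\<^esub> Q) = K_incl ?Ct P \<oplus>\<^bsub>K_ring ?Ct\<^esub> K_incl ?Ct Q"
      by (rule inj) (simp_all add: iF(1) iFe P Q F.ev_add T.ev_add)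
  next
    have "K_incl ?Ct (K_class ?Cfg (E1 0)) = K_class ?Ct (E1 0)"
      by (rule inj) (simp_all add: iF(1) iFe E1(1) E1T F.class_carrier T.class_carrier)
    then show "K_incl ?Ct \<one>\<^bsub>K_ring ?Cfg\<^esub> = \<one>\<^bsub>K_ring ?Ct\<^esub>" unfolding F.one_class T.one_class .
  qed
  have classF: "\<forall>C\<in>?Cfg. K_incl ?Ct (K_class ?Cfg C) = K_class ?Ct C"
  proof
    fix C assume C: "C \<in> ?Cfg"
    then show "K_incl ?Ct (K_class ?Cfg C) = K_class ?Ct C"
      using FT by (intro inj) (auto simp: iF(1) iFe F.class_carrier T.class_carrier)
  qed
  have valF: "(T.ev \<circ> K_incl ?Ct) ` carrier (K_ring ?Cfg) \<subseteq> carrier novikov_poly"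
    using iFe F.ev_bij(2) by fastforce
  have isoF: "T.ev \<circ> K_incl ?Ct \<in> ring_iso (K_ring ?Cfg) novikov_poly"
    by (rule ring_iso_restrict[OF F(2) _ KF.ring_axioms]) (simp add: iFe)

  have homA: "K_incl ?Cfg \<in> hom (add_monoid (K_ring ?AC)) (add_monoid (K_ring ?Cfg))"
  proof (rule homI)
    fix P assume P: "P \<in> carrier (add_monoid (K_ring ?AC))"
    then show "K_incl ?Cfg P \<in> carrier (add_monoid (K_ring ?Cfg))" using iA(1) by simp
    fix Q assume Q: "Q \<in> carrier (add_monoid (K_ring ?AC))"
    show "K_incl ?Cfg (P \<otimes>\<^bsub>add_monoid (K_ring ?AC)\<^esub> Q) = K_incl ?Cfg P \<otimes>\<^bsub>add_monoid (K_ring ?Cfg)\<^esub> K_incl ?Cfg Q"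
      using P Q by (intro injF) (simp_all add: iA(1) iAe F.ev_add A.ev_add)
  qed
  have classA: "\<forall>C\<in>?AC. K_incl ?Cfg (K_class ?AC C) = K_class ?Cfg C"
  proof
    fix C assume C: "C \<in> ?AC"
    then show "K_incl ?Cfg (K_class ?AC C) = K_class ?Cfg C"
      using AF by (intro injF) (auto simp: iA(1) iAe F.class_carrier A.class_carrier)
  qed
  have sm: "r \<odot>\<^bsub>K_module ?AC\<^esub> x \<in> carrier (K_ring ?AC) \<and>
      A.ev (r \<odot>\<^bsub>K_module ?AC\<^esub> x) = F.ev r \<otimes>\<^bsub>novikov\<^esub> A.ev x"
    if r: "r \<in> carrier (K_ring ?Cfg)" and x: "x \<in> carrier (K_ring ?AC)" for r x
  proof -
    obtain p where p: "Poly_Mapping.keys p \<subseteq> ?Cfg" "r = K_coset ?Cfg p" using r by (rule F.carrierE)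
    obtain q where q: "Poly_Mapping.keys q \<subseteq> ?AC" "x = K_coset ?AC q" using x by (rule A.carrierE)
    note s = A.smult_coset[OF F.K_setting_axioms tensor_closed(3) p(1) q(1)]
    have "r \<odot>\<^bsub>K_module ?AC\<^esub> x = K_coset ?AC (frag_tensor p q)"
      unfolding p(2) q(2) using s(1) by (simp add: K_module_def)
    then show ?thesis
      unfolding p(2) q(2) A.carrier_K using s(2,3) p(1) q(1) by (auto simp: A.ev_coset F.ev_coset)
  qed
  have smclass: "\<forall>C\<in>?Cfg. \<forall>D\<in>?AC. C \<otimes>\<^sub>c D \<in> ?AC \<and>
      K_class ?Cfg C \<odot>\<^bsub>K_module ?AC\<^esub> K_class ?AC D = K_class ?AC (C \<otimes>\<^sub>c D)"
  proof (intro ballI conjI)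
    fix C D assume C: "C \<in> ?Cfg" and D: "D \<in> ?AC"
    show CD: "C \<otimes>\<^sub>c D \<in> ?AC" by (rule tensor_closed(3)[OF C D])
    have t: "tame C" "tame D" using F.tame[OF C] A.tame[OF D] by auto
    note s = sm[OF F.class_carrier(1)[OF C] A.class_carrier(1)[OF D]]
    show "K_class ?Cfg C \<odot>\<^bsub>K_module ?AC\<^esub> K_class ?AC D = K_class ?AC (C \<otimes>\<^sub>c D)"
      by (rule injA) (use s C D CD in \<open>auto simp: F.class_carrier A.class_carrier tensor_tame(3)[OF t]\<close>)
  qed
  have MK: "carrier (K_module ?AC) = carrier (K_ring ?AC)" "add (K_module ?AC) = add (K_ring ?AC)"
    "\<zero>\<^bsub>K_module ?AC\<^esub> = \<zero>\<^bsub>K_ring ?AC\<^esub>"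
    by (simp_all add: K_module_def)
  have M0: "carrier novikov_poly0_module = novikov_poly0" "add novikov_poly0_module = add novikov"
    "\<zero>\<^bsub>novikov_poly0_module\<^esub> = \<zero>\<^bsub>novikov\<^esub>" "smult novikov_poly0_module = mult novikov"
    by (simp_all add: novikov_poly0_module_def)
  have evA: "A.ev x \<in> carrier novikov" "A.ev x \<in> novikov_poly0" if "x \<in> carrier (K_ring ?AC)" for x
    using that A.ev_bij(2) novikov_poly_carrier by (auto simp: novikov_poly0_def)
  have evF: "F.ev x \<in> carrier novikov" if "x \<in> carrier (K_ring ?Cfg)" for x
    using that F.ev_bij(2) novikov_poly_carrier by blast
  have moduleA: "Module.module (K_ring ?Cfg) (K_module ?AC)"
  proof (rule moduleI[OF F(1)], unfold MK)
    show "abelian_group (K_module ?AC)"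
    proof (rule abelian_groupI, unfold MK)
      fix x assume x: "x \<in> carrier (K_ring ?AC)"
      have "\<ominus>\<^bsub>novikov_poly0_module\<^esub> A.ev x \<in> novikov_poly0"
        using M.a_inv_closed[of "A.ev x"] evA(2)[OF x] by (simp add: M0)
      then obtain y where y: "y \<in> carrier (K_ring ?AC)" "A.ev y = \<ominus>\<^bsub>novikov_poly0_module\<^esub> A.ev x"
        unfolding A.ev_bij(2)[symmetric] by (metis imageE)
      have "\<ominus>\<^bsub>novikov_poly0_module\<^esub> A.ev x \<oplus>\<^bsub>novikov\<^esub> A.ev x = \<zero>\<^bsub>novikov\<^esub>"
        using M.M.l_neg[of "A.ev x"] evA(2)[OF x] by (simp add: M0)
      then show "\<exists>y\<in>carrier (K_ring ?AC). y \<oplus>\<^bsub>K_ring ?AC\<^esub> x = \<zero>\<^bsub>K_ring ?AC\<^esub>"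
        using x y by (intro bexI[of _ y] injA) (simp_all add: A.ev_add A.ev_zero)
      show "\<zero>\<^bsub>K_ring ?AC\<^esub> \<oplus>\<^bsub>K_ring ?AC\<^esub> x = x"
        by (rule injA) (simp_all add: x A.ev_add A.ev_zero evA)
      fix y assume y: "y \<in> carrier (K_ring ?AC)"
      show "x \<oplus>\<^bsub>K_ring ?AC\<^esub> y \<in> carrier (K_ring ?AC)" by (rule A.ev_add(1)[OF x y])
      show "x \<oplus>\<^bsub>K_ring ?AC\<^esub> y = y \<oplus>\<^bsub>K_ring ?AC\<^esub> x"
        by (rule injA) (simp_all add: x y A.ev_add evA N.a_comm)
      fix z assume z: "z \<in> carrier (K_ring ?AC)"
      show "x \<oplus>\<^bsub>K_ring ?AC\<^esub> y \<oplus>\<^bsub>K_ring ?AC\<^esub> z = x \<oplus>\<^bsub>K_ring ?AC\<^esub> (y \<oplus>\<^bsub>K_ring ?AC\<^esub> z)"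
        by (rule injA) (simp_all add: x y z A.ev_add evA N.a_assoc)
    qed (rule A.ev_zero(1))
  next
    fix r x assume r: "r \<in> carrier (K_ring ?Cfg)" and x: "x \<in> carrier (K_ring ?AC)"
    show "r \<odot>\<^bsub>K_module ?AC\<^esub> x \<in> carrier (K_ring ?AC)" using sm[OF r x] by simp
    fix y assume y: "y \<in> carrier (K_ring ?AC)"
    show "r \<odot>\<^bsub>K_module ?AC\<^esub> (x \<oplus>\<^bsub>K_ring ?AC\<^esub> y) = r \<odot>\<^bsub>K_module ?AC\<^esub> x \<oplus>\<^bsub>K_ring ?AC\<^esub> r \<odot>\<^bsub>K_module ?AC\<^esub> y"
      by (rule injA) (simp_all add: r x y sm A.ev_add evA evF N.r_distr)
  next
    fix r s x assume r: "r \<in> carrier (K_ring ?Cfg)" and s: "s \<in> carrier (K_ring ?Cfg)" and x: "x \<in> carrier (K_ring ?AC)"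
    show "(r \<oplus>\<^bsub>K_ring ?Cfg\<^esub> s) \<odot>\<^bsub>K_module ?AC\<^esub> x = r \<odot>\<^bsub>K_module ?AC\<^esub> x \<oplus>\<^bsub>K_ring ?AC\<^esub> s \<odot>\<^bsub>K_module ?AC\<^esub> x"
      by (rule injA) (simp_all add: r s x sm A.ev_add F.ev_add evA evF N.l_distr)
    show "(r \<otimes>\<^bsub>K_ring ?Cfg\<^esub> s) \<odot>\<^bsub>K_module ?AC\<^esub> x = r \<odot>\<^bsub>K_module ?AC\<^esub> (s \<odot>\<^bsub>K_module ?AC\<^esub> x)"
      by (rule injA) (simp_all add: r s x sm F.ev_mult evA evF N.m_assoc)
  next
    fix x assume x: "x \<in> carrier (K_ring ?AC)"
    have "F.ev \<one>\<^bsub>K_ring ?Cfg\<^esub> = \<one>\<^bsub>novikov\<^esub>"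
      unfolding F.one_class F.class_carrier(2)[OF E1(1)] E1(2) novikov_one ..
    then show "\<one>\<^bsub>K_ring ?Cfg\<^esub> \<odot>\<^bsub>K_module ?AC\<^esub> x = x"
      by (intro injA) (simp_all add: x sm evA)
  qed
  have muA: "((T.ev \<circ> K_incl ?Ct) \<circ> K_incl ?Cfg) x = A.ev x" if "x \<in> carrier (K_ring ?AC)" for x
    using iFe[OF iA(1)[OF that]] iAe[OF that] by simp
  have valA: "((T.ev \<circ> K_incl ?Ct) \<circ> K_incl ?Cfg) ` carrier (K_ring ?AC) \<subseteq> novikov_poly0"
    using muA evA(2) by fastforce
  have isoA: "(T.ev \<circ> K_incl ?Ct) \<circ> K_incl ?Cfg \<in> iso (add_monoid (K_module ?AC)) (add_monoid novikov_poly0_module)"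
  proof (rule isoI)
    show "(T.ev \<circ> K_incl ?Ct) \<circ> K_incl ?Cfg \<in> hom (add_monoid (K_module ?AC)) (add_monoid novikov_poly0_module)"
      by (rule homI) (simp_all only: monoid.simps partial_object.simps MK M0 muA evA A.ev_add)
    have "bij_betw A.ev (carrier (K_ring ?AC)) novikov_poly0"
      using A.ev_bij by (simp add: bij_betw_def)
    then have "bij_betw ((T.ev \<circ> K_incl ?Ct) \<circ> K_incl ?Cfg) (carrier (K_ring ?AC)) novikov_poly0"
      by (rule bij_betw_cong[THEN iffD1, rotated]) (simp only: muA)
    then show "bij_betw ((T.ev \<circ> K_incl ?Ct) \<circ> K_incl ?Cfg) (carrier (add_monoid (K_module ?AC))) (carrier (add_monoid novikov_poly0_module))"
      by (simp only: monoid.simps partial_object.simps MK M0)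
  qed
  have compat: "\<forall>r \<in> carrier (K_ring ?Cfg). \<forall>x \<in> carrier (K_module ?AC).
      ((T.ev \<circ> K_incl ?Ct) \<circ> K_incl ?Cfg) (r \<odot>\<^bsub>K_module ?AC\<^esub> x) =
      (T.ev \<circ> K_incl ?Ct) r \<odot>\<^bsub>novikov_poly0_module\<^esub> ((T.ev \<circ> K_incl ?Ct) \<circ> K_incl ?Cfg) x"
    unfolding MK M0
  proof (intro ballI)
    fix r x assume r: "r \<in> carrier (K_ring ?Cfg)" and x: "x \<in> carrier (K_ring ?AC)"
    have "(T.ev \<circ> K_incl ?Ct) r = F.ev r" using iFe[OF r] by simp
    then show "((T.ev \<circ> K_incl ?Ct) \<circ> K_incl ?Cfg) (r \<odot>\<^bsub>K_module ?AC\<^esub> x) =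
        (T.ev \<circ> K_incl ?Ct) r \<otimes>\<^bsub>novikov\<^esub> ((T.ev \<circ> K_incl ?Ct) \<circ> K_incl ?Cfg) x"
      using sm[OF r x] muA[OF x] muA[of "r \<odot>\<^bsub>K_module ?AC\<^esub> x"] by simp
  qed
  show ?thesis
    unfolding Ct_def Cfg_def ACfg_def Let_def
    by (intro conjI exI[of _ T.ev])
      (fact rings T(2) lamE uniq FT inclF classF valF isoF homA classA moduleA smclass
        ideal_novikov_poly0 module_novikov_poly0 valA isoA compat)+
qed

end
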